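(* The 2-category $\mathbf{UltSp}$ of ultraconvergence spaces, continuous maps and transformations is isomorphic to the 2-category of normalized lax $\underline\beta$-algebras, representable colax morphisms, and algebra 2-cells, where $\underline\beta$ is the left skew monad on $\mathbf{PROF}$ extending the ultracompletion pseudomonad $\beta$ on $\mathbf{CAT}$.
   Context: Profunctors. For locally small categories, a profunctor $F\colon C\nrightarrow D$ is a functor $F\colon D^{\mathrm{op}}\times C\to\mathbf{Set}$; it is small if each $F(-,c)$ is a small colimit of representables; $(G\circ F)(e,c)=\int^dG(e,d)\times F(d,c)$; $f_\diamond(d,c)=D(d,fc)$ for a functor $f\colon C\to D$. $\mathbf{CAT}$ is the 2-category of locally small categories and $\mathbf{PROF}$ is the bicategory of locally small categories and small profunctors. Ultracompletion. For a locally small category $C$, $\beta C$ has as objects triples $(X,h,\nu)$ with $X$ a set, $h\colon X\to\mathrm{Ob}(C)$, $\nu$ an ultrafilter on $X$. Morphisms $(X,h,\nu)\to(X',h',\nu')$ are pairs $(g\colon X'\to X,\ (\alpha_x\colon h(gx)\to h'(x))_{x\in X'})$ with $g_*\nu'=\nu$, two pairs being identified if they agree on some member of $\nu'$. For $f\colon C\to D$, $\beta f(X,h,\nu)=(X,fh,\nu)$. Write $1$ for the singleton $\{*\}$ and for its unique ultrafilter. Unit: $\eta_C(c)=(1,c,1)$. Multiplication: for $(X,H,\nu)\in\beta^2C$, $H(x)=(X_x,h_x,\nu_x)$, $\mu_C(X,H,\nu)=(\sum_xX_x,\ (h_x(z))_{(x,z)},\ \sum_{x:\nu}\nu_x)$,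 where $S\in\sum_{x:\nu}\nu_x$ iff $\{x\mid S\cap X_x\in\nu_x\}\in\nu$. This is a pseudomonad on $\mathbf{CAT}$ with canonical isomorphisms $\mu\eta_\beta\cong1\cong\mu\,\beta\eta$, $\mu\,\beta\mu\cong\mu\mu_\beta$. The skew monad $\underline\beta$. It acts on objects as $\beta$; for $F\colon C\nrightarrow D$, $\underline\beta F((X,h,\nu),(Y,k,\xi))$ is the set of pairs $(t\colon Y\to X,\ (\zeta_y\in F(h(ty),k(y)))_{y\in Y})$ with $t_*\xi=\nu$, modulo agreement on a member of $\xi$, with the evident functoriality; it is natural in $F$ via $\underline\beta(\alpha)(t,\zeta)=(t,(\alpha\zeta_y)_y)$. The lax compositor $\psi\colon\underline\beta G\circ\underline\beta F\Rightarrow\underline\beta(G\circ F)$ sends $[(p,\gamma),(p',\gamma')]$ to $(pp',([\gamma_{p'(y)},\gamma'_y])_y)$. One has $\underline\beta(f_\diamond)\cong(\beta f)_\diamond$ and an evident comparison between $\underline\beta(G\circ f_\diamond)$ and $\underline\beta G\circ(\beta f)_\diamond$, sending $(t,\zeta)$ with $\zeta_y\in G(h(ty),fk(y))$ to the same pair $(t,\zeta)$ regarded as an element of $\underline\beta G((X,h,\nu),(Y,fk,\xi))$. Unit and multiplication have components $(\eta_C)_\diamond,(\mu_C)_\diamond$. For $t=(p,(\gamma_y)_y)\in\underline\beta^2F((X,H,\nu),(Y,K,\xi))$ with $\gamma_y=(p_y,(\gamma_{y,w})_w)\in\underline\beta F(H(py),K(y))$, write $\mu(t)\in\underline\beta F(\mu(X,H,\nu),\mu(Y,K,\xi))$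 for the class of $((y,w)\mapsto(p(y),p_y(w)),(\gamma_{y,w}))$. Lax $\underline\beta$-algebras (unfolded). A lax $\underline\beta$-algebra is a category $A_0$, a small profunctor $A\colon\beta A_0\nrightarrow A_0$, and natural transformations $\Gamma\colon A_0(a,a')\to A(a,\eta(a'))$ (i.e. $1_{A_0}\Rightarrow A\circ(\eta_{A_0})_\diamond$) and $\Delta\colon A\circ\underline\beta A\Rightarrow A\circ(\mu_{A_0})_\diamond$; write $\Delta(r,s)\in A(a,\mu(Y))$ for $r\in A(a,x)$, $s\in\underline\beta A(x,Y)$, $x\in\beta A_0$, $Y\in\beta^2A_0$. Axioms, for $r\in A(a,x)$, up to transport along the canonical isomorphisms of the pseudomonad $\beta$: (1) $\Delta(\Gamma(\mathrm{id}_a),(\mathrm{id}_1,r))=r$, where $(\mathrm{id}_1,r)\in\underline\beta A(\eta(a),\eta(x))$; (2) for $x=(X,k,\nu)$, $\Delta(r,(\mathrm{id}_X,(\Gamma(\mathrm{id}_{k(z)}))_{z\in X}))=r$, where the second argument lies in $\underline\beta A(x,\beta\eta(x))$; (3) for $s\in\underline\beta A(x,Y)$, $t\in\underline\beta^2A(Y,Z)$: $\Delta(\Delta(r,s),\mu(t))=\Delta(r,\underline\beta\Delta(\psi(s,t)))$, where $\underline\beta\Delta(\psi(s,t))\in\underline\beta(A\circ(\mu_{A_0})_\diamond)(x,Z)$ is regarded as an element of $\underline\beta A(x,\beta\mu(Z))$ via the comparison above. It is normalized if the comparison functor $A_0\to\mathrm{pt}(A)$ is fully faithful, equivalently each $\Gamma\colon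 A_0(a,a')\to A(a,\eta(a'))$ is bijective; here $\mathrm{pt}(A)$ is the category with the objects of $A_0$, $\mathrm{pt}(A)(a,a')=A(a,\eta(a'))$, and identities and composition induced by $\Gamma$ and $\Delta$. A representable colax morphism $A\to A'$ is a functor $f\colon A_0\to A_0'$ with a natural transformation $f_\diamond\circ A\Rightarrow A'\circ(\beta f)_\diamond$, i.e. a natural family $\Theta\colon A(a,x)\to A'(fa,\beta f(x))$, such that $\Theta(\Gamma(\mathrm{id}_a))=\Gamma'(\mathrm{id}_{fa})$ and $\Theta(\Delta(r,s))=\Delta'(\Theta(r),\Theta_*(s))$, where $\Theta_*(t,\zeta)=(t,(\Theta\zeta_y)_y)$. An algebra 2-cell $(f,\Theta)\Rightarrow(f',\Theta')$ is a natural transformation $\sigma\colon f\Rightarrow f'$ such that $A'(fa,(\beta\sigma)_x)(\Theta(r))=A'(\sigma_a,\beta f'(x))(\Theta'(r))$ for all $r\in A(a,x)$. Ultraconvergence spaces. An ultraconvergence space is a discrete category $A_0$ with: a profunctor $A\colon\beta A_0\nrightarrow A_0$, assumed to be small, whose elements $r\in A(a,(X,b,\nu))$ are called ultraconvergence arrows and written $r\colon a\rightarrowtail(b_x)_{x:\nu}$, with $r[g]$ for the action of a $\beta A_0$-arrow $g\colon(X,b,\nu)\to(Y,c,\xi)$; identities $\mathrm{id}_a\colon a\rightarrowtail(a)_{*:1}$ for each $a\in A_0$; and for $r\colon a\rightarrowtail(b_x)_{x:\nu}$ and a family $(s_x\colon b_x\rightarrowtail(c_{x,y})_{y:\xi_x})_{x:\nu}$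 indexed by $x\in X$, a composite $(s_x)_{x:\nu}\cdot r\colon a\rightarrowtail(c_{x,y})_{(x,y):\sum_{x:\nu}\xi_x}$. Axioms: $(s_{g(y)})_{y:\xi}\cdot r[g]=((s_x)_{x:\nu}\cdot r)[g\otimes\mathrm{id}]$ with $g\otimes\mathrm{id}\colon(y,z)\mapsto(g(y),z)$; $(s_x[g_x])_{x:\nu}\cdot r=((s_x)_{x:\nu}\cdot r)[\mathrm{id}\otimes(g_x)]$ with $\mathrm{id}\otimes(g_x)\colon(x,z)\mapsto(x,g_x(z))$; $(r)_{*:1}\cdot\mathrm{id}_a=r$; $(\mathrm{id}_{b_x})_{x:\nu}\cdot r=r$; $(t_{x,y})_{(x,y):\sum_{x:\nu}\xi_x}\cdot((s_x)_{x:\nu}\cdot r)=((t_{x,y})_{y:\xi_x}\cdot s_x)_{x:\nu}\cdot r$ (index sets such as $\sum_{*:1}\nu$, $\sum_{x:\nu}1$ and $\nu$ being canonically identified). A continuous map $A\to A'$ is a functor (equivalently, a function on objects) $f\colon A_0\to A_0'$ with functions $f\colon A(a,(X,b,\nu))\to A'(fa,(X,fb,\nu))$ such that $f(r[g])=f(r)[g]$, $f(\mathrm{id}_a)=\mathrm{id}_{fa}$, $f((s_x)_{x:\nu}\cdot r)=(f(s_x))_{x:\nu}\cdot f(r)$. A transformation $f\Rightarrow g$ of continuous maps $A\to A'$ is a family $\alpha_a\colon f(a)\rightarrowtail(g(a))_{*:1}$, $a\in A_0$, such that $(g(r))_{*:1}\cdot\alpha_a=(\alpha_{b_x})_{x:\nu}\cdot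 f(r)$ for all $r\colon a\rightarrowtail(b_x)_{x:\nu}$ in $A$. Compositions are the evident ones.
   Formalization: Smallness of the profunctor of an ultraconvergence space is taken over its category of points, not over the discrete category of points; with the latter the claim fails, e.g. for Set with arrows a → ultraproduct of b. *)

theory Defs
  imports Main "HOL-Library.FuncSet"
begin

unbundle cardinal_syntax

section \<open>A universe of sets\<close>

text \<open>
  A type \<open>'u\<close> of class \<open>universe\<close> plays the role of the universe \<open>V = V\<^sub>\<kappa>\<close> of sets: the cardinality
  of \<open>'u\<close> is regular and strong limit.  For \<open>\<kappa>\<close> inaccessible and \<open>'u = V\<^sub>\<kappa>\<close> the small subsets of
  \<open>'u\<close> are exactly the elements of \<open>V\<^sub>\<kappa>\<close>, i.e. the sets, and arbitrary subsets of \<open>'u\<close> are the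
  classes.  (Uncountability is not required; \<open>\<kappa> = \<omega>\<close> is a degenerate instance.)
\<close>

definition small :: "'a set \<Rightarrow> bool" where
  "small X \<longleftrightarrow> |X| <o |UNIV :: 'a set|"

class universe =
  fixes star :: 'a
    and pair :: "'a \<Rightarrow> 'a \<Rightarrow> 'a"
  assumes pair_inject: "pair x y = pair x' y' \<longleftrightarrow> x = x' \<and> y = y'"
    and strong_limit: "small X \<Longrightarrow> |Pow X| <o |UNIV :: 'a set|"
    and regular: "small I \<Longrightarrow> (\<And>i. i \<in> I \<Longrightarrow> small (Y i)) \<Longrightarrow> small (\<Union>i\<in>I. Y i)"

definition ufst :: "'u::universe \<Rightarrow> 'u" where
  "ufst w = (THE x. \<exists>y. w = pair x y)"

definition usnd :: "'u::universe \<Rightarrow> 'u" where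
  "usnd w = (THE y. \<exists>x. w = pair x y)"


section \<open>Categories, functors, profunctors\<close>

text \<open>
  Hom-sets are indexed by source and target and need not be disjoint.  Structures that are components
  of objects or 1-cells of the 2-categories below have to satisfy the additional
  \<open>_ext\<close>-conditions (junk values are \<open>undefined\<close>), so that equality in HOL is equality of the
  mathematical structures.
\<close>

record ('o, 'm) cat =
  Obj :: "'o set"
  Hom :: "'o \<Rightarrow> 'o \<Rightarrow> 'm set"
  Ide :: "'o \<Rightarrow> 'm"
  Cmp :: "'o \<Rightarrow> 'o \<Rightarrow> 'o \<Rightarrow> 'm \<Rightarrow> 'm \<Rightarrow> 'm"  \<comment> \<open>\<open>Cmp C a b c g f = g \<circ> f\<close> for \<open>f: a \<rightarrow> b\<close>, \<open>g: b \<rightarrow> c\<close>\<close>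

locale category =
  fixes C :: "('o, 'm) cat"
  assumes Hom_Obj: "f \<in> Hom C a b \<Longrightarrow> a \<in> Obj C \<and> b \<in> Obj C"
    and Ide_Hom: "a \<in> Obj C \<Longrightarrow> Ide C a \<in> Hom C a a"
    and Cmp_Hom: "f \<in> Hom C a b \<Longrightarrow> g \<in> Hom C b c \<Longrightarrow> Cmp C a b c g f \<in> Hom C a c"
    and Cmp_Ide_left: "f \<in> Hom C a b \<Longrightarrow> Cmp C a b b (Ide C b) f = f"
    and Cmp_Ide_right: "f \<in> Hom C a b \<Longrightarrow> Cmp C a a b f (Ide C a) = f"
    and Cmp_assoc: "f \<in> Hom C a b \<Longrightarrow> g \<in> Hom C b c \<Longrightarrow> h \<in> Hom C c d \<Longrightarrow>
      Cmp C a c d h (Cmp C a b c g f) = Cmp C a b d (Cmp C b c d h g) f"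

definition cat_ext :: "('o, 'm) cat \<Rightarrow> bool" where
  "cat_ext C \<longleftrightarrow>
     (\<forall>a. a \<notin> Obj C \<longrightarrow> Ide C a = undefined) \<and>
     (\<forall>a b c g f. \<not> (f \<in> Hom C a b \<and> g \<in> Hom C b c) \<longrightarrow> Cmp C a b c g f = undefined)"

definition locally_small :: "('o, 'm) cat \<Rightarrow> bool" where
  "locally_small C \<longleftrightarrow> (\<forall>a b. small (Hom C a b))"

definition disc :: "'o set \<Rightarrow> ('o, 'o) cat" where
  "disc S = \<lparr> Obj = S,
     Hom = (\<lambda>a b. if a \<in> S \<and> a = b then {a} else {}),
     Ide = (\<lambda>a. a),
     Cmp = (\<lambda>a b c g f. a) \<rparr>"

record ('o, 'm, 'p, 'n) ftr =
  fo :: "'o \<Rightarrow> 'p"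
  fm :: "'o \<Rightarrow> 'o \<Rightarrow> 'm \<Rightarrow> 'n"

locale is_functor =
  fixes C :: "('o, 'm) cat" and D :: "('p, 'n) cat" and F :: "('o, 'm, 'p, 'n) ftr"
  assumes fo_Obj: "a \<in> Obj C \<Longrightarrow> fo F a \<in> Obj D"
    and fm_Hom: "f \<in> Hom C a b \<Longrightarrow> fm F a b f \<in> Hom D (fo F a) (fo F b)"
    and fm_Ide: "a \<in> Obj C \<Longrightarrow> fm F a a (Ide C a) = Ide D (fo F a)"
    and fm_Cmp: "f \<in> Hom C a b \<Longrightarrow> g \<in> Hom C b c \<Longrightarrow>
      fm F a c (Cmp C a b c g f) = Cmp D (fo F a) (fo F b) (fo F c) (fm F b c g) (fm F a b f)"

definition ftr_ext :: "('o, 'm) cat \<Rightarrow> ('o, 'm, 'p, 'n) ftr \<Rightarrow> bool" where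
  "ftr_ext C F \<longleftrightarrow> fo F \<in> extensional (Obj C) \<and> (\<forall>a b. fm F a b \<in> extensional (Hom C a b))"

definition ftr_id :: "('o, 'm, 'o, 'm) ftr" where
  "ftr_id = \<lparr> fo = (\<lambda>a. a), fm = (\<lambda>a b f. f) \<rparr>"

text \<open>
  A profunctor \<open>F: C \<nrightarrow> D\<close> is a functor \<open>D\<^sup>o\<^sup>p \<times> C \<rightarrow> Set\<close>.  For \<open>u: d' \<rightarrow> d\<close> in \<open>D\<close>,
  \<open>v: c \<rightarrow> c'\<close> in \<open>C\<close> and \<open>r \<in> F(d,c)\<close>, the element \<open>F(u,v)(r) \<in> F(d',c')\<close> is
  \<open>Act F d d' c c' u v r\<close>.
\<close>

record ('d, 'dm, 'c, 'cm, 'r) prof =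
  Els :: "'d \<Rightarrow> 'c \<Rightarrow> 'r set"
  Act :: "'d \<Rightarrow> 'd \<Rightarrow> 'c \<Rightarrow> 'c \<Rightarrow> 'dm \<Rightarrow> 'cm \<Rightarrow> 'r \<Rightarrow> 'r"

locale profunctor =
  fixes C :: "('c, 'cm) cat" and D :: "('d, 'dm) cat" and F :: "('d, 'dm, 'c, 'cm, 'r) prof"
  assumes Els_Obj: "r \<in> Els F d c \<Longrightarrow> d \<in> Obj D \<and> c \<in> Obj C"
    and Act_Els: "u \<in> Hom D d' d \<Longrightarrow> v \<in> Hom C c c' \<Longrightarrow> r \<in> Els F d c \<Longrightarrow>
      Act F d d' c c' u v r \<in> Els F d' c'"
    and Act_Ide: "r \<in> Els F d c \<Longrightarrow> Act F d d c c (Ide D d) (Ide C c) r = r"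
    and Act_Cmp: "u \<in> Hom D d' d \<Longrightarrow> u' \<in> Hom D d'' d' \<Longrightarrow> v \<in> Hom C c c' \<Longrightarrow> v' \<in> Hom C c' c'' \<Longrightarrow>
      r \<in> Els F d c \<Longrightarrow>
      Act F d d'' c c'' (Cmp D d'' d' d u u') (Cmp C c c' c'' v' v) r =
      Act F d' d'' c' c'' u' v' (Act F d d' c c' u v r)"

definition prof_ext :: "('c, 'cm) cat \<Rightarrow> ('d, 'dm) cat \<Rightarrow> ('d, 'dm, 'c, 'cm, 'r) prof \<Rightarrow> bool" where
  "prof_ext C D F \<longleftrightarrow>
     (\<forall>d d' c c' u v r. \<not> (u \<in> Hom D d' d \<and> v \<in> Hom C c c' \<and> r \<in> Els F d c) \<longrightarrow>
        Act F d d' c c' u v r = undefined)"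

abbreviation lact where
  "lact C F d d' c u r \<equiv> Act F d d' c c u (Ide C c) r"

abbreviation ract where
  "ract D F d c c' v r \<equiv> Act F d d c c' (Ide D d) v r"

definition homp :: "('o, 'm) cat \<Rightarrow> ('o, 'm, 'o, 'm, 'm) prof" where
  "homp C = \<lparr> Els = Hom C,
     Act = (\<lambda>d d' c c' u v r. Cmp C d' d c' (Cmp C d c c' v r) u) \<rparr>"

text \<open>
  For \<open>F: C \<nrightarrow> D\<close>, \<open>G: C' \<nrightarrow> D'\<close> and functors \<open>p: D \<rightarrow> D'\<close>, \<open>q: C \<rightarrow> C'\<close>: natural families
  \<open>F(d,c) \<rightarrow> G(p d, q c)\<close>.  With \<open>p = id\<close> these are the natural transformations \<open>F \<Rightarrow> G \<circ> q\<^sub>\<diamond>\<close>,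
  since \<open>(G \<circ> q\<^sub>\<diamond>)(d,c) \<cong> G(d, q c)\<close>.
\<close>

definition pcell :: "('c, 'cm) cat \<Rightarrow> ('d, 'dm) cat \<Rightarrow> ('d, 'dm, 'd2, 'dm2) ftr \<Rightarrow> ('c, 'cm, 'c2, 'cm2) ftr \<Rightarrow>
    ('d, 'dm, 'c, 'cm, 'r) prof \<Rightarrow> ('d2, 'dm2, 'c2, 'cm2, 'r2) prof \<Rightarrow> ('d \<Rightarrow> 'c \<Rightarrow> 'r \<Rightarrow> 'r2) \<Rightarrow> bool" where
  "pcell C D p q F G \<theta> \<longleftrightarrow>
     (\<forall>d c. \<theta> d c \<in> Els F d c \<rightarrow>\<^sub>E Els G (fo p d) (fo q c)) \<and>
     (\<forall>d d' c c' u v r. u \<in> Hom D d' d \<longrightarrow> v \<in> Hom C c c' \<longrightarrow> r \<in> Els F d c \<longrightarrow>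
        \<theta> d' c' (Act F d d' c c' u v r) =
        Act G (fo p d) (fo p d') (fo q c) (fo q c') (fm p d' d u) (fm q c c' v) (\<theta> d c r))"

subsection \<open>Composition of profunctors (coend)\<close>

text \<open>
  For \<open>F: C \<nrightarrow> D\<close> and \<open>G: D \<nrightarrow> E\<close> an element of \<open>(G \<circ> F)(e,c) = \<integral>\<^sup>d G(e,d) \<times> F(d,c)\<close> is the class
  \<open>[g,f]\<close> of a triple \<open>(d,g,f)\<close> modulo the equivalence relation generated by
  \<open>(d', G(e,v)(g), f) \<sim> (d, g, F(v,c)(f))\<close> for \<open>v: d \<rightarrow> d'\<close>.
\<close>

definition coend_rel :: "('c, 'cm) cat \<Rightarrow> ('d, 'dm) cat \<Rightarrow> ('e, 'em) cat \<Rightarrow>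
    ('e, 'em, 'd, 'dm, 's) prof \<Rightarrow> ('d, 'dm, 'c, 'cm, 'r) prof \<Rightarrow> 'e \<Rightarrow> 'c \<Rightarrow>
    (('d \<times> 's \<times> 'r) \<times> ('d \<times> 's \<times> 'r)) set" where
  "coend_rel C D E G F e c =
     {((d', ract E G e d d' v g, f), (d, g, lact C F d' d c v f)) | d d' v g f.
        v \<in> Hom D d d' \<and> g \<in> Els G e d \<and> f \<in> Els F d' c}"

definition coend_cls :: "('c, 'cm) cat \<Rightarrow> ('d, 'dm) cat \<Rightarrow> ('e, 'em) cat \<Rightarrow>
    ('e, 'em, 'd, 'dm, 's) prof \<Rightarrow> ('d, 'dm, 'c, 'cm, 'r) prof \<Rightarrow> 'e \<Rightarrow> 'c \<Rightarrow>
    'd \<times> 's \<times> 'r \<Rightarrow> ('d \<times> 's \<times> 'r) set" where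
  "coend_cls C D E G F e c p =
     (coend_rel C D E G F e c \<union> (coend_rel C D E G F e c)\<inverse>)\<^sup>* `` {p}"

definition rep :: "'a set \<Rightarrow> 'a" where
  "rep P = (SOME p. p \<in> P)"

definition pcomp :: "('c, 'cm) cat \<Rightarrow> ('d, 'dm) cat \<Rightarrow> ('e, 'em) cat \<Rightarrow>
    ('e, 'em, 'd, 'dm, 's) prof \<Rightarrow> ('d, 'dm, 'c, 'cm, 'r) prof \<Rightarrow>
    ('e, 'em, 'c, 'cm, ('d \<times> 's \<times> 'r) set) prof" where
  "pcomp C D E G F = \<lparr>
     Els = (\<lambda>e c. coend_cls C D E G F e c `
                    {(d, g, f). d \<in> Obj D \<and> g \<in> Els G e d \<and> f \<in> Els F d c}),
     Act = (\<lambda>e e' c c' u v P. case rep P of (d, g, f) \<Rightarrow>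
              coend_cls C D E G F e' c' (d, lact D G e e' d u g, ract D F d c c' v f)) \<rparr>"

subsection \<open>Small profunctors\<close>

record ('d, 'dm, 'r) presheaf =
  Sec :: "'d \<Rightarrow> 'r set"
  Res :: "'d \<Rightarrow> 'd \<Rightarrow> 'dm \<Rightarrow> 'r \<Rightarrow> 'r"  \<comment> \<open>\<open>Res P d d' u: P d \<rightarrow> P d'\<close> for \<open>u: d' \<rightarrow> d\<close>\<close>

locale is_presheaf =
  fixes D :: "('d, 'dm) cat" and P :: "('d, 'dm, 'r) presheaf"
  assumes Sec_Obj: "r \<in> Sec P d \<Longrightarrow> d \<in> Obj D"
    and Sec_small: "small (Sec P d)"
    and Res_Sec: "u \<in> Hom D d' d \<Longrightarrow> r \<in> Sec P d \<Longrightarrow> Res P d d' u r \<in> Sec P d'"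
    and Res_Ide: "r \<in> Sec P d \<Longrightarrow> Res P d d (Ide D d) r = r"
    and Res_Cmp: "u \<in> Hom D d' d \<Longrightarrow> u' \<in> Hom D d'' d' \<Longrightarrow> r \<in> Sec P d \<Longrightarrow>
      Res P d d'' (Cmp D d'' d' d u u') r = Res P d' d'' u' (Res P d d' u r)"

definition representable :: "('d, 'dm) cat \<Rightarrow> 'd \<Rightarrow> ('d, 'dm, 'dm) presheaf" where
  "representable D x = \<lparr> Sec = (\<lambda>d. Hom D d x), Res = (\<lambda>d d' u v. Cmp D d' d x v u) \<rparr>"

definition psh_map :: "('d, 'dm) cat \<Rightarrow> ('d, 'dm, 'r) presheaf \<Rightarrow> ('d, 'dm, 's) presheaf \<Rightarrow>
    ('d \<Rightarrow> 'r \<Rightarrow> 's) \<Rightarrow> bool" where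
  "psh_map D P Q \<phi> \<longleftrightarrow>
     (\<forall>d. \<phi> d \<in> Sec P d \<rightarrow>\<^sub>E Sec Q d) \<and>
     (\<forall>d d' u r. u \<in> Hom D d' d \<longrightarrow> r \<in> Sec P d \<longrightarrow> \<phi> d' (Res P d d' u r) = Res Q d d' u (\<phi> d r))"

text \<open>Cocones under the diagram \<open>j \<mapsto> D(-, T j)\<close> in the category of presheaves on \<open>D\<close>.\<close>

definition repr_cocone :: "('d, 'dm) cat \<Rightarrow> ('j, 'jm) cat \<Rightarrow> ('j, 'jm, 'd, 'dm) ftr \<Rightarrow>
    ('d, 'dm, 'r) presheaf \<Rightarrow> ('j \<Rightarrow> 'd \<Rightarrow> 'dm \<Rightarrow> 'r) \<Rightarrow> bool" where
  "repr_cocone D J T P leg \<longleftrightarrow>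
     (\<forall>j \<in> Obj J. psh_map D (representable D (fo T j)) P (leg j)) \<and>
     (\<forall>j j' w d v. w \<in> Hom J j j' \<longrightarrow> v \<in> Hom D d (fo T j) \<longrightarrow>
        leg j' d (Cmp D d (fo T j) (fo T j') (fm T j j' w) v) = leg j d v)"

definition small_colim_of_representables :: "('u::universe, 'u) cat \<Rightarrow> ('u, 'u, 'u) presheaf \<Rightarrow> bool" where
  "small_colim_of_representables D P \<longleftrightarrow>
     (\<exists>(J :: ('u, 'u) cat) T leg.
        category J \<and> small (Obj J) \<and> locally_small J \<and> is_functor J D T \<and>
        repr_cocone D J T P leg \<and>
        (\<forall>(Q :: ('u, 'u, 'u) presheaf) \<kappa>. is_presheaf D Q \<longrightarrow> repr_cocone D J T Q \<kappa> \<longrightarrow>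
           (\<exists>!\<phi>. psh_map D P Q \<phi> \<and>
              (\<forall>j \<in> Obj J. \<forall>d. \<forall>v \<in> Hom D d (fo T j). \<phi> d (leg j d v) = \<kappa> j d v))))"

definition prof_presheaf :: "('c, 'cm) cat \<Rightarrow> ('d, 'dm, 'c, 'cm, 'r) prof \<Rightarrow> 'c \<Rightarrow> ('d, 'dm, 'r) presheaf" where
  "prof_presheaf C F c = \<lparr> Sec = (\<lambda>d. Els F d c), Res = (\<lambda>d d' u r. lact C F d d' c u r) \<rparr>"

definition set_valued :: "('d, 'dm, 'c, 'cm, 'r) prof \<Rightarrow> bool" where
  "set_valued F \<longleftrightarrow> (\<forall>d c. small (Els F d c))"

definition small_profunctor :: "('c, 'cm) cat \<Rightarrow> ('u::universe, 'u) cat \<Rightarrow> ('u, 'u, 'c, 'cm, 'u) prof \<Rightarrow> bool" where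
  "small_profunctor C D F \<longleftrightarrow>
     profunctor C D F \<and> set_valued F \<and>
     (\<forall>c \<in> Obj C. small_colim_of_representables D (prof_presheaf C F c))"


section \<open>The ultracompletion\<close>

text \<open>
  Filters on the set \<open>X\<close> are identified with filters on the ambient type that contain \<open>X\<close>; then
  \<open>g\<^sub>*\<nu>\<close> is \<open>filtermap g \<nu>\<close> and ``on some member of \<open>\<nu>\<close>'' is \<open>\<forall>\<^sub>F z in \<nu>\<close>.
\<close>

definition ultrafilter_on :: "'i set \<Rightarrow> 'i filter \<Rightarrow> bool" where
  "ultrafilter_on X \<nu> \<longleftrightarrow> eventually (\<lambda>x. x \<in> X) \<nu> \<and> \<nu> \<noteq> bot \<and>
     (\<forall>P. eventually P \<nu> \<or> eventually (\<lambda>x. \<not> P x) \<nu>)"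

definition usum :: "'u::universe filter \<Rightarrow> ('u \<Rightarrow> 'u filter) \<Rightarrow> 'u filter" where
  "usum \<nu> \<rho> = Abs_filter (\<lambda>P. \<forall>\<^sub>F x in \<nu>. \<forall>\<^sub>F z in \<rho> x. P (pair x z))"

datatype ('i, 'o) ufam = Ufam (Ix: "'i set") (Fm: "'i \<Rightarrow> 'o") (Uf: "'i filter")

type_synonym ('i, 'm) germ = "(('i \<Rightarrow> 'i) \<times> ('i \<Rightarrow> 'm)) set"

text \<open>
  Both the morphisms \<open>x \<rightarrow> y\<close> of \<open>\<beta>C\<close> (with \<open>E = Hom C\<close>) and the elements of \<open>\<beta>F(x,y)\<close> (with
  \<open>E = Els F\<close>) are pairs \<open>(t: Y \<rightarrow> X, (\<zeta>\<^sub>z \<in> E(x(t z), y(z)))\<^sub>z)\<close> with \<open>t\<^sub>*\<xi> = \<nu>\<close>, modulo agreement on a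
  member of \<open>\<xi>\<close>.
\<close>

definition upairs :: "('a \<Rightarrow> 'b \<Rightarrow> 'r set) \<Rightarrow> ('i, 'a) ufam \<Rightarrow> ('i, 'b) ufam \<Rightarrow> ('i, 'r) germ" where
  "upairs E x y = {(t, \<zeta>). t \<in> Ix y \<rightarrow>\<^sub>E Ix x \<and> filtermap t (Uf y) = Uf x \<and>
                     \<zeta> \<in> (\<Pi>\<^sub>E z\<in>Ix y. E (Fm x (t z)) (Fm y z))}"

definition ucls :: "('a \<Rightarrow> 'b \<Rightarrow> 'r set) \<Rightarrow> ('i, 'a) ufam \<Rightarrow> ('i, 'b) ufam \<Rightarrow>
    ('i \<Rightarrow> 'i) \<times> ('i \<Rightarrow> 'r) \<Rightarrow> ('i, 'r) germ" where
  "ucls E x y p = {q \<in> upairs E x y. \<forall>\<^sub>F z in Uf y. fst q z = fst p z \<and> snd q z = snd p z}"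

definition ugerms :: "('a \<Rightarrow> 'b \<Rightarrow> 'r set) \<Rightarrow> ('i, 'a) ufam \<Rightarrow> ('i, 'b) ufam \<Rightarrow> ('i, 'r) germ set" where
  "ugerms E x y = ucls E x y ` upairs E x y"

definition beta :: "('o, 'm) cat \<Rightarrow> (('i, 'o) ufam, ('i, 'm) germ) cat" where
  "beta C = (let B = {x. small (Ix x) \<and> Fm x \<in> Ix x \<rightarrow>\<^sub>E Obj C \<and> ultrafilter_on (Ix x) (Uf x)} in \<lparr>
     Obj = B,
     Hom = (\<lambda>x y. if x \<in> B \<and> y \<in> B then ugerms (Hom C) x y else {}),
     Ide = (\<lambda>x. ucls (Hom C) x x (\<lambda>z\<in>Ix x. z, \<lambda>z\<in>Ix x. Ide C (Fm x z))),
     Cmp = (\<lambda>x y z Q P. case (rep P, rep Q) of ((g, \<alpha>), (g', \<alpha>')) \<Rightarrow>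
              ucls (Hom C) x z
                (\<lambda>w\<in>Ix z. g (g' w),
                 \<lambda>w\<in>Ix z. Cmp C (Fm x (g (g' w))) (Fm y (g' w)) (Fm z w) (\<alpha>' w) (\<alpha> (g' w)))) \<rparr>)"

definition bmap :: "('o \<Rightarrow> 'p) \<Rightarrow> ('i, 'o) ufam \<Rightarrow> ('i, 'p) ufam" where
  "bmap f x = Ufam (Ix x) (\<lambda>z\<in>Ix x. f (Fm x z)) (Uf x)"

text \<open>In the following two definitions \<open>D\<close> resp. \<open>G\<close> is the target of the functor resp. 2-cell.\<close>

definition beta_ftr :: "('p, 'n) cat \<Rightarrow> ('o, 'm, 'p, 'n) ftr \<Rightarrow>
    (('i, 'o) ufam, ('i, 'm) germ, ('i, 'p) ufam, ('i, 'n) germ) ftr" where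
  "beta_ftr D f = \<lparr>
     fo = bmap (fo f),
     fm = (\<lambda>x y P. case rep P of (g, \<alpha>) \<Rightarrow>
             ucls (Hom D) (bmap (fo f) x) (bmap (fo f) y)
               (g, \<lambda>z\<in>Ix y. fm f (Fm x (g z)) (Fm y z) (\<alpha> z))) \<rparr>"

text \<open>
  Action of \<open>\<beta>\<close> on \<open>\<theta>: F(d,c) \<rightarrow> G(p d, q c)\<close>, with values in \<open>\<beta>G(\<beta>p(x), \<beta>q(y))\<close>.  For \<open>p = id\<close>
  this includes the comparison between \<open>\<beta>(G \<circ> q\<^sub>\<diamond>)\<close> and \<open>\<beta>G \<circ> (\<beta>q)\<^sub>\<diamond>\<close>, which does not change
  the pair \<open>(t,\<zeta>)\<close>.
\<close>

definition bcell :: "('d2, 'dm2, 'c2, 'cm2, 's) prof \<Rightarrow> ('d \<Rightarrow> 'd2) \<Rightarrow> ('c \<Rightarrow> 'c2) \<Rightarrow>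
    ('d \<Rightarrow> 'c \<Rightarrow> 'r \<Rightarrow> 's) \<Rightarrow> ('i, 'd) ufam \<Rightarrow> ('i, 'c) ufam \<Rightarrow> ('i, 'r) germ \<Rightarrow> ('i, 's) germ" where
  "bcell G p q \<theta> x y P = (case rep P of (t, \<zeta>) \<Rightarrow>
     ucls (Els G) (bmap p x) (bmap q y) (t, \<lambda>z\<in>Ix y. \<theta> (Fm x (t z)) (Fm y z) (\<zeta> z)))"

definition eta :: "'o \<Rightarrow> ('u::universe, 'o) ufam" where
  "eta c = Ufam {star} (\<lambda>z\<in>{star}. c) (principal {star})"

definition mu :: "('u::universe, ('u, 'o) ufam) ufam \<Rightarrow> ('u, 'o) ufam" where
  "mu Y = Ufam {pair x z | x z. x \<in> Ix Y \<and> z \<in> Ix (Fm Y x)}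
               (\<lambda>w \<in> {pair x z | x z. x \<in> Ix Y \<and> z \<in> Ix (Fm Y x)}. Fm (Fm Y (ufst w)) (usnd w))
               (usum (Uf Y) (\<lambda>x. Uf (Fm Y x)))"

definition eta_ftr :: "('o, 'm) cat \<Rightarrow> ('o, 'm, ('u::universe, 'o) ufam, ('u, 'm) germ) ftr" where
  "eta_ftr C = \<lparr> fo = eta,
     fm = (\<lambda>c c' u. ucls (Hom C) (eta c) (eta c') (\<lambda>z\<in>{star}. z, \<lambda>z\<in>{star}. u)) \<rparr>"

text \<open>
  \<open>(p, (\<gamma>\<^sub>y)\<^sub>y)\<close> with \<open>\<gamma>\<^sub>y = (p\<^sub>y, (\<gamma>\<^sub>y\<^sub>,\<^sub>w)\<^sub>w)\<close> is sent to \<open>((y,w) \<mapsto> (p(y), p\<^sub>y(w)), (\<gamma>\<^sub>y\<^sub>,\<^sub>w))\<close>.  For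
  \<open>E = Hom C\<close> this is \<open>\<mu>\<close> on the morphisms of \<open>\<beta>\<^sup>2C\<close>, for \<open>E = Els F\<close> it is \<open>\<mu>(t)\<close> for
  \<open>t \<in> \<beta>\<^sup>2F(X,Y)\<close>.
\<close>

definition umult :: "('a \<Rightarrow> 'b \<Rightarrow> 'r set) \<Rightarrow> ('u::universe, ('u, 'a) ufam) ufam \<Rightarrow> ('u, ('u, 'b) ufam) ufam \<Rightarrow>
    ('u, ('u, 'r) germ) germ \<Rightarrow> ('u, 'r) germ" where
  "umult E X Y t = (case rep t of (p, \<gamma>) \<Rightarrow>
     ucls E (mu X) (mu Y)
       (\<lambda>v\<in>Ix (mu Y). pair (p (ufst v)) (fst (rep (\<gamma> (ufst v))) (usnd v)),
        \<lambda>v\<in>Ix (mu Y). snd (rep (\<gamma> (ufst v))) (usnd v)))"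

definition mu_ftr :: "('o, 'm) cat \<Rightarrow>
    (('u::universe, ('u, 'o) ufam) ufam, ('u, ('u, 'm) germ) germ, ('u, 'o) ufam, ('u, 'm) germ) ftr" where
  "mu_ftr C = \<lparr> fo = mu, fm = umult (Hom C) \<rparr>"

text \<open>
  The morphism \<open>x \<rightarrow> y\<close> of \<open>\<beta>C\<close> given by a reindexing \<open>g\<close> of the index set of \<open>x\<close> along which the
  families agree.  The canonical isomorphisms of the pseudomonad are of this form.
\<close>

definition rearr :: "('o, 'm) cat \<Rightarrow> ('i, 'o) ufam \<Rightarrow> ('i, 'o) ufam \<Rightarrow> ('i \<Rightarrow> 'i) \<Rightarrow> ('i, 'm) germ" where
  "rearr C x y g = ucls (Hom C) x y (\<lambda>z\<in>Ix y. g z, \<lambda>z\<in>Ix y. Ide C (Fm y z))"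

text \<open>Index part of the canonical isomorphism \<open>\<mu> \<mu>\<^sub>\<beta> \<cong> \<mu> \<beta>\<mu>\<close>.\<close>

definition reassoc :: "'u::universe \<Rightarrow> 'u" where
  "reassoc w = pair (pair (ufst w) (ufst (usnd w))) (usnd (usnd w))"

subsection \<open>Extension to profunctors\<close>

definition bprof :: "('c, 'cm) cat \<Rightarrow> ('d, 'dm) cat \<Rightarrow> ('d, 'dm, 'c, 'cm, 'r) prof \<Rightarrow>
    (('i, 'd) ufam, ('i, 'dm) germ, ('i, 'c) ufam, ('i, 'cm) germ, ('i, 'r) germ) prof" where
  "bprof C D F = \<lparr>
     Els = (\<lambda>x y. if x \<in> Obj (beta D) \<and> y \<in> Obj (beta C) then ugerms (Els F) x y else {}),
     Act = (\<lambda>x x' y y' P Q R. case (rep P, rep Q, rep R) of ((g, \<alpha>), (l, \<delta>), (t, \<zeta>)) \<Rightarrow>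
              ucls (Els F) x' y'
                (\<lambda>w\<in>Ix y'. g (t (l w)),
                 \<lambda>w\<in>Ix y'. Act F (Fm x (t (l w))) (Fm x' (g (t (l w)))) (Fm y (l w)) (Fm y' w)
                              (\<alpha> (t (l w))) (\<delta> w) (\<zeta> (l w)))) \<rparr>"

text \<open>The lax compositor \<open>\<psi>: \<beta>G \<circ> \<beta>F \<Rightarrow> \<beta>(G \<circ> F)\<close>, evaluated at \<open>s \<in> \<beta>G(x,Y)\<close>, \<open>t \<in> \<beta>F(Y,Z)\<close>.\<close>

definition compositor :: "('c, 'cm) cat \<Rightarrow> ('d, 'dm) cat \<Rightarrow> ('e, 'em) cat \<Rightarrow>
    ('e, 'em, 'd, 'dm, 's) prof \<Rightarrow> ('d, 'dm, 'c, 'cm, 'r) prof \<Rightarrow>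
    ('i, 'e) ufam \<Rightarrow> ('i, 'd) ufam \<Rightarrow> ('i, 'c) ufam \<Rightarrow> ('i, 's) germ \<Rightarrow> ('i, 'r) germ \<Rightarrow>
    ('i, ('d \<times> 's \<times> 'r) set) germ" where
  "compositor C D E G F x Y Z s t = (case (rep s, rep t) of ((p, \<gamma>), (p', \<gamma>')) \<Rightarrow>
     ucls (Els (pcomp C D E G F)) x Z
       (\<lambda>y\<in>Ix Z. p (p' y),
        \<lambda>y\<in>Ix Z. coend_cls C D E G F (Fm x (p (p' y))) (Fm Z y) (Fm Y (p' y), \<gamma> (p' y), \<gamma>' y)))"


section \<open>Normalized lax algebras\<close>

type_synonym 'u uprof = "('u, 'u, ('u, 'u) ufam, ('u, 'u) germ, 'u) prof"

record 'u lax_alg =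
  bas :: "('u, 'u) cat"
  str :: "'u uprof"
  gam :: "'u \<Rightarrow> 'u \<Rightarrow> 'u \<Rightarrow> 'u"
  dlt :: "'u \<Rightarrow> ('u, ('u, 'u) ufam) ufam \<Rightarrow> (('u, 'u) ufam \<times> 'u \<times> ('u, 'u) germ) set \<Rightarrow> 'u"

abbreviation bstr :: "'u::universe lax_alg \<Rightarrow>
    (('u, 'u) ufam, ('u, 'u) germ, ('u, ('u, 'u) ufam) ufam, ('u, ('u, 'u) germ) germ, ('u, 'u) germ) prof" where
  "bstr A \<equiv> bprof (beta (bas A)) (bas A) (str A)"

text \<open>\<open>\<Delta>(r,s) \<in> A(a, \<mu>(Y))\<close> for \<open>r \<in> A(a,x)\<close>, \<open>s \<in> \<beta>A(x,Y)\<close>.\<close>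

definition dlt2 :: "'u::universe lax_alg \<Rightarrow> 'u \<Rightarrow> ('u, 'u) ufam \<Rightarrow> ('u, ('u, 'u) ufam) ufam \<Rightarrow>
    'u \<Rightarrow> ('u, 'u) germ \<Rightarrow> 'u" where
  "dlt2 A a x Y r s = dlt A a Y
     (coend_cls (beta (beta (bas A))) (beta (bas A)) (bas A) (str A) (bstr A) a Y (x, r, s))"

locale lax_algebra =
  fixes A :: "'u::universe lax_alg"
  assumes bas_category: "category (bas A)" "cat_ext (bas A)" "locally_small (bas A)"
    and str_profunctor: "small_profunctor (beta (bas A)) (bas A) (str A)"
      "prof_ext (beta (bas A)) (bas A) (str A)"
    and gam_natural: "pcell (bas A) (bas A) ftr_id (eta_ftr (bas A)) (homp (bas A)) (str A) (gam A)"
    and dlt_natural: "pcell (beta (beta (bas A))) (bas A) ftr_id (mu_ftr (bas A))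
      (pcomp (beta (beta (bas A))) (beta (bas A)) (bas A) (str A) (bstr A)) (str A) (dlt A)"
    and unit_left: "r \<in> Els (str A) a x \<Longrightarrow>
      dlt2 A a (eta a) (eta x) (gam A a a (Ide (bas A) a))
        (ucls (Els (str A)) (eta a) (eta x) (\<lambda>z\<in>{star}. z, \<lambda>z\<in>{star}. r)) =
      ract (bas A) (str A) a x (mu (eta x)) (rearr (bas A) x (mu (eta x)) usnd) r"
    and unit_right: "r \<in> Els (str A) a x \<Longrightarrow>
      dlt2 A a x (bmap eta x) r
        (ucls (Els (str A)) x (bmap eta x)
          (\<lambda>z\<in>Ix x. z, \<lambda>z\<in>Ix x. gam A (Fm x z) (Fm x z) (Ide (bas A) (Fm x z)))) =
      ract (bas A) (str A) a x (mu (bmap eta x)) (rearr (bas A) x (mu (bmap eta x)) ufst) r"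
    and assoc: "r \<in> Els (str A) a x \<Longrightarrow> s \<in> Els (bstr A) x Y \<Longrightarrow>
      t \<in> Els (bprof (beta (beta (bas A))) (beta (bas A)) (bstr A)) Y Z \<Longrightarrow>
      ract (bas A) (str A) a (mu (mu Z)) (mu (bmap mu Z))
        (rearr (bas A) (mu (mu Z)) (mu (bmap mu Z)) reassoc)
        (dlt2 A a (mu Y) (mu Z) (dlt2 A a x Y r s) (umult (Els (str A)) Y Z t)) =
      dlt2 A a x (bmap mu Z) r
        (bcell (str A) (\<lambda>a. a) mu (dlt A) x Z
          (compositor (beta (beta (bas A))) (beta (bas A)) (bas A) (str A) (bstr A) x Y Z s t))"

text \<open>The comparison functor \<open>A\<^sub>0 \<rightarrow> pt(A)\<close> is \<open>\<Gamma>: A\<^sub>0(a,a') \<rightarrow> A(a,\<eta>(a'))\<close> on morphisms.\<close>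

definition normalized :: "'u::universe lax_alg \<Rightarrow> bool" where
  "normalized A \<longleftrightarrow> (\<forall>a \<in> Obj (bas A). \<forall>a' \<in> Obj (bas A).
     bij_betw (gam A a a') (Hom (bas A) a a') (Els (str A) a (eta a')))"

record 'u lax_mor =
  mfun :: "('u, 'u, 'u, 'u) ftr"
  mcell :: "'u \<Rightarrow> ('u, 'u) ufam \<Rightarrow> 'u \<Rightarrow> 'u"

locale representable_colax_morphism =
  fixes A A' :: "'u::universe lax_alg" and m :: "'u lax_mor"
  assumes mfun_functor: "is_functor (bas A) (bas A') (mfun m)" "ftr_ext (bas A) (mfun m)"
    and mcell_natural: "pcell (beta (bas A)) (bas A) (mfun m) (beta_ftr (bas A') (mfun m))
      (str A) (str A') (mcell m)"
    and mcell_unit: "a \<in> Obj (bas A) \<Longrightarrow>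
      mcell m a (eta a) (gam A a a (Ide (bas A) a)) =
      gam A' (fo (mfun m) a) (fo (mfun m) a) (Ide (bas A') (fo (mfun m) a))"
    and mcell_mult: "r \<in> Els (str A) a x \<Longrightarrow> s \<in> Els (bstr A) x Y \<Longrightarrow>
      mcell m a (mu Y) (dlt2 A a x Y r s) =
      dlt2 A' (fo (mfun m) a) (bmap (fo (mfun m)) x) (bmap (bmap (fo (mfun m))) Y)
        (mcell m a x r) (bcell (str A') (fo (mfun m)) (bmap (fo (mfun m))) (mcell m) x Y s)"

locale algebra_2cell =
  fixes A A' :: "'u::universe lax_alg" and m m' :: "'u lax_mor" and \<sigma> :: "'u \<Rightarrow> 'u"
  assumes components: "\<sigma> \<in> (\<Pi>\<^sub>E a\<in>Obj (bas A). Hom (bas A') (fo (mfun m) a) (fo (mfun m') a))"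
    and natural: "u \<in> Hom (bas A) a b \<Longrightarrow>
      Cmp (bas A') (fo (mfun m) a) (fo (mfun m) b) (fo (mfun m') b) (\<sigma> b) (fm (mfun m) a b u) =
      Cmp (bas A') (fo (mfun m) a) (fo (mfun m') a) (fo (mfun m') b) (fm (mfun m') a b u) (\<sigma> a)"
    and compatible: "r \<in> Els (str A) a x \<Longrightarrow>
      ract (bas A') (str A') (fo (mfun m) a) (bmap (fo (mfun m)) x) (bmap (fo (mfun m')) x)
        (ucls (Hom (bas A')) (bmap (fo (mfun m)) x) (bmap (fo (mfun m')) x)
          (\<lambda>z\<in>Ix x. z, \<lambda>z\<in>Ix x. \<sigma> (Fm x z)))
        (mcell m a x r) =
      lact (beta (bas A')) (str A') (fo (mfun m') a) (fo (mfun m) a) (bmap (fo (mfun m')) x) (\<sigma> a)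
        (mcell m' a x r)"


section \<open>Ultraconvergence spaces\<close>

text \<open>
  In \<open>r: a \<rightarrowtail> (b\<^sub>x)\<^sub>x\<^sub>:\<^sub>\<nu>\<close> the target is the object \<open>(X,b,\<nu>)\<close> of \<open>\<beta>A\<^sub>0\<close>.  The composite
  \<open>(s\<^sub>z)\<^sub>z\<^sub>:\<^sub>\<nu> \<cdot> r\<close> with \<open>r \<in> A(a,x)\<close> and \<open>s\<^sub>z \<in> A(x\<^sub>z, Y\<^sub>z)\<close> is \<open>ucmp A a x Y s r \<in> A(a, \<mu>(X,Y,\<nu>))\<close>.
\<close>

record 'u ucspace =
  upts :: "'u set"
  uarr :: "'u uprof"
  uid :: "'u \<Rightarrow> 'u"
  ucmp :: "'u \<Rightarrow> ('u, 'u) ufam \<Rightarrow> ('u \<Rightarrow> ('u, 'u) ufam) \<Rightarrow> ('u \<Rightarrow> 'u) \<Rightarrow> 'u \<Rightarrow> 'u"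

abbreviation udisc :: "'u ucspace \<Rightarrow> ('u, 'u) cat" where
  "udisc A \<equiv> disc (upts A)"

definition over :: "('i, 'a) ufam \<Rightarrow> ('i \<Rightarrow> 'b) \<Rightarrow> ('i, 'b) ufam" where
  "over x Y = Ufam (Ix x) Y (Uf x)"

definition reindex :: "'u::universe ucspace \<Rightarrow> ('u, 'u) ufam \<Rightarrow> ('u, 'u) ufam \<Rightarrow> ('u \<Rightarrow> 'u) \<Rightarrow> bool" where
  "reindex A x y g \<longleftrightarrow> x \<in> Obj (beta (udisc A)) \<and> y \<in> Obj (beta (udisc A)) \<and>
     g \<in> Ix y \<rightarrow>\<^sub>E Ix x \<and> filtermap g (Uf y) = Uf x \<and> (\<forall>z\<in>Ix y. Fm y z = Fm x (g z))"

text \<open>\<open>r[g] \<in> A(a,y)\<close> for \<open>r \<in> A(a,x)\<close> and \<open>g: x \<rightarrow> y\<close> in \<open>\<beta>A\<^sub>0\<close>.\<close>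

definition ure :: "'u::universe ucspace \<Rightarrow> 'u \<Rightarrow> ('u, 'u) ufam \<Rightarrow> ('u, 'u) ufam \<Rightarrow> ('u \<Rightarrow> 'u) \<Rightarrow> 'u \<Rightarrow> 'u" where
  "ure A a x y g r = ract (udisc A) (uarr A) a x y (rearr (udisc A) x y g) r"

text \<open>A family \<open>(s\<^sub>z: x\<^sub>z \<rightarrowtail> Y\<^sub>z)\<^sub>z\<close> composable with arrows \<open>a \<rightarrowtail> x\<close>.\<close>

definition ufamily :: "'u::universe ucspace \<Rightarrow> ('u, 'u) ufam \<Rightarrow> ('u \<Rightarrow> ('u, 'u) ufam) \<Rightarrow> ('u \<Rightarrow> 'u) \<Rightarrow> bool" where
  "ufamily A x Y s \<longleftrightarrow> Y \<in> Ix x \<rightarrow>\<^sub>E Obj (beta (udisc A)) \<and> s \<in> (\<Pi>\<^sub>E z\<in>Ix x. Els (uarr A) (Fm x z) (Y z))"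

text \<open>\<open>(r)\<^sub>*\<^sub>:\<^sub>1 \<cdot> u \<in> A(a,x)\<close> for \<open>u: a \<rightarrowtail> (b)\<^sub>*\<^sub>:\<^sub>1\<close> and \<open>r: b \<rightarrowtail> x\<close>, up to \<open>\<Sum>\<^sub>*\<^sub>:\<^sub>1 \<nu> \<cong> \<nu>\<close>.\<close>

definition upre :: "'u::universe ucspace \<Rightarrow> 'u \<Rightarrow> 'u \<Rightarrow> ('u, 'u) ufam \<Rightarrow> 'u \<Rightarrow> 'u \<Rightarrow> 'u" where
  "upre A a b x r u = ure A a (mu (eta x)) x (\<lambda>z\<in>Ix x. pair star z)
     (ucmp A a (eta b) (\<lambda>z\<in>{star}. x) (\<lambda>z\<in>{star}. r) u)"

text \<open>\<open>(s\<^sub>z)\<^sub>z\<^sub>:\<^sub>\<nu> \<cdot> r \<in> A(a,y)\<close> for \<open>r \<in> A(a,x)\<close> and \<open>s\<^sub>z: x\<^sub>z \<rightarrowtail> (y\<^sub>z)\<^sub>*\<^sub>:\<^sub>1\<close>, up to \<open>\<Sum>\<^sub>z\<^sub>:\<^sub>\<nu> 1 \<cong> \<nu>\<close>.\<close>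

definition upost :: "'u::universe ucspace \<Rightarrow> 'u \<Rightarrow> ('u, 'u) ufam \<Rightarrow> ('u, 'u) ufam \<Rightarrow> ('u \<Rightarrow> 'u) \<Rightarrow> 'u \<Rightarrow> 'u" where
  "upost A a x y s r = ure A a (mu (bmap eta y)) y (\<lambda>z\<in>Ix y. pair z star)
     (ucmp A a x (\<lambda>z\<in>Ix x. eta (Fm y z)) s r)"

definition pt :: "'u::universe ucspace \<Rightarrow> ('u, 'u) cat" where
  "pt A = \<lparr> Obj = upts A,
     Hom = (\<lambda>a b. Els (uarr A) a (eta b)),
     Ide = uid A,
     Cmp = (\<lambda>a b c g f. upre A a b (eta c) g f) \<rparr>"

text \<open>
  Smallness of the profunctor \<open>A\<close>: the presheaves \<open>A(-,x)\<close> are small colimits of representables over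
  the category of points \<open>pt(A)\<close>, on which they are presheaves by composition.  (Over the discrete
  category on the class of points the condition would exclude the space of sets and ultraproducts
  \<open>A(a,(X,b,\<nu>)) = Set(a, \<Prod>\<^sub>\<nu> b)\<close>, which is a representable, hence small, normalized lax algebra.)
\<close>

definition pt_presheaf :: "'u::universe ucspace \<Rightarrow> ('u, 'u) ufam \<Rightarrow> ('u, 'u, 'u) presheaf" where
  "pt_presheaf A x = \<lparr> Sec = (\<lambda>a. Els (uarr A) a x), Res = (\<lambda>b a u r. upre A a b x r u) \<rparr>"

locale ultraconvergence_space =
  fixes A :: "'u::universe ucspace"
  assumes uarr_profunctor: "profunctor (beta (udisc A)) (udisc A) (uarr A)" "set_valued (uarr A)"
      "prof_ext (beta (udisc A)) (udisc A) (uarr A)"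
    and uarr_small: "x \<in> Obj (beta (udisc A)) \<Longrightarrow> small_colim_of_representables (pt A) (pt_presheaf A x)"
    and uid_arr: "uid A \<in> (\<Pi>\<^sub>E a\<in>upts A. Els (uarr A) a (eta a))"
    and ucmp_arr: "r \<in> Els (uarr A) a x \<Longrightarrow> ufamily A x Y s \<Longrightarrow>
      ucmp A a x Y s r \<in> Els (uarr A) a (mu (over x Y))"
    and ucmp_ext: "\<not> (r \<in> Els (uarr A) a x \<and> ufamily A x Y s) \<Longrightarrow> ucmp A a x Y s r = undefined"
    and ucmp_reindex: "r \<in> Els (uarr A) a x \<Longrightarrow> ufamily A x Z s \<Longrightarrow> reindex A x y g \<Longrightarrow>
      ucmp A a y (\<lambda>z\<in>Ix y. Z (g z)) (\<lambda>z\<in>Ix y. s (g z)) (ure A a x y g r) =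
      ure A a (mu (over x Z)) (mu (over y (\<lambda>z\<in>Ix y. Z (g z))))
        (\<lambda>w\<in>Ix (mu (over y (\<lambda>z\<in>Ix y. Z (g z)))). pair (g (ufst w)) (usnd w))
        (ucmp A a x Z s r)"
    and ucmp_reindex_family: "r \<in> Els (uarr A) a x \<Longrightarrow> ufamily A x Y s \<Longrightarrow> Z \<in> extensional (Ix x) \<Longrightarrow>
      (\<And>z. z \<in> Ix x \<Longrightarrow> reindex A (Y z) (Z z) (k z)) \<Longrightarrow>
      ucmp A a x Z (\<lambda>z\<in>Ix x. ure A (Fm x z) (Y z) (Z z) (k z) (s z)) r =
      ure A a (mu (over x Y)) (mu (over x Z))
        (\<lambda>w\<in>Ix (mu (over x Z)). pair (ufst w) (k (ufst w) (usnd w)))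
        (ucmp A a x Y s r)"
    and ucmp_uid_left: "r \<in> Els (uarr A) a x \<Longrightarrow> upre A a a x r (uid A a) = r"
    and ucmp_uid_right: "r \<in> Els (uarr A) a x \<Longrightarrow> upost A a x x (\<lambda>z\<in>Ix x. uid A (Fm x z)) r = r"
    and ucmp_assoc: "r \<in> Els (uarr A) a x \<Longrightarrow> ufamily A x Y s \<Longrightarrow> ufamily A (mu (over x Y)) Z t \<Longrightarrow>
      W = (\<lambda>z\<in>Ix x. \<lambda>w\<in>Ix (Y z). Z (pair z w)) \<Longrightarrow>
      ure A a (mu (over (mu (over x Y)) Z)) (mu (over x (\<lambda>z\<in>Ix x. mu (over (Y z) (W z)))))
        (\<lambda>w\<in>Ix (mu (over x (\<lambda>z\<in>Ix x. mu (over (Y z) (W z))))). reassoc w)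
        (ucmp A a (mu (over x Y)) Z t (ucmp A a x Y s r)) =
      ucmp A a x (\<lambda>z\<in>Ix x. mu (over (Y z) (W z)))
        (\<lambda>z\<in>Ix x. ucmp A (Fm x z) (Y z) (W z) (\<lambda>w\<in>Ix (Y z). t (pair z w)) (s z)) r"

record 'u ucmap =
  cpt :: "'u \<Rightarrow> 'u"
  carr :: "'u \<Rightarrow> ('u, 'u) ufam \<Rightarrow> 'u \<Rightarrow> 'u"

locale continuous_map =
  fixes A A' :: "'u::universe ucspace" and f :: "'u ucmap"
  assumes cpt_fun: "cpt f \<in> upts A \<rightarrow>\<^sub>E upts A'"
    and carr_fun: "carr f a x \<in> Els (uarr A) a x \<rightarrow>\<^sub>E Els (uarr A') (cpt f a) (bmap (cpt f) x)"
    and carr_reindex: "r \<in> Els (uarr A) a x \<Longrightarrow> reindex A x y g \<Longrightarrow>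
      carr f a y (ure A a x y g r) =
      ure A' (cpt f a) (bmap (cpt f) x) (bmap (cpt f) y) g (carr f a x r)"
    and carr_uid: "a \<in> upts A \<Longrightarrow> carr f a (eta a) (uid A a) = uid A' (cpt f a)"
    and carr_ucmp: "r \<in> Els (uarr A) a x \<Longrightarrow> ufamily A x Y s \<Longrightarrow>
      carr f a (mu (over x Y)) (ucmp A a x Y s r) =
      ucmp A' (cpt f a) (bmap (cpt f) x) (\<lambda>z\<in>Ix x. bmap (cpt f) (Y z))
        (\<lambda>z\<in>Ix x. carr f (Fm x z) (Y z) (s z)) (carr f a x r)"

locale transformation =
  fixes A A' :: "'u::universe ucspace" and f g :: "'u ucmap" and \<alpha> :: "'u \<Rightarrow> 'u"
  assumes components: "\<alpha> \<in> (\<Pi>\<^sub>E a\<in>upts A. Els (uarr A') (cpt f a) (eta (cpt g a)))"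
    and natural: "r \<in> Els (uarr A) a x \<Longrightarrow>
      upre A' (cpt f a) (cpt g a) (bmap (cpt g) x) (carr g a x r) (\<alpha> a) =
      upost A' (cpt f a) (bmap (cpt f) x) (bmap (cpt g) x) (\<lambda>z\<in>Ix x. \<alpha> (Fm x z)) (carr f a x r)"


section \<open>Strict 2-categories and their isomorphisms\<close>

record ('o, 'f, 's) cat2 =
  Ob2 :: "'o set"
  Hom1 :: "'o \<Rightarrow> 'o \<Rightarrow> 'f set"
  Hom2 :: "'o \<Rightarrow> 'o \<Rightarrow> 'f \<Rightarrow> 'f \<Rightarrow> 's set"
  id1 :: "'o \<Rightarrow> 'f"
  comp1 :: "'o \<Rightarrow> 'o \<Rightarrow> 'o \<Rightarrow> 'f \<Rightarrow> 'f \<Rightarrow> 'f"  \<comment> \<open>\<open>comp1 K A B C g f = g \<circ> f\<close>\<close>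
  id2 :: "'o \<Rightarrow> 'o \<Rightarrow> 'f \<Rightarrow> 's"
  vcomp :: "'o \<Rightarrow> 'o \<Rightarrow> 'f \<Rightarrow> 'f \<Rightarrow> 'f \<Rightarrow> 's \<Rightarrow> 's \<Rightarrow> 's"
    \<comment> \<open>\<open>vcomp K A B f g h \<tau> \<sigma>: f \<Rightarrow> h\<close> for \<open>\<sigma>: f \<Rightarrow> g\<close>, \<open>\<tau>: g \<Rightarrow> h\<close>\<close>
  hcomp :: "'o \<Rightarrow> 'o \<Rightarrow> 'o \<Rightarrow> 'f \<Rightarrow> 'f \<Rightarrow> 'f \<Rightarrow> 'f \<Rightarrow> 's \<Rightarrow> 's \<Rightarrow> 's"
    \<comment> \<open>\<open>hcomp K A B C f f' g g' \<tau> \<sigma>: g \<circ> f \<Rightarrow> g' \<circ> f'\<close> for \<open>\<sigma>: f \<Rightarrow> f'\<close>, \<open>\<tau>: g \<Rightarrow> g'\<close>\<close>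

locale two_category =
  fixes K :: "('o, 'f, 's) cat2"
  assumes id1_Hom1: "A \<in> Ob2 K \<Longrightarrow> id1 K A \<in> Hom1 K A A"
    and comp1_Hom1: "\<lbrakk>A \<in> Ob2 K; B \<in> Ob2 K; C \<in> Ob2 K; f \<in> Hom1 K A B; g \<in> Hom1 K B C\<rbrakk> \<Longrightarrow>
      comp1 K A B C g f \<in> Hom1 K A C"
    and comp1_id1_left: "\<lbrakk>A \<in> Ob2 K; B \<in> Ob2 K; f \<in> Hom1 K A B\<rbrakk> \<Longrightarrow> comp1 K A B B (id1 K B) f = f"
    and comp1_id1_right: "\<lbrakk>A \<in> Ob2 K; B \<in> Ob2 K; f \<in> Hom1 K A B\<rbrakk> \<Longrightarrow> comp1 K A A B f (id1 K A) = f"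
    and comp1_assoc: "\<lbrakk>A \<in> Ob2 K; B \<in> Ob2 K; C \<in> Ob2 K; D \<in> Ob2 K;
      f \<in> Hom1 K A B; g \<in> Hom1 K B C; h \<in> Hom1 K C D\<rbrakk> \<Longrightarrow>
      comp1 K A C D h (comp1 K A B C g f) = comp1 K A B D (comp1 K B C D h g) f"
    and id2_Hom2: "\<lbrakk>A \<in> Ob2 K; B \<in> Ob2 K; f \<in> Hom1 K A B\<rbrakk> \<Longrightarrow> id2 K A B f \<in> Hom2 K A B f f"
    and vcomp_Hom2: "\<lbrakk>A \<in> Ob2 K; B \<in> Ob2 K; f \<in> Hom1 K A B; g \<in> Hom1 K A B; h \<in> Hom1 K A B;
      \<sigma> \<in> Hom2 K A B f g; \<tau> \<in> Hom2 K A B g h\<rbrakk> \<Longrightarrow> vcomp K A B f g h \<tau> \<sigma> \<in> Hom2 K A B f h"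
    and vcomp_id2_left: "\<lbrakk>A \<in> Ob2 K; B \<in> Ob2 K; f \<in> Hom1 K A B; g \<in> Hom1 K A B;
      \<sigma> \<in> Hom2 K A B f g\<rbrakk> \<Longrightarrow> vcomp K A B f g g (id2 K A B g) \<sigma> = \<sigma>"
    and vcomp_id2_right: "\<lbrakk>A \<in> Ob2 K; B \<in> Ob2 K; f \<in> Hom1 K A B; g \<in> Hom1 K A B;
      \<sigma> \<in> Hom2 K A B f g\<rbrakk> \<Longrightarrow> vcomp K A B f f g \<sigma> (id2 K A B f) = \<sigma>"
    and vcomp_assoc: "\<lbrakk>A \<in> Ob2 K; B \<in> Ob2 K; f \<in> Hom1 K A B; g \<in> Hom1 K A B; h \<in> Hom1 K A B;
      k \<in> Hom1 K A B; \<sigma> \<in> Hom2 K A B f g; \<tau> \<in> Hom2 K A B g h; \<upsilon> \<in> Hom2 K A B h k\<rbrakk> \<Longrightarrow>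
      vcomp K A B f h k \<upsilon> (vcomp K A B f g h \<tau> \<sigma>) = vcomp K A B f g k (vcomp K A B g h k \<upsilon> \<tau>) \<sigma>"
    and hcomp_Hom2: "\<lbrakk>A \<in> Ob2 K; B \<in> Ob2 K; C \<in> Ob2 K; f \<in> Hom1 K A B; f' \<in> Hom1 K A B;
      g \<in> Hom1 K B C; g' \<in> Hom1 K B C; \<sigma> \<in> Hom2 K A B f f'; \<tau> \<in> Hom2 K B C g g'\<rbrakk> \<Longrightarrow>
      hcomp K A B C f f' g g' \<tau> \<sigma> \<in> Hom2 K A C (comp1 K A B C g f) (comp1 K A B C g' f')"
    and hcomp_id2: "\<lbrakk>A \<in> Ob2 K; B \<in> Ob2 K; C \<in> Ob2 K; f \<in> Hom1 K A B; g \<in> Hom1 K B C\<rbrakk> \<Longrightarrow>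
      hcomp K A B C f f g g (id2 K B C g) (id2 K A B f) = id2 K A C (comp1 K A B C g f)"
    and interchange: "\<lbrakk>A \<in> Ob2 K; B \<in> Ob2 K; C \<in> Ob2 K;
      f \<in> Hom1 K A B; f' \<in> Hom1 K A B; f'' \<in> Hom1 K A B;
      g \<in> Hom1 K B C; g' \<in> Hom1 K B C; g'' \<in> Hom1 K B C;
      \<sigma> \<in> Hom2 K A B f f'; \<sigma>' \<in> Hom2 K A B f' f''; \<tau> \<in> Hom2 K B C g g'; \<tau>' \<in> Hom2 K B C g' g''\<rbrakk> \<Longrightarrow>
      hcomp K A B C f f'' g g'' (vcomp K B C g g' g'' \<tau>' \<tau>) (vcomp K A B f f' f'' \<sigma>' \<sigma>) =
      vcomp K A C (comp1 K A B C g f) (comp1 K A B C g' f') (comp1 K A B C g'' f'')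
        (hcomp K A B C f' f'' g' g'' \<tau>' \<sigma>') (hcomp K A B C f f' g g' \<tau> \<sigma>)"
    and hcomp_id1_left: "\<lbrakk>A \<in> Ob2 K; B \<in> Ob2 K; f \<in> Hom1 K A B; f' \<in> Hom1 K A B;
      \<sigma> \<in> Hom2 K A B f f'\<rbrakk> \<Longrightarrow>
      hcomp K A B B f f' (id1 K B) (id1 K B) (id2 K B B (id1 K B)) \<sigma> = \<sigma>"
    and hcomp_id1_right: "\<lbrakk>A \<in> Ob2 K; B \<in> Ob2 K; f \<in> Hom1 K A B; f' \<in> Hom1 K A B;
      \<sigma> \<in> Hom2 K A B f f'\<rbrakk> \<Longrightarrow>
      hcomp K A A B (id1 K A) (id1 K A) f f' \<sigma> (id2 K A A (id1 K A)) = \<sigma>"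
    and hcomp_assoc: "\<lbrakk>A \<in> Ob2 K; B \<in> Ob2 K; C \<in> Ob2 K; D \<in> Ob2 K;
      f \<in> Hom1 K A B; f' \<in> Hom1 K A B; g \<in> Hom1 K B C; g' \<in> Hom1 K B C; h \<in> Hom1 K C D; h' \<in> Hom1 K C D;
      \<sigma> \<in> Hom2 K A B f f'; \<tau> \<in> Hom2 K B C g g'; \<upsilon> \<in> Hom2 K C D h h'\<rbrakk> \<Longrightarrow>
      hcomp K A C D (comp1 K A B C g f) (comp1 K A B C g' f') h h' \<upsilon> (hcomp K A B C f f' g g' \<tau> \<sigma>) =
      hcomp K A B D f f' (comp1 K B C D h g) (comp1 K B C D h' g') (hcomp K B C D g g' h h' \<upsilon> \<tau>) \<sigma>"

text \<open>Strict 2-functors that are bijective on objects, 1-cells and 2-cells.\<close>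

locale two_isomorphism =
  K: two_category K + L: two_category L
  for K :: "('o, 'f, 's) cat2" and L :: "('p, 'g, 't) cat2" +
  fixes F0 :: "'o \<Rightarrow> 'p"
    and F1 :: "'o \<Rightarrow> 'o \<Rightarrow> 'f \<Rightarrow> 'g"
    and F2 :: "'o \<Rightarrow> 'o \<Rightarrow> 'f \<Rightarrow> 'f \<Rightarrow> 's \<Rightarrow> 't"
  assumes F0_bij: "bij_betw F0 (Ob2 K) (Ob2 L)"
    and F1_bij: "\<lbrakk>A \<in> Ob2 K; B \<in> Ob2 K\<rbrakk> \<Longrightarrow> bij_betw (F1 A B) (Hom1 K A B) (Hom1 L (F0 A) (F0 B))"
    and F2_bij: "\<lbrakk>A \<in> Ob2 K; B \<in> Ob2 K; f \<in> Hom1 K A B; g \<in> Hom1 K A B\<rbrakk> \<Longrightarrow>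
      bij_betw (F2 A B f g) (Hom2 K A B f g) (Hom2 L (F0 A) (F0 B) (F1 A B f) (F1 A B g))"
    and F1_id1: "A \<in> Ob2 K \<Longrightarrow> F1 A A (id1 K A) = id1 L (F0 A)"
    and F1_comp1: "\<lbrakk>A \<in> Ob2 K; B \<in> Ob2 K; C \<in> Ob2 K; f \<in> Hom1 K A B; g \<in> Hom1 K B C\<rbrakk> \<Longrightarrow>
      F1 A C (comp1 K A B C g f) = comp1 L (F0 A) (F0 B) (F0 C) (F1 B C g) (F1 A B f)"
    and F2_id2: "\<lbrakk>A \<in> Ob2 K; B \<in> Ob2 K; f \<in> Hom1 K A B\<rbrakk> \<Longrightarrow>
      F2 A B f f (id2 K A B f) = id2 L (F0 A) (F0 B) (F1 A B f)"
    and F2_vcomp: "\<lbrakk>A \<in> Ob2 K; B \<in> Ob2 K; f \<in> Hom1 K A B; g \<in> Hom1 K A B; h \<in> Hom1 K A B;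
      \<sigma> \<in> Hom2 K A B f g; \<tau> \<in> Hom2 K A B g h\<rbrakk> \<Longrightarrow>
      F2 A B f h (vcomp K A B f g h \<tau> \<sigma>) =
      vcomp L (F0 A) (F0 B) (F1 A B f) (F1 A B g) (F1 A B h) (F2 A B g h \<tau>) (F2 A B f g \<sigma>)"
    and F2_hcomp: "\<lbrakk>A \<in> Ob2 K; B \<in> Ob2 K; C \<in> Ob2 K; f \<in> Hom1 K A B; f' \<in> Hom1 K A B;
      g \<in> Hom1 K B C; g' \<in> Hom1 K B C; \<sigma> \<in> Hom2 K A B f f'; \<tau> \<in> Hom2 K B C g g'\<rbrakk> \<Longrightarrow>
      F2 A C (comp1 K A B C g f) (comp1 K A B C g' f') (hcomp K A B C f f' g g' \<tau> \<sigma>) =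
      hcomp L (F0 A) (F0 B) (F0 C) (F1 A B f) (F1 A B f') (F1 B C g) (F1 B C g')
        (F2 B C g g' \<tau>) (F2 A B f f' \<sigma>)"

definition two_isomorphic :: "('o, 'f, 's) cat2 \<Rightarrow> ('p, 'g, 't) cat2 \<Rightarrow> bool" where
  "two_isomorphic K L \<longleftrightarrow> (\<exists>F0 F1 F2. two_isomorphism K L F0 F1 F2)"

definition UltSp :: "('u::universe ucspace, 'u ucmap, 'u \<Rightarrow> 'u) cat2" where
  "UltSp = \<lparr>
     Ob2 = {A. ultraconvergence_space A},
     Hom1 = (\<lambda>A B. {f. continuous_map A B f}),
     Hom2 = (\<lambda>A B f g. {\<alpha>. transformation A B f g \<alpha>}),
     id1 = (\<lambda>A. \<lparr> cpt = (\<lambda>a\<in>upts A. a), carr = (\<lambda>a x. \<lambda>r\<in>Els (uarr A) a x. r) \<rparr>),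
     comp1 = (\<lambda>A B C g f. \<lparr> cpt = (\<lambda>a\<in>upts A. cpt g (cpt f a)),
                carr = (\<lambda>a x. \<lambda>r\<in>Els (uarr A) a x. carr g (cpt f a) (bmap (cpt f) x) (carr f a x r)) \<rparr>),
     id2 = (\<lambda>A B f. \<lambda>a\<in>upts A. uid B (cpt f a)),
     vcomp = (\<lambda>A B f g h \<tau> \<sigma>. \<lambda>a\<in>upts A. upre B (cpt f a) (cpt g a) (eta (cpt h a)) (\<tau> a) (\<sigma> a)),
     hcomp = (\<lambda>A B C f f' g g' \<tau> \<sigma>. \<lambda>a\<in>upts A.
                upre C (cpt g (cpt f a)) (cpt g' (cpt f a)) (eta (cpt g' (cpt f' a)))
                  (carr g' (cpt f a) (eta (cpt f' a)) (\<sigma> a)) (\<tau> (cpt f a))) \<rparr>"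

definition NLaxAlg :: "('u::universe lax_alg, 'u lax_mor, 'u \<Rightarrow> 'u) cat2" where
  "NLaxAlg = \<lparr>
     Ob2 = {A. lax_algebra A \<and> normalized A},
     Hom1 = (\<lambda>A B. {m. representable_colax_morphism A B m}),
     Hom2 = (\<lambda>A B m m'. {\<sigma>. algebra_2cell A B m m' \<sigma>}),
     id1 = (\<lambda>A. \<lparr> mfun = \<lparr> fo = (\<lambda>a\<in>Obj (bas A). a), fm = (\<lambda>a b. \<lambda>u\<in>Hom (bas A) a b. u) \<rparr>,
                  mcell = (\<lambda>a x. \<lambda>r\<in>Els (str A) a x. r) \<rparr>),
     comp1 = (\<lambda>A B C n m. \<lparr>
        mfun = \<lparr> fo = (\<lambda>a\<in>Obj (bas A). fo (mfun n) (fo (mfun m) a)),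
                 fm = (\<lambda>a b. \<lambda>u\<in>Hom (bas A) a b.
                         fm (mfun n) (fo (mfun m) a) (fo (mfun m) b) (fm (mfun m) a b u)) \<rparr>,
        mcell = (\<lambda>a x. \<lambda>r\<in>Els (str A) a x.
                   mcell n (fo (mfun m) a) (bmap (fo (mfun m)) x) (mcell m a x r)) \<rparr>),
     id2 = (\<lambda>A B m. \<lambda>a\<in>Obj (bas A). Ide (bas B) (fo (mfun m) a)),
     vcomp = (\<lambda>A B m n p \<tau> \<sigma>. \<lambda>a\<in>Obj (bas A).
                Cmp (bas B) (fo (mfun m) a) (fo (mfun n) a) (fo (mfun p) a) (\<tau> a) (\<sigma> a)),
     hcomp = (\<lambda>A B C m m' n n' \<tau> \<sigma>. \<lambda>a\<in>Obj (bas A).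
                Cmp (bas C) (fo (mfun n) (fo (mfun m) a)) (fo (mfun n') (fo (mfun m) a))
                  (fo (mfun n') (fo (mfun m') a))
                  (fm (mfun n') (fo (mfun m) a) (fo (mfun m') a) (\<sigma> a)) (\<tau> (fo (mfun m) a))) \<rparr>"

end

theory Submission
  imports Defs
begin

text \<open>A normalized lax algebra \<open>B\<close> and its ultraconvergence space have the same arrows: normalization makes \<open>\<Gamma>\<close>
  identify \<open>A\<^sub>0(a,a')\<close> with the arrows \<open>a \<rightarrowtail> (a')\<close>, and the axioms force the action of \<open>A\<^sub>0\<close> and of \<open>\<beta>A\<^sub>0\<close> on arrows
  to be composition with these. Conversely, the arrows \<open>a \<rightarrowtail> (a')\<close> of an ultraconvergence space form a category
  \<open>pt(A)\<close>, over which \<open>A\<close> is a normalized lax algebra with \<open>\<Gamma> = id\<close>. So forgetting the category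
  is bijective on 1-cells and 2-cells and surjective on objects.

  It is not injective on objects: the hom-sets of \<open>B\<close> are recorded only up to the bijection \<open>\<Gamma>\<close>.
  A class bijection \<open>\<Phi>\<close> on objects is obtained by the Schroeder-Bernstein construction from \<open>A \<mapsto> pt(A)\<close> and from the
  injection that labels the arrows \<open>r: a \<rightarrowtail> (a')\<close> of the space of \<open>B\<close> by \<open>(r, \<Gamma>\<^sup>-\<^sup>1(r))\<close>.
  The space of \<open>\<Phi>(A)\<close> is then isomorphic to \<open>A\<close>, and conjugation with these isomorphisms
  gives the action on 1-cells and 2-cells.\<close>

section \<open>Small sets, families and germs\<close>

text \<open>An element of \<beta>A(x,Y) is a germ: an index map with a family, modulo equality
  almost everywhere. A composite in a space takes a family on the whole index set and no index map.
  The two are matched by factoring a germ \<open>(t, \<zeta>)\<close> into the reindexing along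
  \<open>t\<close> and the family \<zeta> over an identity index map, so that \<Delta>(r, (t,
  \<zeta>)) is r[t] composed with \<zeta>. That this depends only on the germ is not an axiom of
  spaces and has to be derived (\<open>dl_cong\<close>).

  The axioms of a space speak of reindexings only, whereas a lax algebra must be natural for all
  unary arrows. This extra naturality comes from associativity: in each case the two sides are
  recognized as reindexings of one iterated composite, and then only index maps have to be compared.

  The 2-category laws of lax algebras are never checked on lax algebras. They are carried over from
  spaces along the bijections of 1-cells and 2-cells. Smallness is likewise moved between
  \<open>A\<^sub>0\<close> and pt(A) along \<Gamma>.\<close>

lemma small_empty: "small ({} :: 'u::universe set)"
  unfolding small_def
  by (rule card_of_ordLess[THEN iffD1]) (auto)

lemma small_image:
  fixes f :: "'u::universe \<Rightarrow> 'u"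
  shows "small X \<Longrightarrow> small (f ` X)"
  unfolding small_def using card_of_image ordLeq_ordLess_trans by blast

lemma small_Pow:
  fixes X :: "'u::universe set" and f :: "'u set \<Rightarrow> 'u"
  assumes "small X"
  shows "small (f ` Pow X)"
  using strong_limit[OF assms] card_of_image[of f "Pow X"] ordLeq_ordLess_trans
  unfolding small_def by blast

text \<open>\<open>Pow {}\<close> has one element, so the strong limit axiom yields small singletons
  from the small empty set.\<close>

lemma small_singleton: "small {a :: 'u::universe}"
  using small_Pow[OF small_empty, of "\<lambda>_. a"] by simp

text \<open>A one-point universe would be a small singleton, that is, of smaller cardinality than
  itself.\<close>

lemma ex_two_points: "\<exists>b. b \<noteq> (a :: 'u::universe)"
proof (rule ccontr)
  assume "\<not> ?thesis"
  then have "(UNIV :: 'u set) = {a}" by auto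
  then show False
    using small_singleton[of a] unfolding small_def by (metis ordLess_irreflexive)
qed

lemma small_Un:
  fixes X Y :: "'u::universe set"
  assumes "small X" "small Y"
  shows "small (X \<union> Y)"
proof -
  obtain b :: 'u where b: "b \<noteq> star" using ex_two_points by blast
  \<comment> \<open>Regularity needs a small index set with two elements. The power set of a
    singleton provides one, with \<open>b\<close> distinct from \<open>star\<close>.\<close>
  have "small ((\<lambda>Z. if Z = {} then star else b) ` Pow {star :: 'u})"
    by (rule small_Pow[OF small_singleton])
  moreover have "(\<lambda>Z. if Z = {} then star else b) ` Pow {star :: 'u} = {star, b}" by auto
  ultimately have s: "small {star, b}" by simp
  have "small (\<Union>i\<in>{star, b}. if i = b then X else Y)"
    by (rule regular[OF s]) (simp add: assms)
  then show ?thesis using b by (simp add: Un_commute)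
qed

lemma ufst_pair [simp]: "ufst (pair x y) = x"
  unfolding ufst_def by (rule the_equality) (auto simp: pair_inject)

lemma usnd_pair [simp]: "usnd (pair x y) = y"
  unfolding usnd_def by (rule the_equality) (auto simp: pair_inject)

lemma reassoc_pair [simp]: "reassoc (pair x (pair y z)) = pair (pair x y) z"
  by (simp add: reassoc_def)

declare pair_inject [simp]

text \<open>The nested quantifier is itself closed under conjunction and weakening, so
  \<open>Abs_filter\<close> in \<open>usum\<close> loses nothing.\<close>

lemma eventually_usum:
  "eventually P (usum \<nu> \<rho>) \<longleftrightarrow> (\<forall>\<^sub>F x in \<nu>. \<forall>\<^sub>F z in \<rho> x. P (pair x z))"
  unfolding usum_def
proof (rule eventually_Abs_filter, standard, goal_cases)
  case (2 P Q)
  from this show ?case by eventually_elim (rule eventually_conj)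
next
  case (3 P Q)
  from 3(2) show ?case by eventually_elim (use 3(1) in \<open>auto elim!: eventually_mono\<close>)
qed simp

text \<open>The objects of \<beta>C depend on the set of objects of C alone. Hence one set serves
  for a category, for the discrete category on its objects and for the category of points.\<close>

definition bobj :: "'o set \<Rightarrow> ('i, 'o) ufam set" where
  "bobj S = {x. small (Ix x) \<and> Fm x \<in> Ix x \<rightarrow>\<^sub>E S \<and> ultrafilter_on (Ix x) (Uf x)}"

lemma Obj_beta [simp]: "Obj (beta C) = bobj (Obj C)"
  by (simp add: beta_def bobj_def Let_def)

lemma Hom_beta: "Hom (beta C) x y =
    (if x \<in> bobj (Obj C) \<and> y \<in> bobj (Obj C) then ugerms (Hom C) x y else {})"
  by (simp add: beta_def bobj_def Let_def)

lemma Ide_beta: "Ide (beta C) x = ucls (Hom C) x x (\<lambda>z\<in>Ix x. z, \<lambda>z\<in>Ix x. Ide C (Fm x z))"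
  by (simp add: beta_def Let_def)

lemma bobjD:
  assumes "x \<in> bobj S"
  shows bobj_small: "small (Ix x)" and bobj_Fm: "Fm x \<in> Ix x \<rightarrow>\<^sub>E S"
    and bobj_uf: "ultrafilter_on (Ix x) (Uf x)" and bobj_ev: "\<forall>\<^sub>F z in Uf x. z \<in> Ix x"
    and bobj_mem: "z \<in> Ix x \<Longrightarrow> Fm x z \<in> S"
    and bobj_ne: "Uf x \<noteq> bot" and bobj_ext: "restrict (Fm x) (Ix x) = Fm x"
  using assms by (auto simp: bobj_def ultrafilter_on_def)

lemma ufam_eqI: "Ix x = Ix y \<Longrightarrow> Fm x = Fm y \<Longrightarrow> Uf x = Uf y \<Longrightarrow> x = y"
  by (cases x; cases y) simp

text \<open>The index half of a representative of a germ. Morphisms of \<beta>C, elements of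
  \<beta>F and reindexings share it, whatever their families are.\<close>

definition uindex :: "('i, 'a) ufam \<Rightarrow> ('i, 'b) ufam \<Rightarrow> ('i \<Rightarrow> 'i) \<Rightarrow> bool" where
  "uindex x y t \<longleftrightarrow> t \<in> Ix y \<rightarrow>\<^sub>E Ix x \<and> filtermap t (Uf y) = Uf x"

lemma uindex_mem: "uindex x y t \<Longrightarrow> z \<in> Ix y \<Longrightarrow> t z \<in> Ix x"
  by (auto simp: uindex_def)

text \<open>The filter of \<open>x\<close> is the image of the filter of \<open>y\<close>, so
  agreement almost everywhere may be pulled back along index maps. Every well-definedness argument
  for germs rests on this.\<close>

lemma uindex_ae: "uindex x y t \<Longrightarrow> (\<forall>\<^sub>F w in Uf x. P w) \<Longrightarrow> \<forall>\<^sub>F z in Uf y. P (t z)"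
  by (metis uindex_def eventually_filtermap)

lemma filtermap_restrict: "\<forall>\<^sub>F z in F. z \<in> I \<Longrightarrow> filtermap (restrict f I) F = filtermap f F"
  unfolding filter_eq_iff eventually_filtermap
  by (intro allI iffI; erule (1) eventually_elim2) simp_all

lemma uindex_id: "\<forall>\<^sub>F z in Uf x. z \<in> Ix x \<Longrightarrow> uindex x x (\<lambda>z\<in>Ix x. z)"
  by (simp add: uindex_def filtermap_restrict filtermap_ident)

lemma uindex_comp:
  assumes "uindex x y g" "uindex y z h" "\<forall>\<^sub>F w in Uf z. w \<in> Ix z"
  shows "uindex x z (\<lambda>w\<in>Ix z. g (h w))"
  using assms by (auto simp: uindex_def filtermap_restrict simp flip: filtermap_filtermap)

lemma mem_upairs: "(t, \<zeta>) \<in> upairs E x y \<longleftrightarrow>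
    uindex x y t \<and> \<zeta> \<in> (\<Pi>\<^sub>E z\<in>Ix y. E (Fm x (t z)) (Fm y z))"
  by (auto simp: upairs_def uindex_def)

lemma upairs_uindex: "(t, \<zeta>) \<in> upairs E x y \<Longrightarrow> uindex x y t"
  by (simp add: mem_upairs)

lemma upairs_mem: "(t, \<zeta>) \<in> upairs E x y \<Longrightarrow> z \<in> Ix y \<Longrightarrow> \<zeta> z \<in> E (Fm x (t z)) (Fm y z)"
  by (auto simp: mem_upairs)

lemma ucls_cong:
  assumes "\<forall>\<^sub>F z in Uf y. fst p z = fst q z \<and> snd p z = snd q z"
  shows "ucls E x y p = ucls E x y q"
proof -
  have "(\<forall>\<^sub>F z in Uf y. fst r z = fst p z \<and> snd r z = snd p z) \<longleftrightarrow>
        (\<forall>\<^sub>F z in Uf y. fst r z = fst q z \<and> snd r z = snd q z)" for r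
    by (rule eventually_cong[OF assms]) simp
  then show ?thesis unfolding ucls_def by simp
qed

lemma ucls_self: "p \<in> upairs E x y \<Longrightarrow> p \<in> ucls E x y p"
  by (simp add: ucls_def)

text \<open>Operations on germs are defined through the choice \<open>rep\<close>. The chosen pair
  is again a legitimate representative and agrees almost everywhere with the given one, which is
  enough to evaluate an operation at any representative.\<close>

lemma rep_ucls:
  assumes "(t, \<zeta>) \<in> upairs E x y"
  obtains t' \<zeta>' where "rep (ucls E x y (t, \<zeta>)) = (t', \<zeta>')" "(t', \<zeta>') \<in> upairs E x y"
    "\<forall>\<^sub>F z in Uf y. t' z = t z \<and> \<zeta>' z = \<zeta> z"
    "ucls E x y (t', \<zeta>') = ucls E x y (t, \<zeta>)"
proof -
  have "rep (ucls E x y (t, \<zeta>)) \<in> ucls E x y (t, \<zeta>)"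
    unfolding rep_def by (rule someI, rule ucls_self[OF assms])
  moreover obtain t' \<zeta>' where e: "rep (ucls E x y (t, \<zeta>)) = (t', \<zeta>')" by fastforce
  ultimately have "(t', \<zeta>') \<in> ucls E x y (t, \<zeta>)" by simp
  then have a: "(t', \<zeta>') \<in> upairs E x y" "\<forall>\<^sub>F z in Uf y. t' z = t z \<and> \<zeta>' z = \<zeta> z"
    by (auto simp: ucls_def)
  then show ?thesis using that[OF e a ucls_cong] by simp
qed

lemma ugermsE:
  assumes "P \<in> ugerms E x y"
  obtains t \<zeta> where "(t, \<zeta>) \<in> upairs E x y" "P = ucls E x y (t, \<zeta>)" "rep P = (t, \<zeta>)"
proof -
  obtain t \<zeta> where t: "(t, \<zeta>) \<in> upairs E x y" and P: "P = ucls E x y (t, \<zeta>)"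
    using assms unfolding ugerms_def by (metis imageE surj_pair)
  obtain t' \<zeta>' where "rep (ucls E x y (t, \<zeta>)) = (t', \<zeta>')" "(t', \<zeta>') \<in> upairs E x y"
    "\<forall>\<^sub>F z in Uf y. t' z = t z \<and> \<zeta>' z = \<zeta> z" "ucls E x y (t', \<zeta>') = ucls E x y (t, \<zeta>)"
    by (rule rep_ucls[OF t])
  then show ?thesis using that[of t' \<zeta>'] unfolding P by simp
qed

section \<open>The category \<open>\<beta>C\<close>\<close>

text \<open>Well-definedness of composition: the first factors agree on a member of the filter of
  \<open>y\<close>, and this is pulled back along \<open>h\<close> to a member of the filter of
  \<open>z\<close>.\<close>

lemma beta_Cmp:
  assumes p: "(g, \<alpha>) \<in> upairs (Hom C) x y" and q: "(h, \<delta>) \<in> upairs (Hom C) y z"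
  shows "Cmp (beta C) x y z (ucls (Hom C) y z (h, \<delta>)) (ucls (Hom C) x y (g, \<alpha>)) =
    ucls (Hom C) x z (\<lambda>w\<in>Ix z. g (h w),
      \<lambda>w\<in>Ix z. Cmp C (Fm x (g (h w))) (Fm y (h w)) (Fm z w) (\<delta> w) (\<alpha> (h w)))"
proof -
  obtain g' \<alpha>' where p': "rep (ucls (Hom C) x y (g, \<alpha>)) = (g', \<alpha>')" "(g', \<alpha>') \<in> upairs (Hom C) x y"
    "\<forall>\<^sub>F z in Uf y. g' z = g z \<and> \<alpha>' z = \<alpha> z"
    "ucls (Hom C) x y (g', \<alpha>') = ucls (Hom C) x y (g, \<alpha>)"
    by (rule rep_ucls[OF p])
  obtain h' \<delta>' where q': "rep (ucls (Hom C) y z (h, \<delta>)) = (h', \<delta>')" "(h', \<delta>') \<in> upairs (Hom C) y z"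
    "\<forall>\<^sub>F w in Uf z. h' w = h w \<and> \<delta>' w = \<delta> w"
    "ucls (Hom C) y z (h', \<delta>') = ucls (Hom C) y z (h, \<delta>)"
    by (rule rep_ucls[OF q])
  have "\<forall>\<^sub>F w in Uf z. g' (h w) = g (h w) \<and> \<alpha>' (h w) = \<alpha> (h w)"
    using uindex_ae[OF upairs_uindex[OF q] p'(3)] .
  then have "\<forall>\<^sub>F w in Uf z. g' (h w) = g (h w) \<and> \<alpha>' (h w) = \<alpha> (h w) \<and> h' w = h w \<and> \<delta>' w = \<delta> w"
    using q'(3) by eventually_elim simp
  then show ?thesis unfolding beta_def Let_def
    by (auto simp: p'(1) q'(1) intro!: ucls_cong elim!: eventually_mono)
qed

lemma upairs_comp:
  assumes "category C" "(g, \<alpha>) \<in> upairs (Hom C) x y" "(h, \<delta>) \<in> upairs (Hom C) y z"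
    "\<forall>\<^sub>F w in Uf z. w \<in> Ix z"
  shows "(\<lambda>w\<in>Ix z. g (h w),
      \<lambda>w\<in>Ix z. Cmp C (Fm x (g (h w))) (Fm y (h w)) (Fm z w) (\<delta> w) (\<alpha> (h w))) \<in> upairs (Hom C) x z"
proof -
  interpret category C by fact
  note u = upairs_uindex[OF assms(2)] upairs_uindex[OF assms(3)]
  show ?thesis unfolding mem_upairs
    using uindex_comp[OF u assms(4)] uindex_mem[OF u(2)] upairs_mem[OF assms(2)] upairs_mem[OF assms(3)]
    by (simp add: Cmp_Hom)
qed

lemma upairs_Ide:
  assumes "category C" "x \<in> bobj (Obj C)"
  shows "(\<lambda>z\<in>Ix x. z, \<lambda>z\<in>Ix x. Ide C (Fm x z)) \<in> upairs (Hom C) x x"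
proof -
  interpret category C by fact
  show ?thesis using assms(2) by (auto simp: mem_upairs uindex_id bobjD intro!: Ide_Hom)
qed

lemma HomBE:
  assumes "P \<in> Hom (beta C) x y"
  obtains t \<zeta> where "x \<in> bobj (Obj C)" "y \<in> bobj (Obj C)" "(t, \<zeta>) \<in> upairs (Hom C) x y"
    "P = ucls (Hom C) x y (t, \<zeta>)" "rep P = (t, \<zeta>)"
  using assms unfolding Hom_beta by (auto split: if_splits elim!: ugermsE)

lemma HomBI: "x \<in> bobj (Obj C) \<Longrightarrow> y \<in> bobj (Obj C) \<Longrightarrow> p \<in> upairs (Hom C) x y \<Longrightarrow>
    ucls (Hom C) x y p \<in> Hom (beta C) x y"
  by (simp add: Hom_beta ugerms_def)

lemma category_beta:
  assumes "category C"
  shows "category (beta C)"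
proof -
  interpret category C by fact
  note C = assms
  show ?thesis
  proof (standard, goal_cases)
    case (1 f a b) then show ?case by (auto simp: Hom_beta split: if_splits)
  next
    case (2 a) then show ?case by (simp add: Ide_beta HomBI upairs_Ide[OF C])
  next
    case (3 f a b g c)
    then obtain t1 z1 t2 z2 where t: "a \<in> bobj (Obj C)" "c \<in> bobj (Obj C)"
      "(t1, z1) \<in> upairs (Hom C) a b" "f = ucls (Hom C) a b (t1, z1)"
      "(t2, z2) \<in> upairs (Hom C) b c" "g = ucls (Hom C) b c (t2, z2)" by (elim HomBE)
    show ?case unfolding t(4,6) beta_Cmp[OF t(3,5)]
      by (rule HomBI[OF t(1,2) upairs_comp[OF C t(3,5) bobj_ev[OF t(2)]]])
  next
    case (4 f a b)
    then obtain t \<zeta> where t: "a \<in> bobj (Obj C)" "b \<in> bobj (Obj C)" "(t, \<zeta>) \<in> upairs (Hom C) a b"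
      "f = ucls (Hom C) a b (t, \<zeta>)" by (elim HomBE)
    have "\<forall>\<^sub>F z in Uf b. z \<in> Ix b" using t bobj_ev by blast
    then show ?case unfolding Ide_beta t(4) beta_Cmp[OF t(3) upairs_Ide[OF C t(2)]]
      by (intro ucls_cong) (auto elim!: eventually_mono simp: upairs_mem[OF t(3)] Cmp_Ide_left)
  next
    case (5 f a b)
    then obtain t \<zeta> where t: "a \<in> bobj (Obj C)" "b \<in> bobj (Obj C)" "(t, \<zeta>) \<in> upairs (Hom C) a b"
      "f = ucls (Hom C) a b (t, \<zeta>)" by (elim HomBE)
    have "\<forall>\<^sub>F z in Uf b. z \<in> Ix b" using t bobj_ev by blast
    then show ?case unfolding Ide_beta t(4) beta_Cmp[OF upairs_Ide[OF C t(1)] t(3)]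
      using upairs_uindex[OF t(3)]
      by (intro ucls_cong) (auto elim!: eventually_mono simp: upairs_mem[OF t(3)] Cmp_Ide_right uindex_mem)
  next
    case (6 f a b g c h d)
    then obtain t1 z1 t2 z2 t3 z3 where t: "d \<in> bobj (Obj C)" "c \<in> bobj (Obj C)"
      "(t1, z1) \<in> upairs (Hom C) a b" "f = ucls (Hom C) a b (t1, z1)"
      "(t2, z2) \<in> upairs (Hom C) b c" "g = ucls (Hom C) b c (t2, z2)"
      "(t3, z3) \<in> upairs (Hom C) c d" "h = ucls (Hom C) c d (t3, z3)" by (elim HomBE)
    have e: "\<forall>\<^sub>F z in Uf d. z \<in> Ix d" "\<forall>\<^sub>F z in Uf c. z \<in> Ix c" using t bobj_ev by blast+
    note u = upairs_uindex[OF t(3)] upairs_uindex[OF t(5)] upairs_uindex[OF t(7)]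
    note m = upairs_mem[OF t(3)] upairs_mem[OF t(5)] upairs_mem[OF t(7)]
    show ?case
      unfolding t beta_Cmp[OF t(3) t(5)] beta_Cmp[OF t(5) t(7)]
        beta_Cmp[OF upairs_comp[OF C t(3) t(5) e(2)] t(7)]
        beta_Cmp[OF t(3) upairs_comp[OF C t(5) t(7) e(1)]]
      by (intro ucls_cong eventually_mono[OF e(1)])
        (simp add: uindex_mem[OF u(1)] uindex_mem[OF u(2)] uindex_mem[OF u(3)]
          Cmp_assoc[OF m(1) m(2) m(3)])
  qed
qed

section \<open>The extension of \<open>\<beta>\<close> to profunctors\<close>

lemma Els_bprof: "Els (bprof C D F) x y =
    (if x \<in> bobj (Obj D) \<and> y \<in> bobj (Obj C) then ugerms (Els F) x y else {})"
  by (simp add: bprof_def)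

lemma bprofE:
  assumes "P \<in> Els (bprof C D F) x y"
  obtains t \<zeta> where "x \<in> bobj (Obj D)" "y \<in> bobj (Obj C)" "(t, \<zeta>) \<in> upairs (Els F) x y"
    "P = ucls (Els F) x y (t, \<zeta>)" "rep P = (t, \<zeta>)"
  using assms unfolding Els_bprof by (auto split: if_splits elim!: ugermsE)

lemma bprofI: "x \<in> bobj (Obj D) \<Longrightarrow> y \<in> bobj (Obj C) \<Longrightarrow> p \<in> upairs (Els F) x y \<Longrightarrow>
    ucls (Els F) x y p \<in> Els (bprof C D F) x y"
  by (simp add: Els_bprof ugerms_def)

text \<open>As for composition in \<beta>C, but with two pullbacks: the left morphism is only known
  on a member of the filter of \<open>x\<close>, which is pulled back along \<open>t\<close> and
  then along \<open>l\<close>.\<close>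

lemma bprof_Act:
  assumes p: "(g, \<alpha>) \<in> upairs (Hom D) x' x" and q: "(l, \<delta>) \<in> upairs (Hom C) y y'"
    and r: "(t, \<zeta>) \<in> upairs (Els F) x y"
  shows "Act (bprof C D F) x x' y y' (ucls (Hom D) x' x (g, \<alpha>)) (ucls (Hom C) y y' (l, \<delta>))
      (ucls (Els F) x y (t, \<zeta>)) =
    ucls (Els F) x' y' (\<lambda>w\<in>Ix y'. g (t (l w)),
      \<lambda>w\<in>Ix y'. Act F (Fm x (t (l w))) (Fm x' (g (t (l w)))) (Fm y (l w)) (Fm y' w)
                              (\<alpha> (t (l w))) (\<delta> w) (\<zeta> (l w)))"
proof -
  obtain g' \<alpha>' where p': "rep (ucls (Hom D) x' x (g, \<alpha>)) = (g', \<alpha>')"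
    "(g', \<alpha>') \<in> upairs (Hom D) x' x" "\<forall>\<^sub>F z in Uf x. g' z = g z \<and> \<alpha>' z = \<alpha> z"
    "ucls (Hom D) x' x (g', \<alpha>') = ucls (Hom D) x' x (g, \<alpha>)"
    by (rule rep_ucls[OF p])
  obtain l' \<delta>' where q': "rep (ucls (Hom C) y y' (l, \<delta>)) = (l', \<delta>')"
    "(l', \<delta>') \<in> upairs (Hom C) y y'" "\<forall>\<^sub>F w in Uf y'. l' w = l w \<and> \<delta>' w = \<delta> w"
    "ucls (Hom C) y y' (l', \<delta>') = ucls (Hom C) y y' (l, \<delta>)"
    by (rule rep_ucls[OF q])
  obtain t' \<zeta>' where r': "rep (ucls (Els F) x y (t, \<zeta>)) = (t', \<zeta>')"
    "(t', \<zeta>') \<in> upairs (Els F) x y" "\<forall>\<^sub>F w in Uf y. t' w = t w \<and> \<zeta>' w = \<zeta> w"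
    "ucls (Els F) x y (t', \<zeta>') = ucls (Els F) x y (t, \<zeta>)"
    by (rule rep_ucls[OF r])
  have "\<forall>\<^sub>F w in Uf y'. g' (t (l w)) = g (t (l w)) \<and> \<alpha>' (t (l w)) = \<alpha> (t (l w))"
    using uindex_ae[OF upairs_uindex[OF q] uindex_ae[OF upairs_uindex[OF r] p'(3)]] .
  moreover have "\<forall>\<^sub>F w in Uf y'. t' (l w) = t (l w) \<and> \<zeta>' (l w) = \<zeta> (l w)"
    using uindex_ae[OF upairs_uindex[OF q] r'(3)] .
  ultimately have "\<forall>\<^sub>F w in Uf y'. g' (t (l w)) = g (t (l w)) \<and> \<alpha>' (t (l w)) = \<alpha> (t (l w)) \<and>
     t' (l w) = t (l w) \<and> \<zeta>' (l w) = \<zeta> (l w) \<and> l' w = l w \<and> \<delta>' w = \<delta> w"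
    using q'(3) by eventually_elim simp
  then show ?thesis unfolding bprof_def
    by (auto simp: p'(1) q'(1) r'(1) intro!: ucls_cong elim!: eventually_mono)
qed

lemma upairs_Act:
  assumes "profunctor C D F" "(g, \<alpha>) \<in> upairs (Hom D) x' x" "(l, \<delta>) \<in> upairs (Hom C) y y'"
    "(t, \<zeta>) \<in> upairs (Els F) x y" "\<forall>\<^sub>F w in Uf y. w \<in> Ix y" "\<forall>\<^sub>F w in Uf y'. w \<in> Ix y'"
  shows "(\<lambda>w\<in>Ix y'. g (t (l w)),
      \<lambda>w\<in>Ix y'. Act F (Fm x (t (l w))) (Fm x' (g (t (l w)))) (Fm y (l w)) (Fm y' w)
                              (\<alpha> (t (l w))) (\<delta> w) (\<zeta> (l w))) \<in> upairs (Els F) x' y'"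
proof -
  interpret profunctor C D F by fact
  note u = upairs_uindex[OF assms(2)] upairs_uindex[OF assms(3)] upairs_uindex[OF assms(4)]
  have "(\<lambda>w\<in>Ix y'. (\<lambda>w\<in>Ix y. g (t w)) (l w)) = (\<lambda>w\<in>Ix y'. g (t (l w)))"
    by (rule restrict_ext) (simp add: uindex_mem[OF u(2)])
  then have "uindex x' y' (\<lambda>w\<in>Ix y'. g (t (l w)))"
    using uindex_comp[OF uindex_comp[OF u(1) u(3) assms(5)] u(2) assms(6)] by simp
  then show ?thesis unfolding mem_upairs
    using uindex_mem[OF u(2)] uindex_mem[OF u(3)] upairs_mem[OF assms(2)] upairs_mem[OF assms(3)]
      upairs_mem[OF assms(4)]
    by (simp add: Act_Els)
qed

lemma profunctor_bprof:
  assumes "profunctor C D F" "category C" "category D"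
  shows "profunctor (beta C) (beta D) (bprof C D F)"
proof -
  interpret profunctor C D F by fact
  interpret C: category C by fact
  interpret D: category D by fact
  note P = assms(1) and C = assms(2) and D = assms(3)
  show ?thesis
  proof (standard, goal_cases)
    case (1 r d c) then show ?case by (auto simp: Els_bprof split: if_splits)
  next
    case (2 u d' d v c c' r)
    obtain g \<alpha> where g: "d' \<in> bobj (Obj D)" "(g, \<alpha>) \<in> upairs (Hom D) d' d" "u = ucls (Hom D) d' d (g, \<alpha>)"
      using 2 by (elim HomBE)
    obtain l \<delta> where l: "c' \<in> bobj (Obj C)" "(l, \<delta>) \<in> upairs (Hom C) c c'"
      "v = ucls (Hom C) c c' (l, \<delta>)" using 2 by (elim HomBE)
    obtain t \<zeta> where t: "c \<in> bobj (Obj C)" "(t, \<zeta>) \<in> upairs (Els F) d c" "r = ucls (Els F) d c (t, \<zeta>)"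
      using 2 by (elim bprofE)
    show ?case unfolding g(3) l(3) t(3) bprof_Act[OF g(2) l(2) t(2)]
      by (rule bprofI[OF g(1) l(1) upairs_Act[OF P g(2) l(2) t(2) bobj_ev[OF t(1)] bobj_ev[OF l(1)]]])
  next
    case (3 r d c)
    then obtain t \<zeta> where t: "d \<in> bobj (Obj D)" "c \<in> bobj (Obj C)" "(t, \<zeta>) \<in> upairs (Els F) d c"
      "r = ucls (Els F) d c (t, \<zeta>)" by (elim bprofE)
    have e: "\<forall>\<^sub>F z in Uf c. z \<in> Ix c" using t bobj_ev by blast
    show ?case unfolding t Ide_beta bprof_Act[OF upairs_Ide[OF D t(1)] upairs_Ide[OF C t(2)] t(3)]
      by (intro ucls_cong eventually_mono[OF e])
        (simp add: uindex_mem[OF upairs_uindex[OF t(3)]] Act_Ide[OF upairs_mem[OF t(3)]])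
  next
    case (4 u d' d u' d'' v c c' v' c'' r)
    obtain g \<alpha> where g: "d \<in> bobj (Obj D)" "(g, \<alpha>) \<in> upairs (Hom D) d' d" "u = ucls (Hom D) d' d (g, \<alpha>)"
      using 4 by (elim HomBE)
    obtain g' \<alpha>' where g': "(g', \<alpha>') \<in> upairs (Hom D) d'' d'" "u' = ucls (Hom D) d'' d' (g', \<alpha>')"
      using 4 by (elim HomBE)
    obtain l \<delta> where l: "c \<in> bobj (Obj C)" "c' \<in> bobj (Obj C)" "(l, \<delta>) \<in> upairs (Hom C) c c'"
      "v = ucls (Hom C) c c' (l, \<delta>)" using 4 by (elim HomBE)
    obtain l' \<delta>' where l': "c'' \<in> bobj (Obj C)" "(l', \<delta>') \<in> upairs (Hom C) c' c''"
      "v' = ucls (Hom C) c' c'' (l', \<delta>')" using 4 by (elim HomBE)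
    obtain t \<zeta> where t: "(t, \<zeta>) \<in> upairs (Els F) d c" "r = ucls (Els F) d c (t, \<zeta>)"
      using 4 by (elim bprofE)
    have e: "\<forall>\<^sub>F z in Uf c. z \<in> Ix c" "\<forall>\<^sub>F z in Uf c'. z \<in> Ix c'" "\<forall>\<^sub>F z in Uf c''. z \<in> Ix c''"
      "\<forall>\<^sub>F z in Uf d. z \<in> Ix d"
      using l l' g bobj_ev by blast+
    note u = upairs_uindex[OF g(2)] upairs_uindex[OF g'(1)] upairs_uindex[OF l(3)]
      upairs_uindex[OF l'(2)] upairs_uindex[OF t(1)]
    show ?case
      unfolding g g' l l' t beta_Cmp[OF g'(1) g(2)] beta_Cmp[OF l(3) l'(2)]
        bprof_Act[OF g(2) l(3) t(1)] bprof_Act[OF g'(1) l'(2) upairs_Act[OF P g(2) l(3) t(1) e(1,2)]]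
        bprof_Act[OF upairs_comp[OF D g'(1) g(2) e(4)] upairs_comp[OF C l(3) l'(2) e(3)] t(1)]
      by (intro ucls_cong eventually_mono[OF e(3)])
        (simp add: uindex_mem[OF u(1)] uindex_mem[OF u(2)] uindex_mem[OF u(3)] uindex_mem[OF u(4)]
          uindex_mem[OF u(5)] Act_Cmp[OF upairs_mem[OF g(2)] upairs_mem[OF g'(1)] upairs_mem[OF l(3)]
          upairs_mem[OF l'(2)] upairs_mem[OF t(1)]])
  qed
qed

section \<open>Composition of profunctors\<close>

text \<open>A function that is constant on generating pairs is constant on the classes of the
  generated equivalence, so it may be evaluated at the chosen representative. Maps out of coends are
  shown to be well defined in this way.\<close>

lemma rep_coend_cls:
  assumes "\<And>p q. (p, q) \<in> coend_rel C D E G F e c \<Longrightarrow> \<phi> p = \<phi> q"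
  shows "\<phi> (rep (coend_cls C D E G F e c p)) = \<phi> p"
proof -
  let ?R = "coend_rel C D E G F e c \<union> (coend_rel C D E G F e c)\<inverse>"
  have "rep (coend_cls C D E G F e c p) \<in> coend_cls C D E G F e c p"
    unfolding rep_def by (rule someI[of _ p]) (simp add: coend_cls_def)
  then have "(p, rep (coend_cls C D E G F e c p)) \<in> ?R\<^sup>*" by (simp add: coend_cls_def)
  then show ?thesis
    by (induction rule: rtrancl_induct) (auto dest: assms)
qed

lemma coend_cls_eqI:
  assumes "(p, q) \<in> coend_rel C D E G F e c"
  shows "coend_cls C D E G F e c p = coend_cls C D E G F e c q"
proof -
  let ?R = "(coend_rel C D E G F e c \<union> (coend_rel C D E G F e c)\<inverse>)\<^sup>*"
  have "(p, q) \<in> ?R" "(q, p) \<in> ?R" using assms by (auto intro!: r_into_rtrancl)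
  then show ?thesis unfolding coend_cls_def by (auto intro: rtrancl_trans)
qed

locale composable =
  E: category E + D: category D + C: category C + G: profunctor D E G + F: profunctor C D F
  for C :: "('c, 'cm) cat" and D :: "('d, 'dm) cat" and E :: "('e, 'em) cat"
    and G :: "('e, 'em, 'd, 'dm, 's) prof" and F :: "('d, 'dm, 'c, 'cm, 'r) prof"
begin

lemma coend_relE:
  assumes "(p, q) \<in> coend_rel C D E G F e c"
  obtains d d' v g f where "p = (d', ract E G e d d' v g, f)" "q = (d, g, lact C F d' d c v f)"
    "v \<in> Hom D d d'" "g \<in> Els G e d" "f \<in> Els F d' c"
    "ract E G e d d' v g \<in> Els G e d'" "lact C F d' d c v f \<in> Els F d c"
    "e \<in> Obj E" "c \<in> Obj C" "d \<in> Obj D" "d' \<in> Obj D"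
proof -
  obtain d d' v g f where a: "p = (d', ract E G e d d' v g, f)" "q = (d, g, lact C F d' d c v f)"
    "v \<in> Hom D d d'" "g \<in> Els G e d" "f \<in> Els F d' c"
    using assms unfolding coend_rel_def by blast
  then have "e \<in> Obj E" "c \<in> Obj C" "d \<in> Obj D" "d' \<in> Obj D" by (auto dest: G.Els_Obj F.Els_Obj)
  with a that show ?thesis by (metis G.Act_Els F.Act_Els E.Ide_Hom C.Ide_Hom)
qed

lemma pcomp_ElsE:
  assumes "P \<in> Els (pcomp C D E G F) e c"
  obtains d g f where "P = coend_cls C D E G F e c (d, g, f)" "g \<in> Els G e d" "f \<in> Els F d c"
  using assms by (auto simp: pcomp_def)

lemma pcomp_ElsI:
  "g \<in> Els G e d \<Longrightarrow> f \<in> Els F d c \<Longrightarrow> coend_cls C D E G F e c (d, g, f) \<in> Els (pcomp C D E G F) e c"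
  by (auto simp: pcomp_def dest: G.Els_Obj)

lemma coend_dinatural:
  "v \<in> Hom D d d' \<Longrightarrow> g \<in> Els G e d \<Longrightarrow> f \<in> Els F d' c \<Longrightarrow>
    coend_cls C D E G F e c (d', ract E G e d d' v g, f) =
    coend_cls C D E G F e c (d, g, lact C F d' d c v f)"
  by (rule coend_cls_eqI) (auto simp: coend_rel_def)

lemma pcomp_Act:
  assumes u: "u \<in> Hom E e' e" and v: "v \<in> Hom C c c'" and g: "g \<in> Els G e d" and f: "f \<in> Els F d c"
  shows "Act (pcomp C D E G F) e e' c c' u v (coend_cls C D E G F e c (d, g, f)) =
    coend_cls C D E G F e' c' (d, lact D G e e' d u g, ract D F d c c' v f)"
proof -
  \<comment> \<open>\<open>Act\<close> of a composite profunctor is \<phi> after \<open>rep\<close>,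
    so \<phi> only has to respect the generating pairs.\<close>
  define \<phi> where "\<phi> = (\<lambda>(d, g, f). coend_cls C D E G F e' c' (d, lact D G e e' d u g, ract D F d c c' v f))"
  have "\<phi> (rep (coend_cls C D E G F e c (d, g, f))) = \<phi> (d, g, f)"
  proof (rule rep_coend_cls)
    fix p q assume "(p, q) \<in> coend_rel C D E G F e c"
    then obtain d d' w g f where pq: "p = (d', ract E G e d d' w g, f)" "q = (d, g, lact C F d' d c w f)"
      "w \<in> Hom D d d'" "g \<in> Els G e d" "f \<in> Els F d' c"
      "ract E G e d d' w g \<in> Els G e d'" "lact C F d' d c w f \<in> Els F d c"
      "e \<in> Obj E" "c \<in> Obj C" "d \<in> Obj D" "d' \<in> Obj D" by (rule coend_relE)
    have o: "e' \<in> Obj E" "c' \<in> Obj C" using u v E.Hom_Obj C.Hom_Obj by auto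
    note [intro!] = E.Ide_Hom D.Ide_Hom C.Ide_Hom G.Act_Els F.Act_Els
    note [simp] = E.Cmp_Ide_right E.Cmp_Ide_left D.Cmp_Ide_right D.Cmp_Ide_left C.Cmp_Ide_right C.Cmp_Ide_left
    note EI = E.Ide_Hom D.Ide_Hom C.Ide_Hom
    \<comment> \<open>The actions of \<open>u\<close> and \<open>w\<close> on \<open>G\<close>
      commute, and so do those of \<open>w\<close> and \<open>v\<close> on \<open>F\<close>, because
      both orders equal the joint action. After the exchange the two triples form a generating pair
      again.\<close>
    have a: "Act G e e' d' d' u (Ide D d') (Act G e e d d' (Ide E e) w g) = Act G e e' d d' u w g"
      using G.Act_Cmp[of "Ide E e" e e u e' w d d' "Ide D d'" d' g] pq u EI by simp
    have b: "Act G e e' d d' u w g = Act G e' e' d d' (Ide E e') w (Act G e e' d d u (Ide D d) g)"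
      using G.Act_Cmp[of u e' e "Ide E e'" e' "Ide D d" d d w d' g] pq u o EI by simp
    have a': "Act F d d c c' (Ide D d) v (Act F d' d c c w (Ide C c) f) = Act F d' d c c' w v f"
      using F.Act_Cmp[of w d d' "Ide D d" d "Ide C c" c c v c' f] pq v EI by simp
    have b': "Act F d' d c c' w v f = Act F d' d c' c' w (Ide C c') (Act F d' d' c c' (Ide D d') v f)"
      using F.Act_Cmp[of "Ide D d'" d' d' w d v c c' "Ide C c'" c' f] pq v o EI by simp
    show "\<phi> p = \<phi> q" unfolding pq \<phi>_def prod.case a b a' b'
      by (rule coend_dinatural) (use pq u v in auto)
  qed
  then show ?thesis by (simp add: pcomp_def \<phi>_def)
qed

end

section \<open>Unit, multiplication and reindexings\<close>

lemma over_sel [simp]: "Ix (over x Y) = Ix x" "Fm (over x Y) = Y" "Uf (over x Y) = Uf x"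
  by (simp_all add: over_def)

lemma bmap_sel [simp]: "Ix (bmap f x) = Ix x" "Fm (bmap f x) = (\<lambda>z\<in>Ix x. f (Fm x z))" "Uf (bmap f x) = Uf x"
  by (simp_all add: bmap_def)

lemma eta_sel [simp]: "Ix (eta c) = {star}" "Fm (eta c) = (\<lambda>z\<in>{star}. c)" "Uf (eta c) = principal {star}"
  by (simp_all add: eta_def)

lemma over_eq: "Ix x = Ix Y \<Longrightarrow> Uf x = Uf Y \<Longrightarrow> over x (Fm Y) = Y"
  by (rule ufam_eqI) simp_all

lemma over_bobj: "x \<in> bobj S \<Longrightarrow> Y \<in> Ix x \<rightarrow>\<^sub>E T \<Longrightarrow> over x Y \<in> bobj T"
  by (simp add: bobj_def)

lemma bmap_bobj: "x \<in> bobj S \<Longrightarrow> (\<And>a. a \<in> S \<Longrightarrow> f a \<in> T) \<Longrightarrow> bmap f x \<in> bobj T"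
  by (auto simp: bobj_def)

lemma eta_bobj: "c \<in> S \<Longrightarrow> eta c \<in> bobj S"
  by (simp add: bobj_def small_singleton ultrafilter_on_def eventually_principal principal_eq_bot_iff)

lemma eta_bobj_iff: "eta c \<in> bobj S \<longleftrightarrow> c \<in> S"
  by (auto simp: eta_bobj dest: bobj_mem[where z = star])

lemma bmap_bmap: "bmap g (bmap f x) = bmap (\<lambda>a. g (f a)) x"
  by (rule ufam_eqI) (auto simp: fun_eq_iff)

lemma bmap_cong: "(\<And>z. z \<in> Ix x \<Longrightarrow> f (Fm x z) = g (Fm x z)) \<Longrightarrow> bmap f x = bmap g x"
  by (rule ufam_eqI) (auto simp: fun_eq_iff)

lemma bmap_id: "x \<in> bobj S \<Longrightarrow> (\<And>a. a \<in> S \<Longrightarrow> f a = a) \<Longrightarrow> bmap f x = x"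
  by (rule ufam_eqI) (auto intro!: extensionalityI[of _ "Ix x"] simp: bobj_mem PiE_iff dest!: bobj_Fm)

lemma bmap_eta [simp]: "bmap f (eta c) = eta (f c)"
  by (rule ufam_eqI) (auto simp: fun_eq_iff)

section \<open>The multiplication on objects\<close>

lemma Ix_mu: "Ix (mu Y) = {pair x z | x z. x \<in> Ix Y \<and> z \<in> Ix (Fm Y x)}"
  by (simp add: mu_def)

lemma mem_Ix_mu [simp]: "pair x z \<in> Ix (mu Y) \<longleftrightarrow> x \<in> Ix Y \<and> z \<in> Ix (Fm Y x)"
  by (auto simp: Ix_mu)

lemma Ix_muE: "w \<in> Ix (mu Y) \<Longrightarrow> (\<And>x z. w = pair x z \<Longrightarrow> x \<in> Ix Y \<Longrightarrow> z \<in> Ix (Fm Y x) \<Longrightarrow> P) \<Longrightarrow> P"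
  by (auto simp: Ix_mu)

lemma Ball_Ix_mu: "(\<forall>w\<in>Ix (mu Y). P w) \<longleftrightarrow> (\<forall>x\<in>Ix Y. \<forall>z\<in>Ix (Fm Y x). P (pair x z))"
  by (auto simp: Ix_mu)

lemma Fm_mu: "x \<in> Ix Y \<Longrightarrow> z \<in> Ix (Fm Y x) \<Longrightarrow> Fm (mu Y) (pair x z) = Fm (Fm Y x) z"
  by (auto simp: mu_def)

lemma Fm_mu_ext: "Fm (mu Y) \<in> extensional (Ix (mu Y))"
  by (simp add: mu_def)

lemma eventually_mu: "eventually P (Uf (mu Y)) \<longleftrightarrow> (\<forall>\<^sub>F x in Uf Y. \<forall>\<^sub>F z in Uf (Fm Y x). P (pair x z))"
  by (simp add: mu_def eventually_usum)

lemma restrict_mu_cong: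
  "(\<And>x z. x \<in> Ix Y \<Longrightarrow> z \<in> Ix (Fm Y x) \<Longrightarrow> f (pair x z) = g (pair x z)) \<Longrightarrow>
   (\<lambda>w\<in>Ix (mu Y). f w) = (\<lambda>w\<in>Ix (mu Y). g w)"
  by (auto simp: Ix_mu fun_eq_iff)

lemma mu_eqI:
  assumes "Ix y = Ix (mu Y)" "Fm y \<in> extensional (Ix y)" "Uf y = Uf (mu Y)"
    "\<And>x z. x \<in> Ix Y \<Longrightarrow> z \<in> Ix (Fm Y x) \<Longrightarrow> Fm y (pair x z) = Fm (Fm Y x) z"
  shows "y = mu Y"
proof (rule ufam_eqI)
  show "Fm y = Fm (mu Y)"
    by (rule extensionalityI[OF _ Fm_mu_ext]) (use assms in \<open>auto simp: Fm_mu elim: Ix_muE\<close>)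
qed (use assms in simp_all)

text \<open>The index set is a small union of small sets, whence regularity. The outer filter
  decides whether \<open>P\<close> holds eventually in almost all inner filters; if it does not,
  almost all inner filters decide for the negation.\<close>

lemma mu_bobj:
  assumes "Y \<in> bobj (bobj S)"
  shows "mu Y \<in> bobj S"
proof -
  note Y = bobj_mem[OF assms]
  have "Ix (mu Y) = (\<Union>x\<in>Ix Y. pair x ` Ix (Fm Y x))" by (auto simp: Ix_mu)
  then have "small (Ix (mu Y))"
    by (auto intro!: regular bobj_small[OF assms] small_image bobj_small[OF Y])
  moreover have "Fm (mu Y) \<in> Ix (mu Y) \<rightarrow>\<^sub>E S"
    using Fm_mu_ext bobj_mem[OF Y] by (auto simp: PiE_iff Fm_mu elim!: Ix_muE)
  moreover have "ultrafilter_on (Ix (mu Y)) (Uf (mu Y))"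
    unfolding ultrafilter_on_def
  proof (intro conjI allI)
    show "\<forall>\<^sub>F x in Uf (mu Y). x \<in> Ix (mu Y)"
      unfolding eventually_mu using bobj_ev[OF assms]
      by eventually_elim (use bobj_ev[OF Y] in \<open>auto elim: eventually_mono\<close>)
    show "Uf (mu Y) \<noteq> bot"
    proof
      assume "Uf (mu Y) = bot"
      then have "\<forall>\<^sub>F x in Uf Y. \<forall>\<^sub>F z in Uf (Fm Y x). False"
        using eventually_mu[of "\<lambda>_. False" Y] by simp
      with bobj_ev[OF assms] have "\<forall>\<^sub>F x in Uf Y. False"
        by eventually_elim (use bobj_ne[OF Y] in \<open>simp add: eventually_False\<close>)
      with bobj_ne[OF assms] show False by (simp add: eventually_False)
    qed
    fix P
    have *: "(\<forall>\<^sub>F x in Uf Y. \<forall>\<^sub>F z in Uf (Fm Y x). P (pair x z)) \<or>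
      (\<forall>\<^sub>F x in Uf Y. \<not> (\<forall>\<^sub>F z in Uf (Fm Y x). P (pair x z)))"
      using bobj_uf[OF assms] by (simp add: ultrafilter_on_def)
    have "\<forall>\<^sub>F x in Uf Y. (\<forall>\<^sub>F z in Uf (Fm Y x). P (pair x z)) \<or> (\<forall>\<^sub>F z in Uf (Fm Y x). \<not> P (pair x z))"
      using bobj_ev[OF assms] by eventually_elim (use bobj_uf[OF Y] in \<open>auto simp: ultrafilter_on_def\<close>)
    then have "\<forall>\<^sub>F x in Uf Y. \<forall>\<^sub>F z in Uf (Fm Y x). \<not> P (pair x z)"
      if "\<forall>\<^sub>F x in Uf Y. \<not> (\<forall>\<^sub>F z in Uf (Fm Y x). P (pair x z))"
      using that by eventually_elim blast
    with * show "eventually P (Uf (mu Y)) \<or> (\<forall>\<^sub>F x in Uf (mu Y). \<not> P x)"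
      unfolding eventually_mu by blast
  qed
  ultimately show ?thesis by (simp add: bobj_def)
qed

text \<open>The intermediate object in the factorization of a germ: \<open>x\<close> reindexed along
  \<open>t\<close>, with the index set and filter of \<open>y\<close>. A pair
  \<open>(t, \<zeta>)\<close> is the reindexing from \<open>x\<close> to \<open>pull x t y\<close>
  followed by the family \<zeta> over the identity index map.\<close>

definition pull :: "('i, 'a) ufam \<Rightarrow> ('i \<Rightarrow> 'i) \<Rightarrow> ('i, 'b) ufam \<Rightarrow> ('i, 'a) ufam" where
  "pull x t y = Ufam (Ix y) (\<lambda>z\<in>Ix y. Fm x (t z)) (Uf y)"

lemma pull_sel [simp]: "Ix (pull x t y) = Ix y" "Fm (pull x t y) = (\<lambda>z\<in>Ix y. Fm x (t z))"
    "Uf (pull x t y) = Uf y"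
  by (simp_all add: pull_def)

lemma pull_bobj: "x \<in> bobj S \<Longrightarrow> y \<in> bobj T \<Longrightarrow> (\<And>z. z \<in> Ix y \<Longrightarrow> t z \<in> Ix x) \<Longrightarrow> pull x t y \<in> bobj S"
  by (auto simp: bobj_def)

text \<open>The relation \<open>reindex\<close> with a bare set of points as parameter, so that it
  also applies to \<beta> of nondiscrete categories and to iterates of \<beta>.\<close>

definition reidx :: "'o set \<Rightarrow> ('i, 'o) ufam \<Rightarrow> ('i, 'o) ufam \<Rightarrow> ('i \<Rightarrow> 'i) \<Rightarrow> bool" where
  "reidx S x y g \<longleftrightarrow> x \<in> bobj S \<and> y \<in> bobj S \<and> uindex x y g \<and> (\<forall>z\<in>Ix y. Fm y z = Fm x (g z))"

lemma reindex_iff: "reindex A x y g \<longleftrightarrow> reidx (upts A) x y g"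
  by (auto simp: reindex_def reidx_def uindex_def disc_def)

lemma reidxD:
  assumes "reidx S x y g"
  shows "x \<in> bobj S" "y \<in> bobj S" "uindex x y g" "z \<in> Ix y \<Longrightarrow> g z \<in> Ix x"
    "z \<in> Ix y \<Longrightarrow> Fm x (g z) = Fm y z" "restrict g (Ix y) = g"
  using assms by (auto simp: reidx_def uindex_mem) (auto simp: uindex_def PiE_iff extensional_restrict)

lemma reidx_id: "x \<in> bobj S \<Longrightarrow> reidx S x x (\<lambda>z\<in>Ix x. z)"
  by (simp add: reidx_def uindex_id bobj_ev)

lemma reidx_comp: "reidx S x y g \<Longrightarrow> reidx S y z h \<Longrightarrow> reidx S x z (\<lambda>w\<in>Ix z. g (h w))"
  by (auto simp: reidx_def uindex_mem intro: uindex_comp bobj_ev)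

lemma uindexI:
  assumes "g \<in> Ix y \<rightarrow>\<^sub>E Ix x" "\<And>P. eventually P (Uf x) \<longleftrightarrow> (\<forall>\<^sub>F z in Uf y. P (g z))"
  shows "uindex x y g"
  using assms by (simp add: uindex_def filter_eq_iff eventually_filtermap)

lemma eventually_restrict:
  "\<forall>\<^sub>F z in F. z \<in> I \<Longrightarrow> (\<forall>\<^sub>F z in F. P (restrict g I z)) \<longleftrightarrow> (\<forall>\<^sub>F z in F. P (g z))"
  by (auto elim: eventually_elim2)

lemma reidx_pull:
  "x \<in> bobj S \<Longrightarrow> y \<in> bobj T \<Longrightarrow> uindex x y t \<Longrightarrow> reidx S x (pull x t y) t"
  by (auto simp: reidx_def uindex_def intro: pull_bobj)

text \<open>Canonical index maps such as \<open>usnd\<close> are total functions, while index maps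
  of germs are extensional; restriction to the index set mediates between them.\<close>

lemma reidx_restrict:
  assumes "x \<in> bobj S" "y \<in> bobj S" "\<And>z. z \<in> Ix y \<Longrightarrow> g z \<in> Ix x"
    "\<And>z. z \<in> Ix y \<Longrightarrow> Fm x (g z) = Fm y z"
    "\<And>P. eventually P (Uf x) \<longleftrightarrow> (\<forall>\<^sub>F z in Uf y. P (g z))"
  shows "reidx S x y (\<lambda>z\<in>Ix y. g z)"
proof -
  have "uindex x y (\<lambda>z\<in>Ix y. g z)"
    by (rule uindexI) (use assms(3) in \<open>simp_all only: eventually_restrict[OF bobj_ev[OF assms(2)]] assms(5),
      simp_all\<close>)
  then show ?thesis using assms(1-4) by (simp add: reidx_def)
qed

section \<open>Canonical isomorphisms of the pseudomonad as reindexings\<close>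

lemma reidx_mu_eta: "x \<in> bobj S \<Longrightarrow> reidx S (mu (eta x)) x (\<lambda>z\<in>Ix x. pair star z)"
  by (rule reidx_restrict)
    (auto simp: Fm_mu eventually_mu eventually_principal intro: mu_bobj eta_bobj)

lemma reidx_mu_eta': "x \<in> bobj S \<Longrightarrow> reidx S x (mu (eta x)) (\<lambda>w\<in>Ix (mu (eta x)). usnd w)"
  by (rule reidx_restrict)
    (auto simp: Fm_mu eventually_mu eventually_principal intro: mu_bobj eta_bobj elim!: Ix_muE)

lemma bmap_eta_bobj: "x \<in> bobj S \<Longrightarrow> bmap eta x \<in> bobj (bobj S)"
  by (rule bmap_bobj) (auto intro: eta_bobj)

lemma eventually_mu_bmap_eta:
  "x \<in> bobj S \<Longrightarrow> eventually P (Uf (mu (bmap eta x))) \<longleftrightarrow> (\<forall>\<^sub>F z in Uf x. P (pair z star))"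
  unfolding eventually_mu bmap_sel
  by (rule eventually_cong[OF bobj_ev]) (auto simp: eventually_principal)

lemma reidx_mu_bmap_eta: "x \<in> bobj S \<Longrightarrow> reidx S (mu (bmap eta x)) x (\<lambda>z\<in>Ix x. pair z star)"
  by (rule reidx_restrict)
    (auto simp: Fm_mu eventually_mu_bmap_eta intro: mu_bobj bmap_eta_bobj)

lemma reidx_mu_bmap_eta': "x \<in> bobj S \<Longrightarrow> reidx S x (mu (bmap eta x)) (\<lambda>w\<in>Ix (mu (bmap eta x)). ufst w)"
  by (rule reidx_restrict)
    (auto simp: Fm_mu eventually_mu_bmap_eta intro: mu_bobj bmap_eta_bobj elim!: Ix_muE)

lemma bmap_mu_bobj: "Z \<in> bobj (bobj (bobj S)) \<Longrightarrow> bmap mu Z \<in> bobj (bobj S)"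
  by (rule bmap_bobj) (auto intro: mu_bobj)

lemma eventually_mu_bmap_mu:
  "Z \<in> bobj S \<Longrightarrow> eventually P (Uf (mu (bmap mu Z))) \<longleftrightarrow>
    (\<forall>\<^sub>F x in Uf Z. \<forall>\<^sub>F y in Uf (Fm Z x). \<forall>\<^sub>F z in Uf (Fm (Fm Z x) y). P (pair x (pair y z)))"
  unfolding eventually_mu[of _ "bmap mu Z"] bmap_sel
  by (rule eventually_cong[OF bobj_ev]) (auto simp: eventually_mu)

lemma eventually_mu_mu:
  assumes "Z \<in> bobj (bobj S)"
  shows "eventually P (Uf (mu (mu Z))) \<longleftrightarrow>
    (\<forall>\<^sub>F x in Uf Z. \<forall>\<^sub>F y in Uf (Fm Z x). \<forall>\<^sub>F z in Uf (Fm (Fm Z x) y). P (pair (pair x y) z))"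
  unfolding eventually_mu[of _ "mu Z"] eventually_mu[of _ Z]
  by (rule eventually_cong[OF bobj_ev[OF assms]], rule eventually_cong[OF bobj_ev[OF bobj_mem[OF assms]]])
    (auto simp: Fm_mu)

text \<open>Both iterated sums quantify over the same triples in the same order, so only the
  bracketing of the pairs changes.\<close>

lemma reidx_reassoc:
  assumes "Z \<in> bobj (bobj (bobj S))"
  shows "reidx S (mu (mu Z)) (mu (bmap mu Z)) (\<lambda>w\<in>Ix (mu (bmap mu Z)). reassoc w)"
  using assms
  by (intro reidx_restrict)
    (auto simp: Fm_mu eventually_mu_mu[OF assms] eventually_mu_bmap_mu intro: mu_bobj bmap_mu_bobj elim!: Ix_muE)

text \<open>Converts between the unrestricted index maps in the axioms of lax algebras and the
  extensional ones that \<open>reidx\<close> speaks of.\<close>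

lemma rearr_restrict: "rearr C x y (\<lambda>z\<in>Ix y. g z) = rearr C x y g"
  unfolding rearr_def by (intro ucls_cong) simp

lemma rearr_cong: "\<forall>\<^sub>F z in Uf y. g z = g' z \<Longrightarrow> rearr C x y g = rearr C x y g'"
  unfolding rearr_def by (rule ucls_cong) (auto elim: eventually_mono)

lemma rearr_eq: "reidx S x y g \<Longrightarrow> rearr C x y g = ucls (Hom C) x y (g, \<lambda>z\<in>Ix y. Ide C (Fm y z))"
  by (simp add: rearr_def reidxD(6))

lemma Ide_beta_rearr: "Ide (beta C) x = rearr C x x (\<lambda>z\<in>Ix x. z)"
  unfolding Ide_beta rearr_def by simp

section \<open>Reindexings as morphisms of \<beta>C\<close>

context category
begin

lemma upairs_rearr: "reidx (Obj C) x y g \<Longrightarrow> (g, \<lambda>z\<in>Ix y. Ide C (Fm y z)) \<in> upairs (Hom C) x y"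
  using reidxD(2) by (fastforce simp: mem_upairs reidxD(3,5) intro!: Ide_Hom bobj_mem)

lemma rearr_Hom: "reidx (Obj C) x y g \<Longrightarrow> rearr C x y g \<in> Hom (beta C) x y"
  by (simp add: rearr_eq HomBI reidxD upairs_rearr)

lemma Cmp_rearr_left:
  assumes g: "reidx (Obj C) x y g" and h: "(h, \<delta>) \<in> upairs (Hom C) y z" "z \<in> bobj T"
  shows "Cmp (beta C) x y z (ucls (Hom C) y z (h, \<delta>)) (rearr C x y g) =
    ucls (Hom C) x z (\<lambda>w\<in>Ix z. g (h w), \<delta>)"
  unfolding rearr_eq[OF g] beta_Cmp[OF upairs_rearr[OF g] h(1)]
  by (intro ucls_cong eventually_mono[OF bobj_ev[OF h(2)]])
    (use upairs_mem[OF h(1)] uindex_mem[OF upairs_uindex[OF h(1)]] in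
      \<open>simp add: reidxD(5)[OF g] Cmp_Ide_right\<close>)

lemma Cmp_rearr_right:
  assumes g: "(g, \<alpha>) \<in> upairs (Hom C) x y" and h: "reidx (Obj C) y z h"
  shows "Cmp (beta C) x y z (rearr C y z h) (ucls (Hom C) x y (g, \<alpha>)) =
    ucls (Hom C) x z (\<lambda>w\<in>Ix z. g (h w), \<lambda>w\<in>Ix z. \<alpha> (h w))"
proof -
  have "\<forall>\<^sub>F w in Uf z. w \<in> Ix z" using reidxD(2)[OF h] by (rule bobj_ev)
  then show ?thesis unfolding rearr_eq[OF h] beta_Cmp[OF g upairs_rearr[OF h]]
  proof (intro ucls_cong, eventually_elim)
    case (elim w)
    show ?case using elim upairs_mem[OF g, of "h w"] Cmp_Ide_left
      by (simp add: reidxD(4,5)[OF h])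
  qed
qed

lemma Cmp_rearr:
  assumes g: "reidx (Obj C) x y g" and h: "reidx (Obj C) y z h"
  shows "Cmp (beta C) x y z (rearr C y z h) (rearr C x y g) = rearr C x z (\<lambda>w\<in>Ix z. g (h w))"
  unfolding rearr_eq[OF h] Cmp_rearr_left[OF g upairs_rearr[OF h] reidxD(2)[OF h]]
  by (simp add: rearr_eq[OF reidx_comp[OF g h]])

end

lemma category_disc: "category (disc S)"
  by standard (auto simp: disc_def split: if_splits)

section \<open>Operations on germs\<close>

text \<open>In a germ of germs, representatives of all members are chosen at once, so that the
  family becomes literally a family of classes. The formulas for \<mu> on germs are stated for this
  form.\<close>

lemma germ_family:
  assumes "(l, \<gamma>) \<in> upairs E2 Y Z" "\<And>w. w \<in> Ix Z \<Longrightarrow> \<gamma> w \<in> ugerms E (Fm Y (l w)) (Fm Z w)"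
  obtains k d where "\<gamma> = (\<lambda>w\<in>Ix Z. ucls E (Fm Y (l w)) (Fm Z w) (k w, d w))"
    "\<And>w. w \<in> Ix Z \<Longrightarrow> (k w, d w) \<in> upairs E (Fm Y (l w)) (Fm Z w)"
proof -
  have "\<exists>q. q \<in> upairs E (Fm Y (l w)) (Fm Z w) \<and> \<gamma> w = ucls E (Fm Y (l w)) (Fm Z w) q" if "w \<in> Ix Z" for w
    using assms(2)[OF that] by (auto simp: ugerms_def)
  then obtain q where q: "\<And>w. w \<in> Ix Z \<Longrightarrow> q w \<in> upairs E (Fm Y (l w)) (Fm Z w) \<and>
      \<gamma> w = ucls E (Fm Y (l w)) (Fm Z w) (q w)" by metis
  have "\<gamma> \<in> extensional (Ix Z)" using assms(1) by (auto simp: mem_upairs PiE_iff)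
  then have "\<gamma> = (\<lambda>w\<in>Ix Z. ucls E (Fm Y (l w)) (Fm Z w) (fst (q w), snd (q w)))"
    using q by (auto simp: fun_eq_iff extensional_def)
  with q show ?thesis by (intro that[of "\<lambda>w. fst (q w)" "\<lambda>w. snd (q w)"]) simp_all
qed

lemma HomBBE:
  assumes "V \<in> Hom (beta (beta C)) Y Z"
  obtains l k d where "Y \<in> bobj (bobj (Obj C))" "Z \<in> bobj (bobj (Obj C))"
    "(l, \<lambda>w\<in>Ix Z. ucls (Hom C) (Fm Y (l w)) (Fm Z w) (k w, d w)) \<in> upairs (Hom (beta C)) Y Z"
    "V = ucls (Hom (beta C)) Y Z (l, \<lambda>w\<in>Ix Z. ucls (Hom C) (Fm Y (l w)) (Fm Z w) (k w, d w))"
    "\<And>w. w \<in> Ix Z \<Longrightarrow> (k w, d w) \<in> upairs (Hom C) (Fm Y (l w)) (Fm Z w)"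
proof -
  obtain l \<gamma> where a: "Y \<in> bobj (bobj (Obj C))" "Z \<in> bobj (bobj (Obj C))" "(l, \<gamma>) \<in> upairs (Hom (beta C)) Y Z"
    "V = ucls (Hom (beta C)) Y Z (l, \<gamma>)" "rep V = (l, \<gamma>)" by (rule HomBE[OF assms, unfolded Obj_beta])
  have "\<gamma> w \<in> ugerms (Hom C) (Fm Y (l w)) (Fm Z w)" if "w \<in> Ix Z" for w
    using upairs_mem[OF a(3) that] by (auto simp: Hom_beta split: if_splits)
  then show ?thesis
  proof (rule germ_family[OF a(3)])
    fix k d assume k: "\<gamma> = (\<lambda>w\<in>Ix Z. ucls (Hom C) (Fm Y (l w)) (Fm Z w) (k w, d w))"
      "\<And>w. w \<in> Ix Z \<Longrightarrow> (k w, d w) \<in> upairs (Hom C) (Fm Y (l w)) (Fm Z w)"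
    show thesis by (rule that[OF a(1,2) a(3,4)[unfolded k(1)] k(2)])
  qed
qed

lemma bprofbE:
  assumes "V \<in> Els (bprof (beta C) (beta D) (bprof C' D' F)) Y Z"
  obtains l k d where "Y \<in> bobj (bobj (Obj D))" "Z \<in> bobj (bobj (Obj C))"
    "(l, \<lambda>w\<in>Ix Z. ucls (Els F) (Fm Y (l w)) (Fm Z w) (k w, d w)) \<in> upairs (Els (bprof C' D' F)) Y Z"
    "V = ucls (Els (bprof C' D' F)) Y Z (l, \<lambda>w\<in>Ix Z. ucls (Els F) (Fm Y (l w)) (Fm Z w) (k w, d w))"
    "\<And>w. w \<in> Ix Z \<Longrightarrow> (k w, d w) \<in> upairs (Els F) (Fm Y (l w)) (Fm Z w)"
proof -
  obtain l \<gamma> where a: "Y \<in> bobj (bobj (Obj D))" "Z \<in> bobj (bobj (Obj C))" "(l, \<gamma>) \<in> upairs (Els (bprof C' D' F)) Y Z"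
    "V = ucls (Els (bprof C' D' F)) Y Z (l, \<gamma>)" "rep V = (l, \<gamma>)" by (rule bprofE[OF assms, unfolded Obj_beta])
  have "\<gamma> w \<in> ugerms (Els F) (Fm Y (l w)) (Fm Z w)" if "w \<in> Ix Z" for w
    using upairs_mem[OF a(3) that] by (auto simp: Els_bprof split: if_splits)
  then show ?thesis
  proof (rule germ_family[OF a(3)])
    fix k d assume k: "\<gamma> = (\<lambda>w\<in>Ix Z. ucls (Els F) (Fm Y (l w)) (Fm Z w) (k w, d w))"
      "\<And>w. w \<in> Ix Z \<Longrightarrow> (k w, d w) \<in> upairs (Els F) (Fm Y (l w)) (Fm Z w)"
    show thesis by (rule that[OF a(1,2) a(3,4)[unfolded k(1)] k(2)])
  qed
qed

text \<open>Two choices are absorbed: the outer representative agrees almost everywhere, and for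
  almost every \<open>y\<close> so does the inner one. Jointly this is agreement almost everywhere
  for the sum filter.\<close>

lemma umult_ucls:
  assumes p: "(p, \<lambda>y\<in>Ix Y. ucls E (Fm X (p y)) (Fm Y y) (k y, \<delta> y)) \<in> upairs E2 X Y"
    and k: "\<And>y. y \<in> Ix Y \<Longrightarrow> (k y, \<delta> y) \<in> upairs E (Fm X (p y)) (Fm Y y)"
    and Y: "Y \<in> bobj S"
  shows "umult E X Y (ucls E2 X Y (p, \<lambda>y\<in>Ix Y. ucls E (Fm X (p y)) (Fm Y y) (k y, \<delta> y))) =
    ucls E (mu X) (mu Y) (\<lambda>v\<in>Ix (mu Y). pair (p (ufst v)) (k (ufst v) (usnd v)),
      \<lambda>v\<in>Ix (mu Y). \<delta> (ufst v) (usnd v))"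
proof -
  let ?\<gamma> = "\<lambda>y\<in>Ix Y. ucls E (Fm X (p y)) (Fm Y y) (k y, \<delta> y)"
  obtain p' \<gamma>' where p': "rep (ucls E2 X Y (p, ?\<gamma>)) = (p', \<gamma>')" "(p', \<gamma>') \<in> upairs E2 X Y"
    "\<forall>\<^sub>F y in Uf Y. p' y = p y \<and> \<gamma>' y = ?\<gamma> y"
    "ucls E2 X Y (p', \<gamma>') = ucls E2 X Y (p, ?\<gamma>)"
    by (rule rep_ucls[OF p])
  have *: "\<forall>\<^sub>F z in Uf (Fm Y y). fst (rep (?\<gamma> y)) z = k y z \<and> snd (rep (?\<gamma> y)) z = \<delta> y z" if "y \<in> Ix Y" for y
    by (rule rep_ucls[OF k[OF that]]) (simp add: that)
  have "\<forall>\<^sub>F y in Uf Y. \<forall>\<^sub>F z in Uf (Fm Y y). p' y = p y \<and> fst (rep (\<gamma>' y)) z = k y z \<and> snd (rep (\<gamma>' y)) z = \<delta> y z"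
    using p'(3) bobj_ev[OF Y]
  proof eventually_elim
    case (elim y)
    from *[OF elim(2)] show ?case by eventually_elim (simp only: elim)
  qed
  then have "\<forall>\<^sub>F v in Uf (mu Y). p' (ufst v) = p (ufst v) \<and> fst (rep (\<gamma>' (ufst v))) (usnd v) = k (ufst v) (usnd v) \<and>
      snd (rep (\<gamma>' (ufst v))) (usnd v) = \<delta> (ufst v) (usnd v)"
    unfolding eventually_mu by simp
  then show ?thesis unfolding umult_def p' prod.case
    by (intro ucls_cong) (auto elim!: eventually_mono)
qed

text \<open>The image of the sum filter is computed one layer at a time, first along
  \<open>p\<close> and then along \<open>k y\<close> inside each fibre.\<close>

lemma umult_upairs:
  assumes p: "uindex X Y p"
    and k: "\<And>y. y \<in> Ix Y \<Longrightarrow> (k y, \<delta> y) \<in> upairs E (Fm X (p y)) (Fm Y y)"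
    and Y: "Y \<in> bobj (bobj S)"
  shows "(\<lambda>v\<in>Ix (mu Y). pair (p (ufst v)) (k (ufst v) (usnd v)),
      \<lambda>v\<in>Ix (mu Y). \<delta> (ufst v) (usnd v)) \<in> upairs E (mu X) (mu Y)"
proof -
  note u = uindex_mem[OF p] and uk = upairs_uindex[OF k]
  have "uindex (mu X) (mu Y) (\<lambda>v\<in>Ix (mu Y). pair (p (ufst v)) (k (ufst v) (usnd v)))"
  proof (rule uindexI)
    fix P
    have "eventually P (Uf (mu X)) \<longleftrightarrow> (\<forall>\<^sub>F x in filtermap p (Uf Y). \<forall>\<^sub>F z in Uf (Fm X x). P (pair x z))"
      using p by (simp add: eventually_mu uindex_def)
    also have "\<dots> \<longleftrightarrow> (\<forall>\<^sub>F y in Uf Y. \<forall>\<^sub>F z in Uf (Fm X (p y)). P (pair (p y) z))"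
      by (simp add: eventually_filtermap)
    also have "\<dots> \<longleftrightarrow> (\<forall>\<^sub>F y in Uf Y. \<forall>\<^sub>F z in Uf (Fm Y y). P (pair (p y) (k y z)))"
    proof (rule eventually_cong[OF bobj_ev[OF Y]])
      fix y assume "y \<in> Ix Y"
      then have "Uf (Fm X (p y)) = filtermap (k y) (Uf (Fm Y y))" using uk by (simp add: uindex_def)
      then show "(\<forall>\<^sub>F z in Uf (Fm X (p y)). P (pair (p y) z)) \<longleftrightarrow> (\<forall>\<^sub>F z in Uf (Fm Y y). P (pair (p y) (k y z)))"
        by (simp add: eventually_filtermap)
    qed
    also have "\<dots> \<longleftrightarrow> (\<forall>\<^sub>F v in Uf (mu Y). P (pair (p (ufst v)) (k (ufst v) (usnd v))))"
      by (simp add: eventually_mu)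
    finally show "eventually P (Uf (mu X)) \<longleftrightarrow>
        (\<forall>\<^sub>F v in Uf (mu Y). P ((\<lambda>v\<in>Ix (mu Y). pair (p (ufst v)) (k (ufst v) (usnd v))) v))"
      by (simp only: eventually_restrict[OF bobj_ev[OF mu_bobj[OF Y]]])
  qed (auto simp: u uindex_mem[OF uk] elim!: Ix_muE)
  then show ?thesis
    by (auto simp: mem_upairs Fm_mu u uindex_mem[OF uk] upairs_mem[OF k] elim!: Ix_muE)
qed

lemma bcell_ucls:
  assumes "(t, \<zeta>) \<in> upairs E x y"
  shows "bcell G p q \<theta> x y (ucls E x y (t, \<zeta>)) =
    ucls (Els G) (bmap p x) (bmap q y) (t, \<lambda>z\<in>Ix y. \<theta> (Fm x (t z)) (Fm y z) (\<zeta> z))"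
proof -
  obtain t' \<zeta>' where p': "rep (ucls E x y (t, \<zeta>)) = (t', \<zeta>')" "(t', \<zeta>') \<in> upairs E x y"
    "\<forall>\<^sub>F z in Uf y. t' z = t z \<and> \<zeta>' z = \<zeta> z" "ucls E x y (t', \<zeta>') = ucls E x y (t, \<zeta>)"
    by (rule rep_ucls[OF assms])
  then show ?thesis unfolding bcell_def p' prod.case
    by (intro ucls_cong) (auto elim!: eventually_mono)
qed

lemma beta_ftr_ucls:
  assumes "(g, \<alpha>) \<in> upairs E x y"
  shows "fm (beta_ftr D f) x y (ucls E x y (g, \<alpha>)) =
    ucls (Hom D) (bmap (fo f) x) (bmap (fo f) y) (g, \<lambda>z\<in>Ix y. fm f (Fm x (g z)) (Fm y z) (\<alpha> z))"
proof -
  obtain t' \<zeta>' where p': "rep (ucls E x y (g, \<alpha>)) = (t', \<zeta>')" "(t', \<zeta>') \<in> upairs E x y"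
    "\<forall>\<^sub>F z in Uf y. t' z = g z \<and> \<zeta>' z = \<alpha> z" "ucls E x y (t', \<zeta>') = ucls E x y (g, \<alpha>)"
    by (rule rep_ucls[OF assms])
  then show ?thesis unfolding beta_ftr_def ftr.simps p' prod.case
    by (intro ucls_cong) (auto elim!: eventually_mono)
qed

lemma upairs_bmap:
  assumes "(t, \<zeta>) \<in> upairs E x y" "\<And>a b r. r \<in> E a b \<Longrightarrow> \<theta> a b r \<in> E' (p a) (q b)"
  shows "(t, \<lambda>z\<in>Ix y. \<theta> (Fm x (t z)) (Fm y z) (\<zeta> z)) \<in> upairs E' (bmap p x) (bmap q y)"
proof -
  have "uindex (bmap p x) (bmap q y) t" using upairs_uindex[OF assms(1)] by (simp add: uindex_def)
  then show ?thesis
    using upairs_mem[OF assms(1)] assms(2) uindex_mem[OF upairs_uindex[OF assms(1)]]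
    by (simp add: mem_upairs)
qed

lemma compositor_ucls:
  assumes s: "(p, \<gamma>) \<in> upairs (Els G) x Y" and t: "(p', \<gamma>') \<in> upairs (Els F) Y Z"
  shows "compositor C D E G F x Y Z (ucls (Els G) x Y (p, \<gamma>)) (ucls (Els F) Y Z (p', \<gamma>')) =
    ucls (Els (pcomp C D E G F)) x Z (\<lambda>y\<in>Ix Z. p (p' y),
        \<lambda>y\<in>Ix Z. coend_cls C D E G F (Fm x (p (p' y))) (Fm Z y) (Fm Y (p' y), \<gamma> (p' y), \<gamma>' y))"
proof -
  obtain q \<xi> where q: "rep (ucls (Els G) x Y (p, \<gamma>)) = (q, \<xi>)" "(q, \<xi>) \<in> upairs (Els G) x Y"
    "\<forall>\<^sub>F z in Uf Y. q z = p z \<and> \<xi> z = \<gamma> z" "ucls (Els G) x Y (q, \<xi>) = ucls (Els G) x Y (p, \<gamma>)"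
    by (rule rep_ucls[OF s])
  obtain q' \<xi>' where q': "rep (ucls (Els F) Y Z (p', \<gamma>')) = (q', \<xi>')" "(q', \<xi>') \<in> upairs (Els F) Y Z"
    "\<forall>\<^sub>F z in Uf Z. q' z = p' z \<and> \<xi>' z = \<gamma>' z" "ucls (Els F) Y Z (q', \<xi>') = ucls (Els F) Y Z (p', \<gamma>')"
    by (rule rep_ucls[OF t])
  have "\<forall>\<^sub>F z in Uf Z. q (p' z) = p (p' z) \<and> \<xi> (p' z) = \<gamma> (p' z)"
    using uindex_ae[OF upairs_uindex[OF t] q(3)] .
  then have "\<forall>\<^sub>F z in Uf Z. q (p' z) = p (p' z) \<and> \<xi> (p' z) = \<gamma> (p' z) \<and> q' z = p' z \<and> \<xi>' z = \<gamma>' z"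
    using q'(3) by eventually_elim simp
  then show ?thesis unfolding compositor_def q(1) q'(1) prod.case
    by (intro ucls_cong) (auto elim!: eventually_mono)
qed

section \<open>Calculus in an ultraconvergence space\<close>

lemma disc_sel [simp]: "Obj (disc S) = S" "Ide (disc S) a = a" "u \<in> Hom (disc S) a b \<longleftrightarrow> a \<in> S \<and> a = b \<and> u = a"
  by (auto simp: disc_def)

lemma over_cong: "Ix x = Ix y \<Longrightarrow> Uf x = Uf y \<Longrightarrow> over x Y = over y Y"
  by (simp add: over_def)

lemma over_eta [simp]: "over (eta b) (\<lambda>z\<in>{star}. x) = eta x"
  by (rule ufam_eqI) simp_all

lemma PiE_restrict: "f \<in> PiE I B \<Longrightarrow> (\<lambda>z\<in>I. f z) = f"
  by (simp add: PiE_iff extensional_restrict)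

section \<open>Reindexings of iterated sums\<close>

lemma reidx_mu:
  assumes X: "X \<in> bobj (bobj S)" and Y: "Y \<in> bobj (bobj S)" and p: "uindex X Y p"
    and k: "\<And>y. y \<in> Ix Y \<Longrightarrow> reidx S (Fm X (p y)) (Fm Y y) (k y)"
  shows "reidx S (mu X) (mu Y) (\<lambda>v\<in>Ix (mu Y). pair (p (ufst v)) (k (ufst v) (usnd v)))"
proof -
  \<comment> \<open>Only the index half of \<open>umult_upairs\<close> is wanted here; a dummy
    family with values in \<open>UNIV\<close> fills the other half.\<close>
  have "(k y, \<lambda>z\<in>Ix (Fm Y y). undefined) \<in> upairs (\<lambda>_ _. UNIV) (Fm X (p y)) (Fm Y y)" if "y \<in> Ix Y" for y
    using k[OF that] by (simp add: mem_upairs reidxD)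
  from umult_upairs[OF p this Y] have "uindex (mu X) (mu Y) (\<lambda>v\<in>Ix (mu Y). pair (p (ufst v)) (k (ufst v) (usnd v)))"
    by (simp add: mem_upairs)
  moreover have "\<forall>z\<in>Ix (mu Y). Fm (mu Y) z = Fm (mu X) ((\<lambda>v\<in>Ix (mu Y). pair (p (ufst v)) (k (ufst v) (usnd v))) z)"
    by (auto simp: Fm_mu uindex_mem[OF p] reidxD[OF k] elim!: Ix_muE)
  ultimately show ?thesis using mu_bobj[OF X] mu_bobj[OF Y] by (simp add: reidx_def)
qed

lemma reidx_over:
  assumes g: "reidx S x y g" and Y: "Y \<in> Ix x \<rightarrow>\<^sub>E bobj S"
  shows "reidx S (mu (over x Y)) (mu (over y (\<lambda>z\<in>Ix y. Y (g z))))
    (\<lambda>w\<in>Ix (mu (over y (\<lambda>z\<in>Ix y. Y (g z)))). pair (g (ufst w)) (usnd w))"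
proof -
  note G = reidxD[OF g]
  have Y': "(\<lambda>z\<in>Ix y. Y (g z)) \<in> Ix y \<rightarrow>\<^sub>E bobj S" using Y G(4) by (auto simp: PiE_iff)
  have "reidx S (mu (over x Y)) (mu (over y (\<lambda>z\<in>Ix y. Y (g z))))
    (\<lambda>v\<in>Ix (mu (over y (\<lambda>z\<in>Ix y. Y (g z)))). pair (g (ufst v)) ((\<lambda>v\<in>Ix (Y (g (ufst v))). v) (usnd v)))"
    using over_bobj[OF G(1) Y] over_bobj[OF G(2) Y'] G(3,4) Y
    by (intro reidx_mu[where k = "\<lambda>y. \<lambda>v\<in>Ix (Y (g y)). v"])
      (auto simp: uindex_def PiE_iff simp del: restrict_apply intro!: reidx_id, simp add: reidx_id)
  also have "(\<lambda>v\<in>Ix (mu (over y (\<lambda>z\<in>Ix y. Y (g z)))). pair (g (ufst v)) ((\<lambda>v\<in>Ix (Y (g (ufst v))). v) (usnd v))) =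
      (\<lambda>w\<in>Ix (mu (over y (\<lambda>z\<in>Ix y. Y (g z)))). pair (g (ufst w)) (usnd w))"
    by (rule restrict_mu_cong) simp
  finally show ?thesis .
qed

lemma reidx_over_family:
  assumes x: "x \<in> bobj T" and Y: "Y \<in> extensional (Ix x)" and Z: "Z \<in> extensional (Ix x)"
    and k: "\<And>z. z \<in> Ix x \<Longrightarrow> reidx S (Y z) (Z z) (k z)"
  shows "reidx S (mu (over x Y)) (mu (over x Z)) (\<lambda>w\<in>Ix (mu (over x Z)). pair (ufst w) (k (ufst w) (usnd w)))"
proof -
  have YZ: "Y \<in> Ix x \<rightarrow>\<^sub>E bobj S" "Z \<in> Ix x \<rightarrow>\<^sub>E bobj S" using Y Z reidxD[OF k] by (auto simp: PiE_iff)
  have "reidx S (mu (over x Y)) (mu (over x Z))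
    (\<lambda>v\<in>Ix (mu (over x Z)). pair ((\<lambda>z\<in>Ix x. z) (ufst v)) (k (ufst v) (usnd v)))"
    using over_bobj[OF x YZ(1)] over_bobj[OF x YZ(2)] k uindex_id[OF bobj_ev[OF x]]
    by (intro reidx_mu[where p = "\<lambda>z\<in>Ix x. z"]) (simp_all add: uindex_def del: restrict_apply, simp)
  also have "(\<lambda>v\<in>Ix (mu (over x Z)). pair ((\<lambda>z\<in>Ix x. z) (ufst v)) (k (ufst v) (usnd v))) =
      (\<lambda>w\<in>Ix (mu (over x Z)). pair (ufst w) (k (ufst w) (usnd w)))"
    by (rule restrict_mu_cong) simp
  finally show ?thesis .
qed

text \<open>Currying the family \<open>Z\<close> on pairs to \<open>W\<close> gives an object of the
  third iterate of \<beta>, and collapsing its two outer layers strictly returns \<open>Z\<close>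
  over the sum. The two sides of \<open>ucmp_assoc\<close> thus live over the two multiplications of
  one object, which \<open>reassoc\<close> relates.\<close>

lemma mu_over_over:
  assumes x: "x \<in> bobj S" and Z: "Z \<in> extensional (Ix (mu (over x Y)))"
    and W: "W = (\<lambda>z\<in>Ix x. \<lambda>w\<in>Ix (Y z). Z (pair z w))"
  shows "mu (over x (\<lambda>z\<in>Ix x. over (Y z) (W z))) = over (mu (over x Y)) Z"
proof (rule mu_eqI[symmetric])
  show "Ix (over (mu (over x Y)) Z) = Ix (mu (over x (\<lambda>z\<in>Ix x. over (Y z) (W z))))" by (auto simp: Ix_mu)
  show "Uf (over (mu (over x Y)) Z) = Uf (mu (over x (\<lambda>z\<in>Ix x. over (Y z) (W z))))"
    unfolding filter_eq_iff over_sel eventually_mu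
    by (intro allI eventually_cong[OF bobj_ev[OF x]]) simp
qed (use Z in \<open>simp_all add: W\<close>)

lemma bmap_mu_over: "bmap mu (over x (\<lambda>z\<in>Ix x. over (Y z) (W z))) = over x (\<lambda>z\<in>Ix x. mu (over (Y z) (W z)))"
  by (rule ufam_eqI) (auto simp: fun_eq_iff)

lemma over_over_bobj:
  assumes x: "x \<in> bobj S" and Y: "Y \<in> Ix x \<rightarrow>\<^sub>E bobj T" and Z: "Z \<in> Ix (mu (over x Y)) \<rightarrow>\<^sub>E R"
    and W: "W = (\<lambda>z\<in>Ix x. \<lambda>w\<in>Ix (Y z). Z (pair z w))"
  shows "over x (\<lambda>z\<in>Ix x. over (Y z) (W z)) \<in> bobj (bobj R)"
proof -
  have Yb: "Y z \<in> bobj T" if "z \<in> Ix x" for z using that Y by auto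
  show ?thesis
    by (rule over_bobj[OF x]) (use Z in \<open>auto simp: W intro!: over_bobj[OF Yb]\<close>)
qed

lemma reidx_over_assoc:
  assumes x: "x \<in> bobj S" and Y: "Y \<in> Ix x \<rightarrow>\<^sub>E bobj S" and Z: "Z \<in> Ix (mu (over x Y)) \<rightarrow>\<^sub>E bobj S"
    and W: "W = (\<lambda>z\<in>Ix x. \<lambda>w\<in>Ix (Y z). Z (pair z w))"
  shows "reidx S (mu (over (mu (over x Y)) Z)) (mu (over x (\<lambda>z\<in>Ix x. mu (over (Y z) (W z)))))
        (\<lambda>w\<in>Ix (mu (over x (\<lambda>z\<in>Ix x. mu (over (Y z) (W z))))). reassoc w)"
  using reidx_reassoc[OF over_over_bobj[OF assms]] Z
  by (simp add: bmap_mu_over mu_over_over[OF x _ W] PiE_iff)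

context ultraconvergence_space
begin

abbreviation "E \<equiv> Els (uarr A)"
abbreviation "Pt \<equiv> upts A"

sublocale P: profunctor "beta (udisc A)" "udisc A" "uarr A" by (rule uarr_profunctor)

sublocale D: category "udisc A" by (rule category_disc)

lemma E_obj: "r \<in> E a x \<Longrightarrow> a \<in> Pt" "r \<in> E a x \<Longrightarrow> x \<in> bobj Pt"
  using P.Els_Obj by auto

section \<open>Reindexing of arrows\<close>

lemma ure_Els: "r \<in> E a x \<Longrightarrow> reidx Pt x y g \<Longrightarrow> ure A a x y g r \<in> E a y"
  unfolding ure_def by (rule P.Act_Els) (auto simp: E_obj intro!: D.rearr_Hom)

lemma ure_id: "r \<in> E a x \<Longrightarrow> ure A a x x (\<lambda>z\<in>Ix x. z) r = r"
  unfolding ure_def using P.Act_Ide[of r a x] by (simp add: Ide_beta_rearr)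

lemma ure_cong: "\<forall>\<^sub>F z in Uf y. g z = g' z \<Longrightarrow> ure A a x y g r = ure A a x y g' r"
  unfolding ure_def by (simp only: rearr_cong)

lemma ure_restrict: "ure A a x y (\<lambda>z\<in>Ix y. g z) r = ure A a x y g r"
  unfolding ure_def by (simp only: rearr_restrict)

lemma ure_comp:
  assumes "r \<in> E a x" "reidx Pt x y g" "reidx Pt y z h"
  shows "ure A a y z h (ure A a x y g r) = ure A a x z (\<lambda>w\<in>Ix z. g (h w)) r"
  unfolding ure_def
  using P.Act_Cmp[of a a a a a "rearr (udisc A) x y g" x y "rearr (udisc A) y z h" z r] assms
    D.rearr_Hom[of x y g] D.rearr_Hom[of y z h] D.Cmp_rearr[of x y g z h]
  by (simp add: E_obj) (simp add: disc_def)

text \<open>Iterated reindexings are identified by comparing index maps pointwise. The laws of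
  composition are reduced to this by writing both sides as reindexings of a single iterated
  composite.\<close>

lemma ure_comp_eq:
  assumes "r \<in> E a x" "reidx Pt x y g" "reidx Pt y z h" "\<And>w. w \<in> Ix z \<Longrightarrow> g (h w) = k w"
  shows "ure A a y z h (ure A a x y g r) = ure A a x z k r"
proof -
  have "(\<lambda>w\<in>Ix z. g (h w)) = (\<lambda>w\<in>Ix z. k w)" by (rule restrict_ext) (rule assms(4))
  then show ?thesis using ure_comp[OF assms(1-3)] by (simp only: ure_restrict)
qed

lemma ufamily_iff: "ufamily A x Y s \<longleftrightarrow> Y \<in> Ix x \<rightarrow>\<^sub>E bobj Pt \<and> s \<in> (\<Pi>\<^sub>E z\<in>Ix x. E (Fm x z) (Y z))"
  by (simp add: ufamily_def)

lemma ufamilyD: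
  assumes "ufamily A x Y s"
  shows "Y \<in> Ix x \<rightarrow>\<^sub>E bobj Pt" "s \<in> (\<Pi>\<^sub>E z\<in>Ix x. E (Fm x z) (Y z))"
    "z \<in> Ix x \<Longrightarrow> s z \<in> E (Fm x z) (Y z)" "z \<in> Ix x \<Longrightarrow> Y z \<in> bobj Pt"
    "(\<lambda>z\<in>Ix x. Y z) = Y" "(\<lambda>z\<in>Ix x. s z) = s" "Y \<in> extensional (Ix x)"
proof -
  show Y: "Y \<in> Ix x \<rightarrow>\<^sub>E bobj Pt" and s: "s \<in> (\<Pi>\<^sub>E z\<in>Ix x. E (Fm x z) (Y z))"
    using assms by (simp_all add: ufamily_iff)
  show "z \<in> Ix x \<Longrightarrow> s z \<in> E (Fm x z) (Y z)" "z \<in> Ix x \<Longrightarrow> Y z \<in> bobj Pt"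
    using PiE_mem[OF s] PiE_mem[OF Y] by blast+
  show "(\<lambda>z\<in>Ix x. Y z) = Y" by (rule PiE_restrict[OF Y])
  show "(\<lambda>z\<in>Ix x. s z) = s" by (rule PiE_restrict[OF s])
  show "Y \<in> extensional (Ix x)" using Y by (simp add: PiE_iff)
qed

lemma ufamilyI:
  assumes "\<And>z. z \<in> Ix x \<Longrightarrow> s z \<in> E (Fm x z) (Y z)" "Y \<in> extensional (Ix x)" "s \<in> extensional (Ix x)"
  shows "ufamily A x Y s"
  using assms E_obj(2)[OF assms(1)] by (simp add: ufamily_iff PiE_iff)

lemma ufamily_over: "r \<in> E a x \<Longrightarrow> ufamily A x Y s \<Longrightarrow> over x Y \<in> bobj (bobj Pt)"
  by (rule over_bobj[OF E_obj(2) ufamilyD(1)])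

text \<open>A vertical morphism from \<open>x\<close> to \<open>y\<close>: the identity on indices,
  with a unary arrow in each component. Over the category of points it is the morphism
  \<open>(id, \<alpha>)\<close> of \<beta>, and \<open>upost\<close> is its action.\<close>

definition ualong :: "('u, 'u) ufam \<Rightarrow> ('u, 'u) ufam \<Rightarrow> ('u \<Rightarrow> 'u) \<Rightarrow> bool" where
  "ualong x y \<alpha> \<longleftrightarrow> x \<in> bobj Pt \<and> y \<in> bobj Pt \<and> Ix y = Ix x \<and> Uf y = Uf x \<and>
     \<alpha> \<in> (\<Pi>\<^sub>E z\<in>Ix x. E (Fm x z) (eta (Fm y z)))"

lemma ualongD:
  assumes "ualong x y \<alpha>"
  shows "x \<in> bobj Pt" "y \<in> bobj Pt" "Ix y = Ix x" "Uf y = Uf x"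
    "z \<in> Ix x \<Longrightarrow> \<alpha> z \<in> E (Fm x z) (eta (Fm y z))" "(\<lambda>z\<in>Ix x. \<alpha> z) = \<alpha>"
    "ufamily A x (\<lambda>z\<in>Ix x. eta (Fm y z)) \<alpha>" "over x (\<lambda>z\<in>Ix x. eta (Fm y z)) = bmap eta y"
proof -
  show 1: "x \<in> bobj Pt" "y \<in> bobj Pt" "Ix y = Ix x" "Uf y = Uf x"
    and 2: "z \<in> Ix x \<Longrightarrow> \<alpha> z \<in> E (Fm x z) (eta (Fm y z))" for z
    using assms PiE_mem by (force simp: ualong_def)+
  have a: "\<alpha> \<in> (\<Pi>\<^sub>E z\<in>Ix x. E (Fm x z) (eta (Fm y z)))" using assms by (simp add: ualong_def)
  show "(\<lambda>z\<in>Ix x. \<alpha> z) = \<alpha>" by (rule PiE_restrict[OF a])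
  show "ufamily A x (\<lambda>z\<in>Ix x. eta (Fm y z)) \<alpha>"
    by (rule ufamilyI) (use a 2 in \<open>simp_all add: PiE_iff\<close>)
  show "over x (\<lambda>z\<in>Ix x. eta (Fm y z)) = bmap eta y" by (simp add: over_def bmap_def 1)
qed

lemma uid_E: "a \<in> Pt \<Longrightarrow> uid A a \<in> E a (eta a)"
  using uid_arr by auto

section \<open>Composition with unary arrows\<close>

lemma upost_def': "ualong x y \<alpha> \<Longrightarrow> upost A a x y \<alpha> r =
    ure A a (mu (bmap eta y)) y (\<lambda>z\<in>Ix y. pair z star) (ucmp A a x (\<lambda>z\<in>Ix x. eta (Fm y z)) \<alpha> r)"
  by (simp add: upost_def)

lemma ucmp_upost_arr:
  assumes "r \<in> E a x" "ualong x y \<alpha>"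
  shows "ucmp A a x (\<lambda>z\<in>Ix x. eta (Fm y z)) \<alpha> r \<in> E a (mu (bmap eta y))"
  using ucmp_arr[OF assms(1) ualongD(7)[OF assms(2)]] by (simp add: ualongD(8)[OF assms(2)])

lemma upost_Els:
  assumes "r \<in> E a x" "ualong x y \<alpha>"
  shows "upost A a x y \<alpha> r \<in> E a y"
  unfolding upost_def
  by (rule ure_Els[OF ucmp_upost_arr[OF assms] reidx_mu_bmap_eta[OF ualongD(2)[OF assms(2)]]])

lemma ufamily_eta: "r \<in> E b x \<Longrightarrow> ufamily A (eta b) (\<lambda>z\<in>{star}. x) (\<lambda>z\<in>{star}. r)"
  by (rule ufamilyI) auto

lemma ucmp_upre_arr:
  assumes "u \<in> E a (eta b)" "r \<in> E b x"
  shows "ucmp A a (eta b) (\<lambda>z\<in>{star}. x) (\<lambda>z\<in>{star}. r) u \<in> E a (mu (eta x))"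
  using ucmp_arr[OF assms(1) ufamily_eta[OF assms(2)]] by simp

lemma upre_Els:
  assumes "u \<in> E a (eta b)" "r \<in> E b x"
  shows "upre A a b x r u \<in> E a x"
  unfolding upre_def
  by (rule ure_Els[OF ucmp_upre_arr[OF assms] reidx_mu_eta[OF E_obj(2)[OF assms(2)]]])

text \<open>Associativity for \<open>r\<close>, \<alpha> and \<open>s\<close>. Both sides reindex
  one composite \<open>Q\<close> with a trivial middle layer: on the left this layer is dropped
  before composing with \<open>s\<close>, on the right after each member of \<alpha> has been
  composed with its member of \<open>s\<close>.\<close>

lemma ucmp_upost:
  assumes r: "r \<in> E a x" and \<alpha>: "ualong x y \<alpha>" and s: "ufamily A y Y s"
  shows "ucmp A a y Y s (upost A a x y \<alpha> r) =
    ucmp A a x Y (\<lambda>z\<in>Ix x. upre A (Fm x z) (Fm y z) (Y z) (s z) (\<alpha> z)) r"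
proof -
  note al = ualongD[OF \<alpha>] and S = ufamilyD[OF s]
  define H :: "'u \<Rightarrow> ('u, 'u) ufam" where "H = (\<lambda>z\<in>Ix x. eta (Fm y z))"
  have H: "over x H = bmap eta y" "ufamily A x H \<alpha>" using al by (simp_all add: H_def)
  \<comment> \<open>The index set of \<open>M\<close> consists of pairs \<open>(z, star)\<close>.
    The family \<open>s\<close> is spread over it by forgetting \<open>star\<close>, which makes
    \<open>ucmp_assoc\<close> applicable; restriction along \<open>g\<close> gives \<open>s\<close>
    back.\<close>
  define M where "M = mu (bmap eta y)"
  define Z where "Z = (\<lambda>w\<in>Ix M. Y (ufst w))"
  define t where "t = (\<lambda>w\<in>Ix M. s (ufst w))"
  define Q0 where "Q0 = ucmp A a x H \<alpha> r"
  have Q0: "Q0 \<in> E a M" unfolding Q0_def H_def M_def by (rule ucmp_upost_arr[OF r \<alpha>])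
  have t: "ufamily A M Z t"
    by (rule ufamilyI) (auto simp: M_def Z_def t_def Fm_mu al(3) elim!: Ix_muE intro!: S(3))
  define Q where "Q = ucmp A a M Z t Q0"
  have Q: "Q \<in> E a (mu (over M Z))" unfolding Q_def by (rule ucmp_arr[OF Q0 t])
  define g where "g = (\<lambda>z\<in>Ix y. pair z star)"
  have g: "reidx Pt M y g" unfolding g_def M_def by (rule reidx_mu_bmap_eta[OF al(2)])
  have "(\<lambda>z\<in>Ix y. Z (g z)) = (\<lambda>z\<in>Ix y. Y z)" "(\<lambda>z\<in>Ix y. t (g z)) = (\<lambda>z\<in>Ix y. s z)"
    by (auto simp: Z_def t_def g_def M_def)
  then have Zg: "(\<lambda>z\<in>Ix y. Z (g z)) = Y" "(\<lambda>z\<in>Ix y. t (g z)) = s" by (simp_all only: S(5,6))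
  have L: "ucmp A a y Y s (upost A a x y \<alpha> r) = ure A a (mu (over M Z)) (mu (over y Y))
      (\<lambda>w\<in>Ix (mu (over y Y)). pair (g (ufst w)) (usnd w)) Q"
    using ucmp_reindex[OF Q0 t g[folded reindex_iff]]
    by (simp only: Zg upost_def'[OF \<alpha>] Q0_def[symmetric] H_def[symmetric] g_def[symmetric] M_def[symmetric] Q_def[symmetric])
  define W where "W = (\<lambda>z\<in>Ix x. \<lambda>w\<in>Ix (H z). Z (pair z w))"
  have W: "W z = (\<lambda>w\<in>{star}. Y z)" "H z = eta (Fm y z)" "over (H z) (W z) = eta (Y z)" if "z \<in> Ix x" for z
    using that by (auto simp: W_def H_def Z_def M_def al(3) fun_eq_iff over_def eta_def)
  define K where "K = (\<lambda>z\<in>Ix x. mu (eta (Y z)))"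
  have K: "(\<lambda>z\<in>Ix x. mu (over (H z) (W z))) = K" unfolding K_def by (rule restrict_ext) (simp add: W)
  define q where "q = (\<lambda>z\<in>Ix x. ucmp A (Fm x z) (eta (Fm y z)) (\<lambda>w\<in>{star}. Y z) (\<lambda>w\<in>{star}. s z) (\<alpha> z))"
  have q: "(\<lambda>z\<in>Ix x. ucmp A (Fm x z) (H z) (W z) (\<lambda>w\<in>Ix (H z). t (pair z w)) (\<alpha> z)) = q"
    unfolding q_def
  proof (rule restrict_ext)
    fix z assume z: "z \<in> Ix x"
    then have "(\<lambda>w\<in>Ix (H z). t (pair z w)) = (\<lambda>w\<in>{star}. s z)"
      by (auto simp: W(2) t_def M_def al(3) fun_eq_iff)
    with z show "ucmp A (Fm x z) (H z) (W z) (\<lambda>w\<in>Ix (H z). t (pair z w)) (\<alpha> z) =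
      ucmp A (Fm x z) (eta (Fm y z)) (\<lambda>w\<in>{star}. Y z) (\<lambda>w\<in>{star}. s z) (\<alpha> z)" by (simp only: W)
  qed
  have A: "ure A a (mu (over M Z)) (mu (over x K)) (\<lambda>w\<in>Ix (mu (over x K)). reassoc w) Q = ucmp A a x K q r"
    using ucmp_assoc[OF r H(2) _ W_def, of t] t unfolding K q H(1) M_def[symmetric] Q_def Q0_def by blast
  have reA: "reidx Pt (mu (over M Z)) (mu (over x K)) (\<lambda>w\<in>Ix (mu (over x K)). reassoc w)"
    using reidx_over_assoc[OF al(1) ufamilyD(1)[OF H(2)] _ W_def] ufamilyD(1)[OF t]
    unfolding K H(1) M_def[symmetric] by blast
  have qf: "ufamily A x K q"
    by (rule ufamilyI) (use S(3) al(3) in \<open>auto simp: K_def q_def intro!: ucmp_upre_arr al(5)\<close>)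
  define k where "k z = (\<lambda>v\<in>Ix (Y z). pair star v)" for z
  have k: "reidx Pt (K z) (Y z) (k z)" if "z \<in> Ix x" for z
    using that S(4) al(3) by (simp add: K_def k_def reidx_mu_eta)
  have Yx: "Y \<in> extensional (Ix x)" using S(7) al(3) by simp
  have up: "(\<lambda>z\<in>Ix x. ure A (Fm x z) (K z) (Y z) (k z) (q z)) =
      (\<lambda>z\<in>Ix x. upre A (Fm x z) (Fm y z) (Y z) (s z) (\<alpha> z))"
    by (rule restrict_ext) (simp add: upre_def K_def k_def q_def)
  have "ucmp A a x Y (\<lambda>z\<in>Ix x. upre A (Fm x z) (Fm y z) (Y z) (s z) (\<alpha> z)) r =
      ure A a (mu (over x K)) (mu (over x Y)) (\<lambda>w\<in>Ix (mu (over x Y)). pair (ufst w) (k (ufst w) (usnd w)))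
        (ure A a (mu (over M Z)) (mu (over x K)) (\<lambda>w\<in>Ix (mu (over x K)). reassoc w) Q)"
    using ucmp_reindex_family[OF r qf Yx k[folded reindex_iff]] unfolding up A .
  also have "\<dots> = ure A a (mu (over M Z)) (mu (over x Y))
      (\<lambda>w\<in>Ix (mu (over x Y)). pair (g (ufst w)) (usnd w)) Q"
    by (rule ure_comp_eq[OF Q reA reidx_over_family[OF al(1) ufamilyD(7)[OF qf] Yx k]])
      (auto simp: k_def g_def K_def al(3) elim!: Ix_muE)
  also have "\<dots> = ucmp A a y Y s (upost A a x y \<alpha> r)"
    unfolding L by (simp only: over_cong[OF al(3,4)])
  finally show ?thesis by simp
qed

text \<open>\<open>upre\<close> is composition over a singleton index set, so this is
  \<open>ucmp_reindex_family\<close> for a family with one member.\<close>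

lemma upre_ure:
  assumes u: "u \<in> E a (eta b)" and r: "r \<in> E b x" and g: "reidx Pt x y g"
  shows "upre A a b y (ure A b x y g r) u = ure A a x y g (upre A a b x r u)"
proof -
  note G = reidxD[OF g]
  define q where "q = ucmp A a (eta b) (\<lambda>z\<in>{star}. x) (\<lambda>z\<in>{star}. r) u"
  have q: "q \<in> E a (mu (eta x))" unfolding q_def by (rule ucmp_upre_arr[OF u r])
  define k where "k = (\<lambda>w\<in>Ix (mu (eta y)). pair (ufst w) (g (usnd w)))"
  have 0: "(\<lambda>z\<in>Ix (eta b). ure A (Fm (eta b) z) ((\<lambda>z\<in>{star}. x) z) ((\<lambda>z\<in>{star}. y) z) g ((\<lambda>z\<in>{star}. r) z)) =
     (\<lambda>z\<in>{star}. ure A b x y g r)" by auto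
  have 1: "ucmp A a (eta b) (\<lambda>z\<in>{star}. y) (\<lambda>z\<in>{star}. ure A b x y g r) u =
      ure A a (mu (eta x)) (mu (eta y)) k q"
    using ucmp_reindex_family[OF u ufamily_eta[OF r], of "\<lambda>z\<in>{star}. y" "\<lambda>_. g"] g
    unfolding 0 by (simp add: reindex_iff k_def q_def)
  have k: "reidx Pt (mu (eta x)) (mu (eta y)) k"
    using reidx_over_family[of "eta b" Pt "\<lambda>z\<in>{star}. x" "\<lambda>z\<in>{star}. y" Pt "\<lambda>_. g"] g
      eta_bobj[OF E_obj(1)[OF r]]
    by (simp add: k_def)
  have "upre A a b y (ure A b x y g r) u = ure A a (mu (eta x)) y (\<lambda>z\<in>Ix y. pair star (g z)) q"
    unfolding upre_def 1
    by (rule ure_comp_eq[OF q k reidx_mu_eta[OF G(2)]]) (simp add: k_def)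
  also have "\<dots> = ure A a x y g (upre A a b x r u)"
    unfolding upre_def q_def[symmetric]
    by (rule ure_comp_eq[symmetric, OF q reidx_mu_eta[OF G(1)] g]) (simp add: G)
  finally show ?thesis .
qed

text \<open>Associativity with a singleton outer layer: \<open>Q\<close> composes \<open>u\<close>,
  \<open>r\<close> and a copy of \<open>s\<close> indexed by pairs \<open>(star, z)\<close>, and
  both sides are reindexings of \<open>Q\<close>.\<close>

lemma upre_ucmp:
  assumes u: "u \<in> E a (eta b)" and r: "r \<in> E b x" and s: "ufamily A x Y s"
  shows "upre A a b (mu (over x Y)) (ucmp A b x Y s r) u = ucmp A a x Y s (upre A a b x r u)"
proof -
  note S = ufamilyD[OF s] and x = E_obj(2)[OF r]
  note eb = E_obj(2)[OF u]
  define M where "M = mu (eta x)"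
  define Z where "Z = (\<lambda>w\<in>Ix M. Y (usnd w))"
  define t where "t = (\<lambda>w\<in>Ix M. s (usnd w))"
  define q where "q = ucmp A a (eta b) (\<lambda>z\<in>{star}. x) (\<lambda>z\<in>{star}. r) u"
  have q: "q \<in> E a M" unfolding q_def M_def by (rule ucmp_upre_arr[OF u r])
  have t: "ufamily A M Z t"
    by (rule ufamilyI) (auto simp: M_def Z_def t_def Fm_mu elim!: Ix_muE intro!: S(3))
  define Q where "Q = ucmp A a M Z t q"
  have Q: "Q \<in> E a (mu (over M Z))" unfolding Q_def by (rule ucmp_arr[OF q t])
  define g where "g = (\<lambda>z\<in>Ix x. pair star z)"
  have g: "reidx Pt M x g" unfolding g_def M_def by (rule reidx_mu_eta[OF x])
  have "(\<lambda>z\<in>Ix x. Z (g z)) = (\<lambda>z\<in>Ix x. Y z)" "(\<lambda>z\<in>Ix x. t (g z)) = (\<lambda>z\<in>Ix x. s z)"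
    by (auto simp: Z_def t_def g_def M_def)
  then have Zg: "(\<lambda>z\<in>Ix x. Z (g z)) = Y" "(\<lambda>z\<in>Ix x. t (g z)) = s" by (simp_all only: S(5,6))
  have L: "ucmp A a x Y s (upre A a b x r u) = ure A a (mu (over M Z)) (mu (over x Y))
      (\<lambda>w\<in>Ix (mu (over x Y)). pair (g (ufst w)) (usnd w)) Q"
    using ucmp_reindex[OF q t g[folded reindex_iff]]
    by (simp only: Zg upre_def q_def[symmetric] g_def[symmetric] M_def[symmetric] Q_def[symmetric])
  define H where "H = (\<lambda>z\<in>{star :: 'u}. x)"
  define W where "W = (\<lambda>z\<in>Ix (eta b). \<lambda>w\<in>Ix (H z). Z (pair z w))"
  have "W star = (\<lambda>w\<in>Ix x. Y w)" by (auto simp: W_def H_def Z_def M_def)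
  then have W: "W star = Y" by (simp only: S(5))
  define N where "N = mu (over x Y)"
  have K: "(\<lambda>z\<in>Ix (eta b). mu (over (H z) (W z))) = (\<lambda>z\<in>{star}. N)"
    by (auto simp: fun_eq_iff W H_def N_def)
  have "(\<lambda>w\<in>Ix x. t (pair star w)) = (\<lambda>w\<in>Ix x. s w)" by (auto simp: t_def M_def)
  then have tt: "(\<lambda>w\<in>Ix x. t (pair star w)) = s" by (simp only: S(6))
  have qq: "(\<lambda>z\<in>Ix (eta b). ucmp A (Fm (eta b) z) (H z) (W z) (\<lambda>w\<in>Ix (H z). t (pair z w)) ((\<lambda>z\<in>{star}. r) z)) =
      (\<lambda>z\<in>{star}. ucmp A b x Y s r)"
    by (auto simp: fun_eq_iff W H_def tt)
  have A: "ure A a (mu (over M Z)) (mu (eta N)) (\<lambda>w\<in>Ix (mu (eta N)). reassoc w) Q =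
      ucmp A a (eta b) (\<lambda>z\<in>{star}. N) (\<lambda>z\<in>{star}. ucmp A b x Y s r) u"
    using ucmp_assoc[OF u ufamily_eta[OF r, folded H_def] _ W_def, of t] t
    unfolding K qq unfolding Q_def q_def M_def H_def over_eta by blast
  have reA: "reidx Pt (mu (over M Z)) (mu (eta N)) (\<lambda>w\<in>Ix (mu (eta N)). reassoc w)"
    using reidx_over_assoc[OF eb ufamilyD(1)[OF ufamily_eta[OF r, folded H_def]] _ W_def] ufamilyD(1)[OF t]
    unfolding K unfolding M_def H_def over_eta by blast
  have N: "N \<in> bobj Pt" unfolding N_def by (rule mu_bobj[OF ufamily_over[OF r s]])
  have "upre A a b N (ucmp A b x Y s r) u = ure A a (mu (over M Z)) N
      (\<lambda>w\<in>Ix N. pair (g (ufst w)) (usnd w)) Q"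
    unfolding upre_def A[symmetric]
    by (rule ure_comp_eq[OF Q reA reidx_mu_eta[OF N]]) (auto simp: g_def N_def elim!: Ix_muE)
  then show ?thesis unfolding L N_def .
qed

lemma upre_upre:
  assumes u: "u \<in> E a (eta b)" and s: "s \<in> E b (eta c)" and r: "r \<in> E c x"
  shows "upre A a c x r (upre A a b (eta c) s u) = upre A a b x (upre A b c x r s) u"
proof -
  have "upre A a b x (upre A b c x r s) u = ure A a (mu (eta x)) x (\<lambda>z\<in>Ix x. pair star z)
      (upre A a b (mu (eta x)) (ucmp A b (eta c) (\<lambda>z\<in>{star}. x) (\<lambda>z\<in>{star}. r) s) u)"
    unfolding upre_def[of A b c]
    by (rule upre_ure[OF u ucmp_upre_arr[OF s r] reidx_mu_eta[OF E_obj(2)[OF r]]])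
  also have "\<dots> = upre A a c x r (upre A a b (eta c) s u)"
    using upre_ucmp[OF u s ufamily_eta[OF r]] by (simp add: upre_def[of A a c])
  finally show ?thesis by simp
qed

lemma upre_upost:
  assumes u: "u \<in> E a (eta b)" and r: "r \<in> E b x" and \<alpha>: "ualong x y \<alpha>"
  shows "upre A a b y (upost A b x y \<alpha> r) u = upost A a x y \<alpha> (upre A a b x r u)"
  unfolding upost_def
    upre_ure[OF u ucmp_upost_arr[OF r \<alpha>] reidx_mu_bmap_eta[OF ualongD(2)[OF \<alpha>]]]
  using upre_ucmp[OF u r ualongD(7)[OF \<alpha>]] by (simp add: ualongD(8)[OF \<alpha>])

text \<open>On the singleton \<open>{star}\<close> the index maps \<open>pair z star\<close> and
  \<open>pair star z\<close> coincide, so the two ways of composing with a unary arrow are one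
  operation.\<close>

lemma upost_eta:
  assumes "u \<in> E a (eta b)" "v \<in> E b (eta c)"
  shows "upost A a (eta b) (eta c) (\<lambda>z\<in>{star}. v) u = upre A a b (eta c) v u"
proof -
  have 1: "(\<lambda>z\<in>Ix (eta b). eta (Fm (eta c) z)) = (\<lambda>z\<in>{star}. eta c)" by auto
  have 2: "(\<lambda>z\<in>Ix (eta c). pair z star) = (\<lambda>z\<in>Ix (eta c). pair star z)" by auto
  show ?thesis unfolding upost_def upre_def 1 2 bmap_eta ..
qed

lemma upost_upost:
  assumes r: "r \<in> E a x" and \<alpha>: "ualong x y \<alpha>" and \<beta>: "ualong y z \<beta>"
  shows "upost A a y z \<beta> (upost A a x y \<alpha> r) =
    upost A a x z (\<lambda>w\<in>Ix x. upre A (Fm x w) (Fm y w) (eta (Fm z w)) (\<beta> w) (\<alpha> w)) r"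
proof -
  note al = ualongD[OF \<alpha>] and bt = ualongD[OF \<beta>]
  have "(\<lambda>w\<in>Ix x. upre A (Fm x w) (Fm y w) ((\<lambda>z'\<in>Ix y. eta (Fm z z')) w) (\<beta> w) (\<alpha> w)) =
      (\<lambda>w\<in>Ix x. upre A (Fm x w) (Fm y w) (eta (Fm z w)) (\<beta> w) (\<alpha> w))"
    by (rule restrict_ext) (simp add: al(3))
  then show ?thesis unfolding upost_def[of A a y z] upost_def[of A a x z]
    using ucmp_upost[OF r \<alpha> bt(7)] by (simp add: al(3))
qed

lemma ualong_uid: "x \<in> bobj Pt \<Longrightarrow> ualong x x (\<lambda>z\<in>Ix x. uid A (Fm x z))"
  by (auto simp: ualong_def intro!: uid_E bobj_mem)

lemma ualong_pull:
  assumes "ualong x y \<alpha>" "reidx Pt y y' g"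
  shows "ualong (pull x g y') y' (\<lambda>z\<in>Ix y'. \<alpha> (g z))"
proof -
  note al = ualongD[OF assms(1)] and G = reidxD[OF assms(2)]
  have "\<alpha> (g z) \<in> E (Fm x (g z)) (eta (Fm y' z))" if "z \<in> Ix y'" for z
    using al(5)[of "g z"] G(4,5)[OF that] al(3) by simp
  then show ?thesis using pull_bobj[OF al(1) G(2), of g] G(2,4) al(3) by (simp add: ualong_def)
qed

text \<open>Reindexing passes through vertical composition once the family is pulled back along
  \<open>g\<close>. The two sides reindex the same composite, along index maps that agree on the
  pairs \<open>(z, star)\<close>.\<close>

lemma ure_upost:
  assumes r: "r \<in> E a x" and \<alpha>: "ualong x y \<alpha>" and g: "reidx Pt y y' g"
  shows "ure A a y y' g (upost A a x y \<alpha> r) =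
    upost A a (pull x g y') y' (\<lambda>z\<in>Ix y'. \<alpha> (g z)) (ure A a x (pull x g y') g r)"
proof -
  note al = ualongD[OF \<alpha>] and G = reidxD[OF g]
  define q where "q = ucmp A a x (\<lambda>z\<in>Ix x. eta (Fm y z)) \<alpha> r"
  have q: "q \<in> E a (mu (bmap eta y))" unfolding q_def by (rule ucmp_upost_arr[OF r \<alpha>])
  \<comment> \<open>The objects \<open>x\<close> and \<open>y\<close> share index set and filter, so
    an index map over \<open>y\<close> is also one over \<open>x\<close>.\<close>
  have ux: "uindex x y' g" using G(3) al(3,4) by (simp add: uindex_def)
  have gx: "reidx Pt x (pull x g y') g" by (rule reidx_pull[OF al(1) G(2) ux])
  define k where "k = (\<lambda>w\<in>Ix (mu (bmap eta y')). pair (g (ufst w)) (usnd w))"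
  have 0: "(\<lambda>z\<in>Ix (pull x g y'). (\<lambda>z\<in>Ix x. eta (Fm y z)) (g z)) = (\<lambda>z\<in>Ix y'. eta (Fm y' z))"
    using G al(3) by (auto simp: fun_eq_iff)
  have o: "over (pull x g y') (\<lambda>z\<in>Ix y'. eta (Fm y' z)) = bmap eta y'"
    by (rule ufam_eqI) auto
  have 1: "ucmp A a (pull x g y') (\<lambda>z\<in>Ix y'. eta (Fm y' z)) (\<lambda>z\<in>Ix y'. \<alpha> (g z)) (ure A a x (pull x g y') g r) =
      ure A a (mu (bmap eta y)) (mu (bmap eta y')) k q"
    using ucmp_reindex[OF r al(7) gx[folded reindex_iff]] unfolding 0 o al(8) k_def q_def by simp
  have k: "reidx Pt (mu (bmap eta y)) (mu (bmap eta y')) k"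
    using reidx_over[OF gx ufamilyD(1)[OF al(7)]] unfolding 0 o al(8) k_def .
  show ?thesis
    unfolding upost_def q_def[symmetric] pull_sel 1
    by (subst ure_comp[OF q k reidx_mu_bmap_eta[OF G(2)]], rule ure_comp_eq[OF q reidx_mu_bmap_eta[OF al(2)] g])
      (simp add: k_def G)
qed

text \<open>Associativity with a trivial innermost layer: the vertical family on pairs is curried
  and absorbed into the members of \<open>s\<close>.\<close>

lemma upost_ucmp:
  assumes r: "r \<in> E a x" and s: "ufamily A x Y s" and Z: "Z \<in> extensional (Ix x)"
    and \<delta>: "\<And>z. z \<in> Ix x \<Longrightarrow> ualong (Y z) (Z z) (\<delta> z)"
  shows "upost A a (mu (over x Y)) (mu (over x Z)) (\<lambda>w\<in>Ix (mu (over x Y)). \<delta> (ufst w) (usnd w)) (ucmp A a x Y s r) =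
    ucmp A a x Z (\<lambda>z\<in>Ix x. upost A (Fm x z) (Y z) (Z z) (\<delta> z) (s z)) r"
proof -
  note S = ufamilyD[OF s] and x = E_obj(2)[OF r]
  note dl = ualongD[OF \<delta>]
  define M where "M = mu (over x Y)"
  define N where "N = mu (over x Z)"
  have Zf: "Z \<in> Ix x \<rightarrow>\<^sub>E bobj Pt" using Z dl(2) by (auto simp: PiE_iff)
  have M: "M \<in> bobj Pt" unfolding M_def by (rule mu_bobj[OF ufamily_over[OF r s]])
  have N: "N \<in> bobj Pt" unfolding N_def by (rule mu_bobj[OF over_bobj[OF x Zf]])
  define d where "d = (\<lambda>w\<in>Ix M. \<delta> (ufst w) (usnd w))"
  have IMN: "Ix N = Ix M" by (auto simp: N_def M_def Ix_mu dl(3))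
  have "Uf N = Uf M"
    unfolding filter_eq_iff N_def M_def eventually_mu over_sel
    by (intro allI eventually_cong[OF bobj_ev[OF x]]) (simp add: dl(4))
  with M N IMN have d: "ualong M N d"
    by (auto simp: ualong_def d_def M_def N_def Fm_mu dl(3,5) elim!: Ix_muE)
  note D = ualongD[OF d]
  define H :: "'u \<Rightarrow> ('u, 'u) ufam" where "H = (\<lambda>w\<in>Ix M. eta (Fm N w))"
  define Q0 where "Q0 = ucmp A a x Y s r"
  have Q0: "Q0 \<in> E a M" unfolding Q0_def M_def by (rule ucmp_arr[OF r s])
  define Q where "Q = ucmp A a M H d Q0"
  have Q: "Q \<in> E a (mu (bmap eta N))" unfolding Q_def H_def by (rule ucmp_upost_arr[OF Q0 d])
  define W where "W = (\<lambda>z\<in>Ix x. \<lambda>w\<in>Ix (Y z). H (pair z w))"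
  have W: "W z = (\<lambda>w\<in>Ix (Y z). eta (Fm (Z z) w))" if "z \<in> Ix x" for z
    unfolding W_def restrict_apply'[OF that]
    by (rule restrict_ext) (use that in \<open>simp add: H_def M_def N_def Fm_mu dl(3)\<close>)
  define K where "K = (\<lambda>z\<in>Ix x. mu (bmap eta (Z z)))"
  have K: "(\<lambda>z\<in>Ix x. mu (over (Y z) (W z))) = K" unfolding K_def by (rule restrict_ext) (simp add: W dl(8))
  define q where "q = (\<lambda>z\<in>Ix x. ucmp A (Fm x z) (Y z) (\<lambda>w\<in>Ix (Y z). eta (Fm (Z z) w)) (\<delta> z) (s z))"
  have q: "(\<lambda>z\<in>Ix x. ucmp A (Fm x z) (Y z) (W z) (\<lambda>w\<in>Ix (Y z). d (pair z w)) (s z)) = q"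
    unfolding q_def
  proof (rule restrict_ext)
    fix z assume z: "z \<in> Ix x"
    then have "(\<lambda>w\<in>Ix (Y z). d (pair z w)) = (\<lambda>w\<in>Ix (Y z). \<delta> z w)"
      by (intro restrict_ext) (simp add: d_def M_def)
    with z show "ucmp A (Fm x z) (Y z) (W z) (\<lambda>w\<in>Ix (Y z). d (pair z w)) (s z) =
      ucmp A (Fm x z) (Y z) (\<lambda>w\<in>Ix (Y z). eta (Fm (Z z) w)) (\<delta> z) (s z)" by (simp only: W dl(6))
  qed
  have oMH: "over M H = bmap eta N" unfolding H_def by (rule D(8))
  have H: "ufamily A M H d" unfolding H_def by (rule D(7))
  have A: "ure A a (mu (bmap eta N)) (mu (over x K)) (\<lambda>w\<in>Ix (mu (over x K)). reassoc w) Q = ucmp A a x K q r"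
    using ucmp_assoc[OF r s H[unfolded M_def] W_def] unfolding M_def[symmetric] K q oMH Q_def Q0_def .
  have reA: "reidx Pt (mu (bmap eta N)) (mu (over x K)) (\<lambda>w\<in>Ix (mu (over x K)). reassoc w)"
    using reidx_over_assoc[OF x S(1) _ W_def] ufamilyD(1)[OF H]
    unfolding K M_def[symmetric] oMH by blast
  have qf: "ufamily A x K q"
    by (rule ufamilyI) (use S(3) in \<open>auto simp: K_def q_def intro!: ucmp_upost_arr \<delta>\<close>)
  define k where "k z = (\<lambda>v\<in>Ix (Z z). pair v star)" for z
  have k: "reidx Pt (K z) (Z z) (k z)" if "z \<in> Ix x" for z
    using that dl(2) by (simp add: K_def k_def reidx_mu_bmap_eta)
  have up: "(\<lambda>z\<in>Ix x. ure A (Fm x z) (K z) (Z z) (k z) (q z)) =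
      (\<lambda>z\<in>Ix x. upost A (Fm x z) (Y z) (Z z) (\<delta> z) (s z))"
    by (rule restrict_ext) (simp add: upost_def K_def k_def q_def)
  have "ucmp A a x Z (\<lambda>z\<in>Ix x. upost A (Fm x z) (Y z) (Z z) (\<delta> z) (s z)) r =
      ure A a (mu (over x K)) N (\<lambda>w\<in>Ix N. pair (ufst w) (k (ufst w) (usnd w)))
        (ure A a (mu (bmap eta N)) (mu (over x K)) (\<lambda>w\<in>Ix (mu (over x K)). reassoc w) Q)"
    using ucmp_reindex_family[OF r qf Z k[folded reindex_iff]] unfolding up A unfolding N_def by simp
  also have "\<dots> = ure A a (mu (bmap eta N)) N (\<lambda>w\<in>Ix N. pair w star) Q"
    using reidx_over_family[OF x ufamilyD(7)[OF qf] Z k] unfolding N_def[symmetric]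
    by (rule ure_comp_eq[OF Q reA]) (auto simp: N_def k_def K_def elim!: Ix_muE)
  also have "\<dots> = upost A a M N d (ucmp A a x Y s r)"
    unfolding upost_def Q_def Q0_def H_def ..
  finally show ?thesis unfolding M_def N_def d_def by simp
qed

text \<open>The value of \<Delta> at \<open>r\<close> and the germ of \<open>(t, \<zeta>)\<close>.
  The pair is split at \<open>pull x t Y\<close>: the reindexing acts on \<open>r\<close>, and the
  family is composed with the result.\<close>

definition dl :: "'u \<Rightarrow> ('u, 'u) ufam \<Rightarrow> ('u, ('u, 'u) ufam) ufam \<Rightarrow> ('u \<Rightarrow> 'u) \<Rightarrow> ('u \<Rightarrow> 'u) \<Rightarrow> 'u \<Rightarrow> 'u" where
  "dl a x Y t \<zeta> r = ucmp A a (pull x t Y) (Fm Y) \<zeta> (ure A a x (pull x t Y) t r)"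

lemma upairs_ufamily:
  assumes "(t, \<zeta>) \<in> upairs E x Y" "Y \<in> bobj (bobj Pt)"
  shows "ufamily A (pull x t Y) (Fm Y) \<zeta>"
  using assms bobj_Fm[OF assms(2)] by (intro ufamilyI) (auto simp: mem_upairs PiE_iff)

lemma dl_Els:
  assumes r: "r \<in> E a x" and t: "(t, \<zeta>) \<in> upairs E x Y" and Y: "Y \<in> bobj (bobj Pt)"
  shows "dl a x Y t \<zeta> r \<in> E a (mu Y)"
  using ucmp_arr[OF ure_Els[OF r reidx_pull[OF E_obj(2)[OF r] Y upairs_uindex[OF t]]] upairs_ufamily[OF t Y]]
  by (simp add: dl_def over_eq)

text \<open>Both sides are reindexings of one composite over two copies of the index set of \<open>Y\<close>, in which the
  filter lives on the first copy.  (Families that agree only on a member of the ultrafilter are not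
  isomorphic in \<open>\<beta>A\<^sub>0\<close>, so that restriction to that member is not available.)\<close>

lemma dl_cong:
  assumes r: "r \<in> E a x" and t: "(t, \<zeta>) \<in> upairs E x Y" and t': "(t', \<zeta>') \<in> upairs E x Y"
    and Y: "Y \<in> bobj (bobj Pt)" and ae: "\<forall>\<^sub>F z in Uf Y. t z = t' z \<and> \<zeta> z = \<zeta>' z"
  shows "dl a x Y t \<zeta> r = dl a x Y t' \<zeta>' r"
proof -
  note x = E_obj(2)[OF r]
  obtain b :: 'u where b: "b \<noteq> star" using ex_two_points by blast
  \<comment> \<open>The copy labelled \<open>star\<close> carries \<open>(t, \<zeta>)\<close> and
    the whole filter; the copy labelled \<open>b\<close> carries
    \<open>(t', \<zeta>')\<close>.\<close>
  define I where "I = pair star ` Ix Y \<union> pair b ` Ix Y"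
  define T where "T = (\<lambda>w\<in>I. if ufst w = star then t (usnd w) else t' (usnd w))"
  define x2 where "x2 = Ufam I (\<lambda>w\<in>I. Fm x (T w)) (filtermap (pair star) (Uf Y))"
  define Y2 where "Y2 = (\<lambda>w\<in>I. Fm Y (usnd w))"
  define S where "S = (\<lambda>w\<in>I. if ufst w = star then \<zeta> (usnd w) else \<zeta>' (usnd w))"
  have I: "pair star z \<in> I" "pair b z \<in> I" if "z \<in> Ix Y" for z using that by (auto simp: I_def)
  have IE: thesis if "w \<in> I" "\<And>z. z \<in> Ix Y \<Longrightarrow> w = pair star z \<Longrightarrow> thesis"
    "\<And>z. z \<in> Ix Y \<Longrightarrow> w = pair b z \<Longrightarrow> thesis" for w thesis using that by (auto simp: I_def)
  note tm = uindex_mem[OF upairs_uindex[OF t]] uindex_mem[OF upairs_uindex[OF t']]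
  have Tm: "T w \<in> Ix x" if "w \<in> I" for w
    using that b by (auto simp: T_def tm elim!: IE)
  have evI: "\<forall>\<^sub>F w in filtermap (pair star) (Uf Y). w \<in> I"
    unfolding eventually_filtermap using bobj_ev[OF Y] by eventually_elim (rule I)
  have x2: "x2 \<in> bobj Pt"
    unfolding bobj_def mem_Collect_eq
  proof (intro conjI)
    show "small (Ix x2)" by (simp add: x2_def I_def small_Un small_image bobj_small[OF Y])
    show "Fm x2 \<in> Ix x2 \<rightarrow>\<^sub>E Pt" by (auto simp: x2_def intro!: bobj_mem[OF x] Tm)
    show "ultrafilter_on (Ix x2) (Uf x2)"
      using evI bobj_uf[OF Y] by (auto simp: ultrafilter_on_def x2_def filtermap_bot_iff eventually_filtermap)
  qed
  have uT: "uindex x x2 T"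
  proof -
    have "T \<in> Ix x2 \<rightarrow>\<^sub>E Ix x" using Tm by (auto simp: x2_def T_def)
    moreover have "eventually P (Uf x) \<longleftrightarrow> (\<forall>\<^sub>F w in Uf x2. P (T w))" for P
    proof -
      have "eventually P (Uf x) \<longleftrightarrow> (\<forall>\<^sub>F z in Uf Y. P (t z))"
        using upairs_uindex[OF t] by (metis uindex_def eventually_filtermap)
      also have "\<dots> \<longleftrightarrow> (\<forall>\<^sub>F z in Uf Y. P (T (pair star z)))"
        by (rule eventually_cong[OF bobj_ev[OF Y]]) (simp add: T_def I)
      finally show ?thesis by (simp add: x2_def eventually_filtermap)
    qed
    ultimately show ?thesis by (rule uindexI)
  qed
  have rT: "reidx Pt x x2 T" using x x2 uT by (simp add: reidx_def x2_def)
  have S: "ufamily A x2 Y2 S"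
  proof (rule ufamilyI)
    fix z assume "z \<in> Ix x2"
    then have "z \<in> I" by (simp add: x2_def)
    then show "S z \<in> E (Fm x2 z) (Y2 z)"
      using upairs_mem[OF t] upairs_mem[OF t'] b
      by (auto simp: x2_def S_def Y2_def T_def elim!: IE)
  qed (auto simp: x2_def Y2_def S_def)
  define r2 where "r2 = ure A a x x2 T r"
  have r2: "r2 \<in> E a x2" unfolding r2_def by (rule ure_Els[OF r rT])
  define Q where "Q = ucmp A a x2 Y2 S r2"
  \<comment> \<open>The map \<open>g\<close> selects, for each index, a copy on which the data equal
    those of \<open>t1\<close> and \<open>\<zeta>1\<close>. As almost all indices go to the copy
    that carries the filter, \<open>g\<close> is a reindexing, and \<open>dl\<close> is read off
    from the common composite \<open>Q\<close>.\<close>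
  have main: "dl a x Y t1 \<zeta>1 r = ure A a (mu (over x2 Y2)) (mu Y) (\<lambda>w\<in>Ix (mu Y). pair (g (ufst w)) (usnd w)) Q"
    if t1: "(t1, \<zeta>1) \<in> upairs E x Y" and g: "g \<in> Ix Y \<rightarrow>\<^sub>E I" "\<forall>\<^sub>F z in Uf Y. g z = pair star z"
      "\<And>z. z \<in> Ix Y \<Longrightarrow> T (g z) = t1 z \<and> S (g z) = \<zeta>1 z \<and> Y2 (g z) = Fm Y z" for t1 \<zeta>1 g
  proof -
    define p where "p = pull x t1 Y"
    have p: "reidx Pt x p t1" unfolding p_def by (rule reidx_pull[OF x Y upairs_uindex[OF t1]])
    have gm: "g z \<in> I" if "z \<in> Ix Y" for z using g(1) that by auto
    have "reidx Pt x2 p (\<lambda>z\<in>Ix p. g z)"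
    proof (rule reidx_restrict[OF x2 reidxD(2)[OF p]])
      fix P
      have "eventually P (Uf x2) \<longleftrightarrow> (\<forall>\<^sub>F z in Uf Y. P (pair star z))"
        by (simp add: x2_def eventually_filtermap)
      also have "\<dots> \<longleftrightarrow> (\<forall>\<^sub>F z in Uf Y. P (g z))" by (rule eventually_cong[OF g(2)]) simp
      finally show "eventually P (Uf x2) \<longleftrightarrow> (\<forall>\<^sub>F z in Uf p. P (g z))" by (simp add: p_def)
    qed (use gm g(3) in \<open>auto simp: p_def x2_def\<close>)
    then have gr: "reidx Pt x2 p g" using g(1) by (simp add: p_def PiE_restrict)
    have rr: "ure A a x2 p g r2 = ure A a x p t1 r"
      unfolding r2_def by (rule ure_comp_eq[OF r rT gr]) (simp add: p_def g(3))
    have "(\<lambda>z\<in>Ix p. Y2 (g z)) = (\<lambda>z\<in>Ix Y. Fm Y z)" by (simp add: p_def g(3) cong: restrict_cong)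
    then have 1: "(\<lambda>z\<in>Ix p. Y2 (g z)) = Fm Y" by (simp add: PiE_restrict[OF bobj_Fm[OF Y]])
    have "(\<lambda>z\<in>Ix p. S (g z)) = (\<lambda>z\<in>Ix Y. \<zeta>1 z)" by (simp add: p_def g(3) cong: restrict_cong)
    then have 2: "(\<lambda>z\<in>Ix p. S (g z)) = \<zeta>1" using t1 by (simp only: mem_upairs) (blast dest: PiE_restrict)
    have 3: "over p (Fm Y) = Y" by (simp add: p_def over_eq)
    show ?thesis unfolding dl_def p_def[symmetric] Q_def
      using ucmp_reindex[OF r2 S gr[folded reindex_iff]] by (simp only: 1 2 3 rr)
  qed
  define g1 where "g1 = (\<lambda>z\<in>Ix Y. pair star z)"
  \<comment> \<open>The second map uses the copy \<open>b\<close> only where the two pairs disagree.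
    This is a null set, so \<open>g2\<close> still respects the filter and equals \<open>g1\<close>
    almost everywhere.\<close>
  define g2 where "g2 = (\<lambda>z\<in>Ix Y. if t z = t' z \<and> \<zeta> z = \<zeta>' z then pair star z else pair b z)"
  have 1: "dl a x Y t \<zeta> r = ure A a (mu (over x2 Y2)) (mu Y) (\<lambda>w\<in>Ix (mu Y). pair (g1 (ufst w)) (usnd w)) Q"
    by (rule main[OF t]) (use I bobj_ev[OF Y] in \<open>auto simp: g1_def T_def S_def Y2_def elim!: eventually_mono\<close>)
  have "\<forall>\<^sub>F z in Uf Y. g2 z = pair star z"
    using ae bobj_ev[OF Y] by eventually_elim (simp add: g2_def)
  then have 2: "dl a x Y t' \<zeta>' r = ure A a (mu (over x2 Y2)) (mu Y) (\<lambda>w\<in>Ix (mu Y). pair (g2 (ufst w)) (usnd w)) Q"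
    by (intro main[OF t']) (use I b in \<open>auto simp: g2_def T_def S_def Y2_def\<close>)
  have "\<forall>\<^sub>F w in Uf (mu Y). g1 (ufst w) = g2 (ufst w)"
    unfolding eventually_mu ufst_pair using ae
    by eventually_elim (simp add: g1_def g2_def)
  then show ?thesis unfolding 1 2
    by (intro ure_cong) (auto elim!: eventually_mono)
qed

end

section \<open>The 2-category of ultraconvergence spaces\<close>

lemma bmap_mu:
  assumes "Y \<in> bobj S"
  shows "bmap f (mu Y) = mu (bmap (bmap f) Y)"
proof (rule mu_eqI)
  show "Ix (bmap f (mu Y)) = Ix (mu (bmap (bmap f) Y))" by (auto simp: Ix_mu)
  show "Uf (bmap f (mu Y)) = Uf (mu (bmap (bmap f) Y))"
    unfolding filter_eq_iff bmap_sel eventually_mu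
    by (intro allI eventually_cong[OF bobj_ev[OF assms]]) simp
qed (auto simp: Fm_mu)

lemma bmap_over: "bmap f (over x Y) = over x (\<lambda>z\<in>Ix x. f (Y z))"
  by (simp add: over_def bmap_def)

lemma over_bmap: "over (bmap f x) Y = over x Y"
  by (rule over_cong) simp_all

lemma reidx_bmap:
  assumes "reidx S x y g" "\<And>a. a \<in> S \<Longrightarrow> f a \<in> T"
  shows "reidx T (bmap f x) (bmap f y) g"
  using assms(1) bmap_bobj[OF _ assms(2)] by (auto simp: reidx_def uindex_def)

section \<open>Continuous maps and composition with unary arrows\<close>

locale uspace_map = A: ultraconvergence_space A + A': ultraconvergence_space A' + continuous_map A A' f
  for A A' :: "'u::universe ucspace" and f
begin

lemma cpt_mem: "a \<in> upts A \<Longrightarrow> cpt f a \<in> upts A'"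
  using cpt_fun by auto

lemma bmap_mem: "x \<in> bobj (upts A) \<Longrightarrow> bmap (cpt f) x \<in> bobj (upts A')"
  by (rule bmap_bobj[OF _ cpt_mem])

lemma carr_E: "r \<in> Els (uarr A) a x \<Longrightarrow> carr f a x r \<in> Els (uarr A') (cpt f a) (bmap (cpt f) x)"
  using carr_fun by auto

lemma carr_E_eta: "r \<in> Els (uarr A) a (eta b) \<Longrightarrow> carr f a (eta b) r \<in> Els (uarr A') (cpt f a) (eta (cpt f b))"
  using carr_E[of r a "eta b"] by simp

lemma ufamily_carr:
  assumes "ufamily A x Y s"
  shows "ufamily A' (bmap (cpt f) x) (\<lambda>z\<in>Ix x. bmap (cpt f) (Y z)) (\<lambda>z\<in>Ix x. carr f (Fm x z) (Y z) (s z))"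
  by (rule A'.ufamilyI) (use carr_E A.ufamilyD(3)[OF assms] in auto)

lemma ualong_carr:
  assumes "A.ualong x y \<alpha>"
  shows "A'.ualong (bmap (cpt f) x) (bmap (cpt f) y) (\<lambda>z\<in>Ix x. carr f (Fm x z) (eta (Fm y z)) (\<alpha> z))"
  using A.ualongD[OF assms] carr_E_eta by (auto simp: A'.ualong_def intro!: bmap_mem)

lemma carr_upre:
  assumes u: "u \<in> Els (uarr A) a (eta b)" and r: "r \<in> Els (uarr A) b x"
  shows "carr f a x (upre A a b x r u) =
    upre A' (cpt f a) (cpt f b) (bmap (cpt f) x) (carr f b x r) (carr f a (eta b) u)"
proof -
  note x = A.E_obj(2)[OF r]
  have 1: "(\<lambda>z\<in>Ix (eta b). bmap (cpt f) ((\<lambda>z\<in>{star}. x) z)) = (\<lambda>z\<in>{star}. bmap (cpt f) x)" by auto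
  have 2: "(\<lambda>z\<in>Ix (eta b). carr f (Fm (eta b) z) ((\<lambda>z\<in>{star}. x) z) ((\<lambda>z\<in>{star}. r) z)) = (\<lambda>z\<in>{star}. carr f b x r)" by auto
  have 3: "bmap (cpt f) (mu (eta x)) = mu (eta (bmap (cpt f) x))"
    using bmap_mu[OF eta_bobj[OF x]] by simp
  show ?thesis unfolding upre_def
    using carr_reindex[OF A.ucmp_upre_arr[OF u r] reidx_mu_eta[OF x, folded reindex_iff]]
      carr_ucmp[OF u A.ufamily_eta[OF r]]
    unfolding 1 2 3 by simp
qed

lemma carr_upost:
  assumes r: "r \<in> Els (uarr A) a x" and \<alpha>: "A.ualong x y \<alpha>"
  shows "carr f a y (upost A a x y \<alpha> r) =
    upost A' (cpt f a) (bmap (cpt f) x) (bmap (cpt f) y)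
      (\<lambda>z\<in>Ix x. carr f (Fm x z) (eta (Fm y z)) (\<alpha> z)) (carr f a x r)"
proof -
  note al = A.ualongD[OF \<alpha>]
  have 1: "(\<lambda>z\<in>Ix x. bmap (cpt f) ((\<lambda>z\<in>Ix x. eta (Fm y z)) z)) = (\<lambda>z\<in>Ix x. eta ((\<lambda>z\<in>Ix y. cpt f (Fm y z)) z))"
    by (rule restrict_ext) (simp add: al(3))
  have 2: "(\<lambda>z\<in>Ix x. carr f (Fm x z) ((\<lambda>z\<in>Ix x. eta (Fm y z)) z) (\<alpha> z)) = (\<lambda>z\<in>Ix x. carr f (Fm x z) (eta (Fm y z)) (\<alpha> z))"
    by (rule restrict_ext) simp
  have "bmap (cpt f) (mu (bmap eta y)) = mu (bmap (bmap (cpt f)) (bmap eta y))"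
    by (rule bmap_mu[OF bmap_eta_bobj[OF al(2)]])
  also have "bmap (bmap (cpt f)) (bmap eta y) = bmap eta (bmap (cpt f) y)" unfolding bmap_bmap by simp
  finally have 3: "bmap (cpt f) (mu (bmap eta y)) = mu (bmap eta (bmap (cpt f) y))" .
  show ?thesis unfolding upost_def bmap_sel
    using carr_reindex[OF A.ucmp_upost_arr[OF r \<alpha>] reidx_mu_bmap_eta[OF al(2), folded reindex_iff]]
      carr_ucmp[OF r al(7)]
    unfolding 1 2 3 al(8) by simp
qed

end

definition uc_id :: "'u::universe ucspace \<Rightarrow> 'u ucmap" where
  "uc_id A = \<lparr> cpt = (\<lambda>a\<in>upts A. a), carr = (\<lambda>a x. \<lambda>r\<in>Els (uarr A) a x. r) \<rparr>"

definition uc_comp :: "'u::universe ucspace \<Rightarrow> 'u ucmap \<Rightarrow> 'u ucmap \<Rightarrow> 'u ucmap" where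
  "uc_comp A g f = \<lparr> cpt = (\<lambda>a\<in>upts A. cpt g (cpt f a)),
                carr = (\<lambda>a x. \<lambda>r\<in>Els (uarr A) a x. carr g (cpt f a) (bmap (cpt f) x) (carr f a x r)) \<rparr>"

lemma UltSp_sel:
  "A \<in> Ob2 UltSp \<longleftrightarrow> ultraconvergence_space A" "f \<in> Hom1 UltSp A B \<longleftrightarrow> continuous_map A B f"
  "\<alpha> \<in> Hom2 UltSp A B f g \<longleftrightarrow> transformation A B f g \<alpha>"
  "id1 UltSp A = uc_id A" "comp1 UltSp A B C h k = uc_comp A h k"
  "id2 UltSp A B f = (\<lambda>a\<in>upts A. uid B (cpt f a))"
  "vcomp UltSp A B f g m \<tau> \<sigma> = (\<lambda>a\<in>upts A. upre B (cpt f a) (cpt g a) (eta (cpt m a)) (\<tau> a) (\<sigma> a))"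
  "hcomp UltSp A B C f f' m m' \<tau> \<sigma> = (\<lambda>a\<in>upts A.
                upre C (cpt m (cpt f a)) (cpt m' (cpt f a)) (eta (cpt m' (cpt f' a)))
                  (carr m' (cpt f a) (eta (cpt f' a)) (\<sigma> a)) (\<tau> (cpt f a)))"
  by (simp_all add: UltSp_def uc_id_def uc_comp_def)

lemma ucmap_eqI: "cpt f = cpt g \<Longrightarrow> (\<And>a x. carr f a x = carr g a x) \<Longrightarrow> f = (g :: 'u ucmap)"
  by (rule ucmap.equality) (auto simp: fun_eq_iff)

lemma uc_id_sel [simp]: "cpt (uc_id A) = (\<lambda>a\<in>upts A. a)" "carr (uc_id A) a x = (\<lambda>r\<in>Els (uarr A) a x. r)"
  by (simp_all add: uc_id_def)

lemma uc_comp_sel [simp]: "cpt (uc_comp A g f) = (\<lambda>a\<in>upts A. cpt g (cpt f a))"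
  "carr (uc_comp A g f) a x = (\<lambda>r\<in>Els (uarr A) a x. carr g (cpt f a) (bmap (cpt f) x) (carr f a x r))"
  by (simp_all add: uc_comp_def)

context ultraconvergence_space
begin

lemma continuous_uc_id: "continuous_map A A (uc_id A)"
proof -
  have b: "bmap (\<lambda>a\<in>Pt. a) x = x" if "x \<in> bobj Pt" for x by (rule bmap_id[OF that]) simp
  show ?thesis
  proof (standard, goal_cases)
    case (3 r a x y g)
    then show ?case
      using ure_Els[OF 3(1)] by (simp add: reindex_iff reidxD(1,2)[of Pt x y g] b E_obj(1)[OF 3(1)])
  next
    case (5 r a x Y s)
    note x = E_obj(2)[OF 5(1)] and S = ufamilyD[OF 5(2)]
    have "(\<lambda>z\<in>Ix x. bmap (\<lambda>a\<in>Pt. a) (Y z)) = (\<lambda>z\<in>Ix x. Y z)"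
      by (rule restrict_ext) (rule b[OF S(4)])
    then have 1: "(\<lambda>z\<in>Ix x. bmap (\<lambda>a\<in>Pt. a) (Y z)) = Y" by (simp only: S(5))
    have "(\<lambda>z\<in>Ix x. (\<lambda>r\<in>E (Fm x z) (Y z). r) (s z)) = (\<lambda>z\<in>Ix x. s z)"
      by (rule restrict_ext) (simp add: S(3))
    then have 2: "(\<lambda>z\<in>Ix x. (\<lambda>r\<in>E (Fm x z) (Y z). r) (s z)) = s" by (simp only: S(6))
    show ?case unfolding uc_id_sel 1 2 b[OF x]
      using 5 ucmp_arr[OF 5] E_obj(1)[OF 5(1)] by simp
  qed (auto simp: b E_obj uid_E eta_bobj)
qed

end

lemma bmap_uc_comp: "x \<in> bobj (upts A) \<Longrightarrow> bmap (cpt (uc_comp A g f)) x = bmap (cpt g) (bmap (cpt f) x)"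
  unfolding bmap_bmap uc_comp_sel by (rule bmap_cong) (auto dest: bobj_mem)

lemma continuous_uc_comp:
  assumes "uspace_map A B f" "uspace_map B C g"
  shows "continuous_map A C (uc_comp A g f)"
proof -
  interpret f: uspace_map A B f by fact
  interpret g: uspace_map B C g by fact
  note b = bmap_uc_comp
  show ?thesis
  proof (standard, goal_cases)
    case 1 then show ?case using f.cpt_mem g.cpt_mem by auto
  next
    case (2 a x)
    show ?case
    proof (cases "\<exists>r. r \<in> Els (uarr A) a x")
      case True
      then have "a \<in> upts A" "x \<in> bobj (upts A)" using f.A.E_obj by auto
      then show ?thesis using f.carr_E g.carr_E by (auto simp: b simp del: uc_comp_sel(1)) simp
    qed auto
  next
    case (3 r a x y g')
    note x = f.A.E_obj[OF 3(1)] and y = reidxD(2)[OF 3(2)[unfolded reindex_iff]]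
    have "reindex B (bmap (cpt f) x) (bmap (cpt f) y) g'"
      using 3(2) unfolding reindex_iff by (rule reidx_bmap) (rule f.cpt_mem)
    from g.carr_reindex[OF f.carr_E[OF 3(1)] this] show ?case
      using f.carr_reindex[OF 3] 3(1) f.A.ure_Els[OF 3[unfolded reindex_iff]] x
      unfolding b[OF x(2)] b[OF y] by simp
  next
    case (4 a)
    then show ?case using f.A.uid_E f.carr_uid g.carr_uid f.cpt_mem by simp
  next
    case (5 r a x Y s)
    note x = f.A.E_obj[OF 5(1)] and S = f.A.ufamilyD[OF 5(2)]
    have 1: "(\<lambda>z\<in>Ix (bmap (cpt f) x). bmap (cpt g) ((\<lambda>z\<in>Ix x. bmap (cpt f) (Y z)) z)) =
        (\<lambda>z\<in>Ix x. bmap (cpt (uc_comp A g f)) (Y z))"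
      unfolding bmap_sel by (rule restrict_ext) (simp only: b[OF S(4)] restrict_apply')
    have 2: "(\<lambda>z\<in>Ix (bmap (cpt f) x). carr g (Fm (bmap (cpt f) x) z) ((\<lambda>z\<in>Ix x. bmap (cpt f) (Y z)) z)
         ((\<lambda>z\<in>Ix x. carr f (Fm x z) (Y z) (s z)) z)) =
        (\<lambda>z\<in>Ix x. carr (uc_comp A g f) (Fm x z) (Y z) (s z))"
      unfolding bmap_sel by (rule restrict_ext) (simp add: S(3))
    have 3: "bmap (cpt f) (mu (over x Y)) = mu (over (bmap (cpt f) x) (\<lambda>z\<in>Ix x. bmap (cpt f) (Y z)))"
      using bmap_mu[OF f.A.ufamily_over[OF 5]] by (simp add: bmap_over over_bmap)
    show ?case
      using f.carr_ucmp[OF 5] g.carr_ucmp[OF f.carr_E[OF 5(1)] f.ufamily_carr[OF 5(2)]]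
        f.A.ucmp_arr[OF 5] 5(1) x
      unfolding b[OF x(2)] 1 2 by (simp add: 3)
  qed
qed

section \<open>Transformations and their compositions\<close>

locale utrans = f: uspace_map A B f + g: uspace_map A B g + transformation A B f g \<alpha>
  for A B :: "'u::universe ucspace" and f g \<alpha>
begin

lemma comp_E: "a \<in> upts A \<Longrightarrow> \<alpha> a \<in> Els (uarr B) (cpt f a) (eta (cpt g a))"
  using components by auto

lemma ualong_comp: "x \<in> bobj (upts A) \<Longrightarrow> f.A'.ualong (bmap (cpt f) x) (bmap (cpt g) x) (\<lambda>z\<in>Ix x. \<alpha> (Fm x z))"
  using f.bmap_mem g.bmap_mem comp_E by (auto simp: f.A'.ualong_def dest: bobj_mem)

text \<open>For an arrow with singleton target \<open>upost\<close> becomes \<open>upre\<close>, and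
  naturality becomes a commuting square in the category of points.\<close>

lemma natural_eta:
  assumes "r \<in> Els (uarr A) a (eta b)"
  shows "upre B (cpt f a) (cpt g a) (eta (cpt g b)) (carr g a (eta b) r) (\<alpha> a) =
    upre B (cpt f a) (cpt f b) (eta (cpt g b)) (\<alpha> b) (carr f a (eta b) r)"
proof -
  have b: "b \<in> upts A" using f.A.E_obj(2)[OF assms] by (simp add: eta_bobj_iff)
  have 1: "(\<lambda>z\<in>Ix (eta b). \<alpha> (Fm (eta b) z)) = (\<lambda>z\<in>{star}. \<alpha> b)" by auto
  show ?thesis
    using natural[OF assms] f.A'.upost_eta[OF f.carr_E_eta[OF assms] comp_E[OF b]] unfolding 1 by simp
qed

end

lemma transformation_id2:
  assumes "uspace_map A B f"
  shows "transformation A B f f (\<lambda>a\<in>upts A. uid B (cpt f a))"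
proof -
  interpret f: uspace_map A B f by fact
  show ?thesis
  proof (standard, goal_cases)
    case 1 then show ?case by (auto intro!: f.A'.uid_E f.cpt_mem)
  next
    case (2 r a x)
    note x = f.A.E_obj[OF 2] and r' = f.carr_E[OF 2]
    have "(\<lambda>z\<in>Ix x. (\<lambda>a\<in>upts A. uid B (cpt f a)) (Fm x z)) = (\<lambda>z\<in>Ix (bmap (cpt f) x). uid B (Fm (bmap (cpt f) x) z))"
      using x by (auto simp: fun_eq_iff bobj_mem)
    then show ?case using f.A'.ucmp_uid_left[OF r'] f.A'.ucmp_uid_right[OF r'] x by simp
  qed
qed

text \<open>Two naturality conditions are pasted: \<open>upre_upre\<close> splits the composite
  component, \<open>upre_upost\<close> exchanges the two sides, and \<open>upost_upost\<close>
  multiplies the components again.\<close>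

lemma transformation_vcomp:
  assumes "utrans A B f g \<sigma>" "utrans A B g h \<tau>"
  shows "transformation A B f h (\<lambda>a\<in>upts A. upre B (cpt f a) (cpt g a) (eta (cpt h a)) (\<tau> a) (\<sigma> a))"
proof -
  interpret s: utrans A B f g \<sigma> by fact
  interpret t: utrans A B g h \<tau> by fact
  show ?thesis
  proof (standard, goal_cases)
    case 1 then show ?case by (auto intro!: s.f.A'.upre_Els s.comp_E t.comp_E)
  next
    case (2 r a x)
    note x = s.f.A.E_obj[OF 2]
    let ?s = "\<lambda>z\<in>Ix x. \<sigma> (Fm x z)" and ?t = "\<lambda>z\<in>Ix x. \<tau> (Fm x z)"
    note us = s.ualong_comp[OF x(2)] and ut = t.ualong_comp[OF x(2)]
    have e: "(\<lambda>z\<in>Ix x. (\<lambda>a\<in>upts A. upre B (cpt f a) (cpt g a) (eta (cpt h a)) (\<tau> a) (\<sigma> a)) (Fm x z)) =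
      (\<lambda>w\<in>Ix (bmap (cpt f) x). upre B (Fm (bmap (cpt f) x) w) (Fm (bmap (cpt g) x) w) (eta (Fm (bmap (cpt h) x) w)) (?t w) (?s w))"
      using x by (auto simp: fun_eq_iff bobj_mem)
    have "upre B (cpt f a) (cpt h a) (bmap (cpt h) x) (carr h a x r) (upre B (cpt f a) (cpt g a) (eta (cpt h a)) (\<tau> a) (\<sigma> a))
      = upre B (cpt f a) (cpt g a) (bmap (cpt h) x) (upre B (cpt g a) (cpt h a) (bmap (cpt h) x) (carr h a x r) (\<tau> a)) (\<sigma> a)"
      by (rule s.f.A'.upre_upre[OF s.comp_E t.comp_E t.g.carr_E]) (use x 2 in simp_all)
    also have "\<dots> = upost B (cpt f a) (bmap (cpt g) x) (bmap (cpt h) x) ?t (upre B (cpt f a) (cpt g a) (bmap (cpt g) x) (carr g a x r) (\<sigma> a))"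
      unfolding t.natural[OF 2] by (rule s.f.A'.upre_upost[OF s.comp_E[OF x(1)] s.g.carr_E[OF 2] ut])
    also have "\<dots> = upost B (cpt f a) (bmap (cpt f) x) (bmap (cpt h) x) (\<lambda>w\<in>Ix (bmap (cpt f) x). upre B (Fm (bmap (cpt f) x) w) (Fm (bmap (cpt g) x) w) (eta (Fm (bmap (cpt h) x) w)) (?t w) (?s w)) (carr f a x r)"
      unfolding s.natural[OF 2] by (rule s.f.A'.upost_upost[OF s.f.carr_E[OF 2] us ut])
    finally show ?case using x unfolding e by simp
  qed
qed

text \<open>The component composes \<tau> with the image of \<sigma> under \<open>g'\<close>. Its
  naturality pushes the condition for \<sigma> through the continuous map \<open>g'\<close> and then
  uses the condition for \<tau> at the image of \<open>r\<close> under \<open>f\<close>.\<close>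

lemma transformation_hcomp:
  assumes "utrans A B f f' \<sigma>" "utrans B C g g' \<tau>"
  shows "transformation A C (uc_comp A g f) (uc_comp A g' f') (\<lambda>a\<in>upts A.
                upre C (cpt g (cpt f a)) (cpt g' (cpt f a)) (eta (cpt g' (cpt f' a)))
                  (carr g' (cpt f a) (eta (cpt f' a)) (\<sigma> a)) (\<tau> (cpt f a)))"
proof -
  interpret s: utrans A B f f' \<sigma> by fact
  interpret t: utrans B C g g' \<tau> by fact
  note cs = t.g.carr_E_eta[OF s.comp_E] and ct = t.comp_E[OF s.f.cpt_mem]
  show ?thesis
  proof (standard, goal_cases)
    case 1 then show ?case by (auto intro!: t.f.A'.upre_Els cs ct)
  next
    case (2 r a x)
    note x = s.f.A.E_obj[OF 2]
    note fr = s.f.carr_E[OF 2] and fr' = s.g.carr_E[OF 2]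
    let ?s = "\<lambda>z\<in>Ix x. carr g' (cpt f (Fm x z)) (eta (cpt f' (Fm x z))) (\<sigma> (Fm x z))"
      and ?t = "\<lambda>z\<in>Ix x. \<tau> (cpt f (Fm x z))"
    let ?u = "carr g' (cpt f a) (eta (cpt f' a)) (\<sigma> a)" and ?v = "\<tau> (cpt f a)"
    let ?gf = "bmap (cpt g) (bmap (cpt f) x)" and ?g'f = "bmap (cpt g') (bmap (cpt f) x)"
      and ?g'f' = "bmap (cpt g') (bmap (cpt f') x)"
    have ess: "(\<lambda>z\<in>Ix (bmap (cpt f) x). carr g' (Fm (bmap (cpt f) x) z) (eta (Fm (bmap (cpt f') x) z)) ((\<lambda>z\<in>Ix x. \<sigma> (Fm x z)) z)) = ?s"
      by auto
    have ett: "(\<lambda>z\<in>Ix (bmap (cpt f) x). \<tau> (Fm (bmap (cpt f) x) z)) = ?t" by auto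
    have us: "t.f.A'.ualong ?g'f ?g'f' ?s"
      using t.g.ualong_carr[OF s.ualong_comp[OF x(2)]] unfolding ess .
    have ut: "t.f.A'.ualong ?gf ?g'f ?t" using t.ualong_comp[OF s.f.bmap_mem[OF x(2)]] unfolding ett .
    have e: "(\<lambda>z\<in>Ix x. (\<lambda>a\<in>upts A. upre C (cpt g (cpt f a)) (cpt g' (cpt f a)) (eta (cpt g' (cpt f' a)))
                  (carr g' (cpt f a) (eta (cpt f' a)) (\<sigma> a)) (\<tau> (cpt f a))) (Fm x z)) =
       (\<lambda>w\<in>Ix ?gf. upre C (Fm ?gf w) (Fm ?g'f w) (eta (Fm ?g'f' w)) (?s w) (?t w))"
      using x by (auto simp: fun_eq_iff bobj_mem)
    have "upre C (cpt g (cpt f a)) (cpt g' (cpt f' a)) ?g'f' (carr g' (cpt f' a) (bmap (cpt f') x) (carr f' a x r))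
         (upre C (cpt g (cpt f a)) (cpt g' (cpt f a)) (eta (cpt g' (cpt f' a))) ?u ?v)
       = upre C (cpt g (cpt f a)) (cpt g' (cpt f a)) ?g'f' (upre C (cpt g' (cpt f a)) (cpt g' (cpt f' a)) ?g'f'
          (carr g' (cpt f' a) (bmap (cpt f') x) (carr f' a x r)) ?u) ?v"
      by (rule t.f.A'.upre_upre[OF ct[OF x(1)] cs[OF x(1)] t.g.carr_E[OF fr']])
    also have "upre C (cpt g' (cpt f a)) (cpt g' (cpt f' a)) ?g'f' (carr g' (cpt f' a) (bmap (cpt f') x) (carr f' a x r)) ?u
       = carr g' (cpt f a) (bmap (cpt f') x) (upre B (cpt f a) (cpt f' a) (bmap (cpt f') x) (carr f' a x r) (\<sigma> a))"
      by (rule t.g.carr_upre[OF s.comp_E[OF x(1)] fr', symmetric])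
    also have "\<dots> = upost C (cpt g' (cpt f a)) ?g'f ?g'f' ?s (carr g' (cpt f a) (bmap (cpt f) x) (carr f a x r))"
      unfolding s.natural[OF 2] t.g.carr_upost[OF fr s.ualong_comp[OF x(2)]] ess ..
    also have "upre C (cpt g (cpt f a)) (cpt g' (cpt f a)) ?g'f' \<dots> ?v =
       upost C (cpt g (cpt f a)) ?g'f ?g'f' ?s (upre C (cpt g (cpt f a)) (cpt g' (cpt f a)) ?g'f (carr g' (cpt f a) (bmap (cpt f) x) (carr f a x r)) ?v)"
      by (rule t.f.A'.upre_upost[OF ct[OF x(1)] t.g.carr_E[OF fr] us])
    also have "\<dots> = upost C (cpt g (cpt f a)) ?g'f ?g'f' ?s (upost C (cpt g (cpt f a)) ?gf ?g'f ?t (carr g (cpt f a) (bmap (cpt f) x) (carr f a x r)))"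
      unfolding t.natural[OF fr] ett ..
    also have "\<dots> = upost C (cpt g (cpt f a)) ?gf ?g'f' (\<lambda>w\<in>Ix ?gf. upre C (Fm ?gf w) (Fm ?g'f w) (eta (Fm ?g'f' w)) (?s w) (?t w)) (carr g (cpt f a) (bmap (cpt f) x) (carr f a x r))"
      by (rule t.f.A'.upost_upost[OF t.f.carr_E[OF fr] ut us])
    finally show ?case using x 2 unfolding e bmap_uc_comp[OF x(2)] by simp
  qed
qed

lemma (in ultraconvergence_space)
  shows upre_uid_left: "u \<in> E a (eta b) \<Longrightarrow> upre A a a (eta b) u (uid A a) = u"
    and upre_uid_right: "u \<in> E a (eta b) \<Longrightarrow> upre A a b (eta b) (uid A b) u = u"
proof -
  assume u: "u \<in> E a (eta b)"
  show "upre A a a (eta b) u (uid A a) = u" by (rule ucmp_uid_left[OF u])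
  have b: "b \<in> Pt" using E_obj(2)[OF u] by (simp add: eta_bobj_iff)
  have 1: "(\<lambda>z\<in>Ix (eta b). uid A (Fm (eta b) z)) = (\<lambda>z\<in>{star}. uid A b)" by auto
  show "upre A a b (eta b) (uid A b) u = u"
    using ucmp_uid_right[OF u] upost_eta[OF u uid_E[OF b]] unfolding 1 by simp
qed

lemma two_category_UltSp: "two_category (UltSp :: ('u::universe ucspace, 'u ucmap, 'u \<Rightarrow> 'u) cat2)"
proof (standard, unfold UltSp_sel, goal_cases)
  case (1 A) then show ?case by (rule ultraconvergence_space.continuous_uc_id)
next
  case (2 A B C f g) then show ?case by (intro continuous_uc_comp uspace_map.intro)
next
  case (3 A B f)
  then interpret f: uspace_map A B f by (intro uspace_map.intro)
  show ?case
  proof (rule ucmap_eqI)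
    have "cpt (uc_comp A (uc_id B) f) = (\<lambda>a\<in>upts A. cpt f a)" using f.cpt_mem by auto
    also have "\<dots> = cpt f" by (rule PiE_restrict[OF f.cpt_fun])
    finally show "cpt (uc_comp A (uc_id B) f) = cpt f" .
    fix a x
    have "carr (uc_comp A (uc_id B) f) a x = (\<lambda>r\<in>Els (uarr A) a x. carr f a x r)" using f.carr_E by auto
    also have "\<dots> = carr f a x" by (rule PiE_restrict[OF f.carr_fun])
    finally show "carr (uc_comp A (uc_id B) f) a x = carr f a x" .
  qed
next
  case (4 A B f)
  then interpret f: uspace_map A B f by (intro uspace_map.intro)
  show ?case
  proof (rule ucmap_eqI)
    have "cpt (uc_comp A f (uc_id A)) = (\<lambda>a\<in>upts A. cpt f a)" by auto
    also have "\<dots> = cpt f" by (rule PiE_restrict[OF f.cpt_fun])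
    finally show "cpt (uc_comp A f (uc_id A)) = cpt f" .
    fix a x
    have "carr (uc_comp A f (uc_id A)) a x = (\<lambda>r\<in>Els (uarr A) a x. carr f a x r)"
      using f.A.E_obj by (auto intro!: restrict_ext simp: bmap_id[of x "upts A"])
    also have "\<dots> = carr f a x" by (rule PiE_restrict[OF f.carr_fun])
    finally show "carr (uc_comp A f (uc_id A)) a x = carr f a x" .
  qed
next
  case (5 A B C D f g h)
  then interpret f: uspace_map A B f by (intro uspace_map.intro)
  show ?case
  proof (rule ucmap_eqI)
    fix a x
    show "carr (uc_comp A h (uc_comp A g f)) a x = carr (uc_comp A (uc_comp B h g) f) a x"
      using f.A.E_obj f.carr_E by (auto intro!: restrict_ext simp: bmap_uc_comp simp del: uc_comp_sel(1)) simp
  qed (use f.cpt_mem in auto)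
next
  case (6 A B f) then show ?case by (intro transformation_id2 uspace_map.intro)
next
  case (7 A B f g h \<sigma> \<tau>)
  then show ?case by (intro transformation_vcomp utrans.intro uspace_map.intro)
next
  case (8 A B f g \<sigma>)
  then interpret s: utrans A B f g \<sigma> by (intro utrans.intro uspace_map.intro)
  have "(\<lambda>a\<in>upts A. upre B (cpt f a) (cpt g a) (eta (cpt g a)) ((\<lambda>a\<in>upts A. uid B (cpt g a)) a) (\<sigma> a)) = (\<lambda>a\<in>upts A. \<sigma> a)"
    by (rule restrict_ext) (simp add: s.f.A'.upre_uid_right s.comp_E)
  then show ?case by (simp only: PiE_restrict[OF s.components])
next
  case (9 A B f g \<sigma>)
  then interpret s: utrans A B f g \<sigma> by (intro utrans.intro uspace_map.intro)
  have "(\<lambda>a\<in>upts A. upre B (cpt f a) (cpt f a) (eta (cpt g a)) (\<sigma> a) ((\<lambda>a\<in>upts A. uid B (cpt f a)) a)) = (\<lambda>a\<in>upts A. \<sigma> a)"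
    by (rule restrict_ext) (simp add: s.f.A'.upre_uid_left s.comp_E)
  then show ?case by (simp only: PiE_restrict[OF s.components])
next
  case (10 A B f g h k \<sigma> \<tau> \<upsilon>)
  then interpret s: utrans A B f g \<sigma> by (intro utrans.intro uspace_map.intro)
  from 10 interpret t: utrans A B g h \<tau> by (intro utrans.intro uspace_map.intro)
  from 10 interpret u: utrans A B h k \<upsilon> by (intro utrans.intro uspace_map.intro)
  show ?case
    by (rule restrict_ext) (simp add: s.f.A'.upre_upre[OF s.comp_E t.comp_E u.comp_E])
next
  case (11 A B C f f' g g' \<sigma> \<tau>)
  then show ?case by (intro transformation_hcomp utrans.intro uspace_map.intro)
next
  case (12 A B C f g)
  then interpret f: uspace_map A B f by (intro uspace_map.intro)
  from 12 interpret g: uspace_map B C g by (intro uspace_map.intro)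
  show ?case
    by (rule restrict_ext) (simp add: f.cpt_mem g.cpt_mem g.carr_uid g.A'.upre_uid_left g.A'.uid_E)
next
  case (13 A B C f f' f'' g g' g'' \<sigma> \<sigma>' \<tau> \<tau>')
  then interpret s: utrans A B f f' \<sigma> by (intro utrans.intro uspace_map.intro)
  from 13 interpret s': utrans A B f' f'' \<sigma>' by (intro utrans.intro uspace_map.intro)
  from 13 interpret t: utrans B C g g' \<tau> by (intro utrans.intro uspace_map.intro)
  from 13 interpret t': utrans B C g' g'' \<tau>' by (intro utrans.intro uspace_map.intro)
  show ?case
  proof (rule restrict_ext)
    fix a assume a: "a \<in> upts A"
    note S = s.comp_E[OF a] and S' = s'.comp_E[OF a]
    note fa = s.f.cpt_mem[OF a] and f'a = s.g.cpt_mem[OF a]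
    note T = t.comp_E[OF fa] and T' = t'.comp_E[OF fa] and T'' = t'.comp_E[OF f'a]
    note G = t'.g.carr_E_eta[OF S] and G' = t'.g.carr_E_eta[OF S'] and H = t.g.carr_E_eta[OF S]
    let ?gfa = "cpt g (cpt f a)" and ?hfa = "cpt g' (cpt f a)" and ?kfa = "cpt g'' (cpt f a)"
    let ?hf'a = "cpt g' (cpt f' a)" and ?kf'a = "cpt g'' (cpt f' a)" and ?kf''a = "cpt g'' (cpt f'' a)"
    let ?G = "carr g'' (cpt f a) (eta (cpt f' a)) (\<sigma> a)" and ?G' = "carr g'' (cpt f' a) (eta (cpt f'' a)) (\<sigma>' a)"
      and ?H = "carr g' (cpt f a) (eta (cpt f' a)) (\<sigma> a)"
    have "upre C ?gfa ?kfa (eta ?kf''a)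
        (carr g'' (cpt f a) (eta (cpt f'' a)) (upre B (cpt f a) (cpt f' a) (eta (cpt f'' a)) (\<sigma>' a) (\<sigma> a)))
        (upre C ?gfa ?hfa (eta ?kfa) (\<tau>' (cpt f a)) (\<tau> (cpt f a))) =
      upre C ?gfa ?hfa (eta ?kf''a) (upre C ?hfa ?kf'a (eta ?kf''a) ?G' (upre C ?hfa ?kfa (eta ?kf'a) ?G (\<tau>' (cpt f a)))) (\<tau> (cpt f a))"
      using t'.g.carr_upre[OF S S'] t.f.A'.upre_upre[OF T T' t.f.A'.upre_Els[OF G G']] t.f.A'.upre_upre[OF T' G G'] by simp
    \<comment> \<open>The exchange behind the interchange law: naturality of \<tau>' at the arrow
      \<open>\<sigma> a\<close>.\<close>
    also have "upre C ?hfa ?kfa (eta ?kf'a) ?G (\<tau>' (cpt f a)) = upre C ?hfa ?hf'a (eta ?kf'a) (\<tau>' (cpt f' a)) ?H"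
      by (rule t'.natural_eta[OF S])
    also have "upre C ?gfa ?hfa (eta ?kf''a) (upre C ?hfa ?kf'a (eta ?kf''a) ?G' \<dots>) (\<tau> (cpt f a)) =
       upre C ?gfa ?hf'a (eta ?kf''a) (upre C ?hf'a ?kf'a (eta ?kf''a) ?G' (\<tau>' (cpt f' a)))
         (upre C ?gfa ?hfa (eta ?hf'a) ?H (\<tau> (cpt f a)))"
      using t.f.A'.upre_upre[OF H T'' G'] t.f.A'.upre_upre[OF T H t.f.A'.upre_Els[OF T'' G']] by simp
    finally show "upre C ?gfa ?kfa (eta ?kf''a)
          (carr g'' (cpt f a) (eta (cpt f'' a)) ((\<lambda>a\<in>upts A. upre B (cpt f a) (cpt f' a) (eta (cpt f'' a)) (\<sigma>' a) (\<sigma> a)) a))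
          ((\<lambda>a\<in>upts B. upre C (cpt g a) (cpt g' a) (eta (cpt g'' a)) (\<tau>' a) (\<tau> a)) (cpt f a)) =
        upre C (cpt (uc_comp A g f) a) (cpt (uc_comp A g' f') a) (eta (cpt (uc_comp A g'' f'') a))
          ((\<lambda>a\<in>upts A. upre C (cpt g' (cpt f' a)) (cpt g'' (cpt f' a)) (eta (cpt g'' (cpt f'' a)))
             (carr g'' (cpt f' a) (eta (cpt f'' a)) (\<sigma>' a)) (\<tau>' (cpt f' a))) a)
          ((\<lambda>a\<in>upts A. upre C (cpt g (cpt f a)) (cpt g' (cpt f a)) (eta (cpt g' (cpt f' a)))
             (carr g' (cpt f a) (eta (cpt f' a)) (\<sigma> a)) (\<tau> (cpt f a))) a)"
      using a fa by simp
  qed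
next
  case (14 A B f f' \<sigma>)
  then interpret s: utrans A B f f' \<sigma> by (intro utrans.intro uspace_map.intro)
  have "(\<lambda>a\<in>upts A. upre B (cpt (uc_id B) (cpt f a)) (cpt (uc_id B) (cpt f a)) (eta (cpt (uc_id B) (cpt f' a)))
       (carr (uc_id B) (cpt f a) (eta (cpt f' a)) (\<sigma> a)) ((\<lambda>a\<in>upts B. uid B (cpt (uc_id B) a)) (cpt f a))) = (\<lambda>a\<in>upts A. \<sigma> a)"
    by (rule restrict_ext) (simp add: s.f.cpt_mem s.g.cpt_mem s.comp_E s.f.A'.upre_uid_left)
  then show ?case by (simp only: PiE_restrict[OF s.components])
next
  case (15 A B f f' \<sigma>)
  then interpret s: utrans A B f f' \<sigma> by (intro utrans.intro uspace_map.intro)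
  have "(\<lambda>a\<in>upts A. upre B (cpt f (cpt (uc_id A) a)) (cpt f' (cpt (uc_id A) a)) (eta (cpt f' (cpt (uc_id A) a)))
       (carr f' (cpt (uc_id A) a) (eta (cpt (uc_id A) a)) ((\<lambda>a\<in>upts A. uid A (cpt (uc_id A) a)) a)) (\<sigma> (cpt (uc_id A) a))) = (\<lambda>a\<in>upts A. \<sigma> a)"
    by (rule restrict_ext) (simp add: s.g.carr_uid s.comp_E s.f.A'.upre_uid_right)
  then show ?case by (simp only: PiE_restrict[OF s.components])
next
  case (16 A B C D f f' g g' h h' \<sigma> \<tau> \<upsilon>)
  then interpret s: utrans A B f f' \<sigma> by (intro utrans.intro uspace_map.intro)
  from 16 interpret t: utrans B C g g' \<tau> by (intro utrans.intro uspace_map.intro)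
  from 16 interpret u: utrans C D h h' \<upsilon> by (intro utrans.intro uspace_map.intro)
  show ?case
  proof (rule restrict_ext)
    fix a assume a: "a \<in> upts A"
    note S = s.comp_E[OF a] and fa = s.f.cpt_mem[OF a] and f'a = s.g.cpt_mem[OF a]
    note T = t.comp_E[OF fa] and G = t.g.carr_E_eta[OF S]
    note U = u.comp_E[OF t.f.cpt_mem[OF fa]]
    have "carr (uc_comp B h' g') (cpt f a) (eta (cpt f' a)) (\<sigma> a) =
      carr h' (cpt g' (cpt f a)) (eta (cpt g' (cpt f' a))) (carr g' (cpt f a) (eta (cpt f' a)) (\<sigma> a))"
      using S by simp
    then show "upre D (cpt h (cpt (uc_comp A g f) a)) (cpt h' (cpt (uc_comp A g f) a)) (eta (cpt h' (cpt (uc_comp A g' f') a)))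
        (carr h' (cpt (uc_comp A g f) a) (eta (cpt (uc_comp A g' f') a))
          ((\<lambda>a\<in>upts A. upre C (cpt g (cpt f a)) (cpt g' (cpt f a)) (eta (cpt g' (cpt f' a)))
             (carr g' (cpt f a) (eta (cpt f' a)) (\<sigma> a)) (\<tau> (cpt f a))) a)) (\<upsilon> (cpt (uc_comp A g f) a)) =
      upre D (cpt (uc_comp B h g) (cpt f a)) (cpt (uc_comp B h' g') (cpt f a)) (eta (cpt (uc_comp B h' g') (cpt f' a)))
        (carr (uc_comp B h' g') (cpt f a) (eta (cpt f' a)) (\<sigma> a))
        ((\<lambda>a\<in>upts B. upre D (cpt h (cpt g a)) (cpt h' (cpt g a)) (eta (cpt h' (cpt g' a)))
             (carr h' (cpt g a) (eta (cpt g' a)) (\<tau> a)) (\<upsilon> (cpt g a))) (cpt f a))"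
      using a fa f'a u.g.carr_upre[OF T G] u.f.A'.upre_upre[OF U u.g.carr_E_eta[OF T] u.g.carr_E_eta[OF G]]
      by simp
  qed
qed

section \<open>Transport of smallness\<close>

text \<open>An isomorphism of categories that fixes objects, with a compatible bijection of
  sections, carries a colimit presentation to one of the same shape \<open>J\<close>. It is needed
  for three changes of the category of points: new junk values, the passage along \<Gamma>, and new
  names for the arrows.\<close>

lemma small_colim_transport:
  fixes D D' :: "('u::universe, 'u) cat" and P P' :: "('u, 'u, 'u) presheaf"
  assumes sm: "small_colim_of_representables D P" and D: "category D" and obj: "Obj D' = Obj D"
    and \<phi>: "\<And>a b. bij_betw (\<phi> a b) (Hom D a b) (Hom D' a b)"
    and \<phi>I: "\<And>a. a \<in> Obj D \<Longrightarrow> \<phi> a a (Ide D a) = Ide D' a"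
    and \<phi>C: "\<And>a b c f g. f \<in> Hom D a b \<Longrightarrow> g \<in> Hom D b c \<Longrightarrow>
      \<phi> a c (Cmp D a b c g f) = Cmp D' a b c (\<phi> b c g) (\<phi> a b f)"
    and PR: "\<And>d d' u r. u \<in> Hom D d' d \<Longrightarrow> r \<in> Sec P d \<Longrightarrow> Res P d d' u r \<in> Sec P d'"
    and l: "\<And>d. bij_betw (l d) (Sec P d) (Sec P' d)"
    and lR: "\<And>d d' u r. u \<in> Hom D d' d \<Longrightarrow> r \<in> Sec P d \<Longrightarrow>
      l d' (Res P d d' u r) = Res P' d d' (\<phi> d' d u) (l d r)"
  shows "small_colim_of_representables D' P'"
proof -
  interpret D: category D by fact
  obtain J :: "('u, 'u) cat" and T leg where J: "category J" "small (Obj J)" "locally_small J"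
    and T: "is_functor J D T" and leg: "repr_cocone D J T P leg"
    and univ: "\<And>(Q :: ('u, 'u, 'u) presheaf) \<kappa>. is_presheaf D Q \<Longrightarrow> repr_cocone D J T Q \<kappa> \<Longrightarrow>
           (\<exists>!\<phi>. psh_map D P Q \<phi> \<and>
              (\<forall>j \<in> Obj J. \<forall>d. \<forall>v \<in> Hom D d (fo T j). \<phi> d (leg j d v) = \<kappa> j d v))"
    using sm unfolding small_colim_of_representables_def by metis
  interpret J: category J by fact
  interpret T: is_functor J D T by fact
  define \<psi> where "\<psi> a b = inv_into (Hom D a b) (\<phi> a b)" for a b
  define m where "m d = inv_into (Sec P d) (l d)" for d
  have \<phi>m: "\<phi> a b u \<in> Hom D' a b" "\<psi> a b (\<phi> a b u) = u" if "u \<in> Hom D a b" for a b u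
    using that \<phi>[of a b] by (auto simp: \<psi>_def bij_betw_def)
  have \<phi>E: thesis if "u' \<in> Hom D' a b" "\<And>u. u \<in> Hom D a b \<Longrightarrow> u' = \<phi> a b u \<Longrightarrow> thesis" for u' a b thesis
    using that \<phi>[of a b] by (auto simp: bij_betw_def)
  have lm: "l d r \<in> Sec P' d" "m d (l d r) = r" if "r \<in> Sec P d" for d r
    using that l[of d] by (auto simp: m_def bij_betw_def)
  have lE: thesis if "r' \<in> Sec P' d" "\<And>r. r \<in> Sec P d \<Longrightarrow> r' = l d r \<Longrightarrow> thesis" for r' d thesis
    using that l[of d] by (auto simp: bij_betw_def)
  define T' where "T' = \<lparr> fo = fo T, fm = (\<lambda>j j' w. \<phi> (fo T j) (fo T j') (fm T j j' w)) \<rparr>"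
  define leg' where "leg' j d = (\<lambda>v\<in>Hom D' d (fo T j). l d (leg j d (\<psi> d (fo T j) v)))" for j d
  have T'_sel [simp]: "fo T' = fo T" "fm T' j j' w = \<phi> (fo T j) (fo T j') (fm T j j' w)" for j j' w
    by (simp_all add: T'_def)
  have legD: "leg j d v \<in> Sec P d" if "j \<in> Obj J" "v \<in> Hom D d (fo T j)" for j d v
    using leg that unfolding repr_cocone_def psh_map_def by (auto simp: representable_def)
  have legR: "leg j d' (Cmp D d' d (fo T j) v u) = Res P d d' u (leg j d v)"
    if "j \<in> Obj J" "v \<in> Hom D d (fo T j)" "u \<in> Hom D d' d" for j d d' u v
    using leg that unfolding repr_cocone_def psh_map_def by (auto simp: representable_def)
  have legC: "leg j' d (Cmp D d (fo T j) (fo T j') (fm T j j' w) v) = leg j d v"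
    if "w \<in> Hom J j j'" "v \<in> Hom D d (fo T j)" for j j' d v w
    using leg that unfolding repr_cocone_def by blast
  have leg'\<phi>: "leg' j d (\<phi> d (fo T j) v) = l d (leg j d v)" if "v \<in> Hom D d (fo T j)" for j d v
    using \<phi>m[OF that] by (simp add: leg'_def)
  have T': "is_functor J D' T'"
    by standard (auto simp: obj T.fo_Obj T.fm_Ide T.fm_Cmp \<phi>I intro!: \<phi>m T.fm_Hom \<phi>C)
  have leg': "repr_cocone D' J T' P' leg'"
    unfolding repr_cocone_def
  proof (intro ballI conjI allI impI)
    fix j assume j: "j \<in> Obj J"
    show "psh_map D' (representable D' (fo T' j)) P' (leg' j)"
      unfolding psh_map_def
    proof (intro conjI allI impI)
      fix d show "leg' j d \<in> Sec (representable D' (fo T' j)) d \<rightarrow>\<^sub>E Sec P' d"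
        by (auto simp: representable_def leg'\<phi> j leg'_def \<phi>m elim!: \<phi>E intro!: lm legD)
    next
      fix d d' u r assume "u \<in> Hom D' d' d" "r \<in> Sec (representable D' (fo T' j)) d"
      then obtain u0 v0 where *: "u0 \<in> Hom D d' d" "u = \<phi> d' d u0" "v0 \<in> Hom D d (fo T j)" "r = \<phi> d (fo T j) v0"
        by (auto simp: representable_def elim!: \<phi>E)
      then show "leg' j d' (Res (representable D' (fo T' j)) d d' u r) = Res P' d d' u (leg' j d r)"
        by (simp add: representable_def leg'\<phi> D.Cmp_Hom legR legD lR j flip: \<phi>C)
    qed
  next
    fix j j' w d v assume w: "w \<in> Hom J j j'" and "v \<in> Hom D' d (fo T' j)"
    then obtain v0 where v: "v0 \<in> Hom D d (fo T j)" "v = \<phi> d (fo T j) v0" by (auto elim!: \<phi>E)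
    show "leg' j' d (Cmp D' d (fo T' j) (fo T' j') (fm T' j j' w) v) = leg' j d v"
      using w v T.fm_Hom[OF w] by (simp add: leg'\<phi> D.Cmp_Hom legC flip: \<phi>C)
  qed
  have "\<exists>!\<phi>'. psh_map D' P' Q \<phi>' \<and> (\<forall>j \<in> Obj J. \<forall>d. \<forall>v \<in> Hom D' d (fo T' j). \<phi>' d (leg' j d v) = \<kappa> j d v)"
    if Q: "is_presheaf D' Q" and \<kappa>: "repr_cocone D' J T' Q \<kappa>" for Q :: "('u, 'u, 'u) presheaf" and \<kappa>
  proof -
    interpret Q: is_presheaf D' Q by fact
    \<comment> \<open>The test presheaf is restricted along \<phi> to one over \<open>D\<close>,
      where the universal property is available.\<close>
    define Q0 where "Q0 = \<lparr> Sec = Sec Q, Res = (\<lambda>d d' u r. Res Q d d' (\<phi> d' d u) r) \<rparr>"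
    define \<kappa>0 where "\<kappa>0 j d = (\<lambda>v\<in>Hom D d (fo T j). \<kappa> j d (\<phi> d (fo T j) v))" for j d
    have Q0_sel [simp]: "Sec Q0 = Sec Q" "Res Q0 d d' u r = Res Q d d' (\<phi> d' d u) r" for d d' u r
      by (simp_all add: Q0_def)
    have Q0: "is_presheaf D Q0"
    proof (standard, goal_cases)
      case (1 r d) then show ?case using Q.Sec_Obj by (simp add: obj)
    next
      case (2 d) then show ?case using Q.Sec_small by simp
    next
      case (3 u d' d r) then show ?case using Q.Res_Sec \<phi>m by simp
    next
      case (4 r d) then show ?case using Q.Res_Ide Q.Sec_Obj by (simp add: \<phi>I obj)
    next
      case (5 u d' d u' d'' r) then show ?case using Q.Res_Cmp \<phi>m by (simp add: \<phi>C)
    qed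
    have kD: "\<kappa> j d v \<in> Sec Q d" if "j \<in> Obj J" "v \<in> Hom D' d (fo T j)" for j d v
      using \<kappa> that unfolding repr_cocone_def psh_map_def by (auto simp: representable_def)
    have kR: "\<kappa> j d' (Cmp D' d' d (fo T j) v u) = Res Q d d' u (\<kappa> j d v)"
      if "j \<in> Obj J" "v \<in> Hom D' d (fo T j)" "u \<in> Hom D' d' d" for j d d' u v
      using \<kappa> that unfolding repr_cocone_def psh_map_def by (auto simp: representable_def)
    have kC: "\<kappa> j' d (Cmp D' d (fo T j) (fo T j') (\<phi> (fo T j) (fo T j') (fm T j j' w)) v) = \<kappa> j d v"
      if "w \<in> Hom J j j'" "v \<in> Hom D' d (fo T j)" for j j' d v w
      using \<kappa> that unfolding repr_cocone_def by simp
    have k0: "repr_cocone D J T Q0 \<kappa>0"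
      unfolding repr_cocone_def
    proof (intro ballI conjI allI impI)
      fix j assume j: "j \<in> Obj J"
      show "psh_map D (representable D (fo T j)) Q0 (\<kappa>0 j)"
        unfolding psh_map_def using j
        by (auto simp: representable_def \<kappa>0_def D.Cmp_Hom \<phi>C kR \<phi>m intro!: kD)
    next
      fix j j' w d v assume "w \<in> Hom J j j'" "v \<in> Hom D d (fo T j)"
      then show "\<kappa>0 j' d (Cmp D d (fo T j) (fo T j') (fm T j j' w) v) = \<kappa>0 j d v"
        using T.fm_Hom by (simp add: \<kappa>0_def D.Cmp_Hom \<phi>C kC \<phi>m)
    qed
    define ok where "ok \<theta> \<longleftrightarrow> psh_map D P Q0 \<theta> \<and>
        (\<forall>j \<in> Obj J. \<forall>d. \<forall>v \<in> Hom D d (fo T j). \<theta> d (leg j d v) = \<kappa>0 j d v)" for \<theta>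
    obtain \<theta> where ok: "ok \<theta>" and uniq: "\<And>\<theta>'. ok \<theta>' \<Longrightarrow> \<theta>' = \<theta>"
      using univ[OF Q0 k0] unfolding ok_def[symmetric] by blast
    have thD: "\<theta> d r \<in> Sec Q d" "u \<in> Hom D d' d \<Longrightarrow> \<theta> d' (Res P d d' u r) = Res Q d d' (\<phi> d' d u) (\<theta> d r)"
      if "r \<in> Sec P d" for d d' r u
      using ok that by (auto simp: ok_def psh_map_def)
    have thL: "\<theta> d (leg j d v) = \<kappa> j d (\<phi> d (fo T j) v)" if "j \<in> Obj J" "v \<in> Hom D d (fo T j)" for j d v
      using ok that by (simp add: ok_def \<kappa>0_def)
    define \<theta>' where "\<theta>' d = (\<lambda>r\<in>Sec P' d. \<theta> d (m d r))" for d
    have th'l: "\<theta>' d (l d r) = \<theta> d r" if "r \<in> Sec P d" for d r using lm[OF that] by (simp add: \<theta>'_def)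
    show ?thesis
    proof (intro ex1I[of _ \<theta>'] conjI ballI allI)
      show "psh_map D' P' Q \<theta>'"
        unfolding psh_map_def
      proof (intro conjI allI impI)
        fix d show "\<theta>' d \<in> Sec P' d \<rightarrow>\<^sub>E Sec Q d"
          by (auto simp: th'l \<theta>'_def lm elim!: lE intro!: thD)
      next
        fix d d' u r assume "u \<in> Hom D' d' d" "r \<in> Sec P' d"
        then obtain u0 r0 where *: "u0 \<in> Hom D d' d" "u = \<phi> d' d u0" "r0 \<in> Sec P d" "r = l d r0"
          by (auto elim!: \<phi>E lE)
        then show "\<theta>' d' (Res P' d d' u r) = Res Q d d' u (\<theta>' d r)"
          by (simp add: th'l PR thD flip: lR)
      qed
      fix j d v assume j: "j \<in> Obj J" and "v \<in> Hom D' d (fo T' j)"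
      then obtain v0 where v: "v0 \<in> Hom D d (fo T j)" "v = \<phi> d (fo T j) v0" by (auto elim!: \<phi>E)
      show "\<theta>' d (leg' j d v) = \<kappa> j d v"
        unfolding v(2) leg'\<phi>[OF v(1)] th'l[OF legD[OF j v(1)]] thL[OF j v(1)] ..
    next
      fix \<chi> assume \<chi>: "psh_map D' P' Q \<chi> \<and> (\<forall>j\<in>Obj J. \<forall>d. \<forall>v\<in>Hom D' d (fo T' j). \<chi> d (leg' j d v) = \<kappa> j d v)"
      then have c: "\<chi> d \<in> Sec P' d \<rightarrow>\<^sub>E Sec Q d" "u \<in> Hom D' d' d \<Longrightarrow> r \<in> Sec P' d \<Longrightarrow>
          \<chi> d' (Res P' d d' u r) = Res Q d d' u (\<chi> d r)"
        "j \<in> Obj J \<Longrightarrow> v \<in> Hom D' d (fo T j) \<Longrightarrow> \<chi> d (leg' j d v) = \<kappa> j d v" for d d' u r j v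
        by (auto simp: psh_map_def)
      \<comment> \<open>Uniqueness: a competing map is pulled back along \<open>l\<close> to a
        competing map over \<open>D\<close>, where it must be \<theta>.\<close>
      define \<chi>0 where "\<chi>0 d = (\<lambda>r\<in>Sec P d. \<chi> d (l d r))" for d
      have "ok \<chi>0"
        unfolding ok_def psh_map_def
      proof (intro conjI allI impI ballI)
        fix d show "\<chi>0 d \<in> Sec P d \<rightarrow>\<^sub>E Sec Q0 d"
          using PiE_mem[OF c(1)] lm(1) by (auto simp: \<chi>0_def)
      next
        fix d d' u r assume "u \<in> Hom D d' d" "r \<in> Sec P d"
        then show "\<chi>0 d' (Res P d d' u r) = Res Q0 d d' u (\<chi>0 d r)"
          using c(2)[OF \<phi>m(1) lm(1)] by (simp add: \<chi>0_def PR lR)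
      next
        fix j d v assume "j \<in> Obj J" "v \<in> Hom D d (fo T j)"
        then show "\<chi>0 d (leg j d v) = \<kappa>0 j d v"
          using c(3)[OF _ \<phi>m(1)] by (simp add: \<chi>0_def legD \<kappa>0_def leg'\<phi>)
      qed
      then have e: "\<chi>0 = \<theta>" by (rule uniq)
      show "\<chi> = \<theta>'"
      proof
        fix d
        have "\<chi> d r = \<theta>' d r" if "r \<in> Sec P' d" for r
          using that by (elim lE) (simp add: th'l flip: e, simp add: \<chi>0_def)
        then show "\<chi> d = \<theta>' d"
          using c(1) by (intro extensionalityI[of _ "Sec P' d"]) (auto simp: \<theta>'_def PiE_iff)
      qed
    qed
  qed
  then show ?thesis unfolding small_colim_of_representables_def
    using J T' leg' by blast
qed

section \<open>The lax algebra of an ultraconvergence space\<close>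

lemma upairs_star: "r \<in> F c c' \<Longrightarrow> (\<lambda>z\<in>{star}. z, \<lambda>z\<in>{star}. r) \<in> upairs F (eta c) (eta c')"
  by (simp add: mem_upairs uindex_def filtermap_principal) (rule restrict_ext, simp)

context ultraconvergence_space
begin

section \<open>Layered reindexing and associativity of \<Delta>\<close>

lemma pull_pull: "(\<And>z. z \<in> Ix w \<Longrightarrow> h z \<in> Ix y) \<Longrightarrow> pull (pull x g y) h w = pull x (\<lambda>z\<in>Ix w. g (h z)) w"
  by (rule ufam_eqI) (auto simp: fun_eq_iff)

text \<open>\<open>ucmp_reindex\<close> moves the outer index map and
  \<open>ucmp_reindex_family\<close> the inner ones. Jointly they carry an index map of layered
  form, as produced by \<mu> on germs, through a composite.\<close>

lemma ure_ucmp_pull: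
  assumes r: "r \<in> E a x" and s: "ufamily A x Y \<gamma>" and Z: "Z \<in> bobj (bobj T)"
    and p: "uindex x Z p" and k: "\<And>y. y \<in> Ix Z \<Longrightarrow> uindex (Y (p y)) (Fm Z y) (k y)"
  shows "ure A a (mu (over x Y)) (mu (over (pull x p Z) (\<lambda>y\<in>Ix Z. pull (Y (p y)) (k y) (Fm Z y))))
      (\<lambda>v\<in>Ix (mu Z). pair (p (ufst v)) (k (ufst v) (usnd v))) (ucmp A a x Y \<gamma> r) =
    ucmp A a (pull x p Z) (\<lambda>y\<in>Ix Z. pull (Y (p y)) (k y) (Fm Z y))
      (\<lambda>y\<in>Ix Z. ure A (Fm x (p y)) (Y (p y)) (pull (Y (p y)) (k y) (Fm Z y)) (k y) (\<gamma> (p y)))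
      (ure A a x (pull x p Z) p r)"
proof -
  note x = E_obj(2)[OF r] and S = ufamilyD[OF s]
  define x2 where "x2 = pull x p Z"
  define Y2 where "Y2 = (\<lambda>y\<in>Ix Z. pull (Y (p y)) (k y) (Fm Z y))"
  have p2: "reidx Pt x x2 p" unfolding x2_def by (rule reidx_pull[OF x Z p])
  have I2: "Ix x2 = Ix Z" by (simp add: x2_def)
  define q where "q = ucmp A a x Y \<gamma> r"
  have q: "q \<in> E a (mu (over x Y))" unfolding q_def by (rule ucmp_arr[OF r s])
  have pm: "p y \<in> Ix x" if "y \<in> Ix Z" for y by (rule uindex_mem[OF p that])
  define Yp where "Yp = (\<lambda>z\<in>Ix x2. Y (p z))"
  define \<gamma>p where "\<gamma>p = (\<lambda>z\<in>Ix x2. \<gamma> (p z))"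
  have f: "ufamily A x2 Yp \<gamma>p"
    by (rule ufamilyI) (auto simp: Yp_def \<gamma>p_def I2 x2_def pm intro!: S(3))
  note r2 = ure_Els[OF r p2]
  define g1 where "g1 = (\<lambda>w\<in>Ix (mu (over x2 Yp)). pair (p (ufst w)) (usnd w))"
  have 1: "ucmp A a x2 Yp \<gamma>p (ure A a x x2 p r) = ure A a (mu (over x Y)) (mu (over x2 Yp)) g1 q"
    using ucmp_reindex[OF r s p2[folded reindex_iff]] unfolding Yp_def \<gamma>p_def q_def g1_def .
  have g1: "reidx Pt (mu (over x Y)) (mu (over x2 Yp)) g1"
    using reidx_over[OF p2 S(1)] unfolding Yp_def g1_def .
  have k2: "reidx Pt (Yp z) (Y2 z) (k z)" if "z \<in> Ix x2" for z
    using reidx_pull[OF S(4)[OF pm] bobj_mem[OF Z] k] that by (simp add: Yp_def Y2_def I2)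
  have Y2e: "Y2 \<in> extensional (Ix x2)" by (simp add: Y2_def I2)
  have "(\<lambda>z\<in>Ix x2. ure A (Fm x2 z) (Yp z) (Y2 z) (k z) (\<gamma>p z)) =
      (\<lambda>y\<in>Ix Z. ure A (Fm x (p y)) (Y (p y)) (pull (Y (p y)) (k y) (Fm Z y)) (k y) (\<gamma> (p y)))"
    by (auto simp: I2 x2_def Yp_def Y2_def \<gamma>p_def cong: restrict_cong)
  then have "ucmp A a x2 Y2 (\<lambda>y\<in>Ix Z. ure A (Fm x (p y)) (Y (p y)) (pull (Y (p y)) (k y) (Fm Z y)) (k y) (\<gamma> (p y))) (ure A a x x2 p r)
     = ure A a (mu (over x2 Yp)) (mu (over x2 Y2)) (\<lambda>w\<in>Ix (mu (over x2 Y2)). pair (ufst w) (k (ufst w) (usnd w)))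
        (ure A a (mu (over x Y)) (mu (over x2 Yp)) g1 q)"
    using ucmp_reindex_family[OF r2 f Y2e k2[folded reindex_iff]] unfolding 1 by simp
  also have "\<dots> = ure A a (mu (over x Y)) (mu (over x2 Y2)) (\<lambda>v\<in>Ix (mu Z). pair (p (ufst v)) (k (ufst v) (usnd v))) q"
  proof (rule ure_comp_eq[OF q g1 reidx_over_family[OF reidxD(2)[OF p2] ufamilyD(7)[OF f] Y2e k2]])
    fix w assume "w \<in> Ix (mu (over x2 Y2))"
    then obtain y z where w: "w = pair y z" "y \<in> Ix x2" "z \<in> Ix (Y2 y)" by (auto elim!: Ix_muE)
    then show "g1 ((\<lambda>w\<in>Ix (mu (over x2 Y2)). pair (ufst w) (k (ufst w) (usnd w))) w) =
        (\<lambda>v\<in>Ix (mu Z). pair (p (ufst v)) (k (ufst v) (usnd v))) w"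
      using reidxD(4)[OF k2[OF w(2)] w(3)] by (simp add: g1_def I2) (simp add: Y2_def)
  qed
  finally show ?thesis unfolding x2_def Y2_def q_def by simp
qed

lemma pull_mu:
  assumes Z: "Z \<in> bobj S" and p: "\<And>y. y \<in> Ix Z \<Longrightarrow> p y \<in> Ix x"
    and k: "\<And>y z. y \<in> Ix Z \<Longrightarrow> z \<in> Ix (Fm Z y) \<Longrightarrow> k y z \<in> Ix (Y (p y))"
  shows "pull (mu (over x Y)) (\<lambda>v\<in>Ix (mu Z). pair (p (ufst v)) (k (ufst v) (usnd v))) (mu Z) =
    mu (over (pull x p Z) (\<lambda>y\<in>Ix Z. pull (Y (p y)) (k y) (Fm Z y)))"
proof (rule mu_eqI)
  show "Uf (pull (mu (over x Y)) (\<lambda>v\<in>Ix (mu Z). pair (p (ufst v)) (k (ufst v) (usnd v))) (mu Z)) =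
     Uf (mu (over (pull x p Z) (\<lambda>y\<in>Ix Z. pull (Y (p y)) (k y) (Fm Z y))))"
    unfolding filter_eq_iff pull_sel over_sel eventually_mu
    by (intro allI eventually_cong[OF bobj_ev[OF Z]]) simp
qed (auto simp: Ix_mu, auto simp: Fm_mu p k)

text \<open>By \<open>ure_ucmp_pull\<close> all reindexings are moved onto \<open>r\<close> and the
  members of \<gamma>. What remains is \<open>ucmp_assoc\<close> for families over identity index
  maps.\<close>

lemma dl_assoc:
  assumes r: "r \<in> E a x" and s: "(p, \<gamma>) \<in> upairs E x Y" and Y: "Y \<in> bobj (bobj Pt)"
    and Z: "Z \<in> bobj (bobj (bobj Pt))" and p': "uindex Y Z p'"
    and k: "\<And>y. y \<in> Ix Z \<Longrightarrow> (k y, d y) \<in> upairs E (Fm Y (p' y)) (Fm Z y)"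
  shows "ure A a (mu (mu Z)) (mu (bmap mu Z)) reassoc
      (dl a (mu Y) (mu Z) (\<lambda>v\<in>Ix (mu Z). pair (p' (ufst v)) (k (ufst v) (usnd v)))
        (\<lambda>v\<in>Ix (mu Z). d (ufst v) (usnd v)) (dl a x Y p \<gamma> r)) =
    dl a x (bmap mu Z) (\<lambda>y\<in>Ix Z. p (p' y))
      (\<lambda>y\<in>Ix Z. dl (Fm x (p (p' y))) (Fm Y (p' y)) (Fm Z y) (k y) (d y) (\<gamma> (p' y))) r"
proof -
  note x = E_obj(2)[OF r] and pu = upairs_uindex[OF s] and ku = upairs_uindex[OF k]
  define x1 where "x1 = pull x p Y"
  have x1: "reidx Pt x x1 p" unfolding x1_def by (rule reidx_pull[OF x Y pu])
  define r1 where "r1 = ure A a x x1 p r"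
  have r1: "r1 \<in> E a x1" unfolding r1_def by (rule ure_Els[OF r x1])
  have f1: "ufamily A x1 (Fm Y) \<gamma>" unfolding x1_def by (rule upairs_ufamily[OF s Y])
  have o1: "over x1 (Fm Y) = Y" by (simp add: x1_def over_eq)
  have p1: "uindex x1 Z p'" using p' by (simp add: uindex_def x1_def)
  define x2 where "x2 = pull x1 p' Z"
  have x2: "reidx Pt x1 x2 p'" unfolding x2_def by (rule reidx_pull[OF reidxD(2)[OF x1] Z p1])
  define r2 where "r2 = ure A a x1 x2 p' r1"
  have r2: "r2 \<in> E a x2" unfolding r2_def by (rule ure_Els[OF r1 x2])
  define Y2 where "Y2 = (\<lambda>y\<in>Ix Z. pull (Fm Y (p' y)) (k y) (Fm Z y))"
  define \<gamma>2 where "\<gamma>2 = (\<lambda>y\<in>Ix Z. ure A (Fm x1 (p' y)) (Fm Y (p' y)) (pull (Fm Y (p' y)) (k y) (Fm Z y)) (k y) (\<gamma> (p' y)))"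
  have I2: "Ix x2 = Ix Z" "Ix x1 = Ix Y" by (simp_all add: x2_def x1_def)
  have pm: "p' y \<in> Ix Y" if "y \<in> Ix Z" for y by (rule uindex_mem[OF p' that])
  have Yb: "Fm Y y \<in> bobj Pt" if "y \<in> Ix Y" for y by (rule bobj_mem[OF Y that])
  have Zb: "Fm Z y \<in> bobj (bobj Pt)" if "y \<in> Ix Z" for y by (rule bobj_mem[OF Z that])
  have kr: "reidx Pt (Fm Y (p' y)) (pull (Fm Y (p' y)) (k y) (Fm Z y)) (k y)" if "y \<in> Ix Z" for y
    by (rule reidx_pull[OF Yb[OF pm] Zb ku]) (use that in simp_all)
  define K where "K = (\<lambda>v\<in>Ix (mu Z). pair (p' (ufst v)) (k (ufst v) (usnd v)))"
  define D where "D = (\<lambda>v\<in>Ix (mu Z). d (ufst v) (usnd v))"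
  define N where "N = mu (over x2 Y2)"
  have N: "pull (mu Y) K (mu Z) = N"
    using pull_mu[OF Z, where x = x1 and Y = "Fm Y" and p = p' and k = k] uindex_mem[OF ku] pm
    by (simp add: o1 I2 K_def N_def x2_def Y2_def)
  have f2: "ufamily A x2 Y2 \<gamma>2"
  proof (rule ufamilyI)
    fix z assume "z \<in> Ix x2"
    then have z: "z \<in> Ix Z" by (simp add: I2)
    then show "\<gamma>2 z \<in> E (Fm x2 z) (Y2 z)"
      using ure_Els[OF ufamilyD(3)[OF f1] kr[OF z]] pm by (simp add: x2_def Y2_def \<gamma>2_def I2)
  qed (simp_all add: Y2_def \<gamma>2_def I2)
  have dl1: "dl a x Y p \<gamma> r = ucmp A a x1 (Fm Y) \<gamma> r1" by (simp add: dl_def x1_def r1_def)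
  have "ure A a (mu Y) N K (ucmp A a x1 (Fm Y) \<gamma> r1) = ucmp A a x2 Y2 \<gamma>2 r2"
    using ure_ucmp_pull[OF r1 f1 Z p1 ku] unfolding o1 x2_def r2_def Y2_def \<gamma>2_def N_def K_def .
  then have L: "dl a (mu Y) (mu Z) K D (dl a x Y p \<gamma> r) = ucmp A a N (Fm (mu Z)) D (ucmp A a x2 Y2 \<gamma>2 r2)"
    unfolding dl1 by (simp add: dl_def N)
  have KD: "(K, D) \<in> upairs E (mu Y) (mu Z)"
    unfolding K_def D_def by (rule umult_upairs[OF p' k Z])
  have f3: "ufamily A N (Fm (mu Z)) D" using upairs_ufamily[OF KD mu_bobj[OF Z]] by (simp add: N)
  have o3: "over N (Fm (mu Z)) = mu Z" unfolding N[symmetric] by (simp add: over_eq)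
  define W where "W = (\<lambda>z\<in>Ix x2. \<lambda>w\<in>Ix (Y2 z). Fm (mu Z) (pair z w))"
  have W: "W y = Fm (Fm Z y)" if "y \<in> Ix Z" for y
  proof -
    have "W y = (\<lambda>w\<in>Ix (Fm Z y). Fm (Fm Z y) w)"
      using that by (auto simp: W_def I2 Y2_def Fm_mu cong: restrict_cong)
    then show ?thesis by (simp only: PiE_restrict[OF bobj_Fm[OF Zb[OF that]]])
  qed
  have B: "(\<lambda>z\<in>Ix x2. mu (over (Y2 z) (W z))) = Fm (bmap mu Z)"
    unfolding bmap_sel I2 by (rule restrict_ext) (simp add: W Y2_def over_eq)
  have o4: "over x2 (Fm (bmap mu Z)) = bmap mu Z" by (rule over_eq) (simp_all add: x2_def)
  have T: "(\<lambda>z\<in>Ix x2. ucmp A (Fm x2 z) (Y2 z) (W z) (\<lambda>w\<in>Ix (Y2 z). D (pair z w)) (\<gamma>2 z)) =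
    (\<lambda>y\<in>Ix Z. dl (Fm x (p (p' y))) (Fm Y (p' y)) (Fm Z y) (k y) (d y) (\<gamma> (p' y)))"
    unfolding I2
  proof (rule restrict_ext)
    fix y assume y: "y \<in> Ix Z"
    have "(\<lambda>w\<in>Ix (Y2 y). D (pair y w)) = (\<lambda>w\<in>Ix (Fm Z y). d y w)"
      using y by (auto simp: Y2_def D_def cong: restrict_cong)
    also have "\<dots> = d y" using k[OF y] unfolding mem_upairs by (blast dest: PiE_restrict)
    finally have "(\<lambda>w\<in>Ix (Y2 y). D (pair y w)) = d y" .
    then show "ucmp A (Fm x2 y) (Y2 y) (W y) (\<lambda>w\<in>Ix (Y2 y). D (pair y w)) (\<gamma>2 y) =
       dl (Fm x (p (p' y))) (Fm Y (p' y)) (Fm Z y) (k y) (d y) (\<gamma> (p' y))"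
      using y pm by (simp add: W dl_def x2_def x1_def Y2_def \<gamma>2_def)
  qed
  \<comment> \<open>The successive reindexings along \<open>p\<close> and \<open>p'\<close> combine
    into one along the composite index map, which is the index map on the right-hand side.\<close>
  have x2': "x2 = pull x (\<lambda>y\<in>Ix Z. p (p' y)) (bmap mu Z)"
    unfolding x2_def x1_def using pull_pull[of Z p' Y x p] pm by (simp add: pull_def)
  have r2': "r2 = ure A a x x2 (\<lambda>y\<in>Ix Z. p (p' y)) r"
    unfolding r2_def r1_def by (rule ure_comp_eq[OF r x1 x2]) (simp add: I2)
  show ?thesis
    unfolding K_def[symmetric] D_def[symmetric] L
    using ucmp_assoc[OF r2 f2 f3[unfolded N_def] W_def]
    unfolding N_def[symmetric] o3 B o4 T ure_restrict
    unfolding dl_def[of a x "bmap mu Z"] x2'[symmetric] r2'[symmetric] .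
qed

text \<open>\<open>pt A\<close> with composition \<open>undefined\<close> off composable pairs, as
  \<open>cat_ext\<close> demands of the category of a lax algebra.\<close>

definition pcat :: "('u, 'u) cat" where
  "pcat = \<lparr> Obj = Pt, Hom = (\<lambda>a b. E a (eta b)), Ide = uid A,
     Cmp = (\<lambda>a b c g f. if f \<in> E a (eta b) \<and> g \<in> E b (eta c) then upre A a b (eta c) g f else undefined) \<rparr>"

lemma pcat_sel [simp]: "Obj pcat = Pt" "Hom pcat a b = E a (eta b)" "Ide pcat = uid A"
  "f \<in> E a (eta b) \<Longrightarrow> g \<in> E b (eta c) \<Longrightarrow> Cmp pcat a b c g f = upre A a b (eta c) g f"
  by (simp_all add: pcat_def)

lemma eta_E: "u \<in> E a (eta b) \<Longrightarrow> b \<in> Pt"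
  using E_obj(2)[of u a "eta b"] by (simp add: eta_bobj_iff)

lemma category_pcat: "category pcat"
proof (standard, goal_cases)
  case (1 f a b) then show ?case using E_obj eta_E by simp
next
  case (6 f a b g c h d) then show ?case by (simp add: upre_Els upre_upre)
qed (simp_all add: uid_E upre_Els upre_uid_left upre_uid_right E_obj eta_E)

sublocale pcat: category pcat by (rule category_pcat)

text \<open>A morphism \<open>(g, \<alpha>)\<close> of \<beta> of the category of points acts
  through its two factors, the reindexing along \<open>g\<close> and then the vertical family
  \<alpha>.\<close>

definition actp :: "'u \<Rightarrow> ('u, 'u) ufam \<Rightarrow> ('u, 'u) ufam \<Rightarrow> ('u \<Rightarrow> 'u) \<Rightarrow> ('u \<Rightarrow> 'u) \<Rightarrow> 'u \<Rightarrow> 'u" where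
  "actp a x y g \<alpha> r = upost A a (pull x g y) y \<alpha> (ure A a x (pull x g y) g r)"

lemma upairs_pcat:
  assumes "(g, \<alpha>) \<in> upairs (Hom pcat) x y" "x \<in> bobj Pt" "y \<in> bobj Pt"
  shows "ualong (pull x g y) y \<alpha>" "reidx Pt x (pull x g y) g" "(g, \<alpha>) \<in> upairs E x (bmap eta y)"
proof -
  show 2: "reidx Pt x (pull x g y) g" by (rule reidx_pull[OF assms(2,3) upairs_uindex[OF assms(1)]])
  show "ualong (pull x g y) y \<alpha>"
    using assms(1) reidxD(2)[OF 2] assms(3) by (auto simp: ualong_def mem_upairs PiE_iff)
  show "(g, \<alpha>) \<in> upairs E x (bmap eta y)"
    using assms(1) by (auto simp: mem_upairs PiE_iff uindex_def)
qed

lemma actp_Els: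
  assumes "r \<in> E a x" "(g, \<alpha>) \<in> upairs (Hom pcat) x y" "y \<in> bobj Pt"
  shows "actp a x y g \<alpha> r \<in> E a y"
  using upairs_pcat[OF assms(2) E_obj(2)[OF assms(1)] assms(3)] assms(1)
  by (auto simp: actp_def intro!: upost_Els ure_Els)

text \<open>Up to a unit isomorphism the action is the case of \<Delta> in which \<alpha> is read as
  a germ into \<open>bmap eta y\<close>. Independence of the representative is thereby inherited
  from \<open>dl_cong\<close>.\<close>

lemma actp_dl: "actp a x y g \<alpha> r = ure A a (mu (bmap eta y)) y (\<lambda>z\<in>Ix y. pair z star) (dl a x (bmap eta y) g \<alpha> r)"
  by (simp add: actp_def upost_def dl_def pull_def)

lemma actp_cong:
  assumes "r \<in> E a x" "(g, \<alpha>) \<in> upairs (Hom pcat) x y" "(g', \<alpha>') \<in> upairs (Hom pcat) x y" "y \<in> bobj Pt"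
    "\<forall>\<^sub>F z in Uf y. g z = g' z \<and> \<alpha> z = \<alpha>' z"
  shows "actp a x y g \<alpha> r = actp a x y g' \<alpha>' r"
  unfolding actp_dl
  using dl_cong[OF assms(1) upairs_pcat(3)[OF assms(2) E_obj(2)[OF assms(1)] assms(4)]
      upairs_pcat(3)[OF assms(3) E_obj(2)[OF assms(1)] assms(4)] bmap_eta_bobj[OF assms(4)]] assms(5)
  by simp

text \<open>The reindexing along \<open>h\<close> is moved past the vertical composition with
  \<alpha> by \<open>ure_upost\<close>. Then two reindexings are adjacent, and two vertical families
  are adjacent, and each pair composes.\<close>

lemma actp_comp:
  assumes r: "r \<in> E a x" and g: "(g, \<alpha>) \<in> upairs (Hom pcat) x y" and h: "(h, \<delta>) \<in> upairs (Hom pcat) y z"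
    and y: "y \<in> bobj Pt" and z: "z \<in> bobj Pt"
  shows "actp a y z h \<delta> (actp a x y g \<alpha> r) = actp a x z (\<lambda>w\<in>Ix z. g (h w))
    (\<lambda>w\<in>Ix z. Cmp pcat (Fm x (g (h w))) (Fm y (h w)) (Fm z w) (\<delta> w) (\<alpha> (h w))) r"
proof -
  note G = upairs_pcat[OF g E_obj(2)[OF r] y] and H = upairs_pcat[OF h y z]
  note hm = uindex_mem[OF upairs_uindex[OF h]]
  have pp: "pull (pull x g y) h (pull y h z) = pull x (\<lambda>w\<in>Ix z. g (h w)) z"
    using pull_pull[of z h y x g] hm by (simp add: pull_def)
  note gh = ualong_pull[OF G(1) H(2), unfolded pp pull_sel]
  have h': "reidx Pt (pull x g y) (pull x (\<lambda>w\<in>Ix z. g (h w)) z) h"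
    using reidx_pull[OF reidxD(2)[OF G(2)] z, of h] upairs_uindex[OF h] pp
    by (simp add: uindex_def) (simp add: pull_def)
  have e: "(\<lambda>w\<in>Ix z. upre A (Fm x (g (h w))) (Fm y (h w)) (eta (Fm z w)) (\<delta> w) (\<alpha> (h w))) =
      (\<lambda>w\<in>Ix z. Cmp pcat (Fm x (g (h w))) (Fm y (h w)) (Fm z w) (\<delta> w) (\<alpha> (h w)))"
    by (rule restrict_ext) (use upairs_mem[OF g] upairs_mem[OF h] hm in simp)
  have e': "(\<lambda>w\<in>Ix (pull x (\<lambda>w\<in>Ix z. g (h w)) z). upre A (Fm (pull x (\<lambda>w\<in>Ix z. g (h w)) z) w) (Fm (pull y h z) w) (eta (Fm z w)) (\<delta> w) ((\<lambda>w\<in>Ix z. \<alpha> (h w)) w))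
    = (\<lambda>w\<in>Ix z. upre A (Fm x (g (h w))) (Fm y (h w)) (eta (Fm z w)) (\<delta> w) (\<alpha> (h w)))"
    by (simp cong: restrict_cong)
  have "actp a y z h \<delta> (actp a x y g \<alpha> r) =
    upost A a (pull y h z) z \<delta> (upost A a (pull x (\<lambda>w\<in>Ix z. g (h w)) z) (pull y h z) (\<lambda>w\<in>Ix z. \<alpha> (h w))
      (ure A a (pull x g y) (pull x (\<lambda>w\<in>Ix z. g (h w)) z) h (ure A a x (pull x g y) g r)))"
    unfolding actp_def ure_upost[OF ure_Els[OF r G(2)] G(1) H(2)] pp by simp
  also have "ure A a (pull x g y) (pull x (\<lambda>w\<in>Ix z. g (h w)) z) h (ure A a x (pull x g y) g r) =
     ure A a x (pull x (\<lambda>w\<in>Ix z. g (h w)) z) (\<lambda>w\<in>Ix z. g (h w)) r"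
    using ure_comp[OF r G(2) h'] by simp
  also have "upost A a (pull y h z) z \<delta> (upost A a (pull x (\<lambda>w\<in>Ix z. g (h w)) z) (pull y h z) (\<lambda>w\<in>Ix z. \<alpha> (h w)) \<dots>) =
    upost A a (pull x (\<lambda>w\<in>Ix z. g (h w)) z) z (\<lambda>w\<in>Ix z. upre A (Fm x (g (h w))) (Fm y (h w)) (eta (Fm z w)) (\<delta> w) (\<alpha> (h w))) \<dots>"
    unfolding e'[symmetric]
    by (rule upost_upost[OF ure_Els[OF r] gh H(1)]) (use ure_comp[OF r G(2) h'] reidx_comp[OF G(2) h'] in simp)
  finally show ?thesis unfolding e by (simp add: actp_def)
qed

text \<open>A vertical family of identities acts trivially by the right unit law, which leaves the
  reindexing.\<close>

lemma actp_rearr: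
  assumes r: "r \<in> E a x" and g: "reidx Pt x y g"
  shows "actp a x y g (\<lambda>z\<in>Ix y. Ide pcat (Fm y z)) r = ure A a x y g r"
proof -
  have "(\<lambda>z\<in>Ix y. Fm x (g z)) = (\<lambda>z\<in>Ix y. Fm y z)" by (rule restrict_ext) (rule reidxD(5)[OF g])
  then have "pull x g y = y" by (simp add: pull_def bobj_ext[OF reidxD(2)[OF g]] del: restrict_apply)
  then show ?thesis using ucmp_uid_right[OF ure_Els[OF r g]] by (simp add: actp_def)
qed

section \<open>Compatibility of left action, right action and \<Delta>\<close>

lemma upre_actp:
  assumes u: "u \<in> E a (eta b)" and r: "r \<in> E b x" and g: "(g, \<alpha>) \<in> upairs (Hom pcat) x y" and y: "y \<in> bobj Pt"
  shows "upre A a b y (actp b x y g \<alpha> r) u = actp a x y g \<alpha> (upre A a b x r u)"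
proof -
  note G = upairs_pcat[OF g E_obj(2)[OF r] y]
  show ?thesis unfolding actp_def upre_upost[OF u ure_Els[OF r G(2)] G(1)] upre_ure[OF u r G(2)] ..
qed

lemma upre_dl:
  assumes u: "u \<in> E a (eta b)" and r: "r \<in> E b x" and t: "(t, \<zeta>) \<in> upairs E x Y" and Y: "Y \<in> bobj (bobj Pt)"
  shows "upre A a b (mu Y) (dl b x Y t \<zeta> r) u = dl a x Y t \<zeta> (upre A a b x r u)"
proof -
  have x: "reidx Pt x (pull x t Y) t" by (rule reidx_pull[OF E_obj(2)[OF r] Y upairs_uindex[OF t]])
  show ?thesis using upre_ucmp[OF u ure_Els[OF r x] upairs_ufamily[OF t Y]]
    by (simp add: dl_def over_eq upre_ure[OF u r x])
qed

text \<open>Dinaturality of \<Delta> in the middle object: the vertical part of the action is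
  absorbed into the members of the germ by \<open>ucmp_upost\<close>. This is what makes \<Delta>
  well defined on the coend.\<close>

lemma dl_actp:
  assumes r: "r \<in> E a x" and g: "(g, \<alpha>) \<in> upairs (Hom pcat) x x'" and x': "x' \<in> bobj Pt"
    and t: "(t, \<zeta>) \<in> upairs E x' Y" and Y: "Y \<in> bobj (bobj Pt)"
  shows "dl a x' Y t \<zeta> (actp a x x' g \<alpha> r) =
    dl a x Y (\<lambda>w\<in>Ix Y. g (t w)) (\<lambda>w\<in>Ix Y. upre A (Fm x (g (t w))) (Fm x' (t w)) (Fm Y w) (\<zeta> w) (\<alpha> (t w))) r"
proof -
  note G = upairs_pcat[OF g E_obj(2)[OF r] x']
  note tm = uindex_mem[OF upairs_uindex[OF t]]
  have tr: "reidx Pt x' (pull x' t Y) t" by (rule reidx_pull[OF x' Y upairs_uindex[OF t]])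
  have pp: "pull (pull x g x') t (pull x' t Y) = pull x (\<lambda>w\<in>Ix Y. g (t w)) Y"
    using pull_pull[of Y t x' x g] tm by (simp add: pull_def)
  note gt = ualong_pull[OF G(1) tr, unfolded pp pull_sel]
  have t': "reidx Pt (pull x g x') (pull x (\<lambda>w\<in>Ix Y. g (t w)) Y) t"
    using reidx_pull[OF reidxD(2)[OF G(2)] Y, of t] upairs_uindex[OF t] pp
    by (simp add: uindex_def) (simp add: pull_def)
  have rr: "ure A a (pull x g x') (pull x (\<lambda>w\<in>Ix Y. g (t w)) Y) t (ure A a x (pull x g x') g r) =
     ure A a x (pull x (\<lambda>w\<in>Ix Y. g (t w)) Y) (\<lambda>w\<in>Ix Y. g (t w)) r"
    using ure_comp[OF r G(2) t'] by simp
  note r' = ure_Els[OF ure_Els[OF r G(2)] t', unfolded rr]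
  show ?thesis
    unfolding dl_def actp_def ure_upost[OF ure_Els[OF r G(2)] G(1) tr] pp pull_sel rr
      ucmp_upost[OF r' gt upairs_ufamily[OF t Y]]
    by (simp cong: restrict_cong)
qed

text \<open>Naturality of \<Delta> in its target: the layered index map goes inside by
  \<open>ure_ucmp_pull\<close>, the layered vertical family by \<open>upost_ucmp\<close>.\<close>

lemma actp_dl_mu:
  assumes r: "r \<in> E a x" and t: "(t, \<zeta>) \<in> upairs E x Y" and Y: "Y \<in> bobj (bobj Pt)" and Z: "Z \<in> bobj (bobj Pt)"
    and l: "uindex Y Z l" and k: "\<And>w. w \<in> Ix Z \<Longrightarrow> (k w, d w) \<in> upairs (Hom pcat) (Fm Y (l w)) (Fm Z w)"
  shows "actp a (mu Y) (mu Z) (\<lambda>v\<in>Ix (mu Z). pair (l (ufst v)) (k (ufst v) (usnd v)))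
      (\<lambda>v\<in>Ix (mu Z). d (ufst v) (usnd v)) (dl a x Y t \<zeta> r) =
    dl a x Z (\<lambda>w\<in>Ix Z. t (l w)) (\<lambda>w\<in>Ix Z. actp (Fm x (t (l w))) (Fm Y (l w)) (Fm Z w) (k w) (d w) (\<zeta> (l w))) r"
proof -
  note x = E_obj(2)[OF r] and tu = upairs_uindex[OF t] and ku = upairs_uindex[OF k]
  define x1 where "x1 = pull x t Y"
  have x1: "reidx Pt x x1 t" unfolding x1_def by (rule reidx_pull[OF x Y tu])
  define r1 where "r1 = ure A a x x1 t r"
  have r1: "r1 \<in> E a x1" unfolding r1_def by (rule ure_Els[OF r x1])
  have f1: "ufamily A x1 (Fm Y) \<zeta>" unfolding x1_def by (rule upairs_ufamily[OF t Y])
  have o1: "over x1 (Fm Y) = Y" by (simp add: x1_def over_eq)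
  have l1: "uindex x1 Z l" using l by (simp add: uindex_def x1_def)
  define x2 where "x2 = pull x1 l Z"
  have x2: "reidx Pt x1 x2 l" unfolding x2_def by (rule reidx_pull[OF reidxD(2)[OF x1] Z l1])
  define r2 where "r2 = ure A a x1 x2 l r1"
  have r2: "r2 \<in> E a x2" unfolding r2_def by (rule ure_Els[OF r1 x2])
  define Y2 where "Y2 = (\<lambda>y\<in>Ix Z. pull (Fm Y (l y)) (k y) (Fm Z y))"
  define \<gamma>2 where "\<gamma>2 = (\<lambda>y\<in>Ix Z. ure A (Fm x1 (l y)) (Fm Y (l y)) (pull (Fm Y (l y)) (k y) (Fm Z y)) (k y) (\<zeta> (l y)))"
  have I2: "Ix x2 = Ix Z" "Ix x1 = Ix Y" by (simp_all add: x2_def x1_def)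
  have lm: "l y \<in> Ix Y" if "y \<in> Ix Z" for y by (rule uindex_mem[OF l that])
  have Yb: "Fm Y y \<in> bobj Pt" if "y \<in> Ix Y" for y by (rule bobj_mem[OF Y that])
  have Zb: "Fm Z y \<in> bobj Pt" if "y \<in> Ix Z" for y by (rule bobj_mem[OF Z that])
  note kp = upairs_pcat[OF k Yb[OF lm] Zb]
  define K where "K = (\<lambda>v\<in>Ix (mu Z). pair (l (ufst v)) (k (ufst v) (usnd v)))"
  define D where "D = (\<lambda>v\<in>Ix (mu Z). d (ufst v) (usnd v))"
  define N where "N = mu (over x2 Y2)"
  have N: "pull (mu Y) K (mu Z) = N"
    using pull_mu[OF Z, where x = x1 and Y = "Fm Y" and p = l and k = k] uindex_mem[OF ku] lm
    by (simp add: o1 I2 K_def N_def x2_def Y2_def)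
  have f2: "ufamily A x2 Y2 \<gamma>2"
  proof (rule ufamilyI)
    fix z assume "z \<in> Ix x2"
    then have z: "z \<in> Ix Z" by (simp add: I2)
    then show "\<gamma>2 z \<in> E (Fm x2 z) (Y2 z)"
      using ure_Els[OF ufamilyD(3)[OF f1] kp(2)[OF z z z]] lm by (simp add: x2_def Y2_def \<gamma>2_def I2)
  qed (simp_all add: Y2_def \<gamma>2_def I2)
  have "ure A a (mu Y) N K (ucmp A a x1 (Fm Y) \<zeta> r1) = ucmp A a x2 Y2 \<gamma>2 r2"
    using ure_ucmp_pull[OF r1 f1 Z l1 ku] unfolding o1 x2_def r2_def Y2_def \<gamma>2_def N_def K_def .
  then have L: "actp a (mu Y) (mu Z) K D (dl a x Y t \<zeta> r) = upost A a N (mu Z) D (ucmp A a x2 Y2 \<gamma>2 r2)"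
    unfolding actp_def N by (simp add: dl_def x1_def r1_def)
  have o3: "over x2 (Fm Z) = Z" by (simp add: x2_def over_eq)
  have D: "D = (\<lambda>w\<in>Ix N. d (ufst w) (usnd w))" unfolding D_def N[symmetric] by simp
  have Ze: "Fm Z \<in> extensional (Ix x2)" using bobj_Fm[OF Z] by (simp add: I2 PiE_iff)
  have d: "ualong (Y2 z) (Fm Z z) (d z)" if "z \<in> Ix x2" for z
    using kp(1)[of z] that by (simp add: I2 Y2_def)
  have M: "upost A a N (mu Z) D (ucmp A a x2 Y2 \<gamma>2 r2) =
     ucmp A a x2 (Fm Z) (\<lambda>z\<in>Ix x2. upost A (Fm x2 z) (Y2 z) (Fm Z z) (d z) (\<gamma>2 z)) r2"
    using upost_ucmp[OF r2 f2 Ze d] unfolding D o3 N_def[symmetric] .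
  have x2': "x2 = pull x (\<lambda>y\<in>Ix Z. t (l y)) Z"
    unfolding x2_def x1_def using pull_pull[of Z l Y x t] lm by simp
  have r2': "r2 = ure A a x x2 (\<lambda>y\<in>Ix Z. t (l y)) r"
    unfolding r2_def r1_def by (rule ure_comp_eq[OF r x1 x2]) (simp add: I2)
  have T: "(\<lambda>z\<in>Ix x2. upost A (Fm x2 z) (Y2 z) (Fm Z z) (d z) (\<gamma>2 z)) =
     (\<lambda>w\<in>Ix Z. actp (Fm x (t (l w))) (Fm Y (l w)) (Fm Z w) (k w) (d w) (\<zeta> (l w)))"
    unfolding I2 by (rule restrict_ext) (simp add: actp_def x2_def x1_def Y2_def \<gamma>2_def lm)
  show ?thesis unfolding K_def[symmetric] D_def[symmetric] L M T
    unfolding dl_def x2'[symmetric] r2'[symmetric] ..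
qed

definition pact :: "'u \<Rightarrow> ('u, 'u) ufam \<Rightarrow> ('u, 'u) ufam \<Rightarrow> ('u, 'u) germ \<Rightarrow> 'u \<Rightarrow> 'u" where
  "pact a x y V r = (case rep V of (g, \<alpha>) \<Rightarrow> actp a x y g \<alpha> r)"

definition pstr :: "'u uprof" where
  "pstr = \<lparr> Els = E, Act = (\<lambda>d d' x y u v r.
     if u \<in> Hom pcat d' d \<and> v \<in> Hom (beta pcat) x y \<and> r \<in> E d x
     then upre A d' d y (pact d x y v r) u else undefined) \<rparr>"

lemma Els_pstr [simp]: "Els pstr = E"
  by (simp add: pstr_def)

lemma pact_ucls:
  assumes "r \<in> E a x" "(g, \<alpha>) \<in> upairs (Hom pcat) x y" "y \<in> bobj Pt"
  shows "pact a x y (ucls (Hom pcat) x y (g, \<alpha>)) r = actp a x y g \<alpha> r"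
proof -
  obtain g' \<alpha>' where p': "rep (ucls (Hom pcat) x y (g, \<alpha>)) = (g', \<alpha>')" "(g', \<alpha>') \<in> upairs (Hom pcat) x y"
    "\<forall>\<^sub>F z in Uf y. g' z = g z \<and> \<alpha>' z = \<alpha> z" "ucls (Hom pcat) x y (g', \<alpha>') = ucls (Hom pcat) x y (g, \<alpha>)"
    by (rule rep_ucls[OF assms(2)])
  show ?thesis unfolding pact_def p'(1) prod.case
    by (rule actp_cong[OF assms(1) p'(2) assms(2,3) p'(3)])
qed

lemma Act_pstr:
  assumes "u \<in> E d' d" "d = eta b" "(g, \<alpha>) \<in> upairs (Hom pcat) x y" "x \<in> bobj Pt" "y \<in> bobj Pt" "r \<in> E b x"
  shows "Act pstr b d' x y u (ucls (Hom pcat) x y (g, \<alpha>)) r = upre A d' b y (actp b x y g \<alpha> r) u"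
  using assms HomBI[of x pcat y "(g, \<alpha>)"] by (simp add: pstr_def pact_ucls)

lemma Act_pstr_uid:
  assumes "(g, \<alpha>) \<in> upairs (Hom pcat) x y" "x \<in> bobj Pt" "y \<in> bobj Pt" "r \<in> E b x"
  shows "Act pstr b b x y (uid A b) (ucls (Hom pcat) x y (g, \<alpha>)) r = actp b x y g \<alpha> r"
  using Act_pstr[OF uid_E refl assms] E_obj(1)[OF assms(4)] ucmp_uid_left[OF actp_Els[OF assms(4,1,3)]] by simp

lemma upairs_pcat_Ide: "x \<in> bobj Pt \<Longrightarrow> (\<lambda>z\<in>Ix x. z, \<lambda>z\<in>Ix x. Ide pcat (Fm x z)) \<in> upairs (Hom pcat) x x"
  by (rule upairs_Ide[OF category_pcat]) simp

lemma actp_Ide: "r \<in> E a x \<Longrightarrow> actp a x x (\<lambda>z\<in>Ix x. z) (\<lambda>z\<in>Ix x. Ide pcat (Fm x z)) r = r"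
  by (subst actp_rearr) (auto intro: reidx_id E_obj simp: ure_id)

lemma Act_pstr_Ide:
  assumes "u \<in> E a (eta b)" "r \<in> E b x"
  shows "Act pstr b a x x u (Ide (beta pcat) x) r = upre A a b x r u"
  unfolding Ide_beta Act_pstr[OF assms(1) refl upairs_pcat_Ide[OF E_obj(2)[OF assms(2)]] E_obj(2)[OF assms(2)] E_obj(2)[OF assms(2)] assms(2)]
    actp_Ide[OF assms(2)] ..

text \<open>Functoriality is \<open>upre_upre\<close> on the left and \<open>actp_comp\<close> on
  the right; \<open>upre_actp\<close> makes the two actions commute.\<close>

lemma profunctor_pstr: "profunctor (beta pcat) pcat pstr"
proof (standard, goal_cases)
  case (1 r d c) then show ?case by (simp add: E_obj)
next
  case (2 u d' d v c c' r)
  obtain g \<alpha> where g: "c \<in> bobj Pt" "c' \<in> bobj Pt" "(g, \<alpha>) \<in> upairs (Hom pcat) c c'" "v = ucls (Hom pcat) c c' (g, \<alpha>)"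
    using 2(2) by (elim HomBE) (simp only: pcat_sel)
  show ?case using 2 unfolding g(4) by (simp add: Act_pstr g upre_Els actp_Els)
next
  case (3 r d c)
  then show ?case using E_obj(1)[of r d c] by (simp add: Act_pstr_Ide uid_E ucmp_uid_left)
next
  case (4 u d' d u' d'' v c c' v' c'' r)
  obtain g \<alpha> where g: "c \<in> bobj Pt" "c' \<in> bobj Pt" "(g, \<alpha>) \<in> upairs (Hom pcat) c c'" "v = ucls (Hom pcat) c c' (g, \<alpha>)"
    using 4(3) by (elim HomBE) (simp only: pcat_sel)
  obtain h \<delta> where h: "c'' \<in> bobj Pt" "(h, \<delta>) \<in> upairs (Hom pcat) c' c''" "v' = ucls (Hom pcat) c' c'' (h, \<delta>)"
    using 4(4) by (elim HomBE) (simp only: pcat_sel)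
  note u = 4(1,2,5)[simplified]
  note gh = upairs_comp[OF category_pcat g(3) h(2) bobj_ev[OF h(1)]]
  have "Act pstr d d'' c c'' (Cmp pcat d'' d' d u u') (Cmp (beta pcat) c c' c'' v' v) r =
    upre A d'' d c'' (actp d c' c'' h \<delta> (actp d c c' g \<alpha> r)) (upre A d'' d' (eta d) u u')"
    unfolding g(4) h(3) beta_Cmp[OF g(3) h(2)] pcat_sel(4)[OF u(2,1)]
      Act_pstr[OF upre_Els[OF u(2,1)] refl gh g(1) h(1) u(3)] actp_comp[OF u(3) g(3) h(2) g(2) h(1)] ..
  also have "\<dots> = upre A d'' d' c'' (actp d' c' c'' h \<delta> (upre A d' d c' (actp d c c' g \<alpha> r) u)) u'"
    using upre_upre[OF u(2,1) actp_Els[OF actp_Els[OF u(3) g(3,2)] h(2,1)]]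
      upre_actp[OF u(1) actp_Els[OF u(3) g(3,2)] h(2,1)] by simp
  also have "\<dots> = Act pstr d' d'' c' c'' u' v' (Act pstr d d' c c' u v r)"
    unfolding g(4) h(3) Act_pstr[OF u(1) refl g(3,1,2) u(3)]
      Act_pstr[OF u(2) refl h(2) g(2) h(1) upre_Els[OF u(1) actp_Els[OF u(3) g(3,2)]]] ..
  finally show ?case .
qed

section \<open>\<Delta> as a map out of the coend\<close>

abbreviation "pbstr \<equiv> bprof (beta pcat) pcat pstr"

sublocale PC: composable "beta (beta pcat)" "beta pcat" pcat pstr pbstr
  by (intro composable.intro category_pcat category_beta profunctor_pstr profunctor_bprof)

definition pdls :: "'u \<Rightarrow> ('u, 'u) ufam \<Rightarrow> ('u, ('u, 'u) ufam) ufam \<Rightarrow> 'u \<Rightarrow> ('u, 'u) germ \<Rightarrow> 'u" where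
  "pdls a x Y r s = (case rep s of (t, \<zeta>) \<Rightarrow> dl a x Y t \<zeta> r)"

text \<open>Two choices hide here, a triple in the coend class and a pair in the germ. They are
  removed by \<open>pdlt_cls\<close> and \<open>pdls_ucls\<close>.\<close>

definition pdlt :: "'u \<Rightarrow> ('u, ('u, 'u) ufam) ufam \<Rightarrow> (('u, 'u) ufam \<times> 'u \<times> ('u, 'u) germ) set \<Rightarrow> 'u" where
  "pdlt a Y = (\<lambda>P\<in>Els (pcomp (beta (beta pcat)) (beta pcat) pcat pstr pbstr) a Y.
     case rep P of (x, r, s) \<Rightarrow> pdls a x Y r s)"

lemma pdls_ucls:
  assumes "r \<in> E a x" "(t, \<zeta>) \<in> upairs E x Y" "Y \<in> bobj (bobj Pt)"
  shows "pdls a x Y r (ucls E x Y (t, \<zeta>)) = dl a x Y t \<zeta> r"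
proof -
  obtain t' \<zeta>' where p': "rep (ucls E x Y (t, \<zeta>)) = (t', \<zeta>')" "(t', \<zeta>') \<in> upairs E x Y"
    "\<forall>\<^sub>F z in Uf Y. t' z = t z \<and> \<zeta>' z = \<zeta> z" "ucls E x Y (t', \<zeta>') = ucls E x Y (t, \<zeta>)"
    by (rule rep_ucls[OF assms(2)])
  show ?thesis unfolding pdls_def p'(1) prod.case
    by (rule dl_cong[OF assms(1) p'(2) assms(2,3) p'(3)])
qed

lemma pbstrE:
  assumes "s \<in> Els pbstr x Y"
  obtains t \<zeta> where "x \<in> bobj Pt" "Y \<in> bobj (bobj Pt)" "(t, \<zeta>) \<in> upairs E x Y" "s = ucls E x Y (t, \<zeta>)"
  using assms by (elim bprofE) simp

text \<open>Invariance under a generating pair of the coend is \<open>dl_actp\<close>: on one side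
  the morphism acts on the arrow, on the other it is composed into the germ.\<close>

lemma pdlt_cls:
  assumes r: "r \<in> E a x" and s: "s \<in> Els pbstr x Y"
  shows "pdlt a Y (coend_cls (beta (beta pcat)) (beta pcat) pcat pstr pbstr a Y (x, r, s)) = pdls a x Y r s"
proof -
  define \<phi> where "\<phi> = (\<lambda>(x, r, s). pdls a x Y r s)"
  have "\<phi> (rep (coend_cls (beta (beta pcat)) (beta pcat) pcat pstr pbstr a Y (x, r, s))) = \<phi> (x, r, s)"
  proof (rule rep_coend_cls)
    fix p q assume "(p, q) \<in> coend_rel (beta (beta pcat)) (beta pcat) pcat pstr pbstr a Y"
    then obtain d d' v g f where pq: "p = (d', ract pcat pstr a d d' v g, f)"
      "q = (d, g, lact (beta (beta pcat)) pbstr d' d Y v f)"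
      "v \<in> Hom (beta pcat) d d'" "g \<in> E a d" "f \<in> Els pbstr d' Y" by (rule PC.coend_relE) simp
    obtain h \<alpha> where h: "d \<in> bobj Pt" "d' \<in> bobj Pt" "(h, \<alpha>) \<in> upairs (Hom pcat) d d'" "v = ucls (Hom pcat) d d' (h, \<alpha>)"
      using pq(3) by (elim HomBE) (simp only: pcat_sel)
    obtain t \<zeta> where t: "Y \<in> bobj (bobj Pt)" "(t, \<zeta>) \<in> upairs E d' Y" "f = ucls E d' Y (t, \<zeta>)"
      using pq(5) by (elim pbstrE)
    note hu = upairs_uindex[OF h(3)] and tu = upairs_uindex[OF t(2)]
    have gE: "g \<in> E a d" by (rule pq(4))
    have t': "(t, \<zeta>) \<in> upairs (Els pstr) d' Y" using t(2) by simp
    have "Y \<in> bobj (Obj (beta pcat))" using t(1) by simp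
    note YI = upairs_Ide[OF PC.D.category_axioms this]
    have Z: "(\<lambda>w\<in>Ix Y. Act pstr (Fm d' (t w)) (Fm d (h (t w))) (Fm Y w) (Fm Y w) (\<alpha> (t w)) (Ide (beta pcat) (Fm Y w)) (\<zeta> w))
       = (\<lambda>w\<in>Ix Y. upre A (Fm d (h (t w))) (Fm d' (t w)) (Fm Y w) (\<zeta> w) (\<alpha> (t w)))"
      by (rule restrict_ext, rule Act_pstr_Ide)
        (use upairs_mem[OF h(3)] upairs_mem[OF t(2)] uindex_mem[OF tu] in simp_all)
    have l: "lact (beta (beta pcat)) pbstr d' d Y v f = ucls E d Y (\<lambda>w\<in>Ix Y. h (t w),
        \<lambda>w\<in>Ix Y. upre A (Fm d (h (t w))) (Fm d' (t w)) (Fm Y w) (\<zeta> w) (\<alpha> (t w)))"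
      unfolding h(4) t(3) Ide_beta[of "beta pcat"] Els_pstr[symmetric] bprof_Act[OF h(3) YI t']
      unfolding Z[symmetric] by (auto intro!: ucls_cong cong: restrict_cong)
    have m: "(\<lambda>w\<in>Ix Y. h (t w), \<lambda>w\<in>Ix Y. upre A (Fm d (h (t w))) (Fm d' (t w)) (Fm Y w) (\<zeta> w) (\<alpha> (t w))) \<in> upairs E d Y"
      using uindex_comp[OF hu tu bobj_ev[OF t(1)]] upairs_mem[OF h(3)] upairs_mem[OF t(2)] uindex_mem[OF tu]
      by (simp add: mem_upairs upre_Els)
    have ra: "ract pcat pstr a d d' v g = actp a d d' h \<alpha> g"
      unfolding h(4) pcat_sel(3) by (rule Act_pstr_uid[OF h(3,1,2) gE])
    show "\<phi> p = \<phi> q"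
      unfolding pq \<phi>_def prod.case ra l pdls_ucls[OF gE m t(1)] unfolding t(3) pdls_ucls[OF actp_Els[OF gE h(3,2)] t(2,1)]
      by (rule dl_actp[OF gE h(3,2) t(2,1)])
  qed
  moreover have "coend_cls (beta (beta pcat)) (beta pcat) pcat pstr pbstr a Y (x, r, s) \<in>
      Els (pcomp (beta (beta pcat)) (beta pcat) pcat pstr pbstr) a Y"
    by (rule PC.pcomp_ElsI) (use r s in simp_all)
  ultimately show ?thesis by (simp add: pdlt_def \<phi>_def)
qed

text \<open>\<Gamma> is the identity, since the hom-sets of \<open>pcat\<close> already consist of
  the arrows with singleton target.\<close>

definition lax_of :: "'u lax_alg" where
  "lax_of = \<lparr> bas = pcat, str = pstr, gam = (\<lambda>a b. \<lambda>u\<in>E a (eta b). u), dlt = pdlt \<rparr>"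

lemma lax_of_sel [simp]: "bas lax_of = pcat" "str lax_of = pstr"
  "gam lax_of a b = (\<lambda>u\<in>E a (eta b). u)" "dlt lax_of = pdlt"
  by (simp_all add: lax_of_def)

lemma dlt2_lax_of:
  assumes "r \<in> E a x" "(t, \<zeta>) \<in> upairs E x Y" "Y \<in> bobj (bobj Pt)"
  shows "dlt2 lax_of a x Y r (ucls E x Y (t, \<zeta>)) = dl a x Y t \<zeta> r"
proof -
  have s: "ucls E x Y (t, \<zeta>) \<in> Els pbstr x Y"
    using bprofI[of x pcat Y "beta pcat" "(t, \<zeta>)" pstr] assms E_obj(2)[OF assms(1)] by simp
  show ?thesis unfolding dlt2_def lax_of_sel pdlt_cls[OF assms(1) s] by (rule pdls_ucls[OF assms])
qed

lemma upairs_eta: "v \<in> E c (eta c') \<Longrightarrow> (\<lambda>z\<in>{star}. z, \<lambda>z\<in>{star}. v) \<in> upairs (Hom pcat) (eta c) (eta c')"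
  by (rule upairs_star) simp

text \<open>On singletons the right action is composition in the category of points, which is the
  naturality of the identity \<Gamma>.\<close>

lemma actp_eta:
  assumes "r \<in> E a (eta c)" "v \<in> E c (eta c')"
  shows "actp a (eta c) (eta c') (\<lambda>z\<in>{star}. z) (\<lambda>z\<in>{star}. v) r = upre A a c (eta c') v r"
proof -
  have p: "pull (eta c) (\<lambda>z\<in>{star}. z) (eta c' :: ('u, 'u) ufam) = eta c"
    by (rule ufam_eqI) auto
  show ?thesis unfolding actp_def p using ure_id[OF assms(1)] upost_eta[OF assms] by simp
qed

lemma category_pt: "category (pt A)"
proof (standard, goal_cases)
  case (1 f a b) then show ?case using E_obj eta_E by (simp add: pt_def)
next
  case (6 f a b g c h d) then show ?case by (simp add: pt_def upre_upre)
qed (simp_all add: pt_def uid_E upre_Els upre_uid_left upre_uid_right)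

text \<open>\<open>pt A\<close> and \<open>pcat\<close> differ in junk values only, so smallness is
  transported along identities.\<close>

lemma small_pstr: "small_profunctor (beta pcat) pcat pstr"
  unfolding small_profunctor_def
proof (intro conjI ballI profunctor_pstr)
  show "set_valued pstr" using uarr_profunctor(2) by (simp add: set_valued_def)
  fix x :: "('u, 'u) ufam" assume "x \<in> Obj (beta pcat)"
  then have x: "x \<in> Obj (beta (udisc A))" by simp
  show "small_colim_of_representables pcat (prof_presheaf (beta pcat) pstr x)"
    by (rule small_colim_transport[OF uarr_small[OF x] category_pt, where \<phi> = "\<lambda>_ _ u. u" and l = "\<lambda>_ r. r"])
      (auto simp: pt_def pt_presheaf_def prof_presheaf_def Act_pstr_Ide upre_Els bij_betw_def)
qed

text \<open>The two halves of naturality are \<open>upre_dl\<close> on the left and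
  \<open>actp_dl_mu\<close> on the right; the rest evaluates the actions at representatives.\<close>

lemma dlt_natural_pcat:
  "pcell (beta (beta pcat)) pcat ftr_id (mu_ftr pcat)
      (pcomp (beta (beta pcat)) (beta pcat) pcat pstr pbstr) pstr pdlt"
  unfolding pcell_def
proof (intro conjI allI impI)
  fix d c
  have "pdlt d c P \<in> E d (mu c)" if P: "P \<in> Els (pcomp (beta (beta pcat)) (beta pcat) pcat pstr pbstr) d c" for P
  proof -
    obtain x r s where p: "P = coend_cls (beta (beta pcat)) (beta pcat) pcat pstr pbstr d c (x, r, s)"
      "r \<in> E d x" "s \<in> Els pbstr x c" using PC.pcomp_ElsE[OF P] by (metis Els_pstr)
    obtain t \<zeta> where t: "c \<in> bobj (bobj Pt)" "(t, \<zeta>) \<in> upairs E x c" "s = ucls E x c (t, \<zeta>)"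
      using p(3) by (elim pbstrE)
    show ?thesis unfolding p(1) pdlt_cls[OF p(2,3)] unfolding t(3) pdls_ucls[OF p(2) t(2,1)]
      by (rule dl_Els[OF p(2) t(2,1)])
  qed
  then show "pdlt d c \<in> Els (pcomp (beta (beta pcat)) (beta pcat) pcat pstr pbstr) d c \<rightarrow>\<^sub>E Els pstr (fo ftr_id d) (fo (mu_ftr pcat) c)"
    by (auto simp: ftr_id_def mu_ftr_def) (simp add: pdlt_def)
next
  fix d d' Y Z u V P
  assume u: "u \<in> Hom pcat d' d" and V: "V \<in> Hom (beta (beta pcat)) Y Z"
    and P: "P \<in> Els (pcomp (beta (beta pcat)) (beta pcat) pcat pstr pbstr) d Y"
  obtain x r s where p: "P = coend_cls (beta (beta pcat)) (beta pcat) pcat pstr pbstr d Y (x, r, s)"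
    "r \<in> E d x" "s \<in> Els pbstr x Y" using PC.pcomp_ElsE[OF P] by (metis Els_pstr)
  obtain t \<zeta> where t: "x \<in> bobj Pt" "Y \<in> bobj (bobj Pt)" "(t, \<zeta>) \<in> upairs E x Y" "s = ucls E x Y (t, \<zeta>)"
    using p(3) by (elim pbstrE)
  obtain l k \<delta> where l: "Y \<in> bobj (bobj (Obj pcat))" "Z \<in> bobj (bobj (Obj pcat))"
    "(l, \<lambda>w\<in>Ix Z. ucls (Hom pcat) (Fm Y (l w)) (Fm Z w) (k w, \<delta> w)) \<in> upairs (Hom (beta pcat)) Y Z"
    "V = ucls (Hom (beta pcat)) Y Z (l, \<lambda>w\<in>Ix Z. ucls (Hom pcat) (Fm Y (l w)) (Fm Z w) (k w, \<delta> w))"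
    "\<And>w. w \<in> Ix Z \<Longrightarrow> (k w, \<delta> w) \<in> upairs (Hom pcat) (Fm Y (l w)) (Fm Z w)"
    by (rule HomBBE[OF V]) (rule that; assumption)
  have Z: "Z \<in> bobj (bobj Pt)" using l(2) by simp
  note lu = upairs_uindex[OF l(3)] and tu = upairs_uindex[OF t(3)] and ku = l(5)
  have u': "u \<in> E d' (eta d)" using u by simp
  have t': "(t, \<zeta>) \<in> upairs (Els pstr) x Y" using t(3) by simp
  have xi: "x \<in> bobj (Obj pcat)" using t(1) by simp
  have S: "(\<lambda>w\<in>Ix Z. Act pstr (Fm x (t (l w))) (Fm x (t (l w))) (Fm Y (l w)) (Fm Z w) (uid A (Fm x (t (l w))))
        (ucls (Hom pcat) (Fm Y (l w)) (Fm Z w) (k w, \<delta> w)) (\<zeta> (l w))) =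
      (\<lambda>w\<in>Ix Z. actp (Fm x (t (l w))) (Fm Y (l w)) (Fm Z w) (k w) (\<delta> w) (\<zeta> (l w)))"
    by (rule restrict_ext, rule Act_pstr_uid)
      (use l(5) upairs_mem[OF t(3)] uindex_mem[OF lu] bobj_mem[OF t(2)] bobj_mem[OF Z] in simp_all)
  have sV: "ract (beta pcat) pbstr x Y Z V s = ucls E x Z (\<lambda>w\<in>Ix Z. t (l w),
      \<lambda>w\<in>Ix Z. actp (Fm x (t (l w))) (Fm Y (l w)) (Fm Z w) (k w) (\<delta> w) (\<zeta> (l w)))" (is "_ = ucls E x Z (?t, ?\<zeta>)")
    unfolding l(4) t(4) Ide_beta[of pcat x] Els_pstr[symmetric] bprof_Act[OF upairs_Ide[OF category_pcat xi] l(3) t']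
    unfolding S[symmetric] using uindex_mem[OF lu] uindex_mem[OF tu] by (auto intro!: ucls_cong cong: restrict_cong)
  have m: "(?t, ?\<zeta>) \<in> upairs E x Z"
    using uindex_comp[OF tu lu bobj_ev[OF Z]] actp_Els[OF upairs_mem[OF t(3) uindex_mem[OF lu]] ku bobj_mem[OF Z]]
    by (simp add: mem_upairs)
  note um = umult_upairs[OF lu ku Z]
  have uV: "umult (Hom pcat) Y Z V = ucls (Hom pcat) (mu Y) (mu Z)
      (\<lambda>v\<in>Ix (mu Z). pair (l (ufst v)) (k (ufst v) (usnd v)), \<lambda>v\<in>Ix (mu Z). \<delta> (ufst v) (usnd v))"
    unfolding l(4) by (rule umult_ucls[OF l(3) ku Z])
  have ur: "lact (beta pcat) pstr d d' x u r = upre A d' d x r u" by (rule Act_pstr_Ide[OF u' p(2)])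
  note ru = upre_Els[OF u' p(2)]
  have sZ: "ract (beta pcat) pbstr x Y Z V s \<in> Els pbstr x Z"
    unfolding sV using bprofI[of x pcat Z "beta pcat" "(?t, ?\<zeta>)" pstr] m t(1) Z by simp
  have "pdlt d' Z (Act (pcomp (beta (beta pcat)) (beta pcat) pcat pstr pbstr) d d' Y Z u V P) =
      dl d' x Z ?t ?\<zeta> (upre A d' d x r u)"
    unfolding p(1) using PC.pcomp_Act[OF u V _ p(3), of r] p(2) pdlt_cls[OF ru sZ] pdls_ucls[OF ru m Z]
    by (simp add: ur sV)
  also have "\<dots> = upre A d' d (mu Z) (dl d x Z ?t ?\<zeta> r) u" by (rule upre_dl[OF u' p(2) m Z, symmetric])
  also have "dl d x Z ?t ?\<zeta> r = actp d (mu Y) (mu Z) (\<lambda>v\<in>Ix (mu Z). pair (l (ufst v)) (k (ufst v) (usnd v)))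
      (\<lambda>v\<in>Ix (mu Z). \<delta> (ufst v) (usnd v)) (dl d x Y t \<zeta> r)"
    by (rule actp_dl_mu[OF p(2) t(3,2) Z lu ku, symmetric])
  also have "upre A d' d (mu Z) \<dots> u = Act pstr d d' (mu Y) (mu Z) u (umult (Hom pcat) Y Z V) (pdlt d Y P)"
    unfolding uV p(1) pdlt_cls[OF p(2,3)] unfolding t(4) pdls_ucls[OF p(2) t(3,2)]
    by (rule Act_pstr[OF u' refl um mu_bobj[OF t(2)] mu_bobj[OF Z] dl_Els[OF p(2) t(3,2)], symmetric])
  finally show "pdlt d' Z (Act (pcomp (beta (beta pcat)) (beta pcat) pcat pstr pbstr) d d' Y Z u V P) =
       Act pstr (fo ftr_id d) (fo ftr_id d') (fo (mu_ftr pcat) Y) (fo (mu_ftr pcat) Z) (fm ftr_id d' d u)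
         (fm (mu_ftr pcat) Y Z V) (pdlt d Y P)"
    by (simp add: ftr_id_def mu_ftr_def)
qed

lemma ract_rearr:
  assumes "reidx Pt x y (\<lambda>z\<in>Ix y. g z)" "r \<in> E a x"
  shows "ract pcat pstr a x y (rearr pcat x y g) r = ure A a x y g r"
proof -
  have rr: "rearr pcat x y g = ucls (Hom pcat) x y (\<lambda>z\<in>Ix y. g z, \<lambda>z\<in>Ix y. Ide pcat (Fm y z))"
    using rearr_eq[OF assms(1), of pcat] by (simp only: rearr_restrict)
  have "(\<lambda>z\<in>Ix y. g z, \<lambda>z\<in>Ix y. Ide pcat (Fm y z)) \<in> upairs (Hom pcat) x y"
    by (rule pcat.upairs_rearr) (use assms in simp)
  then show ?thesis unfolding rr pcat_sel(3)
    using actp_rearr[OF assms(2,1)] Act_pstr_uid[OF _ reidxD(1)[OF assms(1)] reidxD(2)[OF assms(1)] assms(2)]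
    by (simp add: ure_restrict)
qed

lemma lax_algebra_lax_of: "lax_algebra lax_of"
proof (rule lax_algebra.intro, unfold lax_of_sel, goal_cases)
  case 1 show ?case by (rule category_pcat)
next
  case 2 show ?case using uid_arr by (auto simp: cat_ext_def pcat_def PiE_iff extensional_def)
next
  case 3 show ?case using uarr_profunctor(2) by (simp add: locally_small_def set_valued_def)
next
  case 4 show ?case by (rule small_pstr)
next
  case 5 show ?case by (simp add: prof_ext_def pstr_def)
next
  case 6 show ?case
    unfolding pcell_def
  proof (intro conjI allI impI)
    fix d c show "(\<lambda>u\<in>E d (eta c). u) \<in> Els (homp pcat) d c \<rightarrow>\<^sub>E Els pstr (fo ftr_id d) (fo (eta_ftr pcat) c)"
      by (auto simp: homp_def ftr_id_def eta_ftr_def)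
  next
    fix d d' c c' u v r assume "u \<in> Hom pcat d' d" "v \<in> Hom pcat c c'" "r \<in> Els (homp pcat) d c"
    then have a: "u \<in> E d' (eta d)" "v \<in> E c (eta c')" "r \<in> E d (eta c)" by (simp_all add: homp_def)
    note o = E_obj(2)[OF a(3)] eta_bobj[OF eta_E[OF a(2)]]
    show "(\<lambda>u\<in>E d' (eta c'). u) (Act (homp pcat) d d' c c' u v r) =
       Act pstr (fo ftr_id d) (fo ftr_id d') (fo (eta_ftr pcat) c) (fo (eta_ftr pcat) c') (fm ftr_id d' d u)
         (fm (eta_ftr pcat) c c' v) ((\<lambda>u\<in>E d (eta c). u) r)"
      using a Act_pstr[OF a(1) refl upairs_eta[OF a(2)] o a(3)]
      by (simp add: homp_def ftr_id_def eta_ftr_def upre_Els actp_eta)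
  qed
next
  case 7 show ?case by (rule dlt_natural_pcat)
next
  case (8 r a x)
  have r: "r \<in> E a x" using 8 by simp
  note a = E_obj(1)[OF r] and x = E_obj(2)[OF r]
  have m: "(\<lambda>z\<in>{star}. z, \<lambda>z\<in>{star}. r) \<in> upairs E (eta a) (eta x)"
    using r by (rule upairs_star)
  have p: "pull (eta a) (\<lambda>z\<in>{star}. z) (eta x :: ('u, ('u, 'u) ufam) ufam) = eta a" by (rule ufam_eqI) auto
  define q where "q = ucmp A a (eta a) (\<lambda>z\<in>{star}. x) (\<lambda>z\<in>{star}. r) (uid A a)"
  have q: "q \<in> E a (mu (eta x))" unfolding q_def by (rule ucmp_upre_arr[OF uid_E[OF a] r])
  have "dlt2 lax_of a (eta a) (eta x) (uid A a) (ucls E (eta a) (eta x) (\<lambda>z\<in>{star}. z, \<lambda>z\<in>{star}. r)) = q"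
    using dlt2_lax_of[OF uid_E[OF a] m eta_bobj[OF x]] ure_id[OF uid_E[OF a]] unfolding dl_def p q_def by simp
  \<comment> \<open>The unit axiom of the space describes \<open>q\<close> after its reindexing to
    \<open>x\<close>. Nothing is lost by that, because \<open>pair star\<close> and
    \<open>usnd\<close> are inverse index maps.\<close>
  also have "q = ure A a (mu (eta x)) (mu (eta x)) (\<lambda>w\<in>Ix (mu (eta x)). w) q" by (rule ure_id[OF q, symmetric])
  also have "\<dots> = ure A a x (mu (eta x)) (\<lambda>w\<in>Ix (mu (eta x)). usnd w) (ure A a (mu (eta x)) x (\<lambda>z\<in>Ix x. pair star z) q)"
    by (rule ure_comp_eq[OF q reidx_mu_eta[OF x] reidx_mu_eta'[OF x], symmetric]) (auto elim!: Ix_muE)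
  also have "ure A a (mu (eta x)) x (\<lambda>z\<in>Ix x. pair star z) q = r"
    using ucmp_uid_left[OF r] by (simp add: upre_def q_def)
  also have "ure A a x (mu (eta x)) (\<lambda>w\<in>Ix (mu (eta x)). usnd w) r = ract pcat pstr a x (mu (eta x)) (rearr pcat x (mu (eta x)) usnd) r"
    unfolding ract_rearr[OF reidx_mu_eta'[OF x] r] by (rule ure_restrict)
  finally have *: "dlt2 lax_of a (eta a) (eta x) (uid A a) (ucls E (eta a) (eta x) (\<lambda>z\<in>{star}. z, \<lambda>z\<in>{star}. r)) =
    ract pcat pstr a x (mu (eta x)) (rearr pcat x (mu (eta x)) usnd) r" .
  have e: "(\<lambda>u\<in>E a (eta a). u) (Ide pcat a) = uid A a" using a by (simp add: uid_E)
  show ?case unfolding e Els_pstr by (rule *)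
next
  case (9 r a x)
  have r: "r \<in> E a x" using 9 by simp
  note a = E_obj(1)[OF r] and x = E_obj(2)[OF r]
  let ?u = "\<lambda>z\<in>Ix x. uid A (Fm x z)"
  have e: "(\<lambda>z\<in>Ix x. (\<lambda>u\<in>E (Fm x z) (eta (Fm x z)). u) (Ide pcat (Fm x z))) = ?u"
    by (rule restrict_ext) (simp add: uid_E bobj_mem[OF x])
  note al = ualong_uid[OF x]
  have m: "(\<lambda>z\<in>Ix x. z, ?u) \<in> upairs E x (bmap eta x)"
    using uindex_id[OF bobj_ev[OF x]] bobj_mem[OF x] by (simp add: mem_upairs uid_E) (simp add: uindex_def)
  have p: "pull x (\<lambda>z\<in>Ix x. z) (bmap eta x) = x"
    by (rule ufam_eqI) (use bobj_ext[OF x] in \<open>simp_all cong: restrict_cong\<close>)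
  define q where "q = ucmp A a x (\<lambda>z\<in>Ix x. eta (Fm x z)) ?u r"
  have q: "q \<in> E a (mu (bmap eta x))" unfolding q_def by (rule ucmp_upost_arr[OF r al])
  have "dlt2 lax_of a x (bmap eta x) r (ucls E x (bmap eta x) (\<lambda>z\<in>Ix x. z, ?u)) = q"
    using dlt2_lax_of[OF r m bmap_eta_bobj[OF x]] ure_id[OF r] unfolding dl_def p q_def by simp
  also have "q = ure A a (mu (bmap eta x)) (mu (bmap eta x)) (\<lambda>w\<in>Ix (mu (bmap eta x)). w) q" by (rule ure_id[OF q, symmetric])
  also have "\<dots> = ure A a x (mu (bmap eta x)) (\<lambda>w\<in>Ix (mu (bmap eta x)). ufst w)
      (ure A a (mu (bmap eta x)) x (\<lambda>z\<in>Ix x. pair z star) q)"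
    by (rule ure_comp_eq[OF q reidx_mu_bmap_eta[OF x] reidx_mu_bmap_eta'[OF x], symmetric]) (auto elim!: Ix_muE)
  also have "ure A a (mu (bmap eta x)) x (\<lambda>z\<in>Ix x. pair z star) q = r"
    using ucmp_uid_right[OF r] by (simp add: upost_def q_def)
  also have "ure A a x (mu (bmap eta x)) (\<lambda>w\<in>Ix (mu (bmap eta x)). ufst w) r =
      ract pcat pstr a x (mu (bmap eta x)) (rearr pcat x (mu (bmap eta x)) ufst) r"
    unfolding ract_rearr[OF reidx_mu_bmap_eta'[OF x] r] by (rule ure_restrict)
  finally show ?case unfolding e Els_pstr .
next
  case (10 r a x s Y t Z)
  have r: "r \<in> E a x" using 10(1) by simp
  obtain p \<gamma> where s: "x \<in> bobj Pt" "Y \<in> bobj (bobj Pt)" "(p, \<gamma>) \<in> upairs E x Y" "s = ucls E x Y (p, \<gamma>)"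
    using 10(2) by (elim pbstrE)
  obtain p' k d where t0: "Y \<in> bobj (bobj (Obj pcat))" "Z \<in> bobj (bobj (Obj (beta pcat)))"
    "(p', \<lambda>w\<in>Ix Z. ucls (Els pstr) (Fm Y (p' w)) (Fm Z w) (k w, d w)) \<in> upairs (Els pbstr) Y Z"
    "t = ucls (Els pbstr) Y Z (p', \<lambda>w\<in>Ix Z. ucls (Els pstr) (Fm Y (p' w)) (Fm Z w) (k w, d w))"
    "\<And>w. w \<in> Ix Z \<Longrightarrow> (k w, d w) \<in> upairs (Els pstr) (Fm Y (p' w)) (Fm Z w)"
    by (rule bprofbE[OF 10(3)]) (rule that; assumption)
  have Z: "Z \<in> bobj (bobj (bobj Pt))" using t0(2) by simp
  let ?g = "\<lambda>w\<in>Ix Z. ucls E (Fm Y (p' w)) (Fm Z w) (k w, d w)"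
  have t: "(p', ?g) \<in> upairs (Els pbstr) Y Z" "t = ucls (Els pbstr) Y Z (p', ?g)"
    "\<And>w. w \<in> Ix Z \<Longrightarrow> (k w, d w) \<in> upairs E (Fm Y (p' w)) (Fm Z w)"
    using t0(3-5) by simp_all
  note pu = upairs_uindex[OF t(1)] and su = upairs_uindex[OF s(3)]
  have s': "(p, \<gamma>) \<in> upairs (Els pstr) x Y" using s(3) by simp
  note dE = dl_Els[OF r s(3,2)] and um = umult_upairs[OF pu t(3) Z]
  let ?K = "\<lambda>v\<in>Ix (mu Z). pair (p' (ufst v)) (k (ufst v) (usnd v))" and ?D = "\<lambda>v\<in>Ix (mu Z). d (ufst v) (usnd v)"
  have uM: "umult E Y Z t = ucls E (mu Y) (mu Z) (?K, ?D)"
    unfolding t(2) by (rule umult_ucls[OF t(1,3) Z])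
  have L: "dlt2 lax_of a (mu Y) (mu Z) (dlt2 lax_of a x Y r s) (umult E Y Z t) =
      dl a (mu Y) (mu Z) ?K ?D (dl a x Y p \<gamma> r)"
    unfolding s(4) dlt2_lax_of[OF r s(3,2)] uM
    by (rule dlt2_lax_of[OF dE um mu_bobj[OF Z]])
  let ?P = "pcomp (beta (beta pcat)) (beta pcat) pcat pstr pbstr"
  let ?c = "\<lambda>y. coend_cls (beta (beta pcat)) (beta pcat) pcat pstr pbstr (Fm x (p (p' y))) (Fm Z y) (Fm Y (p' y), \<gamma> (p' y), ?g y)"
  have gm: "\<gamma> (p' y) \<in> E (Fm x (p (p' y))) (Fm Y (p' y))" "?g y \<in> Els pbstr (Fm Y (p' y)) (Fm Z y)" if "y \<in> Ix Z" for y
    using upairs_mem[OF s(3) uindex_mem[OF pu that]] upairs_mem[OF t(1) that] by simp_all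
  have C: "compositor (beta (beta pcat)) (beta pcat) pcat pstr pbstr x Y Z s t =
      ucls (Els ?P) x Z (\<lambda>y\<in>Ix Z. p (p' y), \<lambda>y\<in>Ix Z. ?c y)"
    unfolding s(4) t(2) Els_pstr[symmetric] by (rule compositor_ucls[OF s' t(1)[folded Els_pstr]])
  have Cm: "(\<lambda>y\<in>Ix Z. p (p' y), \<lambda>y\<in>Ix Z. ?c y) \<in> upairs (Els ?P) x Z"
    unfolding mem_upairs using uindex_comp[OF su pu bobj_ev[OF Z]] gm
    by (auto intro!: PC.pcomp_ElsI)
  have bx: "bmap (\<lambda>a. a) x = x" by (rule bmap_id[OF s(1)]) simp
  have dc: "pdlt (Fm x (p (p' y))) (Fm Z y) (?c y) = dl (Fm x (p (p' y))) (Fm Y (p' y)) (Fm Z y) (k y) (d y) (\<gamma> (p' y))"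
    if "y \<in> Ix Z" for y
    unfolding pdlt_cls[OF gm[OF that]] using pdls_ucls[OF gm(1)[OF that] t(3)[OF that] bobj_mem[OF Z that]] that by simp
  let ?d = "\<lambda>y\<in>Ix Z. dl (Fm x (p (p' y))) (Fm Y (p' y)) (Fm Z y) (k y) (d y) (\<gamma> (p' y))"
  have "(\<lambda>z\<in>Ix Z. pdlt (Fm x ((\<lambda>y\<in>Ix Z. p (p' y)) z)) (Fm Z z) ((\<lambda>y\<in>Ix Z. ?c y) z)) = ?d"
    by (rule restrict_ext) (use dc in simp)
  then have B: "bcell pstr (\<lambda>a. a) mu pdlt x Z (compositor (beta (beta pcat)) (beta pcat) pcat pstr pbstr x Y Z s t) =
      ucls E x (bmap mu Z) (\<lambda>y\<in>Ix Z. p (p' y), ?d)"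
    unfolding C bcell_ucls[OF Cm] bx Els_pstr by (simp only:)
  have m: "(\<lambda>y\<in>Ix Z. p (p' y), ?d) \<in> upairs E x (bmap mu Z)"
    using uindex_comp[OF su pu bobj_ev[OF Z]] dl_Els[OF gm(1) t(3) bobj_mem[OF Z]]
    by (simp add: mem_upairs) (simp add: uindex_def)
  have dE2: "dl a (mu Y) (mu Z) ?K ?D (dl a x Y p \<gamma> r) \<in> E a (mu (mu Z))"
    by (rule dl_Els[OF dE um mu_bobj[OF Z]])
  show ?case
    unfolding Els_pstr L B dlt2_lax_of[OF r m bmap_mu_bobj[OF Z]] ract_rearr[OF reidx_reassoc[OF Z] dE2]
    by (rule dl_assoc[OF r s(3,2) Z pu t(3)])
qed

lemma normalized_lax_of: "normalized lax_of"
  by (simp add: normalized_def bij_betw_def inj_on_def)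

end

section \<open>The ultraconvergence space of a normalized lax algebra\<close>

locale cat_profunctor = C: category C + D: category D + F: profunctor C D F
  for C :: "('c, 'cm) cat" and D :: "('d, 'dm) cat" and F :: "('d, 'dm, 'c, 'cm, 'r) prof"
begin

text \<open>A joint action is the two one-sided actions in either order, so statements about
  \<open>Act\<close> reduce to one-sided ones.\<close>

lemma Act_split:
  assumes u: "u \<in> Hom D d' d" and v: "v \<in> Hom C c c'" and r: "r \<in> Els F d c"
  shows "Act F d d' c c' u v r = lact C F d d' c' u (ract D F d c c' v r)"
    "Act F d d' c c' u v r = ract D F d' c c' v (lact C F d d' c u r)"
proof -
  have o: "d \<in> Obj D" "d' \<in> Obj D" "c \<in> Obj C" "c' \<in> Obj C" using D.Hom_Obj[OF u] C.Hom_Obj[OF v] by auto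
  show "Act F d d' c c' u v r = lact C F d d' c' u (ract D F d c c' v r)"
    using F.Act_Cmp[OF D.Ide_Hom u v C.Ide_Hom r] o D.Cmp_Ide_left[OF u] C.Cmp_Ide_left[OF v] by simp
  show "Act F d d' c c' u v r = ract D F d' c c' v (lact C F d d' c u r)"
    using F.Act_Cmp[OF u D.Ide_Hom C.Ide_Hom v r] o D.Cmp_Ide_right[OF u] C.Cmp_Ide_right[OF v] by simp
qed

lemma ract_Els: "v \<in> Hom C c c' \<Longrightarrow> r \<in> Els F d c \<Longrightarrow> ract D F d c c' v r \<in> Els F d c'"
  using F.Act_Els D.Ide_Hom F.Els_Obj by blast

lemma lact_Els: "u \<in> Hom D d' d \<Longrightarrow> r \<in> Els F d c \<Longrightarrow> lact C F d d' c u r \<in> Els F d' c"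
  using F.Act_Els C.Ide_Hom F.Els_Obj by blast

lemma ract_comp:
  assumes "v \<in> Hom C c c'" "v' \<in> Hom C c' c''" "r \<in> Els F d c"
  shows "ract D F d c' c'' v' (ract D F d c c' v r) = ract D F d c c'' (Cmp C c c' c'' v' v) r"
  using F.Act_Cmp[OF D.Ide_Hom D.Ide_Hom assms] F.Els_Obj[OF assms(3)]
    D.Cmp_Ide_left[OF D.Ide_Hom] by simp

lemma lact_rearr_ucls:
  assumes g: "reidx (Obj D) x' x g" and t: "(t, \<zeta>) \<in> upairs (Els F) x Y" and Y: "Y \<in> bobj (Obj C)"
  shows "lact (beta C) (bprof C D F) x x' Y (rearr D x' x g) (ucls (Els F) x Y (t, \<zeta>)) =
    ucls (Els F) x' Y (\<lambda>w\<in>Ix Y. g (t w), \<zeta>)"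
  unfolding rearr_eq[OF g] Ide_beta bprof_Act[OF D.upairs_rearr[OF g] upairs_Ide[OF C.category_axioms Y] t]
proof (intro ucls_cong eventually_mono[OF bobj_ev[OF Y]])
  fix z assume z: "z \<in> Ix Y"
  note m = upairs_mem[OF t z] and tz = uindex_mem[OF upairs_uindex[OF t] z]
  show "fst (\<lambda>w\<in>Ix Y. g (t ((\<lambda>z\<in>Ix Y. z) w)),
             \<lambda>w\<in>Ix Y. Act F (Fm x (t ((\<lambda>z\<in>Ix Y. z) w))) (Fm x' (g (t ((\<lambda>z\<in>Ix Y. z) w)))) (Fm Y ((\<lambda>z\<in>Ix Y. z) w)) (Fm Y w)
               ((\<lambda>z\<in>Ix x. Ide D (Fm x z)) (t ((\<lambda>z\<in>Ix Y. z) w))) ((\<lambda>z\<in>Ix Y. Ide C (Fm Y z)) w) (\<zeta> ((\<lambda>z\<in>Ix Y. z) w))) z =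
         fst (\<lambda>w\<in>Ix Y. g (t w), \<zeta>) z \<and>
         snd (\<lambda>w\<in>Ix Y. g (t ((\<lambda>z\<in>Ix Y. z) w)),
             \<lambda>w\<in>Ix Y. Act F (Fm x (t ((\<lambda>z\<in>Ix Y. z) w))) (Fm x' (g (t ((\<lambda>z\<in>Ix Y. z) w)))) (Fm Y ((\<lambda>z\<in>Ix Y. z) w)) (Fm Y w)
               ((\<lambda>z\<in>Ix x. Ide D (Fm x z)) (t ((\<lambda>z\<in>Ix Y. z) w))) ((\<lambda>z\<in>Ix Y. Ide C (Fm Y z)) w) (\<zeta> ((\<lambda>z\<in>Ix Y. z) w))) z =
         snd (\<lambda>w\<in>Ix Y. g (t w), \<zeta>) z"
    using z tz reidxD(5)[OF g tz] F.Act_Ide[OF m] by simp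
qed

lemma ract_ucls:
  assumes l: "(l, \<delta>) \<in> upairs (Hom C) Y Z" and t: "(t, \<zeta>) \<in> upairs (Els F) x Y"
    and x: "x \<in> bobj (Obj D)"
  shows "ract (beta D) (bprof C D F) x Y Z (ucls (Hom C) Y Z (l, \<delta>)) (ucls (Els F) x Y (t, \<zeta>)) =
    ucls (Els F) x Z (\<lambda>w\<in>Ix Z. t (l w), \<lambda>w\<in>Ix Z. ract D F (Fm x (t (l w))) (Fm Y (l w)) (Fm Z w) (\<delta> w) (\<zeta> (l w)))"
  unfolding Ide_beta bprof_Act[OF upairs_Ide[OF D.category_axioms x] l t]
  using uindex_mem[OF upairs_uindex[OF l]] uindex_mem[OF upairs_uindex[OF t]]
  by (auto intro!: ucls_cong cong: restrict_cong)

lemma ract_rearr_ucls: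
  assumes g: "reidx (Obj C) Y Z g" and t: "(t, \<zeta>) \<in> upairs (Els F) x Y" and x: "x \<in> bobj (Obj D)"
  shows "ract (beta D) (bprof C D F) x Y Z (rearr C Y Z g) (ucls (Els F) x Y (t, \<zeta>)) =
    ucls (Els F) x Z (\<lambda>w\<in>Ix Z. t (g w), \<lambda>w\<in>Ix Z. \<zeta> (g w))"
proof -
  have "(\<lambda>w\<in>Ix Z. ract D F (Fm x (t (g w))) (Fm Y (g w)) (Fm Z w) ((\<lambda>z\<in>Ix Z. Ide C (Fm Z z)) w) (\<zeta> (g w))) =
    (\<lambda>w\<in>Ix Z. \<zeta> (g w))"
  proof (rule restrict_ext)
    fix w assume w: "w \<in> Ix Z"
    note gw = reidxD(4)[OF g w] and e = reidxD(5)[OF g w]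
    show "ract D F (Fm x (t (g w))) (Fm Y (g w)) (Fm Z w) ((\<lambda>z\<in>Ix Z. Ide C (Fm Z z)) w) (\<zeta> (g w)) = \<zeta> (g w)"
      using F.Act_Ide[OF upairs_mem[OF t gw]] w by (simp add: e)
  qed
  then show ?thesis unfolding rearr_eq[OF g] ract_ucls[OF C.upairs_rearr[OF g] t x] by (simp only:)
qed

end

text \<open>Families of identities multiply to a family of identities, so \<mu> sends layered
  reindexings to reindexings.\<close>

lemma umult_rearr_family:
  assumes C: "category C" and X: "X \<in> bobj (bobj (Obj C))" and Y: "Y \<in> bobj (bobj (Obj C))" and g: "uindex X Y g"
    and k: "\<And>y. y \<in> Ix Y \<Longrightarrow> reidx (Obj C) (Fm X (g y)) (Fm Y y) (k y)"
  shows "umult (Hom C) X Y (ucls (Hom (beta C)) X Y (g, \<lambda>y\<in>Ix Y. rearr C (Fm X (g y)) (Fm Y y) (k y))) =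
    rearr C (mu X) (mu Y) (\<lambda>v\<in>Ix (mu Y). pair (g (ufst v)) (k (ufst v) (usnd v)))"
    "(g, \<lambda>y\<in>Ix Y. rearr C (Fm X (g y)) (Fm Y y) (k y)) \<in> upairs (Hom (beta C)) X Y"
proof -
  interpret category C by fact
  have p: "(g, \<lambda>y\<in>Ix Y. rearr C (Fm X (g y)) (Fm Y y) (k y)) \<in> upairs (Hom (beta C)) X Y"
    using g by (auto simp: mem_upairs intro!: rearr_Hom k)
  then show "(g, \<lambda>y\<in>Ix Y. rearr C (Fm X (g y)) (Fm Y y) (k y)) \<in> upairs (Hom (beta C)) X Y" .
  have e: "(\<lambda>y\<in>Ix Y. rearr C (Fm X (g y)) (Fm Y y) (k y)) =
      (\<lambda>y\<in>Ix Y. ucls (Hom C) (Fm X (g y)) (Fm Y y) (k y, \<lambda>z\<in>Ix (Fm Y y). Ide C (Fm (Fm Y y) z)))"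
    by (rule restrict_ext) (rule rearr_eq[OF k])
  have i: "(\<lambda>v\<in>Ix (mu Y). (\<lambda>z\<in>Ix (Fm Y (ufst v)). Ide C (Fm (Fm Y (ufst v)) z)) (usnd v)) = (\<lambda>z\<in>Ix (mu Y). Ide C (Fm (mu Y) z))"
    by (rule restrict_mu_cong) (simp add: Fm_mu)
  have "umult (Hom C) X Y (ucls (Hom (beta C)) X Y (g, \<lambda>y\<in>Ix Y. rearr C (Fm X (g y)) (Fm Y y) (k y))) =
     ucls (Hom C) (mu X) (mu Y) (\<lambda>v\<in>Ix (mu Y). pair (g (ufst v)) (k (ufst v) (usnd v)), \<lambda>z\<in>Ix (mu Y). Ide C (Fm (mu Y) z))"
    unfolding e i[symmetric] by (rule umult_ucls[OF p[unfolded e] upairs_rearr[OF k] Y])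
  also have "\<dots> = rearr C (mu X) (mu Y) (\<lambda>v\<in>Ix (mu Y). pair (g (ufst v)) (k (ufst v) (usnd v)))"
    by (rule rearr_eq[OF reidx_mu[OF X Y g k], symmetric])
  finally show "umult (Hom C) X Y (ucls (Hom (beta C)) X Y (g, \<lambda>y\<in>Ix Y. rearr C (Fm X (g y)) (Fm Y y) (k y))) =
    rearr C (mu X) (mu Y) (\<lambda>v\<in>Ix (mu Y). pair (g (ufst v)) (k (ufst v) (usnd v)))" .
qed

lemma umult_rearr:
  assumes C: "category C" and g: "reidx (bobj (Obj C)) X Y g"
  shows "umult (Hom C) X Y (rearr (beta C) X Y g) =
    rearr C (mu X) (mu Y) (\<lambda>v\<in>Ix (mu Y). pair (g (ufst v)) (usnd v))"
proof -
  note G = reidxD[OF g]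
  have k: "reidx (Obj C) (Fm X (g y)) (Fm Y y) (\<lambda>z\<in>Ix (Fm Y y). z)" if "y \<in> Ix Y" for y
    using G(5)[OF that] bobj_mem[OF G(2) that] by (simp add: reidx_id del: restrict_apply)
  have "rearr (beta C) X Y g = ucls (Hom (beta C)) X Y (g, \<lambda>y\<in>Ix Y. rearr C (Fm X (g y)) (Fm Y y) (\<lambda>z\<in>Ix (Fm Y y). z))"
    unfolding rearr_eq[OF g] Ide_beta_rearr using G(5) by (simp cong: restrict_cong)
  then have "umult (Hom C) X Y (rearr (beta C) X Y g) =
      rearr C (mu X) (mu Y) (\<lambda>v\<in>Ix (mu Y). pair (g (ufst v)) ((\<lambda>z\<in>Ix (Fm Y (ufst v)). z) (usnd v)))"
    using umult_rearr_family(1)[OF C G(1,2,3) k] by simp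
  also have "(\<lambda>v\<in>Ix (mu Y). pair (g (ufst v)) ((\<lambda>z\<in>Ix (Fm Y (ufst v)). z) (usnd v))) = (\<lambda>v\<in>Ix (mu Y). pair (g (ufst v)) (usnd v))"
    by (rule restrict_mu_cong) simp
  finally show ?thesis .
qed

locale nlax_algebra = lax_algebra B for B :: "'u::universe lax_alg" +
  assumes norm: "normalized B"
begin

abbreviation "C \<equiv> bas B"
abbreviation "Pt \<equiv> Obj (bas B)"
abbreviation "S \<equiv> str B"
abbreviation "E \<equiv> Els (str B)"

sublocale C: category "bas B" by (rule bas_category)

lemma profunctor_str: "profunctor (beta (bas B)) (bas B) (str B)"
  using str_profunctor(1) by (simp add: small_profunctor_def)

sublocale S: cat_profunctor "beta (bas B)" "bas B" "str B"
  by (intro cat_profunctor.intro category_beta bas_category profunctor_str)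

sublocale bS: cat_profunctor "beta (beta (bas B))" "beta (bas B)" "bstr B"
  by (intro cat_profunctor.intro category_beta bas_category profunctor_bprof profunctor_str)

sublocale PC: composable "beta (beta (bas B))" "beta (bas B)" "bas B" "str B" "bstr B"
  by (intro composable.intro category_beta bas_category profunctor_bprof profunctor_str)

lemma E_obj: "r \<in> E a x \<Longrightarrow> a \<in> Pt" "r \<in> E a x \<Longrightarrow> x \<in> bobj Pt"
  using S.F.Els_Obj by auto

lemma bstrI: "x \<in> bobj Pt \<Longrightarrow> Y \<in> bobj (bobj Pt) \<Longrightarrow> p \<in> upairs E x Y \<Longrightarrow> ucls E x Y p \<in> Els (bstr B) x Y"
  by (rule bprofI) simp_all

lemma bstrE:
  assumes "s \<in> Els (bstr B) x Y"
  obtains t \<zeta> where "x \<in> bobj Pt" "Y \<in> bobj (bobj Pt)" "(t, \<zeta>) \<in> upairs E x Y" "s = ucls E x Y (t, \<zeta>)"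
  using assms by (elim bprofE) simp

section \<open>Naturality of \<Delta> on pairs\<close>

lemma dlt2_Act:
  assumes r: "r \<in> E a x" and s: "s \<in> Els (bstr B) x Y" and u: "u \<in> Hom C a' a" and V: "V \<in> Hom (beta (beta C)) Y Z"
  shows "dlt2 B a' x Z (lact (beta C) S a a' x u r) (ract (beta C) (bstr B) x Y Z V s) =
    Act S a a' (mu Y) (mu Z) u (umult (Hom C) Y Z V) (dlt2 B a x Y r s)"
proof -
  let ?P = "pcomp (beta (beta C)) (beta C) C S (bstr B)"
  have "dlt B a' Z (Act ?P a a' Y Z u V P) = Act S a a' (mu Y) (mu Z) u (umult (Hom C) Y Z V) (dlt B a Y P)"
    if "P \<in> Els ?P a Y" for P
    using dlt_natural u V that by (simp add: pcell_def ftr_id_def mu_ftr_def)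
  from this[OF PC.pcomp_ElsI[OF r s]] show ?thesis unfolding dlt2_def PC.pcomp_Act[OF u V r s] .
qed

lemma dlt2_Els:
  assumes r: "r \<in> E a x" and s: "s \<in> Els (bstr B) x Y"
  shows "dlt2 B a x Y r s \<in> E a (mu Y)"
  using dlt_natural[unfolded pcell_def] PC.pcomp_ElsI[OF r s]
  by (auto simp: dlt2_def ftr_id_def mu_ftr_def)

lemma umult_Ide:
  assumes "Y \<in> bobj (bobj Pt)"
  shows "umult (Hom C) Y Y (Ide (beta (beta C)) Y) = Ide (beta C) (mu Y)"
proof -
  have "(\<lambda>v\<in>Ix (mu Y). pair ((\<lambda>z\<in>Ix Y. z) (ufst v)) (usnd v)) = (\<lambda>v\<in>Ix (mu Y). v)"
    by (rule restrict_mu_cong) simp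
  then show ?thesis unfolding Ide_beta_rearr umult_rearr[OF bas_category(1) reidx_id[OF assms]] by (simp only:)
qed

lemma dlt2_lact:
  assumes r: "r \<in> E a x" and s: "s \<in> Els (bstr B) x Y" and u: "u \<in> Hom C a' a"
  shows "dlt2 B a' x Y (lact (beta C) S a a' x u r) s = lact (beta C) S a a' (mu Y) u (dlt2 B a x Y r s)"
proof -
  have Y: "Y \<in> bobj (bobj Pt)" using s by (elim bstrE)
  have "Ide (beta (beta C)) Y \<in> Hom (beta (beta C)) Y Y" using bS.C.Ide_Hom Y by simp
  from dlt2_Act[OF r s u this] show ?thesis using bS.F.Act_Ide[OF s] umult_Ide[OF Y] by simp
qed

lemma dlt2_ract:
  assumes r: "r \<in> E a x" and s: "s \<in> Els (bstr B) x Y" and V: "V \<in> Hom (beta (beta C)) Y Z"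
  shows "dlt2 B a x Z r (ract (beta C) (bstr B) x Y Z V s) =
    ract C S a (mu Y) (mu Z) (umult (Hom C) Y Z V) (dlt2 B a x Y r s)"
  using dlt2_Act[OF r s C.Ide_Hom[OF E_obj(1)[OF r]] V] S.F.Act_Ide[OF r] by simp

lemma dlt2_dinatural:
  assumes "v \<in> Hom (beta C) x x'" "r \<in> E a x" "s \<in> Els (bstr B) x' Y"
  shows "dlt2 B a x' Y (ract C S a x x' v r) s = dlt2 B a x Y r (lact (beta (beta C)) (bstr B) x' x Y v s)"
  unfolding dlt2_def PC.coend_dinatural[OF assms] ..

text \<open>A morphism of \<beta> of a discrete category carries no data besides its index map, so
  only \<open>fst (rep v)\<close> enters the action. In \<open>ucmp\<close> a family is read as a
  germ over the identity index map.\<close>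

definition usp :: "'u ucspace" where
  "usp = \<lparr> upts = Pt,
     uarr = \<lparr> Els = E, Act = (\<lambda>d d' x y u v r.
       if u \<in> Hom (disc Pt) d' d \<and> v \<in> Hom (beta (disc Pt)) x y \<and> r \<in> E d x
       then ract C S d x y (rearr C x y (fst (rep v))) r else undefined) \<rparr>,
     uid = (\<lambda>a\<in>Pt. gam B a a (Ide C a)),
     ucmp = (\<lambda>a x Y s r. if r \<in> E a x \<and> Y \<in> Ix x \<rightarrow>\<^sub>E bobj Pt \<and> s \<in> (\<Pi>\<^sub>E z\<in>Ix x. E (Fm x z) (Y z))
       then dlt2 B a x (over x Y) r (ucls E x (over x Y) (\<lambda>z\<in>Ix x. z, s)) else undefined) \<rparr>"

lemma usp_sel [simp]: "upts usp = Pt" "Els (uarr usp) = E" "uid usp = (\<lambda>a\<in>Pt. gam B a a (Ide C a))"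
  by (simp_all add: usp_def)

lemma ufamily_usp: "ufamily usp x Y s \<longleftrightarrow> Y \<in> Ix x \<rightarrow>\<^sub>E bobj Pt \<and> s \<in> (\<Pi>\<^sub>E z\<in>Ix x. E (Fm x z) (Y z))"
  by (simp add: ufamily_def)

lemma ucmp_usp: "r \<in> E a x \<Longrightarrow> ufamily usp x Y s \<Longrightarrow>
    ucmp usp a x Y s r = dlt2 B a x (over x Y) r (ucls E x (over x Y) (\<lambda>z\<in>Ix x. z, s))"
  by (simp add: ufamily_usp) (simp add: usp_def)

lemma reindex_usp: "reindex usp x y g \<longleftrightarrow> reidx Pt x y g"
  by (simp add: reindex_iff)

text \<open>Over a discrete category the family of a germ is forced by its endpoints, which leaves
  the index map.\<close>

lemma disc_HomE:
  assumes "v \<in> Hom (beta (disc T)) x y"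
  obtains g where "reidx T x y g" "v = rearr (disc T) x y g"
proof -
  obtain g \<alpha> where g: "x \<in> bobj T" "y \<in> bobj T" "(g, \<alpha>) \<in> upairs (Hom (disc T)) x y"
    "v = ucls (Hom (disc T)) x y (g, \<alpha>)"
    using assms by (elim HomBE) simp
  have m: "Fm x (g z) = Fm y z \<and> \<alpha> z = Fm y z" if "z \<in> Ix y" for z
    using upairs_mem[OF g(3) that] by simp
  have r: "reidx T x y g" using g m upairs_uindex[OF g(3)] by (simp add: reidx_def)
  have "ucls (Hom (disc T)) x y (g, \<alpha>) = rearr (disc T) x y g"
    unfolding rearr_eq[OF r] by (intro ucls_cong eventually_mono[OF bobj_ev[OF g(2)]]) (simp add: m)
  with r g(4) show ?thesis using that by simp
qed

text \<open>The index map chosen by \<open>rep\<close> agrees with \<open>g\<close> almost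
  everywhere only, a difference that \<open>rearr\<close> does not see.\<close>

lemma Act_usp:
  assumes g: "reidx Pt x y g" and r: "r \<in> E a x"
  shows "Act (uarr usp) a a x y a (rearr (disc Pt) x y g) r = ract C S a x y (rearr C x y g) r"
proof -
  interpret D: category "disc Pt" by (rule category_disc)
  have p: "(g, \<lambda>z\<in>Ix y. Ide (disc Pt) (Fm y z)) \<in> upairs (Hom (disc Pt)) x y"
    using D.upairs_rearr[of x y g] g by simp
  obtain g' \<alpha>' where p': "rep (rearr (disc Pt) x y g) = (g', \<alpha>')"
    "\<forall>\<^sub>F z in Uf y. g' z = g z \<and> \<alpha>' z = (\<lambda>z\<in>Ix y. Ide (disc Pt) (Fm y z)) z"
    using rep_ucls[OF p] unfolding rearr_eq[OF g] by blast
  have "rearr C x y g' = rearr C x y g" by (rule rearr_cong) (use p'(2) in \<open>auto elim: eventually_mono\<close>)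
  then show ?thesis using D.rearr_Hom[of x y g] g r E_obj(1)[OF r] by (simp add: usp_def p')
qed

lemma ure_usp: "reidx Pt x y g \<Longrightarrow> r \<in> E a x \<Longrightarrow> ure usp a x y g r = ract C S a x y (rearr C x y g) r"
  by (simp add: ure_def Act_usp)

lemma ract_rearr_Els: "reidx Pt x y g \<Longrightarrow> r \<in> E a x \<Longrightarrow> ract C S a x y (rearr C x y g) r \<in> E a y"
  by (rule S.ract_Els[OF C.rearr_Hom])

lemma ract_rearr_comp:
  assumes "reidx Pt x y g" "reidx Pt y z h" "r \<in> E a x" "\<And>w. w \<in> Ix z \<Longrightarrow> g (h w) = k w"
  shows "ract C S a y z (rearr C y z h) (ract C S a x y (rearr C x y g) r) = ract C S a x z (rearr C x z k) r"
proof -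
  have "(\<lambda>w\<in>Ix z. g (h w)) = (\<lambda>w\<in>Ix z. k w)" by (rule restrict_ext) (rule assms(4))
  then show ?thesis
    unfolding S.ract_comp[OF C.rearr_Hom[OF assms(1)] C.rearr_Hom[OF assms(2)] assms(3)] C.Cmp_rearr[OF assms(1,2)]
    by (simp only: rearr_restrict)
qed

lemma ract_rearr_id: "r \<in> E a x \<Longrightarrow> (\<And>z. z \<in> Ix x \<Longrightarrow> g z = z) \<Longrightarrow> ract C S a x x (rearr C x x g) r = r"
  using S.F.Act_Ide[of r a x] rearr_restrict[of C x x g] rearr_restrict[of C x x "\<lambda>z. z"]
  by (simp add: Ide_beta_rearr cong: restrict_cong)

lemma profunctor_usp: "profunctor (beta (disc Pt)) (disc Pt) (uarr usp)"
proof -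
  interpret D: category "disc Pt" by (rule category_disc)
  have d: "Cmp (disc Pt) a b c f g = a" for a b c f g by (simp add: disc_def)
  show ?thesis
  proof (standard, goal_cases)
    case (1 r d c) then show ?case by (simp add: E_obj)
  next
    case (2 u d' d v c c' r)
    then show ?case by (elim disc_HomE) (simp add: Act_usp ract_rearr_Els)
  next
    case (3 r d c)
    then show ?case using E_obj[of r d c] by (simp add: Ide_beta_rearr Act_usp reidx_id ract_rearr_id)
  next
    case (4 u d' d u' d'' v c c' v' c'' r)
    obtain g where g: "reidx Pt c c' g" "v = rearr (disc Pt) c c' g" using 4(3) by (rule disc_HomE)
    obtain h where h: "reidx Pt c' c'' h" "v' = rearr (disc Pt) c' c'' h" using 4(4) by (rule disc_HomE)
    have "Cmp (beta (disc Pt)) c c' c'' v' v = rearr (disc Pt) c c'' (\<lambda>w\<in>Ix c''. g (h w))"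
      using D.Cmp_rearr[of c c' g c'' h] g h by simp
    then show ?case using 4 g h ract_rearr_comp[OF g(1) h(1), of r d "\<lambda>w\<in>Ix c''. g (h w)"]
      by (simp add: d Act_usp reidx_comp[OF g(1) h(1)] ract_rearr_Els)
  qed
qed

lemma upairs_ufamily_usp:
  assumes "ufamily usp x Y s" "x \<in> bobj Pt"
  shows "(\<lambda>z\<in>Ix x. z, s) \<in> upairs E x (over x Y)" "over x Y \<in> bobj (bobj Pt)"
    "ucls E x (over x Y) (\<lambda>z\<in>Ix x. z, s) \<in> Els (bstr B) x (over x Y)"
proof -
  show p: "(\<lambda>z\<in>Ix x. z, s) \<in> upairs E x (over x Y)"
    using assms uindex_id[OF bobj_ev[OF assms(2)]] by (simp add: mem_upairs ufamily_usp PiE_iff) (simp add: uindex_def)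
  show o: "over x Y \<in> bobj (bobj Pt)" using assms by (simp add: ufamily_usp over_bobj)
  show "ucls E x (over x Y) (\<lambda>z\<in>Ix x. z, s) \<in> Els (bstr B) x (over x Y)" by (rule bstrI[OF assms(2) o p])
qed

text \<open>The left action of the reindexing along \<open>t\<close> turns the family \<zeta> over
  the identity into the germ of \<open>(t, \<zeta>)\<close>, and dinaturality moves this reindexing
  onto \<open>r\<close>. Hence \<Delta> is determined by composition and reindexing in the
  space.\<close>

lemma dlt2_pull:
  assumes r: "r \<in> E a x" and t: "(t, \<zeta>) \<in> upairs E x Y" and Y: "Y \<in> bobj (bobj Pt)"
  shows "dlt2 B a x Y r (ucls E x Y (t, \<zeta>)) =
    ucmp usp a (pull x t Y) (Fm Y) \<zeta> (ure usp a x (pull x t Y) t r)"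
    "ufamily usp (pull x t Y) (Fm Y) \<zeta>"
proof -
  note x = E_obj(2)[OF r] and tu = upairs_uindex[OF t]
  let ?x = "pull x t Y"
  have g: "reidx Pt x ?x t" by (rule reidx_pull[OF x Y tu])
  have f: "ufamily usp ?x (Fm Y) \<zeta>"
    using t bobj_Fm[OF Y] by (auto simp: ufamily_usp mem_upairs PiE_iff)
  have o: "over ?x (Fm Y) = Y" by (rule over_eq) simp_all
  note p = upairs_ufamily_usp[OF f reidxD(2)[OF g], unfolded o]
  have "lact (beta (beta C)) (bstr B) ?x x Y (rearr C x ?x t) (ucls E ?x Y (\<lambda>z\<in>Ix ?x. z, \<zeta>)) =
    ucls E x Y (\<lambda>w\<in>Ix Y. t ((\<lambda>z\<in>Ix ?x. z) w), \<zeta>)"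
    by (rule S.lact_rearr_ucls[OF g p(1)]) (use Y in simp)
  also have "(\<lambda>w\<in>Ix Y. t ((\<lambda>z\<in>Ix ?x. z) w)) = (\<lambda>w\<in>Ix Y. t w)" by (rule restrict_ext) simp
  also have "(\<lambda>w\<in>Ix Y. t w) = t" using tu unfolding uindex_def by (blast dest: PiE_restrict)
  finally have L: "lact (beta (beta C)) (bstr B) ?x x Y (rearr C x ?x t) (ucls E ?x Y (\<lambda>z\<in>Ix ?x. z, \<zeta>)) = ucls E x Y (t, \<zeta>)" .
  show "dlt2 B a x Y r (ucls E x Y (t, \<zeta>)) = ucmp usp a ?x (Fm Y) \<zeta> (ure usp a x ?x t r)"
    unfolding ure_usp[OF g r] ucmp_usp[OF ract_rearr_Els[OF g r] f] o
      dlt2_dinatural[OF C.rearr_Hom[OF g] r p(3)] L ..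
  show "ufamily usp ?x (Fm Y) \<zeta>" by (rule f)
qed

section \<open>\<Gamma> and composition with unary arrows\<close>

lemma gam_E: "u \<in> Hom C a b \<Longrightarrow> gam B a b u \<in> E a (eta b)"
  using gam_natural unfolding pcell_def by (auto simp: homp_def ftr_id_def eta_ftr_def)

lemma eta_E: "r \<in> E a (eta b) \<Longrightarrow> b \<in> Pt"
  using E_obj(2)[of r a "eta b"] by (simp add: eta_bobj_iff)

text \<open>Outside the objects both sides are empty, so normalization extends to all indices and
  later case distinctions disappear.\<close>

lemma gam_bij: "bij_betw (gam B a b) (Hom C a b) (E a (eta b))"
proof (cases "a \<in> Pt \<and> b \<in> Pt")
  case True then show ?thesis using norm by (simp add: normalized_def)
next
  case False
  then have "Hom C a b = {}" "E a (eta b) = {}" using C.Hom_Obj E_obj(1) eta_E by blast+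
  then show ?thesis by (simp add: bij_betw_def)
qed

lemma gam_Act:
  assumes "u \<in> Hom C d' d" "v \<in> Hom C c c'" "r \<in> Hom C d c"
  shows "gam B d' c' (Cmp C d' d c' (Cmp C d c c' v r) u) =
    Act S d d' (eta c) (eta c') u (ucls (Hom C) (eta c) (eta c') (\<lambda>z\<in>{star}. z, \<lambda>z\<in>{star}. v)) (gam B d c r)"
  using gam_natural assms unfolding pcell_def by (simp add: homp_def ftr_id_def eta_ftr_def)

lemma Ide_beta_eta: "ucls (Hom C) (eta c) (eta c) (\<lambda>z\<in>{star}. z, \<lambda>z\<in>{star}. Ide C c) = Ide (beta C) (eta c)"
  unfolding Ide_beta by (intro ucls_cong) simp

lemma gam_lact:
  assumes u: "u \<in> Hom C d' d" and r: "r \<in> Hom C d c"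
  shows "gam B d' c (Cmp C d' d c r u) = lact (beta C) S d d' (eta c) u (gam B d c r)"
  using gam_Act[OF u C.Ide_Hom r] C.Hom_Obj[OF r] C.Cmp_Ide_left[OF r] by (simp add: Ide_beta_eta)

lemma gam_ract:
  assumes v: "v \<in> Hom C c c'" and r: "r \<in> Hom C d c"
  shows "gam B d c' (Cmp C d c c' v r) = ract C S d (eta c) (eta c')
    (ucls (Hom C) (eta c) (eta c') (\<lambda>z\<in>{star}. z, \<lambda>z\<in>{star}. v)) (gam B d c r)"
  using gam_Act[OF C.Ide_Hom v r] C.Hom_Obj[OF r] C.Cmp_Ide_right[OF C.Cmp_Hom[OF r v]] by simp

lemma gam_Ide_E: "a \<in> Pt \<Longrightarrow> gam B a a (Ide C a) \<in> E a (eta a)"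
  by (rule gam_E[OF C.Ide_Hom])

lemma ufamily_usp_eta: "r \<in> E b x \<Longrightarrow> ufamily usp (eta b) (\<lambda>z\<in>{star}. x) (\<lambda>z\<in>{star}. r)"
  by (auto simp: ufamily_usp E_obj)

lemma upre_usp:
  assumes u: "u \<in> E a (eta b)" and r: "r \<in> E b x"
  shows "upre usp a b x r u = ract C S a (mu (eta x)) x (rearr C (mu (eta x)) x (\<lambda>z\<in>Ix x. pair star z))
    (dlt2 B a (eta b) (eta x) u (ucls E (eta b) (eta x) (\<lambda>z\<in>{star}. z, \<lambda>z\<in>{star}. r)))"
proof -
  note f = ufamily_usp_eta[OF r] and x = E_obj(2)[OF r]
  note p = upairs_ufamily_usp[OF f E_obj(2)[OF u]]
  show ?thesis
    unfolding upre_def ucmp_usp[OF u f]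
    using ure_usp[OF reidx_mu_eta[OF x] dlt2_Els[OF u p(3)[unfolded over_eta]]] by simp
qed

lemma upre_uid_usp: "r \<in> E a x \<Longrightarrow> upre usp a a x r (gam B a a (Ide C a)) = r"
proof -
  assume r: "r \<in> E a x"
  note x = E_obj(2)[OF r]
  have "rearr C x (mu (eta x)) usnd = rearr C x (mu (eta x)) (\<lambda>w\<in>Ix (mu (eta x)). usnd w)"
    by (rule rearr_restrict[symmetric])
  then show ?thesis unfolding upre_usp[OF gam_Ide_E[OF E_obj(1)[OF r]] r] unit_left[OF r]
    using ract_rearr_comp[OF reidx_mu_eta'[OF x] reidx_mu_eta[OF x] r, of "\<lambda>z. z"]
      ract_rearr_id[OF r] by simp
qed

text \<open>\<Gamma>(u) is \<Gamma>(id) acted on by \<open>u\<close>, and \<Delta> is natural on the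
  left. Composing \<open>r\<close> with \<Gamma>(u) is therefore the action of \<open>u\<close> on
  the composite of \<open>r\<close> with \<Gamma>(id), and that composite is \<open>r\<close> by the
  left unit law.\<close>

lemma lact_upre:
  assumes u: "u \<in> Hom C a' a" and r: "r \<in> E a x"
  shows "lact (beta C) S a a' x u r = upre usp a' a x r (gam B a' a u)"
proof -
  note a = E_obj(1)[OF r] and x = E_obj(2)[OF r]
  note i = gam_Ide_E[OF a]
  have g: "gam B a' a u = lact (beta C) S a a' (eta a) u (gam B a a (Ide C a))"
    using gam_lact[OF u C.Ide_Hom[OF a]] C.Cmp_Ide_left[OF u] by simp
  note p = upairs_ufamily_usp[OF ufamily_usp_eta[OF r] eta_bobj[OF a], unfolded over_eta]
  have p': "ucls E (eta a) (eta x) (\<lambda>z\<in>{star}. z, \<lambda>z\<in>{star}. r) \<in> Els (bstr B) (eta a) (eta x)"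
    using p(3) by simp
  let ?q = "dlt2 B a (eta a) (eta x) (gam B a a (Ide C a)) (ucls E (eta a) (eta x) (\<lambda>z\<in>{star}. z, \<lambda>z\<in>{star}. r))"
  have h: "rearr C (mu (eta x)) x (\<lambda>z\<in>Ix x. pair star z) \<in> Hom (beta C) (mu (eta x)) x"
    by (rule C.rearr_Hom[OF reidx_mu_eta[OF x]])
  have "upre usp a' a x r (gam B a' a u) =
    ract C S a' (mu (eta x)) x (rearr C (mu (eta x)) x (\<lambda>z\<in>Ix x. pair star z)) (lact (beta C) S a a' (mu (eta x)) u ?q)"
    unfolding upre_usp[OF gam_E[OF u] r] unfolding g dlt2_lact[OF i p' u] ..
  also have "\<dots> = lact (beta C) S a a' x u (ract C S a (mu (eta x)) x (rearr C (mu (eta x)) x (\<lambda>z\<in>Ix x. pair star z)) ?q)"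
    using S.Act_split[OF u h dlt2_Els[OF i p']] by simp
  also have "ract C S a (mu (eta x)) x (rearr C (mu (eta x)) x (\<lambda>z\<in>Ix x. pair star z)) ?q = r"
    using upre_uid_usp[OF r] unfolding upre_usp[OF i r] .
  finally show ?thesis by simp
qed

text \<open>With this \<Gamma> becomes an isomorphism of categories from \<open>A\<^sub>0\<close> to
  the category of points, along which smallness is transported.\<close>

lemma gam_Cmp:
  assumes "f \<in> Hom C a b" "g \<in> Hom C b c"
  shows "gam B a c (Cmp C a b c g f) = upre usp a b (eta c) (gam B b c g) (gam B a b f)"
  unfolding gam_lact[OF assms] by (rule lact_upre[OF assms(1) gam_E[OF assms(2)]])

lemma ultraconvergence_space_usp: "ultraconvergence_space usp"
proof (rule ultraconvergence_space.intro, goal_cases)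
  case 1 show ?case using profunctor_usp by simp
next
  case 2 show ?case using str_profunctor(1) by (simp add: small_profunctor_def set_valued_def)
next
  case 3 show ?case by (simp add: prof_ext_def) (simp add: usp_def)
next
  case (4 x)
  then have x: "x \<in> Obj (beta C)" by simp
  have sm: "small_colim_of_representables C (prof_presheaf (beta C) S x)"
    using str_profunctor(1) x unfolding small_profunctor_def by blast
  have ue: "upre usp d' d x r (gam B d' d u) \<in> E d' x" if "u \<in> Hom C d' d" "r \<in> E d x" for d d' u r
    using S.lact_Els[OF that] lact_upre[OF that] by simp
  show ?case
    by (rule small_colim_transport[OF sm bas_category(1), where \<phi> = "gam B" and l = "\<lambda>_ r. r"])
      (auto simp: pt_def pt_presheaf_def prof_presheaf_def gam_bij gam_Cmp lact_upre ue bij_betw_id[unfolded id_def])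
next
  case 5 show ?case by (auto simp: gam_Ide_E)
next
  case (6 r a x Y s)
  then have r: "r \<in> E a x" by simp
  note p = upairs_ufamily_usp[OF 6(2) E_obj(2)[OF r]]
  show ?case using dlt2_Els[OF r p(3)] by (simp add: ucmp_usp[OF r 6(2)])
next
  case (7 r a x Y s) then show ?case unfolding ufamily_usp by (auto simp: usp_def)
next
  case (8 r a x Z s y g)
  then have r: "r \<in> E a x" and g: "reidx Pt x y g" by (simp_all add: reindex_usp)
  note x = E_obj(2)[OF r] and f = 8(2) and G = reidxD[OF g]
  note p = upairs_ufamily_usp[OF f x]
  let ?Z = "\<lambda>z\<in>Ix y. Z (g z)" and ?s = "\<lambda>z\<in>Ix y. s (g z)"
  have "s (g z) \<in> E (Fm y z) (Z (g z))" if "z \<in> Ix y" for z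
    using f G(4)[OF that] unfolding G(5)[OF that, symmetric] by (auto simp: ufamily_usp)
  then have f': "ufamily usp y ?Z ?s" using f G(4) by (auto simp: ufamily_usp PiE_iff)
  note p' = upairs_ufamily_usp[OF f' G(2)]
  have gb: "reidx (bobj Pt) (over x Z) (over y ?Z) g"
    using g p(2) p'(2) by (simp add: reidx_def uindex_def)
  have V: "rearr (beta C) (over x Z) (over y ?Z) g \<in> Hom (beta (beta C)) (over x Z) (over y ?Z)"
    using S.C.rearr_Hom[of "over x Z" "over y ?Z" g] gb by simp
  have e: "(\<lambda>w\<in>Ix y. g ((\<lambda>z\<in>Ix y. z) w)) = (\<lambda>w\<in>Ix y. (\<lambda>z\<in>Ix x. z) (g w))"
    by (rule restrict_ext) (simp add: G(4))
  \<comment> \<open>The reindexing \<open>g\<close> acting from the left on the reindexed family and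
    from the right on the original family gives one and the same germ. Dinaturality treats the first
    reading, naturality in the target the second.\<close>
  have "lact (beta (beta C)) (bstr B) y x (over y ?Z) (rearr C x y g) (ucls E y (over y ?Z) (\<lambda>z\<in>Ix y. z, ?s)) =
    ucls E x (over y ?Z) (\<lambda>w\<in>Ix y. g ((\<lambda>z\<in>Ix y. z) w), ?s)"
    using S.lact_rearr_ucls[OF g p'(1)] p'(2) by simp
  also have "\<dots> = ract (beta C) (bstr B) x (over x Z) (over y ?Z) (rearr (beta C) (over x Z) (over y ?Z) g)
      (ucls E x (over x Z) (\<lambda>z\<in>Ix x. z, s))"
    unfolding e using S.ract_rearr_ucls[OF _ p(1) x, of "over y ?Z" g] gb by simp
  finally have "dlt2 B a y (over y ?Z) (ract C S a x y (rearr C x y g) r) (ucls E y (over y ?Z) (\<lambda>z\<in>Ix y. z, ?s)) =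
    ract C S a (mu (over x Z)) (mu (over y ?Z)) (rearr C (mu (over x Z)) (mu (over y ?Z))
      (\<lambda>v\<in>Ix (mu (over y ?Z)). pair (g (ufst v)) (usnd v))) (dlt2 B a x (over x Z) r (ucls E x (over x Z) (\<lambda>z\<in>Ix x. z, s)))"
    unfolding dlt2_dinatural[OF C.rearr_Hom[OF g] r p'(3)] using dlt2_ract[OF r p(3) V] umult_rearr[OF bas_category(1) gb] by simp
  moreover have "reidx Pt (mu (over x Z)) (mu (over y ?Z)) (\<lambda>v\<in>Ix (mu (over y ?Z)). pair (g (ufst v)) (usnd v))"
    by (rule reidx_over[OF g]) (use f in \<open>simp add: ufamily_usp\<close>)
  ultimately show ?case
    using ucmp_usp[OF ract_rearr_Els[OF g r] f'] ucmp_usp[OF r f] ure_usp[OF g r] ure_usp[OF _ dlt2_Els[OF r p(3)]]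
    by simp
next
  case (9 r a x Y s Z k)
  then have r: "r \<in> E a x" and k: "\<And>z. z \<in> Ix x \<Longrightarrow> reidx Pt (Y z) (Z z) (k z)" by (simp_all add: reindex_usp)
  note x = E_obj(2)[OF r] and f = 9(2)
  have f': "Y \<in> Ix x \<rightarrow>\<^sub>E bobj Pt" "\<And>z. z \<in> Ix x \<Longrightarrow> s z \<in> E (Fm x z) (Y z)" using f by (auto simp: ufamily_usp)
  note p = upairs_ufamily_usp[OF f x]
  let ?s = "\<lambda>z\<in>Ix x. ract C S (Fm x z) (Y z) (Z z) (rearr C (Y z) (Z z) (k z)) (s z)"
  have s: "(\<lambda>z\<in>Ix x. ure usp (Fm x z) (Y z) (Z z) (k z) (s z)) = ?s"
    by (rule restrict_ext) (rule ure_usp[OF k f'(2)])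
  have fz: "ufamily usp x Z ?s"
    using 9(3) reidxD(2)[OF k] by (auto simp: ufamily_usp PiE_iff intro!: ract_rearr_Els k f')
  note pz = upairs_ufamily_usp[OF fz x]
  have i: "uindex (over x Y) (over x Z) (\<lambda>z\<in>Ix x. z)" using uindex_id[OF bobj_ev[OF x]] by (simp add: uindex_def)
  have k': "\<And>y. y \<in> Ix (over x Z) \<Longrightarrow> reidx Pt (Fm (over x Y) ((\<lambda>z\<in>Ix x. z) y)) (Fm (over x Z) y) (k y)"
    using k by simp
  \<comment> \<open>The reindexings \<open>k\<close> are collected into one morphism of the second
    iterate of \<beta>, so that naturality of \<Delta> applies to all members at once.\<close>
  let ?V = "(\<lambda>z\<in>Ix x. z, \<lambda>y\<in>Ix (over x Z). rearr C (Fm (over x Y) ((\<lambda>z\<in>Ix x. z) y)) (Fm (over x Z) y) (k y))"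
  note um = umult_rearr_family[OF bas_category(1) p(2) pz(2) i k']
  have V: "ucls (Hom (beta C)) (over x Y) (over x Z) ?V \<in> Hom (beta (beta C)) (over x Y) (over x Z)"
    by (rule HomBI[OF _ _ um(2)]) (use p(2) pz(2) in simp_all)
  have e: "(\<lambda>w\<in>Ix (over x Z). (\<lambda>z\<in>Ix x. z) ((\<lambda>z\<in>Ix x. z) w)) = (\<lambda>z\<in>Ix x. z)"
    "(\<lambda>w\<in>Ix (over x Z). ract C S (Fm x ((\<lambda>z\<in>Ix x. z) ((\<lambda>z\<in>Ix x. z) w))) (Fm (over x Y) ((\<lambda>z\<in>Ix x. z) w)) (Fm (over x Z) w)
      ((\<lambda>y\<in>Ix (over x Z). rearr C (Fm (over x Y) ((\<lambda>z\<in>Ix x. z) y)) (Fm (over x Z) y) (k y)) w) (s ((\<lambda>z\<in>Ix x. z) w))) = ?s"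
    by (simp_all cong: restrict_cong)
  have a: "ract (beta C) (bstr B) x (over x Y) (over x Z) (ucls (Hom (beta C)) (over x Y) (over x Z) ?V)
      (ucls E x (over x Y) (\<lambda>z\<in>Ix x. z, s)) = ucls E x (over x Z) (\<lambda>z\<in>Ix x. z, ?s)"
    using S.ract_ucls[OF um(2) p(1) x] unfolding e .
  have q: "(\<lambda>v\<in>Ix (mu (over x Z)). pair ((\<lambda>z\<in>Ix x. z) (ufst v)) (k (ufst v) (usnd v))) =
    (\<lambda>v\<in>Ix (mu (over x Z)). pair (ufst v) (k (ufst v) (usnd v)))"
    by (rule restrict_mu_cong) simp
  have u1: "umult (Hom C) (over x Y) (over x Z) (ucls (Hom (beta C)) (over x Y) (over x Z) ?V) =
    rearr C (mu (over x Y)) (mu (over x Z)) (\<lambda>v\<in>Ix (mu (over x Z)). pair (ufst v) (k (ufst v) (usnd v)))"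
    unfolding q[symmetric] by (rule um(1))
  have "reidx Pt (mu (over x Y)) (mu (over x Z)) (\<lambda>v\<in>Ix (mu (over x Z)). pair (ufst v) (k (ufst v) (usnd v)))"
    by (rule reidx_over_family[OF x _ 9(3) k]) (use f'(1) in \<open>simp add: PiE_iff\<close>)
  then show ?case
    unfolding s ucmp_usp[OF r fz] ucmp_usp[OF r f] a[symmetric] dlt2_ract[OF r p(3) V] u1
    using dlt2_Els[OF r p(3)] by (simp add: ure_usp)
next
  case (10 r a x)
  then show ?case using upre_uid_usp[of r a x] E_obj(1)[of r a x] by simp
next
  case (11 r a x)
  then have r: "r \<in> E a x" by simp
  note x = E_obj(2)[OF r]
  let ?u = "\<lambda>z\<in>Ix x. gam B (Fm x z) (Fm x z) (Ide C (Fm x z))"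
  have e: "(\<lambda>z\<in>Ix x. uid usp (Fm x z)) = ?u" by (rule restrict_ext) (simp add: bobj_mem[OF x])
  have f: "ufamily usp x (\<lambda>z\<in>Ix x. eta (Fm x z)) ?u"
    by (auto simp: ufamily_usp intro!: eta_bobj gam_Ide_E bobj_mem[OF x])
  have o: "over x (\<lambda>z\<in>Ix x. eta (Fm x z)) = bmap eta x" by (simp add: over_def bmap_def)
  note p = upairs_ufamily_usp[OF f x, unfolded o]
  have "rearr C x (mu (bmap eta x)) ufst = rearr C x (mu (bmap eta x)) (\<lambda>w\<in>Ix (mu (bmap eta x)). ufst w)"
    by (rule rearr_restrict[symmetric])
  then show ?case
    unfolding upost_def e ucmp_usp[OF r f] o
    using ract_rearr_comp[OF reidx_mu_bmap_eta'[OF x] reidx_mu_bmap_eta[OF x] r, of "\<lambda>z. z"]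
      ract_rearr_id[OF r] ure_usp[OF reidx_mu_bmap_eta[OF x] dlt2_Els[OF r p(3)]] unit_right[OF r] by simp
next
  case (12 r a x Y s Z t W)
  then have r: "r \<in> E a x" by simp
  note x = E_obj(2)[OF r] and f = 12(2) and ft = 12(3) and W = 12(4)
  have f': "Y \<in> Ix x \<rightarrow>\<^sub>E bobj Pt" "\<And>z. z \<in> Ix x \<Longrightarrow> s z \<in> E (Fm x z) (Y z)" using f by (auto simp: ufamily_usp)
  have ft': "Z \<in> Ix (mu (over x Y)) \<rightarrow>\<^sub>E bobj Pt" "t \<in> extensional (Ix (mu (over x Y)))"
    "\<And>z w. z \<in> Ix x \<Longrightarrow> w \<in> Ix (Y z) \<Longrightarrow> t (pair z w) \<in> E (Fm (Y z) w) (Z (pair z w))"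
    using ft by (auto simp: ufamily_usp PiE_iff Ball_Ix_mu Fm_mu)
  note p = upairs_ufamily_usp[OF f x]
  define X where "X = over x Y"
  define Zb where "Zb = over x (\<lambda>z\<in>Ix x. over (Y z) (W z))"
  have Zb: "Zb \<in> bobj (bobj (bobj Pt))" unfolding Zb_def by (rule over_over_bobj[OF x f'(1) ft'(1) W])
  have mZ: "mu Zb = over (mu X) Z"
    unfolding Zb_def X_def by (rule mu_over_over[OF x _ W]) (use ft'(1) in \<open>simp add: PiE_iff\<close>)
  have bZ: "bmap mu Zb = over x (\<lambda>z\<in>Ix x. mu (over (Y z) (W z)))" unfolding Zb_def by (rule bmap_mu_over)
  have XI: "Ix X = Ix x" "Ix Zb = Ix x" by (simp_all add: X_def Zb_def)
  let ?i = "\<lambda>z\<in>Ix x. z" and ?tz = "\<lambda>z. \<lambda>w\<in>Ix (Y z). t (pair z w)"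
  have fz: "ufamily usp (Y z) (W z) (?tz z)" if "z \<in> Ix x" for z
    using that ft'(1,3) by (auto simp: ufamily_usp W PiE_iff Ball_Ix_mu)
  have Yz: "Y z \<in> bobj Pt" if "z \<in> Ix x" for z using f'(1) that by auto
  note pz = upairs_ufamily_usp[OF fz Yz]
  let ?k = "\<lambda>z. \<lambda>w\<in>Ix (Y z). w"
  \<comment> \<open>The restrictions of \<open>t\<close> to the fibres form a germ of germs
    \<open>T\<close> over identity index maps. Its image under \<mu> is the uncurried
    \<open>t\<close>, so the associativity axiom at \<open>T\<close> compares the two required
    composites.\<close>
  let ?g = "\<lambda>z\<in>Ix Zb. ucls E (Fm X (?i z)) (Fm Zb z) (?k z, ?tz z)"
  have k: "(?k z, ?tz z) \<in> upairs E (Fm X (?i z)) (Fm Zb z)" if "z \<in> Ix Zb" for z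
    using pz(1)[of z] that by (simp add: XI) (simp add: X_def Zb_def)
  have iu: "uindex X Zb ?i" using uindex_id[OF bobj_ev[OF x]] by (simp add: uindex_def X_def Zb_def)
  have gz: "?g z \<in> Els (bstr B) (Fm X (?i z)) (Fm Zb z)" if "z \<in> Ix Zb" for z
    using pz(3)[of z] that by (simp add: XI) (simp add: X_def Zb_def)
  have gp: "(?i, ?g) \<in> upairs (Els (bstr B)) X Zb" using iu gz by (auto simp: mem_upairs)
  define T where "T = ucls (Els (bstr B)) X Zb (?i, ?g)"
  have T: "T \<in> Els (bprof (beta (beta C)) (beta C) (bstr B)) X Zb"
    unfolding T_def by (rule bprofI) (use p(2) Zb gp in \<open>simp_all add: X_def\<close>)
  have "umult E X Zb T = ucls E (mu X) (mu Zb) (\<lambda>v\<in>Ix (mu Zb). pair (?i (ufst v)) (?k (ufst v) (usnd v)),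
      \<lambda>v\<in>Ix (mu Zb). ?tz (ufst v) (usnd v))"
    unfolding T_def by (rule umult_ucls[OF gp k Zb])
  also have "(\<lambda>v\<in>Ix (mu Zb). pair (?i (ufst v)) (?k (ufst v) (usnd v))) = (\<lambda>v\<in>Ix (mu Zb). v)"
    by (rule restrict_mu_cong) (simp add: XI, simp add: Zb_def)
  also have "(\<lambda>v\<in>Ix (mu Zb). ?tz (ufst v) (usnd v)) = (\<lambda>v\<in>Ix (mu Zb). t v)"
    by (rule restrict_mu_cong) (simp add: XI, simp add: Zb_def)
  also have "Ix (mu Zb) = Ix (mu X)" by (simp add: mZ)
  also have "(\<lambda>v\<in>Ix (mu X). t v) = t" using ft'(2) by (simp add: X_def extensional_restrict)
  finally have uT: "umult E X Zb T = ucls E (mu X) (mu Zb) (\<lambda>v\<in>Ix (mu X). v, t)" .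
  let ?s = "ucls E x X (?i, s)"
  let ?P = "pcomp (beta (beta C)) (beta C) C S (bstr B)"
  let ?c = "\<lambda>y. coend_cls (beta (beta C)) (beta C) C S (bstr B) (Fm x (?i (?i y))) (Fm Zb y) (Fm X (?i y), s (?i y), ?g y)"
  have C: "compositor (beta (beta C)) (beta C) C S (bstr B) x X Zb ?s T =
      ucls (Els ?P) x Zb (\<lambda>y\<in>Ix Zb. ?i (?i y), \<lambda>y\<in>Ix Zb. ?c y)"
    unfolding T_def by (rule compositor_ucls[OF p(1)[folded X_def] gp])
  have sm: "s (?i y) \<in> E (Fm x (?i (?i y))) (Fm X (?i y))" if "y \<in> Ix Zb" for y
    using f'(2) that by (simp add: X_def Zb_def)
  have ii: "(\<lambda>y\<in>Ix Zb. ?i (?i y)) = ?i" by (rule ext) (simp add: XI)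
  have Cm: "(\<lambda>y\<in>Ix Zb. ?i (?i y), \<lambda>y\<in>Ix Zb. ?c y) \<in> upairs (Els ?P) x Zb"
    unfolding mem_upairs
  proof
    show "uindex x Zb (\<lambda>y\<in>Ix Zb. ?i (?i y))" unfolding ii using iu by (simp add: uindex_def X_def)
    show "(\<lambda>y\<in>Ix Zb. ?c y) \<in> (\<Pi>\<^sub>E z\<in>Ix Zb. Els ?P (Fm x ((\<lambda>y\<in>Ix Zb. ?i (?i y)) z)) (Fm Zb z))"
      using PC.pcomp_ElsI[OF sm gz] by simp
  qed
  have bx: "bmap (\<lambda>a. a) x = x" by (rule bmap_id[OF x]) simp
  define q where "q = (\<lambda>z\<in>Ix x. ucmp usp (Fm x z) (Y z) (W z) (?tz z) (s z))"
  have qe: "(\<lambda>z\<in>Ix Zb. dlt B (Fm x ((\<lambda>y\<in>Ix Zb. ?i (?i y)) z)) (Fm Zb z) ((\<lambda>y\<in>Ix Zb. ?c y) z)) = q"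
    unfolding XI q_def
  proof (rule restrict_ext)
    fix z assume z: "z \<in> Ix x"
    have "dlt B (Fm x z) (Fm Zb z) (coend_cls (beta (beta C)) (beta C) C S (bstr B) (Fm x z) (Fm Zb z) (Fm X z, s z, ?g z)) =
        dlt2 B (Fm x z) (Y z) (over (Y z) (W z)) (s z) (ucls E (Y z) (over (Y z) (W z)) (?k z, ?tz z))"
      using z by (simp add: dlt2_def XI) (simp add: X_def Zb_def)
    also have "\<dots> = ucmp usp (Fm x z) (Y z) (W z) (?tz z) (s z)" by (rule ucmp_usp[OF f'(2)[OF z] fz[OF z], symmetric])
    finally show "dlt B (Fm x ((\<lambda>y\<in>Ix x. ?i (?i y)) z)) (Fm Zb z) ((\<lambda>y\<in>Ix x. coend_cls (beta (beta C)) (beta C) C S (bstr B) (Fm x (?i (?i y))) (Fm Zb y) (Fm X (?i y), s (?i y), (\<lambda>z\<in>Ix x. ucls E (Fm X (?i z)) (Fm Zb z) (?k z, ?tz z)) y)) z) =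
       ucmp usp (Fm x z) (Y z) (W z) (?tz z) (s z)"
      using z by (simp add: XI)
  qed
  have Bc: "bcell S (\<lambda>a. a) mu (dlt B) x Zb (compositor (beta (beta C)) (beta C) C S (bstr B) x X Zb ?s T) =
      ucls E x (bmap mu Zb) (?i, q)"
    unfolding C bcell_ucls[OF Cm] bx unfolding qe unfolding ii ..
  have fq: "ufamily usp x (\<lambda>z\<in>Ix x. mu (over (Y z) (W z))) q"
    using dlt2_Els[OF f'(2) pz(3)] mu_bobj[OF pz(2)]
    by (auto simp: ufamily_usp q_def ucmp_usp[OF f'(2) fz])
  note as = assoc[OF r p(3)[folded X_def] T]
  note q0 = dlt2_Els[OF r p(3)]
  note pt = upairs_ufamily_usp[OF ft mu_bobj[OF p(2)]]
  have re: "rearr C (mu (mu Zb)) (mu (bmap mu Zb)) reassoc = rearr C (mu (mu Zb)) (mu (bmap mu Zb)) (\<lambda>w\<in>Ix (mu (bmap mu Zb)). reassoc w)"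
    by (rule rearr_restrict[symmetric])
  have u1: "ucmp usp a (mu (over x Y)) Z t (ucmp usp a x Y s r) = dlt2 B a (mu X) (mu Zb) (dlt2 B a x X r ?s) (umult E X Zb T)"
    using ucmp_usp[OF q0 ft] ucmp_usp[OF r f] unfolding uT mZ X_def[symmetric] by simp
  have u2: "ucmp usp a (mu (over x Y)) Z t (ucmp usp a x Y s r) \<in> E a (mu (mu Zb))"
    using dlt2_Els[OF q0 pt(3)] ucmp_usp[OF q0 ft] ucmp_usp[OF r f] by (simp add: mZ X_def)
  have "ure usp a (mu (mu Zb)) (mu (bmap mu Zb)) (\<lambda>w\<in>Ix (mu (bmap mu Zb)). reassoc w)
      (ucmp usp a (mu (over x Y)) Z t (ucmp usp a x Y s r)) = ucmp usp a x (\<lambda>z\<in>Ix x. mu (over (Y z) (W z))) q r"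
    unfolding ure_usp[OF reidx_reassoc[OF Zb] u2] re[symmetric]
    using as unfolding u1 Bc ucmp_usp[OF r fq] bZ .
  then show ?case unfolding mZ bZ q_def X_def .
qed

end

section \<open>Morphisms and 2-cells\<close>

context nlax_algebra
begin

lemma pull_id: "x \<in> bobj T \<Longrightarrow> Ix y = Ix x \<Longrightarrow> Uf y = Uf x \<Longrightarrow> pull x (\<lambda>z\<in>Ix x. z) y = x"
  by (rule ufam_eqI) (simp_all add: bobj_ext cong: restrict_cong)

lemma gam_family:
  assumes "(\<lambda>z\<in>Ix x. z, \<alpha>) \<in> upairs (Hom C) x y" "x \<in> bobj Pt" "y \<in> bobj Pt" "Ix y = Ix x" "Uf y = Uf x"
  shows "ufamily usp x (\<lambda>z\<in>Ix x. eta (Fm y z)) (\<lambda>z\<in>Ix x. gam B (Fm x z) (Fm y z) (\<alpha> z))"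
  using assms upairs_mem[OF assms(1)] bobj_mem[OF assms(3)] by (auto simp: ufamily_usp intro!: gam_E eta_bobj)

text \<open>The morphism \<open>(id, \<alpha>)\<close> of \<open>\<beta>A\<^sub>0\<close> acts on \<open>r\<close> as composition with \<open>\<Gamma>(\<alpha>)\<close>: apply the right unit law to \<open>r\<close>,
  and note that \<open>\<Gamma>(\<alpha>)\<close> is obtained from \<open>\<Gamma>(id)\<close> by the right action of \<open>\<alpha>\<close>.\<close>

lemma ract_upost_id:
  assumes r: "r \<in> E a x" and \<alpha>: "(\<lambda>z\<in>Ix x. z, \<alpha>) \<in> upairs (Hom C) x y" and y: "y \<in> bobj Pt"
    and Iy: "Ix y = Ix x" "Uf y = Uf x"
  shows "ract C S a x y (ucls (Hom C) x y (\<lambda>z\<in>Ix x. z, \<alpha>)) r =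
    upost usp a x y (\<lambda>z\<in>Ix x. gam B (Fm x z) (Fm y z) (\<alpha> z)) r"
proof -
  note x = E_obj(2)[OF r]
  let ?bx = "bmap eta x :: ('u, ('u, 'u) ufam) ufam" and ?by = "bmap eta y :: ('u, ('u, 'u) ufam) ufam"
  have al: "\<alpha> z \<in> Hom C (Fm x z) (Fm y z)" if "z \<in> Ix x" for z using upairs_mem[OF \<alpha>, of z] that Iy by simp
  let ?u = "\<lambda>z\<in>Ix x. gam B (Fm x z) (Fm x z) (Ide C (Fm x z))" and ?g = "\<lambda>z\<in>Ix x. gam B (Fm x z) (Fm y z) (\<alpha> z)"
  have f: "ufamily usp x (\<lambda>z\<in>Ix x. eta (Fm x z)) ?u"
    by (auto simp: ufamily_usp intro!: eta_bobj gam_Ide_E bobj_mem[OF x])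
  have o: "over x (\<lambda>z\<in>Ix x. eta (Fm x z)) = bmap eta x" by (simp add: over_def bmap_def)
  note p = upairs_ufamily_usp[OF f x, unfolded o]
  note f' = gam_family[OF \<alpha> x y Iy]
  have o': "over x (\<lambda>z\<in>Ix x. eta (Fm y z)) = bmap eta y" by (simp add: over_def bmap_def Iy)
  note p' = upairs_ufamily_usp[OF f' x, unfolded o']
  \<comment> \<open>Each component of \<alpha> is placed over a singleton. This gives a morphism
    \<open>V\<close> between the families of units at \<open>x\<close> and at \<open>y\<close>, and
    \<Delta> is natural with respect to it.\<close>
  let ?d = "\<lambda>z. \<lambda>w\<in>{star}. \<alpha> z" and ?k = "\<lambda>z. \<lambda>w\<in>{star :: 'u}. w" and ?i = "\<lambda>z\<in>Ix x. z"
  let ?h = "\<lambda>z\<in>Ix ?by. ucls (Hom C) (Fm ?bx (?i z)) (Fm ?by z) (?k z, ?d z)"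
  have h: "(?k z, ?d z) \<in> upairs (Hom C) (Fm ?bx (?i z)) (Fm ?by z)" if "z \<in> Ix ?by" for z
    using upairs_star[where F = "Hom C", OF al] that Iy by simp
  have iu: "uindex ?bx ?by ?i" using uindex_id[OF bobj_ev[OF x]] Iy by (simp add: uindex_def)
  have H: "(?i, ?h) \<in> upairs (Hom (beta C)) ?bx ?by"
    unfolding mem_upairs using iu h by (auto simp: Iy intro!: HomBI eta_bobj bobj_mem[OF x] bobj_mem[OF y])
  define V where "V = ucls (Hom (beta C)) ?bx ?by (?i, ?h)"
  have V: "V \<in> Hom (beta (beta C)) ?bx ?by"
    unfolding V_def by (rule HomBI[OF _ _ H]) (use bmap_eta_bobj[OF x] bmap_eta_bobj[OF y] in simp_all)
  have "(\<lambda>w\<in>Ix ?by. ?i (?i w)) = ?i" by (rule ext) (simp add: Iy)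
  moreover have "(\<lambda>w\<in>Ix ?by. ract C S (Fm x (?i (?i w))) (Fm ?bx (?i w)) (Fm ?by w) (?h w) (?u (?i w))) = ?g"
    unfolding bmap_sel Iy
  proof (rule restrict_ext)
    fix z assume z: "z \<in> Ix x"
    then show "ract C S (Fm x (?i (?i z))) ((\<lambda>z\<in>Ix x. eta (Fm x z)) (?i z)) ((\<lambda>z\<in>Ix x. eta (Fm y z)) z)
        ((\<lambda>z\<in>Ix x. ucls (Hom C) ((\<lambda>z\<in>Ix x. eta (Fm x z)) (?i z)) ((\<lambda>z\<in>Ix x. eta (Fm y z)) z) (?k z, ?d z)) z) (?u (?i z)) =
      gam B (Fm x z) (Fm y z) (\<alpha> z)"
      using gam_ract[OF al[OF z] C.Ide_Hom[OF bobj_mem[OF x z]]] C.Cmp_Ide_right[OF al[OF z]] by simp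
  qed
  ultimately have sV: "ract (beta C) (bstr B) x ?bx ?by V (ucls E x ?bx (?i, ?u)) =
      ucls E x ?by (?i, ?g)"
    unfolding V_def S.ract_ucls[OF H p(1) x] by (simp only:)
  have uV: "umult (Hom C) ?bx ?by V = ucls (Hom C) (mu ?bx) (mu ?by)
      (\<lambda>v\<in>Ix (mu ?by). pair (?i (ufst v)) (?k (ufst v) (usnd v)), \<lambda>v\<in>Ix (mu ?by). ?d (ufst v) (usnd v))"
    unfolding V_def by (rule umult_ucls[OF H h bmap_eta_bobj[OF y]])
  have um: "(\<lambda>v\<in>Ix (mu ?by). pair (?i (ufst v)) (?k (ufst v) (usnd v)), \<lambda>v\<in>Ix (mu ?by). ?d (ufst v) (usnd v))
     \<in> upairs (Hom C) (mu ?bx) (mu ?by)"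
    by (rule umult_upairs[OF iu h bmap_eta_bobj[OF y]])
  have UV: "umult (Hom C) ?bx ?by V \<in> Hom (beta C) (mu ?bx) (mu ?by)"
    unfolding uV by (rule HomBI[OF _ _ um]) (auto intro!: mu_bobj bmap_eta_bobj x y)
  have rx: "reidx Pt x (mu ?bx) (\<lambda>w\<in>Ix (mu ?bx). ufst w)" by (rule reidx_mu_bmap_eta'[OF x])
  have ry: "reidx Pt (mu ?by) y (\<lambda>z\<in>Ix y. pair z star)" by (rule reidx_mu_bmap_eta[OF y])
  have rx': "rearr C x (mu ?bx) ufst = rearr C x (mu ?bx) (\<lambda>w\<in>Ix (mu ?bx). ufst w)"
    by (rule rearr_restrict[symmetric])
  let ?R = "rearr C x (mu ?bx) (\<lambda>w\<in>Ix (mu ?bx). ufst w)" and ?R' = "rearr C (mu ?by) y (\<lambda>z\<in>Ix y. pair z star)"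
  let ?U = "umult (Hom C) ?bx ?by V"
  have um': "(\<lambda>w\<in>Ix (mu ?by). (\<lambda>w\<in>Ix (mu ?bx). ufst w) ((\<lambda>v\<in>Ix (mu ?by). pair (?i (ufst v)) (?k (ufst v) (usnd v))) w),
      \<lambda>v\<in>Ix (mu ?by). ?d (ufst v) (usnd v)) \<in> upairs (Hom C) x (mu ?by)"
    unfolding mem_upairs
    using uindex_comp[OF reidxD(3)[OF rx] upairs_uindex[OF um] bobj_ev[OF reidxD(1)[OF ry]]] al Iy
    by (auto simp: Fm_mu elim!: Ix_muE)
  \<comment> \<open>The unit isomorphisms before and after the image of \<open>V\<close> under \<mu>
    cancel and leave \<open>(id, \<alpha>)\<close>.\<close>
  have c: "Cmp (beta C) x (mu ?by) y ?R' (Cmp (beta C) x (mu ?bx) (mu ?by) ?U ?R) =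
    ucls (Hom C) x y (?i, \<alpha>)"
    unfolding uV C.Cmp_rearr_left[OF rx um reidxD(1)[OF ry]] C.Cmp_rearr_right[OF um' ry]
    by (intro ucls_cong eventually_mono[OF bobj_ev[OF y]]) (simp add: Iy)
  have q: "upost usp a x y ?g r = ract C S a (mu ?by) y ?R' (dlt2 B a x ?by r (ucls E x ?by (?i, ?g)))"
    unfolding upost_def ucmp_usp[OF r f'] o' by (rule ure_usp[OF ry dlt2_Els[OF r p'(3)]])
  show ?thesis
    unfolding q sV[symmetric] dlt2_ract[OF r p(3) V] unit_right[OF r] rx'
      S.ract_comp[OF C.rearr_Hom[OF rx] UV r]
      S.ract_comp[OF S.C.Cmp_Hom[OF C.rearr_Hom[OF rx] UV] C.rearr_Hom[OF ry] r] c ..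
qed

text \<open>A morphism of \<beta> of \<open>A\<^sub>0\<close> is a reindexing followed by a vertical
  morphism. Hence its action is determined by the space together with \<Gamma>.\<close>

lemma ract_upost:
  assumes r: "r \<in> E a x" and g: "(g, \<alpha>) \<in> upairs (Hom C) x y" and y: "y \<in> bobj Pt"
  shows "ract C S a x y (ucls (Hom C) x y (g, \<alpha>)) r =
    upost usp a (pull x g y) y (\<lambda>z\<in>Ix y. gam B (Fm x (g z)) (Fm y z) (\<alpha> z)) (ure usp a x (pull x g y) g r)"
proof -
  note x = E_obj(2)[OF r] and gu = upairs_uindex[OF g]
  let ?x = "pull x g y"
  have rg: "reidx Pt x ?x g" by (rule reidx_pull[OF x y gu])
  note x' = reidxD(2)[OF rg]
  have a: "(\<lambda>z\<in>Ix ?x. z, \<alpha>) \<in> upairs (Hom C) ?x y"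
    using g uindex_id[OF bobj_ev[OF x']] by (auto simp: mem_upairs uindex_def PiE_iff)
  have "(\<lambda>w\<in>Ix y. g ((\<lambda>z\<in>Ix ?x. z) w)) = (\<lambda>w\<in>Ix y. g w)" by (rule restrict_ext) simp
  also have "\<dots> = g" using gu unfolding uindex_def by (blast dest: PiE_restrict)
  finally have e: "(\<lambda>w\<in>Ix y. g ((\<lambda>z\<in>Ix ?x. z) w)) = g" .
  have "ucls (Hom C) x y (g, \<alpha>) = Cmp (beta C) x ?x y (ucls (Hom C) ?x y (\<lambda>z\<in>Ix ?x. z, \<alpha>)) (rearr C x ?x g)"
    using C.Cmp_rearr_left[OF rg a y] unfolding e by simp
  then have "ract C S a x y (ucls (Hom C) x y (g, \<alpha>)) r =
      ract C S a ?x y (ucls (Hom C) ?x y (\<lambda>z\<in>Ix ?x. z, \<alpha>)) (ract C S a x ?x (rearr C x ?x g) r)"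
    using S.ract_comp[OF C.rearr_Hom[OF rg] HomBI[OF x' y a] r] by simp
  also have "\<dots> = upost usp a ?x y (\<lambda>z\<in>Ix ?x. gam B (Fm ?x z) (Fm y z) (\<alpha> z)) (ract C S a x ?x (rearr C x ?x g) r)"
    by (rule ract_upost_id[OF ract_rearr_Els[OF rg r] a y]) simp_all
  finally show ?thesis unfolding ure_usp[OF rg r] by (simp cong: restrict_cong)
qed

definition gami :: "'u \<Rightarrow> 'u \<Rightarrow> 'u \<Rightarrow> 'u" where
  "gami a b = inv_into (Hom C a b) (gam B a b)"

lemma gami [simp]:
  "u \<in> Hom C a b \<Longrightarrow> gami a b (gam B a b u) = u"
  "r \<in> E a (eta b) \<Longrightarrow> gam B a b (gami a b r) = r"
  "r \<in> E a (eta b) \<Longrightarrow> gami a b r \<in> Hom C a b"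
  using gam_bij[of a b] by (auto simp: gami_def bij_betw_def f_inv_into_f inv_into_into)

lemma gam_eqD: "gam B a b u = gam B a b v \<Longrightarrow> u \<in> Hom C a b \<Longrightarrow> v \<in> Hom C a b \<Longrightarrow> u = v"
  by (metis gami(1))

end

locale nlax_pair = B: nlax_algebra B + B': nlax_algebra B' for B B' :: "'u::universe lax_alg"
begin

text \<open>The effect on morphisms is forced: a morphism of \<open>A\<^sub>0\<close> is known from
  its image under \<Gamma>, and there the continuous map already acts.\<close>

definition lmor :: "'u ucmap \<Rightarrow> 'u lax_mor" where
  "lmor f = \<lparr> mfun = \<lparr> fo = cpt f, fm = (\<lambda>a b. \<lambda>u\<in>Hom (bas B) a b.
       B'.gami (cpt f a) (cpt f b) (carr f a (eta b) (gam B a b u))) \<rparr>, mcell = carr f \<rparr>"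

lemma lmor_sel [simp]: "fo (mfun (lmor f)) = cpt f" "mcell (lmor f) = carr f"
  "fm (mfun (lmor f)) a b = (\<lambda>u\<in>Hom (bas B) a b. B'.gami (cpt f a) (cpt f b) (carr f a (eta b) (gam B a b u)))"
  by (simp_all add: lmor_def)

definition umor :: "'u lax_mor \<Rightarrow> 'u ucmap" where
  "umor m = \<lparr> cpt = fo (mfun m), carr = mcell m \<rparr>"

lemma umor_sel [simp]: "cpt (umor m) = fo (mfun m)" "carr (umor m) = mcell m"
  by (simp_all add: umor_def)

lemma uspace_map_usp: "continuous_map B.usp B'.usp f \<Longrightarrow> uspace_map B.usp B'.usp f"
  by (intro uspace_map.intro B.ultraconvergence_space_usp B'.ultraconvergence_space_usp)

lemma bmap_pull: "uindex x y g \<Longrightarrow> bmap f (pull x g y) = pull (bmap f x) g (bmap k y)"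
  by (rule ufam_eqI) (auto simp: fun_eq_iff uindex_mem)

text \<open>A continuous map preserves reindexing and composition with unary arrows. By
  \<open>lact_upre\<close> and \<open>ract_upost\<close> these are the two actions, so naturality of
  the cell follows; compatibility with \<Delta> follows in the same way from
  \<open>dlt2_pull\<close>.\<close>

lemma representable_lmor:
  assumes "continuous_map B.usp B'.usp f"
  shows "representable_colax_morphism B B' (lmor f)"
proof -
  interpret f: uspace_map B.usp B'.usp f by (rule uspace_map_usp[OF assms])
  note cE = f.carr_E[simplified] and cEe = f.carr_E_eta[simplified] and cp = f.cpt_mem[simplified]
  have fH: "fm (mfun (lmor f)) a b u \<in> Hom (bas B') (cpt f a) (cpt f b)"
    and gf: "gam B' (cpt f a) (cpt f b) (fm (mfun (lmor f)) a b u) = carr f a (eta b) (gam B a b u)"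
    if "u \<in> Hom (bas B) a b" for a b u
    using cEe[OF B.gam_E[OF that]] that by simp_all
  have fI: "fm (mfun (lmor f)) a a (Ide (bas B) a) = Ide (bas B') (cpt f a)" if a: "a \<in> Obj (bas B)" for a
    using f.carr_uid[simplified, OF a] a cp[OF a] B.C.Ide_Hom[OF a] B'.C.Ide_Hom by simp
  have fC: "fm (mfun (lmor f)) a c (Cmp (bas B) a b c v u) =
      Cmp (bas B') (cpt f a) (cpt f b) (cpt f c) (fm (mfun (lmor f)) b c v) (fm (mfun (lmor f)) a b u)"
    if "u \<in> Hom (bas B) a b" "v \<in> Hom (bas B) b c" for a b c u v
  proof (rule B'.gam_eqD)
    show "gam B' (cpt f a) (cpt f c) (fm (mfun (lmor f)) a c (Cmp (bas B) a b c v u)) =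
      gam B' (cpt f a) (cpt f c) (Cmp (bas B') (cpt f a) (cpt f b) (cpt f c) (fm (mfun (lmor f)) b c v) (fm (mfun (lmor f)) a b u))"
      unfolding gf[OF B.C.Cmp_Hom[OF that]] B'.gam_Cmp[OF fH[OF that(1)] fH[OF that(2)]] gf[OF that(1)] gf[OF that(2)]
        B.gam_Cmp[OF that]
      using f.carr_upre B.gam_E that by simp
  qed (use fH B.C.Cmp_Hom B'.C.Cmp_Hom that in blast)+
  show ?thesis
  proof (rule representable_colax_morphism.intro, goal_cases)
    case 1 show ?case by standard (use cp fH fI fC in \<open>simp_all del: lmor_sel(3)\<close>)
  next
    case 2 show ?case using f.cpt_fun by (auto simp: ftr_ext_def PiE_iff)
  next
    case 3
    have lnat: "carr f d' x (lact (beta (bas B)) (str B) d d' x u r) =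
      lact (beta (bas B')) (str B') (cpt f d) (cpt f d') (bmap (cpt f) x) (fm (mfun (lmor f)) d' d u) (carr f d x r)"
      if u: "u \<in> Hom (bas B) d' d" and r: "r \<in> Els (str B) d x" for d d' x u r
      unfolding B.lact_upre[OF u r] B'.lact_upre[OF fH[OF u] cE[OF r]] gf[OF u]
      using f.carr_upre B.gam_E[OF u] r by simp
    have rnat: "carr f d y (ract (bas B) (str B) d x y v r) =
      ract (bas B') (str B') (cpt f d) (bmap (cpt f) x) (bmap (cpt f) y) (fm (beta_ftr (bas B') (mfun (lmor f))) x y v) (carr f d x r)"
      if v: "v \<in> Hom (beta (bas B)) x y" and r: "r \<in> Els (str B) d x" for d x y v r
    proof -
      obtain g \<alpha> where g: "x \<in> bobj (Obj (bas B))" "y \<in> bobj (Obj (bas B))" "(g, \<alpha>) \<in> upairs (Hom (bas B)) x y"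
        "v = ucls (Hom (bas B)) x y (g, \<alpha>)" using v by (elim HomBE)
      note gu = upairs_uindex[OF g(3)]
      have rg: "reidx (Obj (bas B)) x (pull x g y) g" by (rule reidx_pull[OF g(1,2) gu])
      have ap: "f.A.ualong (pull x g y) y (\<lambda>z\<in>Ix y. gam B (Fm x (g z)) (Fm y z) (\<alpha> z))"
        using reidxD(2)[OF rg] g(2) upairs_mem[OF g(3)] by (auto simp: f.A.ualong_def B.gam_E)
      have g': "(g, \<lambda>z\<in>Ix y. fm (mfun (lmor f)) (Fm x (g z)) (Fm y z) (\<alpha> z)) \<in> upairs (Hom (bas B')) (bmap (cpt f) x) (bmap (cpt f) y)"
        by (rule upairs_bmap[OF g(3)]) (rule fH)
      have pr: "ract (bas B) (str B) d x (pull x g y) (rearr (bas B) x (pull x g y) g) r \<in> Els (str B) d (pull x g y)"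
        by (rule B.ract_rearr_Els[OF rg r])
      have bp: "bmap (cpt f) (pull x g y) = pull (bmap (cpt f) x) g (bmap (cpt f) y)" by (rule bmap_pull[OF gu])
      have e: "(\<lambda>z\<in>Ix y. carr f (Fm (pull x g y) z) (eta (Fm y z)) ((\<lambda>z\<in>Ix y. gam B (Fm x (g z)) (Fm y z) (\<alpha> z)) z)) =
         (\<lambda>z\<in>Ix (bmap (cpt f) y). gam B' (Fm (bmap (cpt f) x) (g z)) (Fm (bmap (cpt f) y) z) ((\<lambda>z\<in>Ix y. fm (mfun (lmor f)) (Fm x (g z)) (Fm y z) (\<alpha> z)) z))"
        unfolding bmap_sel
        by (rule restrict_ext) (use gf[OF upairs_mem[OF g(3)]] uindex_mem[OF gu] in \<open>simp del: lmor_sel(3)\<close>)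
      have "carr f d y (ract (bas B) (str B) d x y v r) =
        upost B'.usp (cpt f d) (bmap (cpt f) (pull x g y)) (bmap (cpt f) y)
          (\<lambda>z\<in>Ix y. carr f (Fm (pull x g y) z) (eta (Fm y z)) ((\<lambda>z\<in>Ix y. gam B (Fm x (g z)) (Fm y z) (\<alpha> z)) z))
          (carr f d (pull x g y) (ure B.usp d x (pull x g y) g r))"
        unfolding g(4) B.ract_upost[OF r g(3,2)]
        using f.carr_upost[OF _ ap, of "ure B.usp d x (pull x g y) g r" d] pr B.ure_usp[OF rg r] by simp
      also have "carr f d (pull x g y) (ure B.usp d x (pull x g y) g r) =
        ure B'.usp (cpt f d) (bmap (cpt f) x) (bmap (cpt f) (pull x g y)) g (carr f d x r)"
        by (rule f.carr_reindex) (use r rg in \<open>simp_all add: B.reindex_usp\<close>)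
      also have "upost B'.usp (cpt f d) (bmap (cpt f) (pull x g y)) (bmap (cpt f) y)
          (\<lambda>z\<in>Ix y. carr f (Fm (pull x g y) z) (eta (Fm y z)) ((\<lambda>z\<in>Ix y. gam B (Fm x (g z)) (Fm y z) (\<alpha> z)) z)) \<dots> =
        ract (bas B') (str B') (cpt f d) (bmap (cpt f) x) (bmap (cpt f) y) (fm (beta_ftr (bas B') (mfun (lmor f))) x y v) (carr f d x r)"
        unfolding e bp g(4) beta_ftr_ucls[OF g(3)] lmor_sel(1)
        by (rule B'.ract_upost[OF cE[OF r] g', symmetric]) (use f.bmap_mem g(2) in simp)
      finally show ?thesis .
    qed
    have bH: "fm (beta_ftr (bas B') (mfun (lmor f))) x y v \<in> Hom (beta (bas B')) (bmap (cpt f) x) (bmap (cpt f) y)"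
      if v: "v \<in> Hom (beta (bas B)) x y" for x y v
    proof -
      obtain g \<alpha> where g: "x \<in> bobj (Obj (bas B))" "y \<in> bobj (Obj (bas B))" "(g, \<alpha>) \<in> upairs (Hom (bas B)) x y"
        "v = ucls (Hom (bas B)) x y (g, \<alpha>)" using v by (elim HomBE)
      show ?thesis unfolding g(4) beta_ftr_ucls[OF g(3)] lmor_sel(1)
        by (rule HomBI[OF _ _ upairs_bmap[OF g(3)]]) (use f.bmap_mem g(1,2) in \<open>simp_all del: lmor_sel(3) add: fH\<close>)
    qed
    show ?case unfolding pcell_def
    proof (intro conjI allI impI)
      fix d c show "mcell (lmor f) d c \<in> Els (str B) d c \<rightarrow>\<^sub>E Els (str B') (fo (mfun (lmor f)) d) (fo (beta_ftr (bas B') (mfun (lmor f))) c)"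
        using f.carr_fun[of d c] by (simp add: beta_ftr_def)
    next
      fix d d' x y u v r assume a: "u \<in> Hom (bas B) d' d" "v \<in> Hom (beta (bas B)) x y" "r \<in> Els (str B) d x"
      show "mcell (lmor f) d' y (Act (str B) d d' x y u v r) =
        Act (str B') (fo (mfun (lmor f)) d) (fo (mfun (lmor f)) d') (fo (beta_ftr (bas B') (mfun (lmor f))) x)
          (fo (beta_ftr (bas B') (mfun (lmor f))) y) (fm (mfun (lmor f)) d' d u)
          (fm (beta_ftr (bas B') (mfun (lmor f))) x y v) (mcell (lmor f) d x r)"
        using lnat[OF a(1) B.S.ract_Els[OF a(2,3)]] rnat[OF a(2,3)] B.S.Act_split(1)[OF a]
          B'.S.Act_split(1)[OF fH[OF a(1)] bH[OF a(2)] cE[OF a(3)]]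
        by (simp add: beta_ftr_def del: lmor_sel(3))
    qed
  next
    case (4 a)
    then show ?case using f.carr_uid[of a] cp[OF 4] by simp
  next
    case (5 r a x s Y)
    obtain t \<zeta> where t: "x \<in> bobj (Obj (bas B))" "Y \<in> bobj (bobj (Obj (bas B)))" "(t, \<zeta>) \<in> upairs (Els (str B)) x Y"
      "s = ucls (Els (str B)) x Y (t, \<zeta>)" using 5(2) by (rule B.bstrE)
    note r = 5(1) and tu = upairs_uindex[OF t(3)]
    have rg: "reidx (Obj (bas B)) x (pull x t Y) t" by (rule reidx_pull[OF t(1,2) tu])
    have bp: "bmap (cpt f) (pull x t Y) = pull (bmap (cpt f) x) t (bmap (bmap (cpt f)) Y)" by (rule bmap_pull[OF tu])
    have Y': "bmap (bmap (cpt f)) Y \<in> bobj (bobj (Obj (bas B')))"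
      by (rule bmap_bobj[OF t(2)]) (use f.bmap_mem in simp)
    have t': "(t, \<lambda>z\<in>Ix Y. carr f (Fm x (t z)) (Fm Y z) (\<zeta> z)) \<in> upairs (Els (str B')) (bmap (cpt f) x) (bmap (bmap (cpt f)) Y)"
      by (rule upairs_bmap[OF t(3)]) (rule cE)
    note d = B.dlt2_pull[OF r t(3,2)]
    have rE: "ure B.usp a x (pull x t Y) t r \<in> Els (str B) a (pull x t Y)"
      using B.ure_usp[OF rg r] B.ract_rearr_Els[OF rg r] by simp
    have o: "over (pull x t Y) (Fm Y) = Y" by (rule over_eq) simp_all
    have e: "(\<lambda>z\<in>Ix Y. carr f (Fm (pull x t Y) z) (Fm Y z) (\<zeta> z)) = (\<lambda>z\<in>Ix Y. carr f (Fm x (t z)) (Fm Y z) (\<zeta> z))"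
      by (simp cong: restrict_cong)
    have "carr f a (mu Y) (dlt2 B a x Y r s) = ucmp B'.usp (cpt f a) (bmap (cpt f) (pull x t Y)) (\<lambda>z\<in>Ix Y. bmap (cpt f) (Fm Y z))
        (\<lambda>z\<in>Ix Y. carr f (Fm x (t z)) (Fm Y z) (\<zeta> z)) (carr f a (pull x t Y) (ure B.usp a x (pull x t Y) t r))"
      unfolding t(4) d(1) e[symmetric] using f.carr_ucmp[OF _ d(2)] rE o by simp
    also have "carr f a (pull x t Y) (ure B.usp a x (pull x t Y) t r) =
        ure B'.usp (cpt f a) (bmap (cpt f) x) (bmap (cpt f) (pull x t Y)) t (carr f a x r)"
      by (rule f.carr_reindex) (use r rg in \<open>simp_all add: B.reindex_usp\<close>)
    finally show ?case
      unfolding lmor_sel bp unfolding t(4) bcell_ucls[OF t(3)] B'.dlt2_pull(1)[OF cE[OF r] t' Y'] bmap_sel .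
  qed
qed

text \<open>The functor part of a morphism is recovered from its cell: the cell preserves
  \<Gamma>(id) and is natural on the left, so it sends \<Gamma>(u) to the image under \<Gamma>' of
  the functor value at \<open>u\<close>.\<close>

lemma continuous_umor:
  assumes "representable_colax_morphism B B' m"
  shows "continuous_map B.usp B'.usp (umor m)" "lmor (umor m) = m"
proof -
  interpret m: representable_colax_morphism B B' m by fact
  interpret f: is_functor "bas B" "bas B'" "mfun m" by (rule m.mfun_functor)
  define f where "f = fo (mfun m)"
  have mE: "mcell m a x \<in> Els (str B) a x \<rightarrow>\<^sub>E Els (str B') (f a) (bmap f x)" for a x
    using m.mcell_natural by (simp add: pcell_def f_def beta_ftr_def)
  have mA: "mcell m d' y (Act (str B) d d' x y u v r) =
      Act (str B') (f d) (f d') (bmap f x) (bmap f y) (fm (mfun m) d' d u) (fm (beta_ftr (bas B') (mfun m)) x y v) (mcell m d x r)"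
    if "u \<in> Hom (bas B) d' d" "v \<in> Hom (beta (bas B)) x y" "r \<in> Els (str B) d x" for d d' x y u v r
    using m.mcell_natural that by (simp add: pcell_def f_def beta_ftr_def)
  have bf: "bmap f x \<in> bobj (Obj (bas B'))" if "x \<in> bobj (Obj (bas B))" for x
    by (rule bmap_bobj[OF that]) (simp add: f_def f.fo_Obj)
  \<comment> \<open>A functor preserves identities, so \<beta> of it sends a reindexing to the
    reindexing with the same index map.\<close>
  have rr: "fm (beta_ftr (bas B') (mfun m)) x y (rearr (bas B) x y g) = rearr (bas B') (bmap f x) (bmap f y) g"
    and rg: "reidx (Obj (bas B')) (bmap f x) (bmap f y) g"
    if g: "reidx (Obj (bas B)) x y g" for x y g
  proof -
    show g': "reidx (Obj (bas B')) (bmap f x) (bmap f y) g"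
      by (rule reidx_bmap[OF g]) (simp add: f_def f.fo_Obj)
    have "(\<lambda>z\<in>Ix y. fm (mfun m) (Fm x (g z)) (Fm y z) ((\<lambda>z\<in>Ix y. Ide (bas B) (Fm y z)) z)) =
        (\<lambda>z\<in>Ix (bmap f y). Ide (bas B') (Fm (bmap f y) z))"
      unfolding bmap_sel
      by (rule restrict_ext) (simp add: reidxD(5)[OF g] f.fm_Ide bobj_mem[OF reidxD(2)[OF g]] f_def)
    then show "fm (beta_ftr (bas B') (mfun m)) x y (rearr (bas B) x y g) = rearr (bas B') (bmap f x) (bmap f y) g"
      unfolding rearr_eq[OF g] beta_ftr_ucls[OF B.C.upairs_rearr[OF g]] rearr_eq[OF g'] by (simp only: f_def)
  qed
  have mg: "mcell m a (eta b) (gam B a b u) = gam B' (f a) (f b) (fm (mfun m) a b u)" if u: "u \<in> Hom (bas B) a b" for a b u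
  proof -
    have o: "a \<in> Obj (bas B)" "b \<in> Obj (bas B)" using B.C.Hom_Obj[OF u] by auto
    have u': "fm (mfun m) a b u \<in> Hom (bas B') (f a) (f b)" using f.fm_Hom[OF u] by (simp add: f_def)
    note fb = B'.C.Hom_Obj[OF u', THEN conjunct2]
    have i: "fm (beta_ftr (bas B') (mfun m)) (eta b) (eta b) (Ide (beta (bas B)) (eta b)) = Ide (beta (bas B')) (eta (f b))"
      unfolding Ide_beta_rearr rr[OF reidx_id[OF eta_bobj[OF o(2)]]] by simp
    have "mcell m a (eta b) (gam B a b u) = mcell m a (eta b) (lact (beta (bas B)) (str B) b a (eta b) u (gam B b b (Ide (bas B) b)))"
      using B.gam_lact[OF u B.C.Ide_Hom[OF o(2)]] B.C.Cmp_Ide_left[OF u] by simp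
    also have "\<dots> = lact (beta (bas B')) (str B') (f b) (f a) (eta (f b)) (fm (mfun m) a b u) (gam B' (f b) (f b) (Ide (bas B') (f b)))"
      using mA[OF u B.S.C.Ide_Hom B.gam_Ide_E[OF o(2)]] eta_bobj[OF o(2)] m.mcell_unit[OF o(2)] by (simp add: i f_def)
    also have "\<dots> = gam B' (f a) (f b) (fm (mfun m) a b u)"
      using B'.gam_lact[OF u' B'.C.Ide_Hom[OF fb]] B'.C.Cmp_Ide_left[OF u'] by simp
    finally show ?thesis .
  qed
  show "continuous_map B.usp B'.usp (umor m)"
  proof (rule continuous_map.intro, goal_cases)
    case 1 show ?case using m.mfun_functor(2) f.fo_Obj by (auto simp: ftr_ext_def PiE_iff)
  next
    case (2 a x) show ?case using mE by (simp add: f_def)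
  next
    case (3 r a x y g)
    then have r: "r \<in> Els (str B) a x" and g: "reidx (Obj (bas B)) x y g" by (simp_all add: B.reindex_usp)
    note a = B.E_obj(1)[OF r]
    show ?case
      using mA[OF B.C.Ide_Hom[OF a] B.C.rearr_Hom[OF g] r] B.ure_usp[OF g r] B'.ure_usp[OF rg[OF g] PiE_mem[OF mE r]]
        f.fm_Ide[OF a] rr[OF g] by (simp add: f_def)
  next
    case (4 a)
    then show ?case using m.mcell_unit[of a] f.fo_Obj[of a] by simp
  next
    case (5 r a x Y s)
    then have r: "r \<in> Els (str B) a x" by simp
    note x = B.E_obj(2)[OF r] and fs = 5(2)
    note p = B.upairs_ufamily_usp[OF fs x]
    let ?s = "\<lambda>z\<in>Ix x. mcell m (Fm x z) (Y z) (s z)" and ?Y = "\<lambda>z\<in>Ix x. bmap f (Y z)"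
    have fs': "Y \<in> Ix x \<rightarrow>\<^sub>E bobj (Obj (bas B))" "\<And>z. z \<in> Ix x \<Longrightarrow> s z \<in> Els (str B) (Fm x z) (Y z)"
      using fs by (auto simp: B.ufamily_usp)
    have f': "ufamily B'.usp (bmap f x) ?Y ?s"
      using fs' bf PiE_mem[OF mE] by (auto simp: B'.ufamily_usp)
    have o: "over (bmap f x) ?Y = bmap (bmap f) (over x Y)" by (simp add: bmap_over over_bmap)
    have e: "(\<lambda>z\<in>Ix (over x Y). mcell m (Fm x ((\<lambda>z\<in>Ix x. z) z)) (Fm (over x Y) z) (s z)) = ?s" by (simp cong: restrict_cong)
    have b: "bcell (str B') f (bmap f) (mcell m) x (over x Y) (ucls (Els (str B)) x (over x Y) (\<lambda>z\<in>Ix x. z, s)) =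
      ucls (Els (str B')) (bmap f x) (over (bmap f x) ?Y) (\<lambda>z\<in>Ix (bmap f x). z, ?s)"
      unfolding bcell_ucls[OF p(1)] e o by simp
    show ?case
      using m.mcell_mult[OF r p(3)] B.ucmp_usp[OF r fs] B'.ucmp_usp[OF PiE_mem[OF mE r] f']
      unfolding f_def[symmetric] umor_sel b by (simp only: o)
  qed
  have "fm (mfun (lmor (umor m))) a b = fm (mfun m) a b" for a b
  proof (rule extensionalityI[of _ "Hom (bas B) a b"])
    show "fm (mfun m) a b \<in> extensional (Hom (bas B) a b)" using m.mfun_functor(2) by (simp add: ftr_ext_def)
    fix u assume u: "u \<in> Hom (bas B) a b"
    then show "fm (mfun (lmor (umor m))) a b u = fm (mfun m) a b u"
      using mg[OF u] f.fm_Hom[OF u] by (simp add: f_def)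
  qed simp
  then have "mfun (lmor (umor m)) = mfun m"
    by (intro ftr.equality) (auto simp: fun_eq_iff)
  then show "lmor (umor m) = m" by (intro lax_mor.equality) simp_all
qed

lemma umor_lmor: "umor (lmor f) = f"
  by (intro ucmap.equality) simp_all

lemma lmor_bij: "bij_betw lmor (Hom1 UltSp B.usp B'.usp) (Hom1 NLaxAlg B B')"
  by (rule bij_betw_byWitness[where f' = umor])
    (auto simp: UltSp_sel NLaxAlg_def umor_lmor continuous_umor representable_lmor)

section \<open>The correspondence of 2-cells\<close>

definition lcell :: "'u ucmap \<Rightarrow> 'u ucmap \<Rightarrow> ('u \<Rightarrow> 'u) \<Rightarrow> 'u \<Rightarrow> 'u" where
  "lcell f g \<alpha> = (\<lambda>a\<in>Obj (bas B). B'.gami (cpt f a) (cpt g a) (\<alpha> a))"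

definition ucell :: "'u ucmap \<Rightarrow> 'u ucmap \<Rightarrow> ('u \<Rightarrow> 'u) \<Rightarrow> 'u \<Rightarrow> 'u" where
  "ucell f g \<sigma> = (\<lambda>a\<in>Obj (bas B). gam B' (cpt f a) (cpt g a) (\<sigma> a))"

lemma ract_cell:
  assumes f: "uspace_map B.usp B'.usp f" and g: "uspace_map B.usp B'.usp g"
    and \<sigma>: "\<And>a. a \<in> Obj (bas B) \<Longrightarrow> \<sigma> a \<in> Hom (bas B') (cpt f a) (cpt g a)" and r: "r \<in> Els (str B) a x"
  shows "ract (bas B') (str B') (cpt f a) (bmap (cpt f) x) (bmap (cpt g) x)
        (ucls (Hom (bas B')) (bmap (cpt f) x) (bmap (cpt g) x) (\<lambda>z\<in>Ix x. z, \<lambda>z\<in>Ix x. \<sigma> (Fm x z))) (carr f a x r) =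
    upost B'.usp (cpt f a) (bmap (cpt f) x) (bmap (cpt g) x) (\<lambda>z\<in>Ix x. ucell f g \<sigma> (Fm x z)) (carr f a x r)"
proof -
  interpret f: uspace_map B.usp B'.usp f by fact
  interpret g: uspace_map B.usp B'.usp g by fact
  note x = B.E_obj(2)[OF r]
  note fx = f.bmap_mem[simplified, OF x] and gx = g.bmap_mem[simplified, OF x]
  have m: "(\<lambda>z\<in>Ix (bmap (cpt f) x). z, \<lambda>z\<in>Ix x. \<sigma> (Fm x z)) \<in> upairs (Hom (bas B')) (bmap (cpt f) x) (bmap (cpt g) x)"
    using uindex_id[OF bobj_ev[OF fx]] \<sigma> bobj_mem[OF x] by (simp add: mem_upairs uindex_def)
  have e: "(\<lambda>z\<in>Ix (bmap (cpt f) x). gam B' (Fm (bmap (cpt f) x) z) (Fm (bmap (cpt g) x) z) ((\<lambda>z\<in>Ix x. \<sigma> (Fm x z)) z)) =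
      (\<lambda>z\<in>Ix x. ucell f g \<sigma> (Fm x z))"
    unfolding bmap_sel by (rule restrict_ext) (simp add: ucell_def bobj_mem[OF x])
  show ?thesis using B'.ract_upost_id[OF f.carr_E[simplified, OF r] m gx] unfolding e by simp
qed

text \<open>The compatibility of a 2-cell with \<open>r\<close> is the naturality of the
  transformation at \<open>r\<close>, read through \<open>lact_upre\<close> and
  \<open>ract_upost_id\<close>. Its naturality for a morphism \<open>u\<close> of
  \<open>A\<^sub>0\<close> is the case of the arrow \<Gamma>(u), because \<Gamma>' is
  injective.\<close>

lemma ucell_iff:
  assumes f: "continuous_map B.usp B'.usp f" and g: "continuous_map B.usp B'.usp g"
    and \<sigma>: "\<sigma> \<in> (\<Pi>\<^sub>E a\<in>Obj (bas B). Hom (bas B') (cpt f a) (cpt g a))"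
  shows "algebra_2cell B B' (lmor f) (lmor g) \<sigma> \<longleftrightarrow> transformation B.usp B'.usp f g (ucell f g \<sigma>)"
proof -
  interpret f: uspace_map B.usp B'.usp f by (rule uspace_map_usp[OF f])
  interpret g: uspace_map B.usp B'.usp g by (rule uspace_map_usp[OF g])
  have s: "\<sigma> a \<in> Hom (bas B') (cpt f a) (cpt g a)" if "a \<in> Obj (bas B)" for a using \<sigma> that by auto
  have c: "ucell f g \<sigma> \<in> (\<Pi>\<^sub>E a\<in>Obj (bas B). Els (str B') (cpt f a) (eta (cpt g a)))"
    using s by (auto simp: ucell_def intro!: B'.gam_E)
  have eq: "upost B'.usp (cpt f a) (bmap (cpt f) x) (bmap (cpt g) x) (\<lambda>z\<in>Ix x. ucell f g \<sigma> (Fm x z)) (carr f a x r) =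
      ract (bas B') (str B') (cpt f a) (bmap (cpt f) x) (bmap (cpt g) x)
        (ucls (Hom (bas B')) (bmap (cpt f) x) (bmap (cpt g) x) (\<lambda>z\<in>Ix x. z, \<lambda>z\<in>Ix x. \<sigma> (Fm x z))) (carr f a x r)"
    "upre B'.usp (cpt f a) (cpt g a) (bmap (cpt g) x) (carr g a x r) (ucell f g \<sigma> a) =
      lact (beta (bas B')) (str B') (cpt g a) (cpt f a) (bmap (cpt g) x) (\<sigma> a) (carr g a x r)"
    if r: "r \<in> Els (str B) a x" for r a x
    using ract_cell[OF f.uspace_map_axioms g.uspace_map_axioms s r] B'.lact_upre[OF s[OF B.E_obj(1)[OF r]] g.carr_E[simplified, OF r]]
      B.E_obj(1)[OF r] by (simp_all add: ucell_def)
  show ?thesis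
  proof
    assume "algebra_2cell B B' (lmor f) (lmor g) \<sigma>"
    then interpret a: algebra_2cell B B' "lmor f" "lmor g" \<sigma> .
    show "transformation B.usp B'.usp f g (ucell f g \<sigma>)"
      by standard (use c eq a.compatible in simp_all)
  next
    assume "transformation B.usp B'.usp f g (ucell f g \<sigma>)"
    then interpret t: utrans B.usp B'.usp f g "ucell f g \<sigma>"
      by (intro utrans.intro f.uspace_map_axioms g.uspace_map_axioms)
    show "algebra_2cell B B' (lmor f) (lmor g) \<sigma>"
    proof (rule algebra_2cell.intro, goal_cases)
      case 1 show ?case using \<sigma> by simp
    next
      case (2 u a b)
      then have o: "a \<in> Obj (bas B)" "b \<in> Obj (bas B)" using B.C.Hom_Obj by blast+
      note gu = B.gam_E[OF 2]
      note fE = f.carr_E_eta[simplified, OF gu] and gE = g.carr_E_eta[simplified, OF gu]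
      show ?case
      proof (rule B'.gam_eqD)
        show "gam B' (cpt f a) (cpt g b) (Cmp (bas B') (fo (mfun (lmor f)) a) (fo (mfun (lmor f)) b) (fo (mfun (lmor g)) b) (\<sigma> b) (fm (mfun (lmor f)) a b u)) =
          gam B' (cpt f a) (cpt g b) (Cmp (bas B') (fo (mfun (lmor f)) a) (fo (mfun (lmor g)) a) (fo (mfun (lmor g)) b) (fm (mfun (lmor g)) a b u) (\<sigma> a))"
          using t.natural_eta[simplified, OF gu] B'.gam_Cmp[OF B'.gami(3)[OF fE] s[OF o(2)]] B'.gam_Cmp[OF s[OF o(1)] B'.gami(3)[OF gE]]
            2 o fE gE by (simp add: ucell_def)
      qed (use 2 o s fE gE in \<open>auto intro!: B'.C.Cmp_Hom\<close>)
    next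
      case (3 r a x) then show ?case using t.natural[of r a x] eq[OF 3] by simp
    qed
  qed
qed

lemma lcell_bij:
  assumes f: "continuous_map B.usp B'.usp f" and g: "continuous_map B.usp B'.usp g"
  shows "bij_betw (lcell f g) (Hom2 UltSp B.usp B'.usp f g) (Hom2 NLaxAlg B B' (lmor f) (lmor g))"
proof (rule bij_betw_byWitness[where f' = "ucell f g"])
  have L: "\<sigma> \<in> Hom2 NLaxAlg B B' (lmor f) (lmor g) \<longleftrightarrow> \<sigma> \<in> (\<Pi>\<^sub>E a\<in>Obj (bas B). Hom (bas B') (cpt f a) (cpt g a)) \<and>
      transformation B.usp B'.usp f g (ucell f g \<sigma>)" for \<sigma>
    using ucell_iff[OF f g, of \<sigma>] algebra_2cell.components[of B B' "lmor f" "lmor g" \<sigma>] by (auto simp: NLaxAlg_def)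
  have K: "\<alpha> \<in> (\<Pi>\<^sub>E a\<in>Obj (bas B). Els (str B') (cpt f a) (eta (cpt g a)))" if "\<alpha> \<in> Hom2 UltSp B.usp B'.usp f g" for \<alpha>
    using that transformation.components[of B.usp B'.usp f g \<alpha>] by (simp add: UltSp_sel)
  show uc: "\<forall>\<alpha>\<in>Hom2 UltSp B.usp B'.usp f g. ucell f g (lcell f g \<alpha>) = \<alpha>"
  proof
    fix \<alpha> assume "\<alpha> \<in> Hom2 UltSp B.usp B'.usp f g"
    note k = K[OF this]
    have "ucell f g (lcell f g \<alpha>) = (\<lambda>a\<in>Obj (bas B). \<alpha> a)"
      unfolding ucell_def lcell_def by (rule restrict_ext) (use PiE_mem[OF k] in simp)
    then show "ucell f g (lcell f g \<alpha>) = \<alpha>" by (simp only: PiE_restrict[OF k])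
  qed
  show "\<forall>\<sigma>\<in>Hom2 NLaxAlg B B' (lmor f) (lmor g). lcell f g (ucell f g \<sigma>) = \<sigma>"
  proof
    fix \<sigma> assume "\<sigma> \<in> Hom2 NLaxAlg B B' (lmor f) (lmor g)"
    then have k: "\<sigma> \<in> (\<Pi>\<^sub>E a\<in>Obj (bas B). Hom (bas B') (cpt f a) (cpt g a))" by (simp add: L)
    have "lcell f g (ucell f g \<sigma>) = (\<lambda>a\<in>Obj (bas B). \<sigma> a)"
      unfolding ucell_def lcell_def by (rule restrict_ext) (use PiE_mem[OF k] in simp)
    then show "lcell f g (ucell f g \<sigma>) = \<sigma>" by (simp only: PiE_restrict[OF k])
  qed
  have "lcell f g \<alpha> \<in> (\<Pi>\<^sub>E a\<in>Obj (bas B). Hom (bas B') (cpt f a) (cpt g a))" if "\<alpha> \<in> Hom2 UltSp B.usp B'.usp f g" for \<alpha>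
    using PiE_mem[OF K[OF that]] by (auto simp: lcell_def)
  then show "lcell f g ` Hom2 UltSp B.usp B'.usp f g \<subseteq> Hom2 NLaxAlg B B' (lmor f) (lmor g)"
    using uc by (auto simp: L UltSp_sel)
  show "ucell f g ` Hom2 NLaxAlg B B' (lmor f) (lmor g) \<subseteq> Hom2 UltSp B.usp B'.usp f g"
    by (auto simp: L UltSp_sel)
qed

end

section \<open>Local isomorphisms of strict 2-categories\<close>

text \<open>2-cells are bundled with their boundaries, so that the laws can be stated without indices.\<close>

context two_category
begin

definition cell :: "'o \<Rightarrow> 'o \<Rightarrow> 'o \<times> 'o \<times> 'f \<times> 'f \<times> 's \<Rightarrow> bool" where
  "cell A B s \<longleftrightarrow> (\<exists>f g \<sigma>. s = (A, B, f, g, \<sigma>) \<and> A \<in> Ob2 K \<and> B \<in> Ob2 K \<and> f \<in> Hom1 K A B \<and> g \<in> Hom1 K A B \<and>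
     \<sigma> \<in> Hom2 K A B f g)"

definition hc :: "'o \<times> 'o \<times> 'f \<times> 'f \<times> 's \<Rightarrow> 'o \<times> 'o \<times> 'f \<times> 'f \<times> 's \<Rightarrow> 'o \<times> 'o \<times> 'f \<times> 'f \<times> 's" where
  "hc t s = (case (t, s) of ((B, C, g, g', \<tau>), (A, B', f, f', \<sigma>)) \<Rightarrow>
     (A, C, comp1 K A B C g f, comp1 K A B C g' f', hcomp K A B C f f' g g' \<tau> \<sigma>))"

definition vc :: "'o \<times> 'o \<times> 'f \<times> 'f \<times> 's \<Rightarrow> 'o \<times> 'o \<times> 'f \<times> 'f \<times> 's \<Rightarrow> 'o \<times> 'o \<times> 'f \<times> 'f \<times> 's" where
  "vc t s = (case (t, s) of ((A, B, g, h, \<tau>), (A', B', f, g', \<sigma>)) \<Rightarrow> (A, B, f, h, vcomp K A B f g h \<tau> \<sigma>))"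

definition ic :: "'o \<Rightarrow> 'o \<Rightarrow> 'f \<Rightarrow> 'o \<times> 'o \<times> 'f \<times> 'f \<times> 's" where
  "ic A B f = (A, B, f, f, id2 K A B f)"

section \<open>Laws of bundled 2-cells\<close>

lemma cell_ic: "A \<in> Ob2 K \<Longrightarrow> B \<in> Ob2 K \<Longrightarrow> f \<in> Hom1 K A B \<Longrightarrow> cell A B (ic A B f)"
  by (simp add: cell_def ic_def id2_Hom2)

lemma cell_hc: "cell A B s \<Longrightarrow> cell B C t \<Longrightarrow> cell A C (hc t s)"
  by (auto simp: cell_def hc_def intro: comp1_Hom1 hcomp_Hom2)

lemma hc_assoc: "cell A B s \<Longrightarrow> cell B C t \<Longrightarrow> cell C D u \<Longrightarrow> hc u (hc t s) = hc (hc u t) s"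
  by (auto simp: cell_def hc_def comp1_assoc hcomp_assoc)

lemma hc_ic: "A \<in> Ob2 K \<Longrightarrow> B \<in> Ob2 K \<Longrightarrow> C \<in> Ob2 K \<Longrightarrow> f \<in> Hom1 K A B \<Longrightarrow> g \<in> Hom1 K B C \<Longrightarrow>
    hc (ic B C g) (ic A B f) = ic A C (comp1 K A B C g f)"
  by (simp add: hc_def ic_def hcomp_id2)

lemma hc_id_left: "cell A B s \<Longrightarrow> hc (ic B B (id1 K B)) s = s"
  by (auto simp: cell_def hc_def ic_def comp1_id1_left hcomp_id1_left)

lemma hc_id_right: "cell A B s \<Longrightarrow> hc s (ic A A (id1 K A)) = s"
  by (auto simp: cell_def hc_def ic_def comp1_id1_right hcomp_id1_right)

text \<open>Interchange with an identity 2-cell as the other factor.\<close>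

lemma hc_ic_vc_left:
  assumes "cell A B (A, B, f, g, \<sigma>)" "cell A B (A, B, g, h, \<tau>)" "C \<in> Ob2 K" "q \<in> Hom1 K B C"
  shows "hc (ic B C q) (vc (A, B, g, h, \<tau>) (A, B, f, g, \<sigma>)) =
    vc (hc (ic B C q) (A, B, g, h, \<tau>)) (hc (ic B C q) (A, B, f, g, \<sigma>))"
  using assms interchange[of A B C f g h q q q \<sigma> \<tau> "id2 K B C q" "id2 K B C q"] vcomp_id2_left[of B C q q "id2 K B C q"]
  by (simp add: cell_def hc_def vc_def ic_def id2_Hom2)

lemma hc_ic_vc_right:
  assumes "cell A B (A, B, f, g, \<sigma>)" "cell A B (A, B, g, h, \<tau>)" "C \<in> Ob2 K" "p \<in> Hom1 K C A"
  shows "hc (vc (A, B, g, h, \<tau>) (A, B, f, g, \<sigma>)) (ic C A p) =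
    vc (hc (A, B, g, h, \<tau>) (ic C A p)) (hc (A, B, f, g, \<sigma>) (ic C A p))"
  using assms interchange[of C A B p p p f g h "id2 K C A p" "id2 K C A p" \<sigma> \<tau>] vcomp_id2_left[of C A p p "id2 K C A p"]
  by (simp add: cell_def hc_def vc_def ic_def id2_Hom2)

definition iso1 :: "'o \<Rightarrow> 'o \<Rightarrow> 'f \<Rightarrow> 'f \<Rightarrow> bool" where
  "iso1 A B p p' \<longleftrightarrow> A \<in> Ob2 K \<and> B \<in> Ob2 K \<and> p \<in> Hom1 K A B \<and> p' \<in> Hom1 K B A \<and>
     comp1 K A B A p' p = id1 K A \<and> comp1 K B A B p p' = id1 K B"

lemma iso1_sym: "iso1 A B p p' \<Longrightarrow> iso1 B A p' p"
  by (simp add: iso1_def)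

lemma iso1D:
  assumes "iso1 A B p p'"
  shows "A \<in> Ob2 K" "B \<in> Ob2 K" "p \<in> Hom1 K A B" "p' \<in> Hom1 K B A" "cell A B (ic A B p)" "cell B A (ic B A p')"
    "hc (ic B A p') (ic A B p) = ic A A (id1 K A)" "hc (ic A B p) (ic B A p') = ic B B (id1 K B)"
  using assms by (simp_all add: iso1_def cell_ic hc_ic)

text \<open>Conjugation by isomorphisms from \<open>A\<close> to \<open>B\<close> with inverse
  \<open>p'\<close>, and \<open>q\<close> from \<open>A'\<close> to \<open>B'\<close>. Acting on
  bundled 2-cells it covers 1-cells as well, through their identity 2-cells; \<open>cj1\<close> and
  \<open>cj2\<close> are its components.\<close>

definition cj :: "'o \<Rightarrow> 'o \<Rightarrow> 'o \<Rightarrow> 'o \<Rightarrow> 'f \<Rightarrow> 'f \<Rightarrow> 'o \<times> 'o \<times> 'f \<times> 'f \<times> 's \<Rightarrow> 'o \<times> 'o \<times> 'f \<times> 'f \<times> 's" where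
  "cj A B A' B' q p' s = hc (ic A' B' q) (hc s (ic B A p'))"

definition cj1 :: "'o \<Rightarrow> 'o \<Rightarrow> 'o \<Rightarrow> 'o \<Rightarrow> 'f \<Rightarrow> 'f \<Rightarrow> 'f \<Rightarrow> 'f" where
  "cj1 A B A' B' q p' f = comp1 K B A' B' q (comp1 K B A A' f p')"

definition cj2 :: "'o \<Rightarrow> 'o \<Rightarrow> 'o \<Rightarrow> 'o \<Rightarrow> 'f \<Rightarrow> 'f \<Rightarrow> 'f \<Rightarrow> 'f \<Rightarrow> 's \<Rightarrow> 's" where
  "cj2 A B A' B' q p' f g \<sigma> = hcomp K B A' B' (comp1 K B A A' f p') (comp1 K B A A' g p') q q (id2 K A' B' q)
     (hcomp K B A A' p' p' f g \<sigma> (id2 K B A p'))"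

lemma cj_eq: "cj A B A' B' q p' (A, A', f, g, \<sigma>) =
    (B, B', cj1 A B A' B' q p' f, cj1 A B A' B' q p' g, cj2 A B A' B' q p' f g \<sigma>)"
  by (simp add: cj_def cj1_def cj2_def hc_def ic_def)

lemma cell_cj: "iso1 A B p p' \<Longrightarrow> iso1 A' B' q q' \<Longrightarrow> cell A A' s \<Longrightarrow> cell B B' (cj A B A' B' q p' s)"
  unfolding cj_def by (intro cell_hc) (auto intro: iso1D)

lemma cj_inverse:
  assumes p: "iso1 A B p p'" and q: "iso1 A' B' q q'" and s: "cell A A' s"
  shows "cj B A B' A' q' p (cj A B A' B' q p' s) = s"
proof -
  note P = iso1D[OF p] and Q = iso1D[OF q]
  have "cj B A B' A' q' p (cj A B A' B' q p' s) =
      hc (ic B' A' q') (hc (ic A' B' q) (hc (hc s (ic B A p')) (ic A B p)))"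
    unfolding cj_def hc_assoc[OF P(5) cell_hc[OF P(6) s] Q(5)] ..
  also have "hc (hc s (ic B A p')) (ic A B p) = s"
    unfolding hc_assoc[OF P(5,6) s, symmetric] P(7) hc_id_right[OF s] ..
  also have "hc (ic B' A' q') (hc (ic A' B' q) s) = s"
    unfolding hc_assoc[OF s Q(5,6)] Q(7) hc_id_left[OF s] ..
  finally show ?thesis .
qed

lemma cj_ic:
  assumes p: "iso1 A B p p'" and q: "iso1 A' B' q q'" and f: "f \<in> Hom1 K A A'"
  shows "cj A B A' B' q p' (ic A A' f) = ic B B' (cj1 A B A' B' q p' f)"
  using iso1D[OF p] iso1D[OF q] f by (simp add: cj_def cj1_def hc_ic comp1_Hom1)

lemma cj_id:
  assumes p: "iso1 A B p p'"
  shows "cj A B A B p p' (ic A A (id1 K A)) = ic B B (id1 K B)"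
  using iso1D[OF p] by (simp add: cj_def hc_id_left)

text \<open>Between the two conjugated factors \<open>q'\<close> and \<open>q\<close> meet and
  cancel.\<close>

lemma cj_hc:
  assumes p: "iso1 A B p p'" and q: "iso1 A' B' q q'" and r: "iso1 A'' B'' r r'"
    and s: "cell A A' s" and t: "cell A' A'' t"
  shows "cj A B A'' B'' r p' (hc t s) = hc (cj A' B' A'' B'' r q' t) (cj A B A' B' q p' s)"
proof -
  note P = iso1D[OF p] and Q = iso1D[OF q] and R = iso1D[OF r]
  have sp: "cell B A' (hc s (ic B A p'))" by (rule cell_hc[OF P(6) s])
  have "hc (cj A' B' A'' B'' r q' t) (cj A B A' B' q p' s) =
      hc (ic A'' B'' r) (hc (hc t (ic B' A' q')) (cj A B A' B' q p' s))"
    unfolding cj_def by (rule hc_assoc[OF cell_hc[OF sp Q(5)] cell_hc[OF Q(6) t] R(5), symmetric])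
  also have "hc (hc t (ic B' A' q')) (cj A B A' B' q p' s) = hc t (hc (ic B' A' q') (hc (ic A' B' q) (hc s (ic B A p'))))"
    unfolding cj_def by (rule hc_assoc[OF cell_hc[OF sp Q(5)] Q(6) t, symmetric])
  also have "hc (ic B' A' q') (hc (ic A' B' q) (hc s (ic B A p'))) = hc s (ic B A p')"
    unfolding hc_assoc[OF sp Q(5,6)] Q(7) hc_id_left[OF sp] ..
  also have "hc t (hc s (ic B A p')) = hc (hc t s) (ic B A p')" by (rule hc_assoc[OF P(6) s t])
  finally show ?thesis by (simp add: cj_def)
qed

lemma cj_vc:
  assumes p: "iso1 A B p p'" and q: "iso1 A' B' q q'"
    and s: "cell A A' (A, A', f, g, \<sigma>)" and t: "cell A A' (A, A', g, h, \<tau>)"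
  shows "cj A B A' B' q p' (vc (A, A', g, h, \<tau>) (A, A', f, g, \<sigma>)) =
    vc (cj A B A' B' q p' (A, A', g, h, \<tau>)) (cj A B A' B' q p' (A, A', f, g, \<sigma>))"
proof -
  note P = iso1D[OF p] and Q = iso1D[OF q]
  have c: "cell B A' (hc (A, A', f, g, \<sigma>) (ic B A p'))" "cell B A' (hc (A, A', g, h, \<tau>) (ic B A p'))"
    using cell_hc[OF P(6) s] cell_hc[OF P(6) t] .
  show ?thesis unfolding cj_def hc_ic_vc_right[OF s t P(2,4)]
    using hc_ic_vc_left[OF c[unfolded hc_def ic_def prod.case] Q(2,3)] by (simp add: hc_def ic_def)
qed

lemma cell_iff [simp]: "cell A B (A', B', f, g, \<sigma>) \<longleftrightarrow> A = A' \<and> B = B' \<and> A \<in> Ob2 K \<and> B \<in> Ob2 K \<and> f \<in> Hom1 K A B \<and> g \<in> Hom1 K A B \<and>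
     \<sigma> \<in> Hom2 K A B f g"
  by (auto simp: cell_def)

lemma cj1_Hom1: "iso1 A B p p' \<Longrightarrow> iso1 A' B' q q' \<Longrightarrow> f \<in> Hom1 K A A' \<Longrightarrow> cj1 A B A' B' q p' f \<in> Hom1 K B B'"
  by (simp add: cj1_def iso1_def comp1_Hom1)

text \<open>Conjugation by the inverse isomorphisms is inverse. For 1-cells this is read off from
  \<open>cj_inverse\<close> at identity 2-cells.\<close>

lemma cj1_bij:
  assumes p: "iso1 A B p p'" and q: "iso1 A' B' q q'"
  shows "bij_betw (cj1 A B A' B' q p') (Hom1 K A A') (Hom1 K B B')"
proof (rule bij_betw_byWitness[where f' = "cj1 B A B' A' q' p"])
  have "cj1 B A B' A' q' p (cj1 A B A' B' q p' f) = f" if f: "f \<in> Hom1 K A A'"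
    and p: "iso1 A B p p'" and q: "iso1 A' B' q q'" for f A B A' B' p p' q q'
    using cj_inverse[OF p q cell_ic[OF _ _ f]] iso1D[OF p] iso1D[OF q]
      cj_ic[OF p q f] cj_ic[OF iso1_sym[OF p] iso1_sym[OF q] cj1_Hom1[OF p q f]] by (simp add: ic_def)
  then show "\<forall>f\<in>Hom1 K A A'. cj1 B A B' A' q' p (cj1 A B A' B' q p' f) = f"
    "\<forall>g\<in>Hom1 K B B'. cj1 A B A' B' q p' (cj1 B A B' A' q' p g) = g"
    using assms iso1_sym[OF p] iso1_sym[OF q] by blast+
qed (auto intro: cj1_Hom1[OF p q] cj1_Hom1[OF iso1_sym[OF p] iso1_sym[OF q]])

lemma cj2_Hom2:
  assumes "iso1 A B p p'" "iso1 A' B' q q'" "f \<in> Hom1 K A A'" "g \<in> Hom1 K A A'" "\<sigma> \<in> Hom2 K A A' f g"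
  shows "cj2 A B A' B' q p' f g \<sigma> \<in> Hom2 K B B' (cj1 A B A' B' q p' f) (cj1 A B A' B' q p' g)"
  using cell_cj[OF assms(1,2), of "(A, A', f, g, \<sigma>)"] assms iso1D[OF assms(1)] iso1D[OF assms(2)] by (simp add: cj_eq)

lemma cj2_bij:
  assumes p: "iso1 A B p p'" and q: "iso1 A' B' q q'" and f: "f \<in> Hom1 K A A'" and g: "g \<in> Hom1 K A A'"
  shows "bij_betw (cj2 A B A' B' q p' f g) (Hom2 K A A' f g) (Hom2 K B B' (cj1 A B A' B' q p' f) (cj1 A B A' B' q p' g))"
proof -
  note p' = iso1_sym[OF p] and q' = iso1_sym[OF q]
  note F = cj1_Hom1[OF p q f] and G = cj1_Hom1[OF p q g]
  let ?F = "cj1 A B A' B' q p' f" and ?G = "cj1 A B A' B' q p' g"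
  note O = iso1D(1,2)[OF p] iso1D(1,2)[OF q]
  have inv1: "cj1 B A B' A' q' p (cj1 A B A' B' q p' h) = h" if h: "h \<in> Hom1 K A A'" for h
    using cj_inverse[OF p q cell_ic[OF O(1,3) h]] cj_ic[OF p q h] cj_ic[OF p' q' cj1_Hom1[OF p q h]] by (simp add: ic_def)
  show ?thesis
  proof (rule bij_betw_byWitness[where f' = "cj2 B A B' A' q' p ?F ?G"])
    show "\<forall>\<sigma>\<in>Hom2 K A A' f g. cj2 B A B' A' q' p ?F ?G (cj2 A B A' B' q p' f g \<sigma>) = \<sigma>"
    proof
      fix \<sigma> assume "\<sigma> \<in> Hom2 K A A' f g"
      then show "cj2 B A B' A' q' p ?F ?G (cj2 A B A' B' q p' f g \<sigma>) = \<sigma>"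
        using cj_inverse[OF p q, of "(A, A', f, g, \<sigma>)"] O f g by (simp add: cj_eq)
    qed
    show "\<forall>\<sigma>\<in>Hom2 K B B' ?F ?G. cj2 A B A' B' q p' f g (cj2 B A B' A' q' p ?F ?G \<sigma>) = \<sigma>"
    proof
      fix \<sigma> assume "\<sigma> \<in> Hom2 K B B' ?F ?G"
      then show "cj2 A B A' B' q p' f g (cj2 B A B' A' q' p ?F ?G \<sigma>) = \<sigma>"
        using cj_inverse[OF p' q', of "(B, B', ?F, ?G, \<sigma>)"] O F G by (simp add: cj_eq inv1 f g)
    qed
    show "cj2 A B A' B' q p' f g ` Hom2 K A A' f g \<subseteq> Hom2 K B B' ?F ?G" using cj2_Hom2[OF p q f g] by auto
    show "cj2 B A B' A' q' p ?F ?G ` Hom2 K B B' ?F ?G \<subseteq> Hom2 K A A' f g"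
      using cj2_Hom2[OF p' q' F G] by (auto simp: inv1 f g)
  qed
qed

end

text \<open>\<open>L\<close> enters as a bare record whose cells and operations are those of
  \<open>K\<close> between the objects \<open>U A\<close>, transported along \<open>V1\<close> and
  \<open>V2\<close>. Every law of a 2-category then passes from \<open>K\<close> to
  \<open>L\<close>.\<close>

locale local_isomorphism = K: two_category K
  for K :: "('o, 'f, 's) cat2" +
  fixes L :: "('p, 'g, 't) cat2" and U :: "'p \<Rightarrow> 'o"
    and V1 :: "'p \<Rightarrow> 'p \<Rightarrow> 'f \<Rightarrow> 'g" and V2 :: "'p \<Rightarrow> 'p \<Rightarrow> 'f \<Rightarrow> 'f \<Rightarrow> 's \<Rightarrow> 't"
  assumes U: "A \<in> Ob2 L \<Longrightarrow> U A \<in> Ob2 K"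
    and V1_bij: "A \<in> Ob2 L \<Longrightarrow> B \<in> Ob2 L \<Longrightarrow> bij_betw (V1 A B) (Hom1 K (U A) (U B)) (Hom1 L A B)"
    and V2_bij: "A \<in> Ob2 L \<Longrightarrow> B \<in> Ob2 L \<Longrightarrow> f \<in> Hom1 K (U A) (U B) \<Longrightarrow> g \<in> Hom1 K (U A) (U B) \<Longrightarrow>
      bij_betw (V2 A B f g) (Hom2 K (U A) (U B) f g) (Hom2 L A B (V1 A B f) (V1 A B g))"
    and V1_id1: "A \<in> Ob2 L \<Longrightarrow> id1 L A = V1 A A (id1 K (U A))"
    and V1_comp1: "\<lbrakk>A \<in> Ob2 L; B \<in> Ob2 L; C \<in> Ob2 L; f \<in> Hom1 K (U A) (U B); g \<in> Hom1 K (U B) (U C)\<rbrakk> \<Longrightarrow>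
      comp1 L A B C (V1 B C g) (V1 A B f) = V1 A C (comp1 K (U A) (U B) (U C) g f)"
    and V2_id2: "\<lbrakk>A \<in> Ob2 L; B \<in> Ob2 L; f \<in> Hom1 K (U A) (U B)\<rbrakk> \<Longrightarrow>
      id2 L A B (V1 A B f) = V2 A B f f (id2 K (U A) (U B) f)"
    and V2_vcomp: "\<lbrakk>A \<in> Ob2 L; B \<in> Ob2 L; f \<in> Hom1 K (U A) (U B); g \<in> Hom1 K (U A) (U B); h \<in> Hom1 K (U A) (U B);
      \<sigma> \<in> Hom2 K (U A) (U B) f g; \<tau> \<in> Hom2 K (U A) (U B) g h\<rbrakk> \<Longrightarrow>
      vcomp L A B (V1 A B f) (V1 A B g) (V1 A B h) (V2 A B g h \<tau>) (V2 A B f g \<sigma>) =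
      V2 A B f h (vcomp K (U A) (U B) f g h \<tau> \<sigma>)"
    and V2_hcomp: "\<lbrakk>A \<in> Ob2 L; B \<in> Ob2 L; C \<in> Ob2 L; f \<in> Hom1 K (U A) (U B); f' \<in> Hom1 K (U A) (U B);
      g \<in> Hom1 K (U B) (U C); g' \<in> Hom1 K (U B) (U C); \<sigma> \<in> Hom2 K (U A) (U B) f f'; \<tau> \<in> Hom2 K (U B) (U C) g g'\<rbrakk> \<Longrightarrow>
      hcomp L A B C (V1 A B f) (V1 A B f') (V1 B C g) (V1 B C g') (V2 B C g g' \<tau>) (V2 A B f f' \<sigma>) =
      V2 A C (comp1 K (U A) (U B) (U C) g f) (comp1 K (U A) (U B) (U C) g' f') (hcomp K (U A) (U B) (U C) f f' g g' \<tau> \<sigma>)"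
begin

lemma V1_Hom1: "A \<in> Ob2 L \<Longrightarrow> B \<in> Ob2 L \<Longrightarrow> f \<in> Hom1 K (U A) (U B) \<Longrightarrow> V1 A B f \<in> Hom1 L A B"
  using bij_betwE[OF V1_bij] by blast

lemma V2_Hom2: "A \<in> Ob2 L \<Longrightarrow> B \<in> Ob2 L \<Longrightarrow> f \<in> Hom1 K (U A) (U B) \<Longrightarrow> g \<in> Hom1 K (U A) (U B) \<Longrightarrow>
    \<sigma> \<in> Hom2 K (U A) (U B) f g \<Longrightarrow> V2 A B f g \<sigma> \<in> Hom2 L A B (V1 A B f) (V1 A B g)"
  using bij_betwE[OF V2_bij] by blast

lemma E1:
  assumes "f \<in> Hom1 L A B" "A \<in> Ob2 L" "B \<in> Ob2 L"
  obtains f0 where "f0 \<in> Hom1 K (U A) (U B)" "f = V1 A B f0"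
  using V1_bij[OF assms(2,3)] assms(1) by (auto simp: bij_betw_def)

lemma E2:
  assumes "\<sigma> \<in> Hom2 L A B (V1 A B f) (V1 A B g)" "A \<in> Ob2 L" "B \<in> Ob2 L" "f \<in> Hom1 K (U A) (U B)" "g \<in> Hom1 K (U A) (U B)"
  obtains \<sigma>0 where "\<sigma>0 \<in> Hom2 K (U A) (U B) f g" "\<sigma> = V2 A B f g \<sigma>0"
  using V2_bij[OF assms(2-5)] assms(1) by (auto simp: bij_betw_def)

lemmas V_simps = V1_id1 V1_comp1 V2_id2 V2_vcomp V2_hcomp

lemmas K_closed = U K.id1_Hom1 K.comp1_Hom1 K.id2_Hom2 K.vcomp_Hom2 K.hcomp_Hom2

lemma two_category_L: "two_category L"
proof (standard, goal_cases)
  case (1 A) then show ?case by (simp add: V_simps V1_Hom1 K_closed)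
next
  case (2 A B C f g)
  note o = 2(1-3)
  from 2(4) o(1,2) obtain f0 where f: "f0 \<in> Hom1 K (U A) (U B)" "f = V1 A B f0" by (rule E1)
  from 2(5) o(2,3) obtain g0 where g: "g0 \<in> Hom1 K (U B) (U C)" "g = V1 B C g0" by (rule E1)
  show ?case using o f(1) g(1) unfolding f(2) g(2) by (simp add: V_simps V1_Hom1 K_closed)
next
  case (3 A B f)
  from 3(3,1,2) obtain f0 where f: "f0 \<in> Hom1 K (U A) (U B)" "f = V1 A B f0" by (rule E1)
  show ?case using 3(1,2) f(1) unfolding f(2) by (simp add: V_simps V1_Hom1 K_closed K.comp1_id1_left)
next
  case (4 A B f)
  from 4(3,1,2) obtain f0 where f: "f0 \<in> Hom1 K (U A) (U B)" "f = V1 A B f0" by (rule E1)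
  show ?case using 4(1,2) f(1) unfolding f(2) by (simp add: V_simps V1_Hom1 K_closed K.comp1_id1_right)
next
  case (5 A B C D f g h)
  note o = 5(1-4)
  from 5(5) o(1,2) obtain f0 where f: "f0 \<in> Hom1 K (U A) (U B)" "f = V1 A B f0" by (rule E1)
  from 5(6) o(2,3) obtain g0 where g: "g0 \<in> Hom1 K (U B) (U C)" "g = V1 B C g0" by (rule E1)
  from 5(7) o(3,4) obtain h0 where h: "h0 \<in> Hom1 K (U C) (U D)" "h = V1 C D h0" by (rule E1)
  show ?case using o f(1) g(1) h(1) unfolding f(2) g(2) h(2) by (simp add: V_simps K_closed K.comp1_assoc)
next
  case (6 A B f)
  from 6(3,1,2) obtain f0 where f: "f0 \<in> Hom1 K (U A) (U B)" "f = V1 A B f0" by (rule E1)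
  show ?case using 6(1,2) f(1) unfolding f(2) by (simp add: V_simps V2_Hom2 K_closed)
next
  case (7 A B f g h \<sigma> \<tau>)
  note o = 7(1,2)
  from 7(3) o obtain f0 where f: "f0 \<in> Hom1 K (U A) (U B)" "f = V1 A B f0" by (rule E1)
  from 7(4) o obtain g0 where g: "g0 \<in> Hom1 K (U A) (U B)" "g = V1 A B g0" by (rule E1)
  from 7(5) o obtain h0 where h: "h0 \<in> Hom1 K (U A) (U B)" "h = V1 A B h0" by (rule E1)
  from 7(6)[unfolded f(2) g(2)] o f(1) g(1) obtain s where s: "s \<in> Hom2 K (U A) (U B) f0 g0" "\<sigma> = V2 A B f0 g0 s" by (rule E2)
  from 7(7)[unfolded h(2) g(2)] o g(1) h(1) obtain t where t: "t \<in> Hom2 K (U A) (U B) g0 h0" "\<tau> = V2 A B g0 h0 t" by (rule E2)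
  show ?case using o f(1) g(1) h(1) s(1) t(1) K.vcomp_Hom2[OF U U] unfolding f(2) g(2) h(2) s(2) t(2)
    by (simp add: V_simps V2_Hom2)
next
  case (8 A B f g \<sigma>)
  note o = 8(1,2)
  from 8(3) o obtain f0 where f: "f0 \<in> Hom1 K (U A) (U B)" "f = V1 A B f0" by (rule E1)
  from 8(4) o obtain g0 where g: "g0 \<in> Hom1 K (U A) (U B)" "g = V1 A B g0" by (rule E1)
  from 8(5)[unfolded f(2) g(2)] o f(1) g(1) obtain s where s: "s \<in> Hom2 K (U A) (U B) f0 g0" "\<sigma> = V2 A B f0 g0 s" by (rule E2)
  show ?case using o f(1) g(1) s(1) unfolding f(2) g(2) s(2)
    by (simp add: V_simps K_closed K.vcomp_id2_left)
next
  case (9 A B f g \<sigma>)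
  note o = 9(1,2)
  from 9(3) o obtain f0 where f: "f0 \<in> Hom1 K (U A) (U B)" "f = V1 A B f0" by (rule E1)
  from 9(4) o obtain g0 where g: "g0 \<in> Hom1 K (U A) (U B)" "g = V1 A B g0" by (rule E1)
  from 9(5)[unfolded f(2) g(2)] o f(1) g(1) obtain s where s: "s \<in> Hom2 K (U A) (U B) f0 g0" "\<sigma> = V2 A B f0 g0 s" by (rule E2)
  show ?case using o f(1) g(1) s(1) unfolding f(2) g(2) s(2)
    by (simp add: V_simps K_closed K.vcomp_id2_right)
next
  case (10 A B f g h k \<sigma> \<tau> \<upsilon>)
  note o = 10(1,2)
  from 10(3) o obtain f0 where f: "f0 \<in> Hom1 K (U A) (U B)" "f = V1 A B f0" by (rule E1)
  from 10(4) o obtain g0 where g: "g0 \<in> Hom1 K (U A) (U B)" "g = V1 A B g0" by (rule E1)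
  from 10(5) o obtain h0 where h: "h0 \<in> Hom1 K (U A) (U B)" "h = V1 A B h0" by (rule E1)
  from 10(6) o obtain k0 where k: "k0 \<in> Hom1 K (U A) (U B)" "k = V1 A B k0" by (rule E1)
  from 10(7)[unfolded f(2) g(2)] o f(1) g(1) obtain s where s: "s \<in> Hom2 K (U A) (U B) f0 g0" "\<sigma> = V2 A B f0 g0 s" by (rule E2)
  from 10(8)[unfolded h(2) g(2)] o g(1) h(1) obtain t where t: "t \<in> Hom2 K (U A) (U B) g0 h0" "\<tau> = V2 A B g0 h0 t" by (rule E2)
  from 10(9)[unfolded h(2) k(2)] o h(1) k(1) obtain u where u: "u \<in> Hom2 K (U A) (U B) h0 k0" "\<upsilon> = V2 A B h0 k0 u" by (rule E2)
  show ?case using o f(1) g(1) h(1) k(1) s(1) t(1) u(1) K.vcomp_Hom2[OF U U] K.vcomp_assoc[OF U U]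
    unfolding f(2) g(2) h(2) k(2) s(2) t(2) u(2) by (simp add: V_simps)
next
  case (11 A B C f f' g g' \<sigma> \<tau>)
  note o = 11(1-3)
  from 11(4) o(1,2) obtain f0 where f: "f0 \<in> Hom1 K (U A) (U B)" "f = V1 A B f0" by (rule E1)
  from 11(5) o(1,2) obtain f1 where f': "f1 \<in> Hom1 K (U A) (U B)" "f' = V1 A B f1" by (rule E1)
  from 11(6) o(2,3) obtain g0 where g: "g0 \<in> Hom1 K (U B) (U C)" "g = V1 B C g0" by (rule E1)
  from 11(7) o(2,3) obtain g1 where g': "g1 \<in> Hom1 K (U B) (U C)" "g' = V1 B C g1" by (rule E1)
  from 11(8)[unfolded f(2) f'(2)] o(1,2) f(1) f'(1) obtain s where s: "s \<in> Hom2 K (U A) (U B) f0 f1" "\<sigma> = V2 A B f0 f1 s" by (rule E2)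
  from 11(9)[unfolded g(2) g'(2)] o(2,3) g(1) g'(1) obtain t where t: "t \<in> Hom2 K (U B) (U C) g0 g1" "\<tau> = V2 B C g0 g1 t" by (rule E2)
  show ?case using o f(1) f'(1) g(1) g'(1) s(1) t(1) K.hcomp_Hom2[OF U U U] unfolding f(2) f'(2) g(2) g'(2) s(2) t(2)
    by (simp add: V_simps V2_Hom2 K.comp1_Hom1 U)
next
  case (12 A B C f g)
  note o = 12(1-3)
  from 12(4) o(1,2) obtain f0 where f: "f0 \<in> Hom1 K (U A) (U B)" "f = V1 A B f0" by (rule E1)
  from 12(5) o(2,3) obtain g0 where g: "g0 \<in> Hom1 K (U B) (U C)" "g = V1 B C g0" by (rule E1)
  show ?case using o f(1) g(1) unfolding f(2) g(2) by (simp add: V_simps K_closed K.hcomp_id2)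
next
  case (13 A B C f f' f'' g g' g'' \<sigma> \<sigma>' \<tau> \<tau>')
  note o = 13(1-3)
  from 13(4) o(1,2) obtain f0 where f: "f0 \<in> Hom1 K (U A) (U B)" "f = V1 A B f0" by (rule E1)
  from 13(5) o(1,2) obtain f1 where f': "f1 \<in> Hom1 K (U A) (U B)" "f' = V1 A B f1" by (rule E1)
  from 13(6) o(1,2) obtain f2 where f'': "f2 \<in> Hom1 K (U A) (U B)" "f'' = V1 A B f2" by (rule E1)
  from 13(7) o(2,3) obtain g0 where g: "g0 \<in> Hom1 K (U B) (U C)" "g = V1 B C g0" by (rule E1)
  from 13(8) o(2,3) obtain g1 where g': "g1 \<in> Hom1 K (U B) (U C)" "g' = V1 B C g1" by (rule E1)
  from 13(9) o(2,3) obtain g2 where g'': "g2 \<in> Hom1 K (U B) (U C)" "g'' = V1 B C g2" by (rule E1)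
  from 13(10)[unfolded f(2) f'(2)] o(1,2) f(1) f'(1) obtain s where s: "s \<in> Hom2 K (U A) (U B) f0 f1" "\<sigma> = V2 A B f0 f1 s" by (rule E2)
  from 13(11)[unfolded f'(2) f''(2)] o(1,2) f'(1) f''(1) obtain s' where s': "s' \<in> Hom2 K (U A) (U B) f1 f2" "\<sigma>' = V2 A B f1 f2 s'" by (rule E2)
  from 13(12)[unfolded g(2) g'(2)] o(2,3) g(1) g'(1) obtain t where t: "t \<in> Hom2 K (U B) (U C) g0 g1" "\<tau> = V2 B C g0 g1 t" by (rule E2)
  from 13(13)[unfolded g'(2) g''(2)] o(2,3) g'(1) g''(1) obtain t' where t': "t' \<in> Hom2 K (U B) (U C) g1 g2" "\<tau>' = V2 B C g1 g2 t'" by (rule E2)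
  show ?case
    unfolding f(2) f'(2) f''(2) g(2) g'(2) g''(2) s(2) s'(2) t(2) t'(2)
      V2_vcomp[OF o(1,2) f(1) f'(1) f''(1) s(1) s'(1)] V2_vcomp[OF o(2,3) g(1) g'(1) g''(1) t(1) t'(1)]
      V2_hcomp[OF o f(1) f'(1) g(1) g'(1) s(1) t(1)] V2_hcomp[OF o f'(1) f''(1) g'(1) g''(1) s'(1) t'(1)]
      V1_comp1[OF o f(1) g(1)] V1_comp1[OF o f'(1) g'(1)] V1_comp1[OF o f''(1) g''(1)]
      V2_hcomp[OF o f(1) f''(1) g(1) g''(1) K.vcomp_Hom2[OF U U f(1) f'(1) f''(1) s(1) s'(1), OF o(1,2)]
        K.vcomp_Hom2[OF U U g(1) g'(1) g''(1) t(1) t'(1), OF o(2,3)]]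
      K.interchange[OF U U U f(1) f'(1) f''(1) g(1) g'(1) g''(1) s(1) s'(1) t(1) t'(1), OF o]
    by (rule V2_vcomp[symmetric])
      (use o f(1) f'(1) f''(1) g(1) g'(1) g''(1) s(1) s'(1) t(1) t'(1) in \<open>simp_all add: U K.comp1_Hom1 K.hcomp_Hom2\<close>)
next
  case (14 A B f f' \<sigma>)
  note o = 14(1,2)
  from 14(3) o obtain f0 where f: "f0 \<in> Hom1 K (U A) (U B)" "f = V1 A B f0" by (rule E1)
  from 14(4) o obtain f1 where g: "f1 \<in> Hom1 K (U A) (U B)" "f' = V1 A B f1" by (rule E1)
  from 14(5)[unfolded f(2) g(2)] o f(1) g(1) obtain s where s: "s \<in> Hom2 K (U A) (U B) f0 f1" "\<sigma> = V2 A B f0 f1 s" by (rule E2)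
  show ?case using o f(1) g(1) s(1) unfolding f(2) g(2) s(2)
    by (simp add: V_simps K_closed K.hcomp_id1_left K.comp1_id1_left)
next
  case (15 A B f f' \<sigma>)
  note o = 15(1,2)
  from 15(3) o obtain f0 where f: "f0 \<in> Hom1 K (U A) (U B)" "f = V1 A B f0" by (rule E1)
  from 15(4) o obtain f1 where g: "f1 \<in> Hom1 K (U A) (U B)" "f' = V1 A B f1" by (rule E1)
  from 15(5)[unfolded f(2) g(2)] o f(1) g(1) obtain s where s: "s \<in> Hom2 K (U A) (U B) f0 f1" "\<sigma> = V2 A B f0 f1 s" by (rule E2)
  show ?case using o f(1) g(1) s(1) unfolding f(2) g(2) s(2)
    by (simp add: V_simps K_closed K.hcomp_id1_right K.comp1_id1_right)
next
  case (16 A B C D f f' g g' h h' \<sigma> \<tau> \<upsilon>)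
  note o = 16(1-4)
  from 16(5) o(1,2) obtain f0 where f: "f0 \<in> Hom1 K (U A) (U B)" "f = V1 A B f0" by (rule E1)
  from 16(6) o(1,2) obtain f1 where f': "f1 \<in> Hom1 K (U A) (U B)" "f' = V1 A B f1" by (rule E1)
  from 16(7) o(2,3) obtain g0 where g: "g0 \<in> Hom1 K (U B) (U C)" "g = V1 B C g0" by (rule E1)
  from 16(8) o(2,3) obtain g1 where g': "g1 \<in> Hom1 K (U B) (U C)" "g' = V1 B C g1" by (rule E1)
  from 16(9) o(3,4) obtain h0 where h: "h0 \<in> Hom1 K (U C) (U D)" "h = V1 C D h0" by (rule E1)
  from 16(10) o(3,4) obtain h1 where h': "h1 \<in> Hom1 K (U C) (U D)" "h' = V1 C D h1" by (rule E1)
  from 16(11)[unfolded f(2) f'(2)] o(1,2) f(1) f'(1) obtain s where s: "s \<in> Hom2 K (U A) (U B) f0 f1" "\<sigma> = V2 A B f0 f1 s" by (rule E2)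
  from 16(12)[unfolded g(2) g'(2)] o(2,3) g(1) g'(1) obtain t where t: "t \<in> Hom2 K (U B) (U C) g0 g1" "\<tau> = V2 B C g0 g1 t" by (rule E2)
  from 16(13)[unfolded h(2) h'(2)] o(3,4) h(1) h'(1) obtain u where u: "u \<in> Hom2 K (U C) (U D) h0 h1" "\<upsilon> = V2 C D h0 h1 u" by (rule E2)
  show ?case using o f(1) f'(1) g(1) g'(1) h(1) h'(1) s(1) t(1) u(1)
    unfolding f(2) f'(2) g(2) g'(2) h(2) h'(2) s(2) t(2) u(2)
    by (simp add: V_simps U K.comp1_Hom1 K.hcomp_Hom2 K.comp1_assoc K.hcomp_assoc)
qed

text \<open>\<open>U\<close> may identify objects. A bijection \<Phi> such that
  \<open>U (\<Phi> A)\<close> is isomorphic to \<open>A\<close> repairs this: cells are conjugated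
  along these isomorphisms and then transported by \<open>V1\<close> and \<open>V2\<close>.\<close>

lemma two_isomorphicI:
  assumes \<Phi>: "bij_betw \<Phi> (Ob2 K) (Ob2 L)" and k: "\<And>A. A \<in> Ob2 K \<Longrightarrow> K.iso1 A (U (\<Phi> A)) (k A) (k' A)"
  shows "two_isomorphic K L"
proof -
  interpret L: two_category L by (rule two_category_L)
  have \<Phi>o: "\<Phi> A \<in> Ob2 L" if "A \<in> Ob2 K" for A using \<Phi> that by (auto simp: bij_betw_def)
  let ?c1 = "\<lambda>A B. K.cj1 A (U (\<Phi> A)) B (U (\<Phi> B)) (k B) (k' A)"
  let ?c2 = "\<lambda>A B. K.cj2 A (U (\<Phi> A)) B (U (\<Phi> B)) (k B) (k' A)"
  let ?F1 = "\<lambda>A B f. V1 (\<Phi> A) (\<Phi> B) (?c1 A B f)"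
  let ?F2 = "\<lambda>A B f g \<sigma>. V2 (\<Phi> A) (\<Phi> B) (?c1 A B f) (?c1 A B g) (?c2 A B f g \<sigma>)"
  note ks = k[of A for A]
  have c1H: "?c1 A B f \<in> Hom1 K (U (\<Phi> A)) (U (\<Phi> B))" if "A \<in> Ob2 K" "B \<in> Ob2 K" "f \<in> Hom1 K A B" for A B f
    by (rule K.cj1_Hom1[OF k k]) (use that in auto)
  have c2H: "?c2 A B f g \<sigma> \<in> Hom2 K (U (\<Phi> A)) (U (\<Phi> B)) (?c1 A B f) (?c1 A B g)"
    if "A \<in> Ob2 K" "B \<in> Ob2 K" "f \<in> Hom1 K A B" "g \<in> Hom1 K A B" "\<sigma> \<in> Hom2 K A B f g" for A B f g \<sigma>
    by (rule K.cj2_Hom2[OF k k]) (use that in auto)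
  have "two_isomorphism K L \<Phi> ?F1 ?F2"
  proof (intro two_isomorphism.intro two_isomorphism_axioms.intro, goal_cases)
    case 3 show ?case by (rule \<Phi>)
  next
    case (4 A B)
    show ?case using bij_betw_trans[OF K.cj1_bij[OF k[OF 4(1)] k[OF 4(2)]] V1_bij[OF \<Phi>o[OF 4(1)] \<Phi>o[OF 4(2)]]]
      by (simp add: comp_def)
  next
    case (5 A B f g)
    show ?case using bij_betw_trans[OF K.cj2_bij[OF k[OF 5(1)] k[OF 5(2)] 5(3,4)]
        V2_bij[OF \<Phi>o[OF 5(1)] \<Phi>o[OF 5(2)] c1H[OF 5(1,2,3)] c1H[OF 5(1,2,4)]]]
      by (simp add: comp_def)
  next
    case (6 A)
    have "?c1 A A (id1 K A) = id1 K (U (\<Phi> A))"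
      using K.cj_id[OF k[OF 6]] K.cj_ic[OF k[OF 6] k[OF 6] K.id1_Hom1[OF 6]] by (simp add: K.ic_def)
    then show ?case using V1_id1[OF \<Phi>o[OF 6]] by simp
  next
    case (7 A B C f g)
    have "?c1 A C (comp1 K A B C g f) = comp1 K (U (\<Phi> A)) (U (\<Phi> B)) (U (\<Phi> C)) (?c1 B C g) (?c1 A B f)"
      using K.cj_hc[OF k[OF 7(1)] k[OF 7(2)] k[OF 7(3)] K.cell_ic[OF 7(1,2,4)] K.cell_ic[OF 7(2,3,5)]]
      unfolding K.hc_def K.ic_def prod.case K.cj_eq by simp
    then show ?case using V1_comp1[OF \<Phi>o[OF 7(1)] \<Phi>o[OF 7(2)] \<Phi>o[OF 7(3)] c1H[OF 7(1,2,4)] c1H[OF 7(2,3,5)]] by simp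
  next
    case (8 A B f)
    have "?c2 A B f f (id2 K A B f) = id2 K (U (\<Phi> A)) (U (\<Phi> B)) (?c1 A B f)"
      using K.cj_ic[OF k[OF 8(1)] k[OF 8(2)] 8(3)] unfolding K.ic_def K.cj_eq by simp
    then show ?case using V2_id2[OF \<Phi>o[OF 8(1)] \<Phi>o[OF 8(2)] c1H[OF 8(1,2,3)]] by simp
  next
    case (9 A B f g h \<sigma> \<tau>)
    have "?c2 A B f h (vcomp K A B f g h \<tau> \<sigma>) =
      vcomp K (U (\<Phi> A)) (U (\<Phi> B)) (?c1 A B f) (?c1 A B g) (?c1 A B h) (?c2 A B g h \<tau>) (?c2 A B f g \<sigma>)"
      using K.cj_vc[OF k[OF 9(1)] k[OF 9(2)], of f g \<sigma> h \<tau>] 9 unfolding K.vc_def prod.case K.cj_eq by simp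
    then show ?case using V2_vcomp[OF \<Phi>o[OF 9(1)] \<Phi>o[OF 9(2)] c1H[OF 9(1,2,3)] c1H[OF 9(1,2,4)] c1H[OF 9(1,2,5)]
        c2H[OF 9(1-4,6)] c2H[OF 9(1,2,4,5,7)]] by simp
  next
    case (10 A B C f f' g g' \<sigma> \<tau>)
    have "?c1 A C (comp1 K A B C g f) = comp1 K (U (\<Phi> A)) (U (\<Phi> B)) (U (\<Phi> C)) (?c1 B C g) (?c1 A B f) \<and>
      ?c1 A C (comp1 K A B C g' f') = comp1 K (U (\<Phi> A)) (U (\<Phi> B)) (U (\<Phi> C)) (?c1 B C g') (?c1 A B f') \<and>
      ?c2 A C (comp1 K A B C g f) (comp1 K A B C g' f') (hcomp K A B C f f' g g' \<tau> \<sigma>) =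
      hcomp K (U (\<Phi> A)) (U (\<Phi> B)) (U (\<Phi> C)) (?c1 A B f) (?c1 A B f') (?c1 B C g) (?c1 B C g') (?c2 B C g g' \<tau>) (?c2 A B f f' \<sigma>)"
      using K.cj_hc[OF k[OF 10(1)] k[OF 10(2)] k[OF 10(3)], of "(A, B, f, f', \<sigma>)" "(B, C, g, g', \<tau>)"] 10
      unfolding K.hc_def prod.case K.cj_eq by simp
    then show ?case using V2_hcomp[OF \<Phi>o[OF 10(1)] \<Phi>o[OF 10(2)] \<Phi>o[OF 10(3)] c1H[OF 10(1,2,4)] c1H[OF 10(1,2,5)]
        c1H[OF 10(2,3,6)] c1H[OF 10(2,3,7)] c2H[OF 10(1,2,4,5,8)] c2H[OF 10(2,3,6,7,9)]] by simp
  qed (rule K.two_category_axioms, rule two_category_L)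
  then show ?thesis unfolding two_isomorphic_def by blast
qed

end

section \<open>The local isomorphism\<close>

lemma NLaxAlg_sel:
  "B \<in> Ob2 NLaxAlg \<longleftrightarrow> nlax_algebra B"
  "id1 NLaxAlg A = \<lparr> mfun = \<lparr> fo = (\<lambda>a\<in>Obj (bas A). a), fm = (\<lambda>a b. \<lambda>u\<in>Hom (bas A) a b. u) \<rparr>,
                  mcell = (\<lambda>a x. \<lambda>r\<in>Els (str A) a x. r) \<rparr>"
  "comp1 NLaxAlg A B' C n m = \<lparr>
        mfun = \<lparr> fo = (\<lambda>a\<in>Obj (bas A). fo (mfun n) (fo (mfun m) a)),
                 fm = (\<lambda>a b. \<lambda>u\<in>Hom (bas A) a b.
                         fm (mfun n) (fo (mfun m) a) (fo (mfun m) b) (fm (mfun m) a b u)) \<rparr>,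
        mcell = (\<lambda>a x. \<lambda>r\<in>Els (str A) a x.
                   mcell n (fo (mfun m) a) (bmap (fo (mfun m)) x) (mcell m a x r)) \<rparr>"
  "id2 NLaxAlg A B' m = (\<lambda>a\<in>Obj (bas A). Ide (bas B') (fo (mfun m) a))"
  "vcomp NLaxAlg A B' m n p \<tau> \<sigma> = (\<lambda>a\<in>Obj (bas A).
                Cmp (bas B') (fo (mfun m) a) (fo (mfun n) a) (fo (mfun p) a) (\<tau> a) (\<sigma> a))"
  "hcomp NLaxAlg A B' C m m' n n' \<tau> \<sigma> = (\<lambda>a\<in>Obj (bas A).
                Cmp (bas C) (fo (mfun n) (fo (mfun m) a)) (fo (mfun n') (fo (mfun m) a))
                  (fo (mfun n') (fo (mfun m') a))
                  (fm (mfun n') (fo (mfun m) a) (fo (mfun m') a) (\<sigma> a)) (\<tau> (fo (mfun m) a)))"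
  by (simp_all add: NLaxAlg_def nlax_algebra_def nlax_algebra_axioms_def)

lemma lax_mor_eqI:
  "fo (mfun m) = fo (mfun n) \<Longrightarrow> (\<And>a b. fm (mfun m) a b = fm (mfun n) a b) \<Longrightarrow> (\<And>a x. mcell m a x = mcell n a x) \<Longrightarrow>
    m = (n :: 'u lax_mor)"
  by (intro lax_mor.equality ftr.equality) (auto simp: fun_eq_iff)

abbreviation "Usp \<equiv> nlax_algebra.usp"

text \<open>Composites of 2-cells correspond because \<Gamma> is functorial and bijective: both are
  compared after \<Gamma>, where composition in \<open>A\<^sub>0\<close> becomes
  \<open>upre\<close>.\<close>

lemma local_isomorphism_Usp:
  "local_isomorphism (UltSp :: ('u::universe ucspace, 'u ucmap, 'u \<Rightarrow> 'u) cat2) (NLaxAlg :: ('u lax_alg, 'u lax_mor, 'u \<Rightarrow> 'u) cat2)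
     Usp nlax_pair.lmor nlax_pair.lcell"
proof (intro local_isomorphism.intro local_isomorphism_axioms.intro two_category_UltSp, unfold UltSp_sel NLaxAlg_sel, goal_cases)
  case (1 A) then show ?case by (rule nlax_algebra.ultraconvergence_space_usp)
next
  case (2 A B) then show ?case by (intro nlax_pair.lmor_bij nlax_pair.intro)
next
  case (3 A B f g)
  then show ?case
    using nlax_pair.lcell_bij[of A B f g] nlax_pair.intro[of A B] by simp
next
  case (4 A)
  then interpret A: nlax_pair A A by (intro nlax_pair.intro)
  show ?case
  proof (rule lax_mor_eqI)
    fix a b
    show "fm (mfun \<lparr> mfun = \<lparr> fo = (\<lambda>a\<in>Obj (bas A). a), fm = (\<lambda>a b. \<lambda>u\<in>Hom (bas A) a b. u) \<rparr>, mcell = (\<lambda>a x. \<lambda>r\<in>Els (str A) a x. r) \<rparr>) a b =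
      fm (mfun (A.lmor (uc_id A.B.usp))) a b"
      using A.B.C.Hom_Obj A.B.gam_E by (auto simp: A.lmor_sel intro!: restrict_ext)
  qed simp_all
next
  case (5 A B C f g)
  then interpret AB: nlax_pair A B by (intro nlax_pair.intro)
  from 5 interpret BC: nlax_pair B C by (intro nlax_pair.intro)
  from 5 interpret AC: nlax_pair A C by (intro nlax_pair.intro)
  interpret f: uspace_map AB.B.usp AB.B'.usp f by (rule AB.uspace_map_usp[OF 5(4)])
  note fE = f.carr_E_eta[simplified, OF AB.B.gam_E]
  show ?case
  proof (rule lax_mor_eqI, goal_cases)
    case (2 a b)
    show ?case
      unfolding AC.lmor_sel AB.lmor_sel BC.lmor_sel lax_mor.simps ftr.simps
    proof (rule restrict_ext, goal_cases)
      case (1 u)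
      then have "a \<in> Obj (bas A)" "b \<in> Obj (bas A)" using AB.B.C.Hom_Obj by blast+
      then show ?case using 1 fE[OF 1] AB.B.gam_E[OF 1] by simp
    qed
  qed simp_all
next
  case (6 A B f)
  then interpret AB: nlax_pair A B by (intro nlax_pair.intro)
  interpret f: uspace_map AB.B.usp AB.B'.usp f by (rule AB.uspace_map_usp[OF 6(3)])
  show ?case unfolding AB.lcell_def AB.lmor_sel
    by (rule restrict_ext) (use f.cpt_mem AB.B'.C.Ide_Hom in simp)
next
  case (7 A B f g h \<sigma> \<tau>)
  then interpret AB: nlax_pair A B by (intro nlax_pair.intro)
  from 7(6) have s: "\<sigma> a \<in> Els (str B) (cpt f a) (eta (cpt g a))" if "a \<in> Obj (bas A)" for a
    using transformation.components that by fastforce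
  from 7(7) have t: "\<tau> a \<in> Els (str B) (cpt g a) (eta (cpt h a))" if "a \<in> Obj (bas A)" for a
    using transformation.components that by fastforce
  show ?case unfolding AB.lcell_def AB.lmor_sel
  proof (rule restrict_ext, goal_cases)
    case (1 a)
    have "upre AB.B'.usp (cpt f a) (cpt g a) (eta (cpt h a)) (\<tau> a) (\<sigma> a) =
        gam B (cpt f a) (cpt h a) (Cmp (bas B) (cpt f a) (cpt g a) (cpt h a) (AB.B'.gami (cpt g a) (cpt h a) (\<tau> a)) (AB.B'.gami (cpt f a) (cpt g a) (\<sigma> a)))"
      using AB.B'.gam_Cmp[OF AB.B'.gami(3)[OF s[OF 1]] AB.B'.gami(3)[OF t[OF 1]]] s[OF 1] t[OF 1] by simp
    then show ?case using 1 AB.B'.gami(1)[OF AB.B'.C.Cmp_Hom[OF AB.B'.gami(3)[OF s[OF 1]] AB.B'.gami(3)[OF t[OF 1]]]] by simp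
  qed
next
  case (8 A B C f f' g g' \<sigma> \<tau>)
  then interpret AB: nlax_pair A B by (intro nlax_pair.intro)
  from 8 interpret BC: nlax_pair B C by (intro nlax_pair.intro)
  from 8 interpret AC: nlax_pair A C by (intro nlax_pair.intro)
  interpret f: uspace_map AB.B.usp AB.B'.usp f by (rule AB.uspace_map_usp[OF 8(4)])
  interpret f': uspace_map AB.B.usp AB.B'.usp f' by (rule AB.uspace_map_usp[OF 8(5)])
  interpret g': uspace_map AB.B'.usp BC.B'.usp g' by (rule BC.uspace_map_usp[OF 8(7)])
  from 8(8) have s: "\<sigma> a \<in> Els (str B) (cpt f a) (eta (cpt f' a))" if "a \<in> Obj (bas A)" for a
    using transformation.components that by fastforce
  from 8(9) have t: "\<tau> a \<in> Els (str C) (cpt g a) (eta (cpt g' a))" if "a \<in> Obj (bas B)" for a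
    using transformation.components that by fastforce
  show ?case unfolding AB.lcell_def BC.lcell_def AC.lcell_def AB.lmor_sel BC.lmor_sel
  proof (rule restrict_ext, goal_cases)
    case (1 a)
    note fa = f.cpt_mem[simplified, OF 1]
    note S = s[OF 1] and T = t[OF fa]
    note G = g'.carr_E_eta[simplified, OF S]
    have "upre BC.B'.usp (cpt g (cpt f a)) (cpt g' (cpt f a)) (eta (cpt g' (cpt f' a))) (carr g' (cpt f a) (eta (cpt f' a)) (\<sigma> a)) (\<tau> (cpt f a)) =
        gam C (cpt g (cpt f a)) (cpt g' (cpt f' a)) (Cmp (bas C) (cpt g (cpt f a)) (cpt g' (cpt f a)) (cpt g' (cpt f' a))
          (BC.B'.gami (cpt g' (cpt f a)) (cpt g' (cpt f' a)) (carr g' (cpt f a) (eta (cpt f' a)) (\<sigma> a)))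
          (BC.B'.gami (cpt g (cpt f a)) (cpt g' (cpt f a)) (\<tau> (cpt f a))))"
      using BC.B'.gam_Cmp[OF BC.B'.gami(3)[OF T] BC.B'.gami(3)[OF G]] T G by simp
    then show ?case
      using 1 fa S BC.B'.gami(1)[OF BC.B'.C.Cmp_Hom[OF BC.B'.gami(3)[OF T] BC.B'.gami(3)[OF G]]] by simp
  qed
qed

text \<open>The equality is strict, junk values included. It makes \<open>lax_of\<close> injective
  on spaces and lets identities serve as isomorphisms.\<close>

lemma (in ultraconvergence_space) Usp_lax_of: "Usp lax_of = A"
proof -
  interpret F: nlax_algebra lax_of
    by (intro nlax_algebra.intro nlax_algebra_axioms.intro lax_algebra_lax_of normalized_lax_of)
  have "Act (uarr F.usp) d d' x y u v r = Act (uarr A) d d' x y u v r" for d d' x y u v r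
  proof (cases "u \<in> Hom (udisc A) d' d \<and> v \<in> Hom (beta (udisc A)) x y \<and> r \<in> E d x")
    case True
    then have u: "u = d" "d' = d" and r: "r \<in> E d x" by auto
    obtain g where g: "reidx Pt x y g" "v = rearr (udisc A) x y g" using True F.disc_HomE by blast
    have "reidx (Obj (bas lax_of)) x y g" using g by simp
    note Fa = F.Act_usp[OF this, of r d]
    have g': "reidx Pt x y (\<lambda>z\<in>Ix y. g z)" using g(1) reidxD(6)[OF g(1)] by simp
    show ?thesis using Fa r ract_rearr[OF g' r] u g by (simp add: ure_def)
  next
    case False
    then show ?thesis using uarr_profunctor(3) by (auto simp: prof_ext_def F.usp_def)
  qed
  then have 1: "uarr F.usp = uarr A" by (intro prof.equality) (auto simp: fun_eq_iff)
  have "uid F.usp = (\<lambda>a\<in>Pt. uid A a)" by (auto simp: uid_E)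
  then have 2: "uid F.usp = uid A" by (simp only: PiE_restrict[OF uid_arr])
  have 3: "ucmp F.usp a x Y s r = ucmp A a x Y s r" for a x Y s r
  proof (cases "r \<in> E a x \<and> ufamily A x Y s")
    case True
    then have r: "r \<in> E a x" and f: "ufamily A x Y s" by auto
    have f': "ufamily F.usp x Y s" using f by (simp add: F.ufamily_usp ufamily_iff)
    note x = E_obj(2)[OF r] and o = ufamily_over[OF r f]
    have p: "(\<lambda>z\<in>Ix x. z, s) \<in> upairs E x (over x Y)" using F.upairs_ufamily_usp(1)[OF f'] x by simp
    have pl: "pull x (\<lambda>z\<in>Ix x. z) (over x Y) = x" by (rule F.pull_id[OF x]) simp_all
    show ?thesis using F.ucmp_usp[OF _ f', of r a] r dlt2_lax_of[OF r p o] ure_id[OF r] by (simp add: dl_def pl)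
  next
    case False
    then have "ucmp A a x Y s r = undefined" by (rule ucmp_ext)
    then show ?thesis using False by (auto simp: F.usp_def ufamily_iff)
  qed
  show ?thesis by (rule ucspace.equality) (use 1 2 3 in \<open>simp_all add: fun_eq_iff del: F.usp_sel(3)\<close>)
qed

section \<open>Relabelling of arrows\<close>

text \<open>Transport of structure along renamings of the arrows, one for each source and target.
  The new arrow sets are the images, so injective renamings become bijections.\<close>

locale relabelling = ultraconvergence_space A for A :: "'u::universe ucspace" +
  fixes l :: "'u \<Rightarrow> ('u, 'u) ufam \<Rightarrow> 'u \<Rightarrow> 'u"
  assumes l_inj: "inj_on (l a x) (Els (uarr A) a x)"
begin

text \<open>Extensional, so that the inverse renaming is one definite function, which can be
  recognized from the relabelled space alone (\<open>usp_gsp\<close>).\<close>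

definition li :: "'u \<Rightarrow> ('u, 'u) ufam \<Rightarrow> 'u \<Rightarrow> 'u" where
  "li a x = (\<lambda>r\<in>l a x ` E a x. inv_into (E a x) (l a x) r)"

lemma li_l [simp]: "r \<in> E a x \<Longrightarrow> li a x (l a x r) = r"
  by (simp add: li_def inv_into_f_f[OF l_inj])

definition rel :: "'u ucspace" where
  "rel = \<lparr> upts = Pt,
     uarr = \<lparr> Els = (\<lambda>a x. l a x ` E a x), Act = (\<lambda>d d' x y u v r.
       if u \<in> Hom (udisc A) d' d \<and> v \<in> Hom (beta (udisc A)) x y \<and> r \<in> l d x ` E d x
       then l d' y (Act (uarr A) d d' x y u v (li d x r)) else undefined) \<rparr>,
     uid = (\<lambda>a\<in>Pt. l a (eta a) (uid A a)),
     ucmp = (\<lambda>a x Y s r.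
       if r \<in> l a x ` E a x \<and> Y \<in> Ix x \<rightarrow>\<^sub>E bobj Pt \<and> s \<in> (\<Pi>\<^sub>E z\<in>Ix x. l (Fm x z) (Y z) ` E (Fm x z) (Y z))
       then l a (mu (over x Y)) (ucmp A a x Y (\<lambda>z\<in>Ix x. li (Fm x z) (Y z) (s z)) (li a x r)) else undefined) \<rparr>"

abbreviation "lf x Y s \<equiv> \<lambda>z\<in>Ix x. l (Fm x z) (Y z) (s z)"

lemma rel_sel [simp]: "upts rel = Pt" "Els (uarr rel) a x = l a x ` E a x"
  "uid rel = (\<lambda>a\<in>Pt. l a (eta a) (uid A a))"
  by (simp_all add: rel_def)

lemma Act_rel: "u \<in> Hom (udisc A) d' d \<Longrightarrow> v \<in> Hom (beta (udisc A)) x y \<Longrightarrow> r \<in> E d x \<Longrightarrow>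
    Act (uarr rel) d d' x y u v (l d x r) = l d' y (Act (uarr A) d d' x y u v r)"
  by (simp add: rel_def del: disc_sel)

lemma ufamily_rel:
  assumes "ufamily rel x Y s"
  obtains s0 where "ufamily A x Y s0" "s = lf x Y s0"
proof
  have s: "s \<in> (\<Pi>\<^sub>E z\<in>Ix x. l (Fm x z) (Y z) ` E (Fm x z) (Y z))" and Y: "Y \<in> Ix x \<rightarrow>\<^sub>E bobj Pt"
    using assms by (simp_all add: ufamily_def)
  let ?s = "\<lambda>z\<in>Ix x. li (Fm x z) (Y z) (s z)"
  have m: "s z \<in> l (Fm x z) (Y z) ` E (Fm x z) (Y z)" if "z \<in> Ix x" for z using s that by auto
  then have m': "li (Fm x z) (Y z) (s z) \<in> E (Fm x z) (Y z)" "l (Fm x z) (Y z) (li (Fm x z) (Y z) (s z)) = s z"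
    if "z \<in> Ix x" for z using m[OF that] by auto
  show "ufamily A x Y ?s" using m' Y by (auto simp: ufamily_iff)
  have "lf x Y ?s = (\<lambda>z\<in>Ix x. s z)" by (rule restrict_ext) (simp add: m')
  then show "s = lf x Y ?s" by (simp only: PiE_restrict[OF s])
qed

lemma ufamily_rel_lf: "ufamily A x Y s \<Longrightarrow> ufamily rel x Y (lf x Y s)"
  by (auto simp: ufamily_def)

lemma ucmp_rel:
  assumes r: "r \<in> E a x" and s: "ufamily A x Y s"
  shows "ucmp rel a x Y (lf x Y s) (l a x r) = l a (mu (over x Y)) (ucmp A a x Y s r)"
proof -
  note S = ufamilyD[OF s]
  have "(\<lambda>z\<in>Ix x. li (Fm x z) (Y z) (lf x Y s z)) = (\<lambda>z\<in>Ix x. s z)"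
    by (rule restrict_ext) (simp add: S(3))
  then have "(\<lambda>z\<in>Ix x. li (Fm x z) (Y z) (lf x Y s z)) = s" by (simp only: S(6))
  then show ?thesis using r S(1,3) by (simp add: rel_def)
qed

lemma ure_rel:
  assumes r: "r \<in> E a x" and g: "reidx Pt x y g"
  shows "ure rel a x y g (l a x r) = l a y (ure A a x y g r)"
  unfolding ure_def rel_sel using Act_rel[of a a a "rearr (udisc A) x y g" x y r] r E_obj(1)[OF r] D.rearr_Hom[of x y g] g
  by simp

lemma upre_rel:
  assumes u: "u \<in> E a (eta b)" and r: "r \<in> E b x"
  shows "upre rel a b x (l b x r) (l a (eta b) u) = l a x (upre A a b x r u)"
proof -
  have e: "(\<lambda>z\<in>{star}. l b x r) = lf (eta b) (\<lambda>z\<in>{star}. x) (\<lambda>z\<in>{star}. r)" by auto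
  show ?thesis unfolding upre_def e ucmp_rel[OF u ufamily_eta[OF r]] over_eta
    by (rule ure_rel[OF ucmp_upre_arr[OF u r] reidx_mu_eta[OF E_obj(2)[OF r]]])
qed

lemma profunctor_rel: "profunctor (beta (udisc A)) (udisc A) (uarr rel)"
proof (standard, goal_cases)
  case (1 r d c) then show ?case by (auto dest: E_obj)
next
  case (2 u d' d v c c' r) then show ?case using P.Act_Els by (auto simp: Act_rel simp del: disc_sel)
next
  case (3 r d c)
  then obtain r0 where r: "r0 \<in> E d c" "r = l d c r0" by auto
  have "Ide (beta (udisc A)) c \<in> Hom (beta (udisc A)) c c"
    using category.Ide_Hom[OF category_beta[OF category_disc]] E_obj(2)[OF r(1)] by simp
  then show ?case unfolding r(2) using Act_rel[OF D.Ide_Hom _ r(1)] P.Act_Ide[OF r(1)] E_obj(1)[OF r(1)] by simp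
next
  case (4 u d' d u' d'' v c c' v' c'' r)
  then obtain r0 where r: "r0 \<in> E d c" "r = l d c r0" by auto
  show ?case unfolding r(2) using 4(1-4) P.Act_Cmp[OF 4(1-4) r(1)] r(1) P.Act_Els[OF 4(1,3) r(1)]
      D.Cmp_Hom[OF 4(2,1)] category.Cmp_Hom[OF category_beta[OF category_disc] 4(3,4)]
    by (simp add: Act_rel del: disc_sel)
qed

lemma ultraconvergence_space_rel: "ultraconvergence_space rel"
proof (rule ultraconvergence_space.intro, goal_cases)
  case 1 show ?case using profunctor_rel by simp
next
  case 2 show ?case using uarr_profunctor(2) by (simp add: set_valued_def small_image)
next
  case 3 show ?case by (simp add: prof_ext_def del: disc_sel) (simp add: rel_def del: disc_sel)
next
  case (4 x)
  then have x: "x \<in> Obj (beta (udisc A))" by simp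
  show ?case
    by (rule small_colim_transport[OF uarr_small[OF x] category_pt, where \<phi> = "\<lambda>a b. l a (eta b)" and l = "\<lambda>d. l d x"])
      (auto simp: pt_def pt_presheaf_def upre_rel upre_Els bij_betw_def l_inj)
next
  case 5 show ?case by (auto intro!: imageI uid_E)
next
  case (6 r a x Y s)
  from 6(1) obtain r0 where r: "r0 \<in> E a x" "r = l a x r0" by auto
  from 6(2) obtain s0 where s: "ufamily A x Y s0" "s = lf x Y s0" by (rule ufamily_rel)
  show ?case unfolding r(2) s(2) ucmp_rel[OF r(1) s(1)] using ucmp_arr[OF r(1) s(1)] by simp
next
  case (7 r a x Y s)
  then have "\<not> (r \<in> l a x ` E a x \<and> Y \<in> Ix x \<rightarrow>\<^sub>E bobj Pt \<and> s \<in> (\<Pi>\<^sub>E z\<in>Ix x. l (Fm x z) (Y z) ` E (Fm x z) (Y z)))"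
    by (simp add: ufamily_def)
  then show ?case by (simp only: rel_def ucspace.simps if_False)
next
  case (8 r a x Z s y g)
  from 8(1) obtain r0 where r: "r0 \<in> E a x" "r = l a x r0" by auto
  from 8(2) obtain s0 where s: "ufamily A x Z s0" "s = lf x Z s0" by (rule ufamily_rel)
  have g: "reidx Pt x y g" using 8(3) by (simp add: reindex_iff)
  note G = reidxD[OF g]
  let ?Z = "\<lambda>z\<in>Ix y. Z (g z)" and ?s0 = "\<lambda>z\<in>Ix y. s0 (g z)"
  have "s0 (g z) \<in> E (Fm y z) (Z (g z))" if "z \<in> Ix y" for z
    using ufamilyD(3)[OF s(1) G(4)[OF that]] unfolding G(5)[OF that] .
  then have f: "ufamily A y ?Z ?s0" by (intro ufamilyI) simp_all
  have e: "(\<lambda>z\<in>Ix y. lf x Z s0 (g z)) = lf y ?Z ?s0"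
    by (rule restrict_ext) (simp add: G)
  show ?case
    unfolding r(2) s(2) e ure_rel[OF r(1) g] ucmp_rel[OF r(1) s(1)] ucmp_rel[OF ure_Els[OF r(1) g] f]
      ure_rel[OF ucmp_arr[OF r(1) s(1)] reidx_over[OF g ufamilyD(1)[OF s(1)]]]
      ucmp_reindex[OF r(1) s(1) g[folded reindex_iff]] ..
next
  case (9 r a x Y s Z k)
  from 9(1) obtain r0 where r: "r0 \<in> E a x" "r = l a x r0" by auto
  from 9(2) obtain s0 where s: "ufamily A x Y s0" "s = lf x Y s0" by (rule ufamily_rel)
  have k: "reidx Pt (Y z) (Z z) (k z)" if "z \<in> Ix x" for z using 9(4)[OF that] by (simp add: reindex_iff)
  let ?s0 = "\<lambda>z\<in>Ix x. ure A (Fm x z) (Y z) (Z z) (k z) (s0 z)"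
  have f: "ufamily A x Z ?s0" using 9(3) ure_Els[OF ufamilyD(3)[OF s(1)] k] by (intro ufamilyI) simp_all
  have e: "(\<lambda>z\<in>Ix x. ure rel (Fm x z) (Y z) (Z z) (k z) (lf x Y s0 z)) = lf x Z ?s0"
    by (rule restrict_ext) (simp add: ure_rel[OF ufamilyD(3)[OF s(1)] k])
  have re: "reidx Pt (mu (over x Y)) (mu (over x Z)) (\<lambda>w\<in>Ix (mu (over x Z)). pair (ufst w) (k (ufst w) (usnd w)))"
    by (rule reidx_over_family[OF E_obj(2)[OF r(1)] ufamilyD(7)[OF s(1)] 9(3) k])
  have "ucmp A a x Z ?s0 r0 = ure A a (mu (over x Y)) (mu (over x Z)) (\<lambda>w\<in>Ix (mu (over x Z)). pair (ufst w) (k (ufst w) (usnd w))) (ucmp A a x Y s0 r0)"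
    by (rule ucmp_reindex_family[OF r(1) s(1) 9(3) k[folded reindex_iff]])
  then show ?case
    unfolding r(2) s(2) e ucmp_rel[OF r(1) s(1)] ucmp_rel[OF r(1) f] ure_rel[OF ucmp_arr[OF r(1) s(1)] re] by simp
next
  case (10 r a x)
  then obtain r0 where r: "r0 \<in> E a x" "r = l a x r0" by auto
  show ?case using upre_rel[OF uid_E[OF E_obj(1)[OF r(1)]] r(1)] ucmp_uid_left[OF r(1)] E_obj(1)[OF r(1)] by (simp add: r(2))
next
  case (11 r a x)
  then obtain r0 where r: "r0 \<in> E a x" "r = l a x r0" by auto
  note x = E_obj(2)[OF r(1)]
  note al = ualong_uid[OF x]
  have e: "(\<lambda>z\<in>Ix x. uid rel (Fm x z)) = lf x (\<lambda>z\<in>Ix x. eta (Fm x z)) (\<lambda>z\<in>Ix x. uid A (Fm x z))"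
    by (rule restrict_ext) (simp add: bobj_mem[OF x])
  show ?case
    unfolding upost_def r(2) e ucmp_rel[OF r(1) ualongD(7)[OF al]] ualongD(8)[OF al]
      ure_rel[OF ucmp_upost_arr[OF r(1) al] reidx_mu_bmap_eta[OF x]] ucmp_uid_right[OF r(1), unfolded upost_def] ..
next
  case (12 r a x Y s Z t W)
  from 12(1) obtain r0 where r: "r0 \<in> E a x" "r = l a x r0" by auto
  from 12(2) obtain s0 where s: "ufamily A x Y s0" "s = lf x Y s0" by (rule ufamily_rel)
  from 12(3) obtain t0 where t: "ufamily A (mu (over x Y)) Z t0" "t = lf (mu (over x Y)) Z t0" by (rule ufamily_rel)
  note x = E_obj(2)[OF r(1)] and S = ufamilyD[OF s(1)] and T = ufamilyD[OF t(1)] and W = 12(4)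
  note rs = ucmp_arr[OF r(1) s(1)]
  have Wz: "ufamily A (Y z) (W z) (\<lambda>w\<in>Ix (Y z). t0 (pair z w))" if z: "z \<in> Ix x" for z
  proof (rule ufamilyI)
    fix w assume "w \<in> Ix (Y z)"
    then show "(\<lambda>w\<in>Ix (Y z). t0 (pair z w)) w \<in> E (Fm (Y z) w) (W z w)"
      using T(3)[of "pair z w"] z by (simp add: W Fm_mu)
  qed (simp_all add: W z)
  let ?Y = "\<lambda>z\<in>Ix x. mu (over (Y z) (W z))"
  let ?q = "\<lambda>z\<in>Ix x. ucmp A (Fm x z) (Y z) (W z) (\<lambda>w\<in>Ix (Y z). t0 (pair z w)) (s0 z)"
  have fq: "ufamily A x ?Y ?q"
    by (rule ufamilyI) (simp_all add: ucmp_arr[OF S(3) Wz])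
  have e: "(\<lambda>z\<in>Ix x. ucmp rel (Fm x z) (Y z) (W z) (\<lambda>w\<in>Ix (Y z). t (pair z w)) (s z)) = lf x ?Y ?q"
  proof (rule restrict_ext)
    fix z assume z: "z \<in> Ix x"
    have "(\<lambda>w\<in>Ix (Y z). t (pair z w)) = lf (Y z) (W z) (\<lambda>w\<in>Ix (Y z). t0 (pair z w))"
      by (rule restrict_ext) (simp add: t(2) W z Fm_mu)
    then show "ucmp rel (Fm x z) (Y z) (W z) (\<lambda>w\<in>Ix (Y z). t (pair z w)) (s z) = l (Fm x z) (?Y z) (?q z)"
      using z ucmp_rel[OF S(3)[OF z] Wz[OF z]] by (simp add: s(2))
  qed
  note re = reidx_over_assoc[OF x S(1) T(1) W]
  show ?case
    unfolding e unfolding r(2) s(2) t(2) ucmp_rel[OF r(1) s(1)] ucmp_rel[OF rs t(1)] ucmp_rel[OF r(1) fq]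
      ure_rel[OF ucmp_arr[OF rs t(1)] re] ucmp_assoc[OF r(1) s(1) t(1) W] ..
qed

definition lab :: "'u ucmap" where
  "lab = \<lparr> cpt = (\<lambda>a\<in>Pt. a), carr = (\<lambda>a x. \<lambda>r\<in>E a x. l a x r) \<rparr>"

lemma lab_sel [simp]: "cpt lab = (\<lambda>a\<in>Pt. a)" "carr lab a x = (\<lambda>r\<in>E a x. l a x r)"
  by (simp_all add: lab_def)

lemma continuous_lab: "continuous_map A rel lab"
proof -
  have b: "bmap (\<lambda>a\<in>Pt. a) x = x" if "x \<in> bobj Pt" for x by (rule bmap_id[OF that]) simp
  show ?thesis
  proof (rule continuous_map.intro, goal_cases)
    case (3 r a x y g)
    then show ?case
      using ure_Els[OF 3(1)] ure_rel[OF 3(1)] by (simp add: reindex_iff reidxD(1,2)[of Pt x y g] b E_obj(1)[OF 3(1)])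
  next
    case (5 r a x Y s)
    note x = E_obj(2)[OF 5(1)] and S = ufamilyD[OF 5(2)]
    have "(\<lambda>z\<in>Ix x. bmap (\<lambda>a\<in>Pt. a) (Y z)) = (\<lambda>z\<in>Ix x. Y z)" by (rule restrict_ext) (rule b[OF S(4)])
    then have 1: "(\<lambda>z\<in>Ix x. bmap (\<lambda>a\<in>Pt. a) (Y z)) = Y" by (simp only: S(5))
    have 2: "(\<lambda>z\<in>Ix x. (\<lambda>r\<in>E (Fm x z) (Y z). l (Fm x z) (Y z) r) (s z)) = lf x Y s"
      by (rule restrict_ext) (simp add: S(3))
    show ?case unfolding lab_sel 1 2 b[OF x] using 5(1) ucmp_arr[OF 5] E_obj(1)[OF 5(1)] ucmp_rel[OF 5] by simp
  qed (auto simp: b E_obj uid_E eta_bobj)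
qed

lemma relabelling_li: "relabelling rel li"
  by (intro relabelling.intro relabelling_axioms.intro ultraconvergence_space_rel)
    (auto simp: inj_on_def)

text \<open>Since relabelling back restores the space strictly, the backward renaming is a
  continuous map into \<open>A\<close> itself and can be the inverse of \<open>lab\<close>.\<close>

lemma rel_rel: "relabelling.rel rel li = A"
proof -
  interpret R: relabelling rel li by (rule relabelling_li)
  have im: "li a x ` l a x ` E a x = E a x" for a x by (force simp: image_iff)
  have ll: "R.li a x r = l a x r" if "r \<in> E a x" for r a x
    using R.li_l[of "l a x r" a x] that by simp
  have "Act (uarr R.rel) d d' x y u v r = Act (uarr A) d d' x y u v r" for d d' x y u v r
  proof (cases "u \<in> Hom (udisc A) d' d \<and> v \<in> Hom (beta (udisc A)) x y \<and> r \<in> E d x")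
    case True
    then show ?thesis
      using R.Act_rel[of u d' d v x y "l d x r"] P.Act_Els[of u d' d v x y r] by (simp add: Act_rel del: disc_sel)
  next
    case False
    then have "Act (uarr A) d d' x y u v r = undefined" using uarr_profunctor(3) by (auto simp: prof_ext_def)
    moreover have "Act (uarr R.rel) d d' x y u v r = undefined" using False by (auto simp: R.rel_def im simp del: disc_sel)
    ultimately show ?thesis by simp
  qed
  then have 1: "uarr R.rel = uarr A" by (intro prof.equality) (auto simp: fun_eq_iff im)
  have "uid R.rel = (\<lambda>a\<in>Pt. uid A a)" by (auto simp: uid_E)
  then have 2: "uid R.rel = uid A" by (simp only: PiE_restrict[OF uid_arr])
  have 3: "ucmp R.rel a x Y s r = ucmp A a x Y s r" for a x Y s r
  proof (cases "r \<in> E a x \<and> ufamily A x Y s")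
    case True
    then have r: "r \<in> E a x" and f: "ufamily A x Y s" by auto
    note S = ufamilyD[OF f]
    have "R.lf x Y (lf x Y s) = (\<lambda>z\<in>Ix x. s z)" by (rule restrict_ext) (simp add: S(3))
    then have "R.lf x Y (lf x Y s) = s" by (simp only: S(6))
    then show ?thesis using R.ucmp_rel[OF _ ufamily_rel_lf[OF f], of "l a x r" a] r ucmp_rel[OF r f] ucmp_arr[OF r f] by simp
  next
    case False
    then have "ucmp A a x Y s r = undefined" by (rule ucmp_ext)
    moreover have "ucmp R.rel a x Y s r = undefined" using False by (auto simp: R.rel_def im ufamily_iff)
    ultimately show ?thesis by simp
  qed
  show ?thesis by (rule ucspace.equality) (use 1 2 3 in \<open>simp_all add: fun_eq_iff del: R.rel_sel(3)\<close>)
qed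

end

lemma iso1_lab:
  assumes "relabelling A l"
  shows "two_category.iso1 UltSp A (relabelling.rel A l) (relabelling.lab A l) (relabelling.lab (relabelling.rel A l) (relabelling.li A l))"
proof -
  interpret R: relabelling A l by fact
  interpret R': relabelling R.rel R.li by (rule R.relabelling_li)
  interpret K: two_category UltSp by (rule two_category_UltSp)
  have b: "bmap (\<lambda>a\<in>R.Pt. a) x = x" if "x \<in> bobj R.Pt" for x by (rule bmap_id[OF that]) simp
  have 1: "uc_comp A R'.lab R.lab = uc_id A"
    by (rule ucmap_eqI) (auto intro!: restrict_ext simp: b R.E_obj)
  have 2: "uc_comp R.rel R.lab R'.lab = uc_id R.rel"
    by (rule ucmap_eqI) (auto intro!: restrict_ext simp: b R.E_obj)
  show ?thesis unfolding K.iso1_def UltSp_sel 1 2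
    using R.continuous_lab R'.continuous_lab R.ultraconvergence_space_axioms R.ultraconvergence_space_rel
    by (simp add: R.rel_rel)
qed

section \<open>The bijection on objects\<close>

text \<open>The values of \<open>gami\<close> on arrows recover the hom-sets, and its inverse is
  \<Gamma>. Identities and composition are pulled back along \<Gamma> from the space, the actions
  come from \<open>lact_upre\<close> and \<open>ract_upost\<close>, and \<Delta> comes from
  \<open>dlt2_pull\<close>.\<close>

lemma (in nlax_pair) eq_if_usp_gami_eq:
  assumes u: "B'.usp = B.usp" and g: "\<And>a b r. r \<in> Els (str B) a (eta b) \<Longrightarrow> B'.gami a b r = B.gami a b r"
  shows "B' = B"
proof -
  have Pt: "Obj (bas B') = Obj (bas B)" using arg_cong[OF u, of upts] by simp
  have E: "Els (str B') = Els (str B)" using arg_cong[OF u, of "\<lambda>A. Els (uarr A)"] by simp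
  have gE: "gam B' a b u \<in> Els (str B) a (eta b)" if "u \<in> Hom (bas B') a b" for a b u
    using B'.gam_E[OF that] by (simp add: E)
  have H: "Hom (bas B') a b = Hom (bas B) a b" for a b
  proof (rule set_eqI, rule iffI)
    fix v assume v: "v \<in> Hom (bas B') a b"
    have "B.gami a b (gam B' a b v) = v" using g[OF gE[OF v]] v by simp
    then show "v \<in> Hom (bas B) a b" using B.gami(3)[OF gE[OF v]] by simp
  next
    fix v assume v: "v \<in> Hom (bas B) a b"
    then have r: "gam B a b v \<in> Els (str B) a (eta b)" by (rule B.gam_E)
    have "B'.gami a b (gam B a b v) = v" using g[OF r] v by simp
    moreover have "B'.gami a b (gam B a b v) \<in> Hom (bas B') a b" using r by (intro B'.gami(3)) (simp add: E)
    ultimately show "v \<in> Hom (bas B') a b" by simp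
  qed
  have gam: "gam B' a b = gam B a b" for a b
  proof (rule ext)
    fix v
    show "gam B' a b v = gam B a b v"
    proof (cases "v \<in> Hom (bas B) a b")
      case True
      then have v: "v \<in> Hom (bas B') a b" by (simp add: H)
      have "B.gami a b (gam B' a b v) = v" using g[OF gE[OF v]] v by simp
      then show ?thesis using B.gami(2)[OF gE[OF v]] by simp
    next
      case False
      have "gam B a b \<in> extensional (Hom (bas B) a b)" "gam B' a b \<in> extensional (Hom (bas B') a b)"
        using B.gam_natural B'.gam_natural by (auto simp: pcell_def homp_def PiE_def)
      then show ?thesis using False by (simp add: H extensional_def)
    qed
  qed
  have Ide: "Ide (bas B') a = Ide (bas B) a" for a
  proof (cases "a \<in> Obj (bas B)")
    case True
    have "gam B a a (Ide (bas B') a) = gam B a a (Ide (bas B) a)"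
      using fun_cong[OF arg_cong[OF u, of uid], of a] True by (simp add: Pt gam)
    then show ?thesis by (rule B.gam_eqD) (use True B.C.Ide_Hom B'.C.Ide_Hom in \<open>auto simp: Pt H\<close>)
  next
    case False then show ?thesis using B.bas_category(2) B'.bas_category(2) by (simp add: cat_ext_def Pt)
  qed
  have Cmp: "Cmp (bas B') a b c v' v = Cmp (bas B) a b c v' v" for a b c v v'
  proof (cases "v \<in> Hom (bas B) a b \<and> v' \<in> Hom (bas B) b c")
    case True
    then have v: "v \<in> Hom (bas B) a b" "v' \<in> Hom (bas B) b c" by auto
    note v1 = v[folded H]
    have "gam B a c (Cmp (bas B') a b c v' v) = gam B a c (Cmp (bas B) a b c v' v)"
      using B.gam_Cmp[OF v] B'.gam_Cmp[OF v1] by (simp add: gam u)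
    then show ?thesis
      by (rule B.gam_eqD[OF _ B'.C.Cmp_Hom[OF v1, unfolded H] B.C.Cmp_Hom[OF v]])
  next
    case False then show ?thesis using B.bas_category(2) B'.bas_category(2) unfolding cat_ext_def by (simp add: H)
  qed
  have bas: "bas B' = bas B"
    by (rule cat.equality) (use Pt H Ide Cmp in \<open>simp_all add: fun_eq_iff\<close>)
  have Act: "Act (str B') d d' x y w v r = Act (str B) d d' x y w v r" for d d' x y w v r
  proof (cases "w \<in> Hom (bas B) d' d \<and> v \<in> Hom (beta (bas B)) x y \<and> r \<in> Els (str B) d x")
    case True
    then have w: "w \<in> Hom (bas B) d' d" and v: "v \<in> Hom (beta (bas B)) x y" and r: "r \<in> Els (str B) d x" by auto
    have w': "w \<in> Hom (bas B') d' d" and v': "v \<in> Hom (beta (bas B')) x y" and r': "r \<in> Els (str B') d x"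
      using w v r by (simp_all add: bas E)
    obtain k \<alpha> where k: "x \<in> bobj (Obj (bas B))" "y \<in> bobj (Obj (bas B))" "(k, \<alpha>) \<in> upairs (Hom (bas B)) x y"
        "v = ucls (Hom (bas B)) x y (k, \<alpha>)" using v by (elim HomBE)
    have k': "(k, \<alpha>) \<in> upairs (Hom (bas B')) x y" "y \<in> bobj (Obj (bas B'))" using k by (simp_all add: bas)
    have ra: "ract (bas B') (str B') d x y v r = ract (bas B) (str B) d x y v r"
      using B.ract_upost[OF r k(3,2)] B'.ract_upost[OF r' k'] by (simp add: k(4) bas gam u)
    note r1 = B.S.ract_Els[OF v r] and r1' = B'.S.ract_Els[OF v' r', unfolded ra]
    show ?thesis
      unfolding B.S.Act_split(1)[OF w v r] B'.S.Act_split(1)[OF w' v' r'] ra B.lact_upre[OF w r1] B'.lact_upre[OF w' r1'] gam u ..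
  next
    case False
    then show ?thesis using B.str_profunctor(2) B'.str_profunctor(2) unfolding prof_ext_def by (simp add: bas E)
  qed
  have str: "str B' = str B" by (rule prof.equality) (use E Act in \<open>simp_all add: fun_eq_iff\<close>)
  let ?P = "pcomp (beta (beta (bas B))) (beta (bas B)) (bas B) (str B) (bstr B)"
  have dlt: "dlt B' a Y P = dlt B a Y P" for a Y P
  proof (cases "P \<in> Els ?P a Y")
    case True
    then obtain x r s where p: "r \<in> Els (str B) a x" "s \<in> Els (bstr B) x Y"
      "P = coend_cls (beta (beta (bas B))) (beta (bas B)) (bas B) (str B) (bstr B) a Y (x, r, s)"
      by (rule B.PC.pcomp_ElsE)
    obtain t \<zeta> where t: "Y \<in> bobj (bobj (Obj (bas B)))" "(t, \<zeta>) \<in> upairs (Els (str B)) x Y" "s = ucls (Els (str B)) x Y (t, \<zeta>)"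
      using p(2) by (rule B.bstrE)
    have t': "r \<in> Els (str B') a x" "(t, \<zeta>) \<in> upairs (Els (str B')) x Y" "Y \<in> bobj (bobj (Obj (bas B')))"
      using p(1) t by (simp_all add: bas str)
    have "dlt2 B' a x Y r s = dlt2 B a x Y r s"
      using B.dlt2_pull(1)[OF p(1) t(2,1)] B'.dlt2_pull(1)[OF t'] by (simp add: t(3) str u)
    then show ?thesis by (simp add: dlt2_def bas str p(3))
  next
    case False
    have "dlt B a Y \<in> extensional (Els ?P a Y)" "dlt B' a Y \<in> extensional (Els ?P a Y)"
      using B.dlt_natural B'.dlt_natural unfolding bas str by (auto simp: pcell_def PiE_def)
    then show ?thesis using False by (simp add: extensional_def)
  qed
  show ?thesis by (rule lax_alg.equality) (use bas str gam dlt in \<open>simp_all add: fun_eq_iff\<close>)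
qed

context nlax_algebra
begin

text \<open>Recording \<open>\<Gamma>\<^sup>-\<^sup>1\<close> in the labels makes \<open>B\<close> recoverable from the relabelled space (lemma \<open>gsp_inject\<close>).\<close>

definition glab :: "'u \<Rightarrow> ('u, 'u) ufam \<Rightarrow> 'u \<Rightarrow> 'u" where
  "glab a x r = (if x \<in> eta ` Pt then pair r (gami a (Fm x star) r) else r)"

lemma relabelling_glab: "relabelling usp glab"
  by (intro relabelling.intro relabelling_axioms.intro ultraconvergence_space_usp)
    (auto simp: inj_on_def glab_def)

definition gsp :: "'u ucspace" where
  "gsp = relabelling.rel usp glab"

lemma gsp_sel: "upts gsp = Pt" "Els (uarr gsp) a x = glab a x ` E a x"
  using relabelling.rel_sel[OF relabelling_glab] by (simp_all add: gsp_def)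

lemma ultraconvergence_space_gsp: "ultraconvergence_space gsp"
  unfolding gsp_def by (rule relabelling.ultraconvergence_space_rel[OF relabelling_glab])

text \<open>Whether an arrow carries a label depends on its target only, so labels can be stripped
  without knowing \<Gamma>. Hence \<open>gsp\<close> determines \<open>usp\<close>.\<close>

lemma usp_gsp:
  "usp = relabelling.rel gsp (\<lambda>a x. \<lambda>r\<in>Els (uarr gsp) a x. if x \<in> eta ` upts gsp then ufst r else r)"
proof -
  interpret G: relabelling usp glab by (rule relabelling_glab)
  have "G.li = (\<lambda>a x. \<lambda>r\<in>Els (uarr gsp) a x. if x \<in> eta ` upts gsp then ufst r else r)"
  proof (intro ext)
    fix a x r
    show "G.li a x r = (\<lambda>r\<in>Els (uarr gsp) a x. if x \<in> eta ` upts gsp then ufst r else r) r"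
    proof (cases "r \<in> glab a x ` E a x")
      case True
      then obtain r0 where r0: "r0 \<in> E a x" "r = glab a x r0" by auto
      have "G.li a x r = r0" using r0 G.li_l[of r0 a x] by simp
      moreover have "(\<lambda>r\<in>Els (uarr gsp) a x. if x \<in> eta ` upts gsp then ufst r else r) r = r0"
        using r0 True by (auto simp: gsp_sel glab_def)
      ultimately show ?thesis by simp
    next
      case False then show ?thesis by (simp add: G.li_def gsp_sel)
    qed
  qed
  then show ?thesis using G.rel_rel by (simp add: gsp_def)
qed

end

text \<open>A labelled arrow of one algebra is a labelled arrow of the other. The first components
  identify the underlying arrows, and then the second components identify the values of
  \<open>gami\<close>.\<close>

lemma (in nlax_pair) gsp_inject:
  assumes "B'.gsp = B.gsp"
  shows "B' = B"
proof (rule eq_if_usp_gami_eq)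
  show u: "B'.usp = B.usp" using B.usp_gsp B'.usp_gsp assms by simp
  fix a b r assume r: "r \<in> Els (str B) a (eta b)"
  have b: "b \<in> Obj (bas B)" by (rule B.eta_E[OF r])
  have b': "b \<in> Obj (bas B')" using b arg_cong[OF u, of upts] by simp
  have "B.glab a (eta b) r \<in> Els (uarr B'.gsp) a (eta b)" using r by (simp add: assms B.gsp_sel)
  then obtain r' where "B.glab a (eta b) r = B'.glab a (eta b) r'" by (auto simp: B'.gsp_sel)
  then show "B'.gami a b r = B.gami a b r" using b b' by (auto simp: B.glab_def B'.glab_def)
qed

text \<open>Beyond a bijection, each value has to be either that of \<open>f\<close> or a preimage
  under \<open>g\<close>, because in both of these cases an isomorphism between the object and the
  space of its partner is at hand.\<close>

lemma Schroeder_Bernstein_choice: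
  assumes f: "inj_on f X" "f ` X \<subseteq> Y" and g: "inj_on g Y" "g ` Y \<subseteq> X"
  obtains h where "bij_betw h X Y" "\<And>a. a \<in> X \<Longrightarrow> h a = f a \<or> h a \<in> Y \<and> g (h a) = a"
proof -
  \<comment> \<open>For a fixed point \<open>S\<close> the complement in \<open>X\<close> is exactly
    the \<open>g\<close>-image of what \<open>f\<close> leaves uncovered on \<open>S\<close>; so
    \<open>f\<close> is used on \<open>S\<close> and the inverse of \<open>g\<close>
    elsewhere.\<close>
  let ?F = "\<lambda>S. X - g ` (Y - f ` S)"
  have "mono ?F" unfolding mono_def by blast
  then have S: "X - g ` (Y - f ` lfp ?F) = lfp ?F" by (rule lfp_unfold[symmetric])
  define S where "S = lfp ?F"
  have S: "S = X - g ` (Y - f ` S)" using S by (simp add: S_def)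
  have SX: "S \<subseteq> X" using S by blast
  have XS: "X - S = g ` (Y - f ` S)" using S g(2) by blast
  define h where "h a = (if a \<in> S then f a else inv_into Y g a)" for a
  have hg: "inv_into Y g a \<in> Y - f ` S \<and> g (inv_into Y g a) = a" if "a \<in> X - S" for a
    using that g(1) unfolding XS by (auto simp: inv_into_f_f)
  have "bij_betw f S (f ` S)" using inj_on_subset[OF f(1) SX] by (simp add: bij_betw_def)
  moreover have "bij_betw (inv_into Y g) (X - S) (Y - f ` S)"
    unfolding XS using g(1) by (auto simp: bij_betw_def inj_on_inv_into image_iff inv_into_f_f inj_on_def)
  ultimately have "bij_betw h (S \<union> (X - S)) (f ` S \<union> (Y - f ` S))"
    unfolding h_def by (rule bij_betw_disjoint_Un) auto
  moreover have "S \<union> (X - S) = X" "f ` S \<union> (Y - f ` S) = Y" using SX f(2) by auto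
  ultimately have "bij_betw h X Y" by (simp only:)
  moreover have "h a = f a \<or> h a \<in> Y \<and> g (h a) = a" if "a \<in> X" for a
    using hg[of a] that by (auto simp: h_def)
  ultimately show ?thesis by (rule that)
qed

lemma (in two_category) iso1_refl: "A \<in> Ob2 K \<Longrightarrow> iso1 A A (id1 K A) (id1 K A)"
  by (simp add: iso1_def id1_Hom1 comp1_id1_left)

theorem theorem5p25:
  shows "two_isomorphic
    (UltSp :: ('u::universe ucspace, 'u ucmap, 'u \<Rightarrow> 'u) cat2)
    (NLaxAlg :: ('u lax_alg, 'u lax_mor, 'u \<Rightarrow> 'u) cat2)"
proof -
  let ?F = "ultraconvergence_space.lax_of :: 'u ucspace \<Rightarrow> 'u lax_alg" and ?G = "nlax_algebra.gsp :: 'u lax_alg \<Rightarrow> 'u ucspace"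
  let ?X = "{A :: 'u ucspace. ultraconvergence_space A}" and ?Y = "{B :: 'u lax_alg. nlax_algebra B}"
  interpret local_isomorphism "UltSp :: ('u ucspace, 'u ucmap, 'u \<Rightarrow> 'u) cat2" "NLaxAlg :: ('u lax_alg, 'u lax_mor, 'u \<Rightarrow> 'u) cat2"
    Usp nlax_pair.lmor nlax_pair.lcell
    by (rule local_isomorphism_Usp)
  have Ob: "Ob2 UltSp = ?X" "Ob2 NLaxAlg = ?Y" by (auto simp: UltSp_sel NLaxAlg_sel)
  have UF: "Usp (?F A) = A" if "A \<in> ?X" for A using that ultraconvergence_space.Usp_lax_of by simp
  have FY: "?F ` ?X \<subseteq> ?Y"
    by (auto intro!: nlax_algebra.intro nlax_algebra_axioms.intro ultraconvergence_space.lax_algebra_lax_of ultraconvergence_space.normalized_lax_of)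
  have Fi: "inj_on ?F ?X" by (rule inj_on_inverseI) (rule UF)
  have Gi: "inj_on ?G ?Y" by (rule inj_onI) (use nlax_pair.gsp_inject nlax_pair.intro in blast)
  have GX: "?G ` ?Y \<subseteq> ?X" by (auto intro: nlax_algebra.ultraconvergence_space_gsp)
  obtain h where h: "bij_betw h ?X ?Y" "\<And>A. A \<in> ?X \<Longrightarrow> h A = ?F A \<or> h A \<in> ?Y \<and> ?G (h A) = A"
    using Schroeder_Bernstein_choice[OF Fi FY Gi GX] by metis
  have "\<exists>k k'. K.iso1 A (Usp (h A)) k k'" if A: "A \<in> ?X" for A
    using h(2)[OF A]
  proof
    assume "h A = ?F A"
    \<comment> \<open>Here the space of \<open>h A\<close> is \<open>A\<close> itself, and the
      identity serves.\<close>
    then show ?thesis using K.iso1_refl[of A] A UF[OF A] by (auto simp: Ob)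
  next
    assume "h A \<in> ?Y \<and> ?G (h A) = A"
    then have B: "nlax_algebra (h A)" and e: "relabelling.rel (Usp (h A)) (nlax_algebra.glab (h A)) = A"
      by (auto simp: nlax_algebra.gsp_def)
    \<comment> \<open>Here \<open>A\<close> is the labelled space of the algebra \<open>h A\<close>,
      and stripping the labels is an isomorphism to its unlabelled space.\<close>
    show ?thesis using K.iso1_sym[OF iso1_lab[OF nlax_algebra.relabelling_glab[OF B]]] unfolding e by blast
  qed
  then obtain k k' where "\<And>A. A \<in> ?X \<Longrightarrow> K.iso1 A (Usp (h A)) (k A) (k' A)" by metis
  then show ?thesis by (intro two_isomorphicI[of h k k']) (simp_all only: Ob h(1))
qed


end
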